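(* Let $N\ge5$ and $m=\lfloor N/2\rfloor$, with cusp orbit representatives ordered so that $\mathfrak c_m=[i\infty]$, and let $P_NV_NQ_N=D_N=\operatorname{diag}(d_1,\dots,d_m)$, $P_N,Q_N\in\operatorname{GL}_m(\mathbb Z)$, be a Smith normal form of the class matrix $V_N$. Let $\mathcal R_N=\mathbb Z/d_1\mathbb Z\times\cdots\times\mathbb Z/d_m\mathbb Z$. For $0\le i\le m-1$ let $\boldsymbol\gamma_i\in\mathcal R_N$ be the class of the $(i+1)$-th column of $P_N$, let $\boldsymbol\gamma_m=\mathbf 0\in\mathcal R_N$, and let $\boldsymbol\beta\in\mathcal R_N$ be the class of $$\boldsymbol\alpha_N=-P_N\left(\tfrac1{12}\mathbf g+A_N\mathbf a^{(1)}\right).$$ For $0\le j\le m+1$, $S\in\mathbb Z$ and $\boldsymbol\rho\in\mathcal R_N$ define $D_j(S,\boldsymbol\rho)$ by $$D_0(S,\boldsymbol\rho)=\begin{cases}1,&S=0\text{ and }\boldsymbol\rho=\mathbf 0,\\0,&\text{otherwise,}\end{cases}$$ and, for $1\le j\le m+1$, by the recursion $$D_j(S,\boldsymbol\rho)=D_{j-1}(S,\boldsymbol\rho)+D_j(S-\mu_{j-1},\boldsymbol\rho-\boldsymbol\gamma_{j-1}),$$ with $D_j(S,\boldsymbol\rho)=0$ whenever $S<0$. Then, for every integer $k\ge0$, $$|L_N(k)|=D_{m+1}(kR_N,-k\boldsymbol\beta),\qquad R_N=\frac1{24}\sum_{d\mid N}d\,\varphi(d)\,\varphi(N/d).$$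
   Context: Notation: $q=e^{2\pi i\tau}$, $\operatorname{Im}\tau>0$; $(x_1,\dots,x_s;q)_\infty=\prod_{i=1}^s\prod_{n\ge0}(1-x_iq^n)$; $\varphi$ is Euler's function; $m=\lfloor N/2\rfloor$. Products: for an even integer $a_0\ge0$ and $\mathbf a=(a_1,\dots,a_m)\in\mathbb Z^m$, $$f^{(N)}_{\mathbf a}(\tau)=q^{\frac N{24}S_1-\frac1{2N}S_2}(q^N;q^N)_\infty^{a_0}\prod_{j=1}^m(q^j,q^{N-j};q^N)_\infty^{a_j},\quad S_1=a_0+2\sum_{j=1}^m a_j,\quad S_2=\sum_{j=1}^m j(N-j)a_j.$$ For an integer $k\ge0$, $L_N(k)$ is the set of all $\mathbf a\in\mathbb Z^m$ such that, with $a_0=2k$, $f^{(N)}_{\mathbf a}\in M_k(\Gamma_1(N))$, the space of holomorphic modular forms of weight $k$ on $\Gamma_1(N)$. Cusps: the cusps of $X_1(N)$ are the $\Gamma_1(N)$-classes $[a/c]$, $\gcd(a,c)=1$, and $g([a/c])=\gcd(c,N)$. Every cusp can be written $[a/(gu)]$ with $g\mid N$, $u$ a unit mod $N/g$, $a\in(\mathbb Z/g\mathbb Z)^\times/\{\pm1\}$, $\gcd(a,gu)=1$. The group $\mathrm{Gal}(\mathbb Q(e^{2\pi i/N})/\mathbb Q)\cong(\mathbb Z/N\mathbb Z)^\times$ acts by $\sigma_x[a/(gu)]=[a/(xgu)]$; the orbits correspond to the pairs $(g,a)$ with $g\mid N$, $a\in(\mathbb Z/g\mathbb Z)^\times/\{\pm1\}$,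 and there are $m+1$ of them. Fix orbit representatives $\mathfrak c_0,\dots,\mathfrak c_m$ with $\mathfrak c_m=[1/N]=[i\infty]$; let $\mu_i=|\mathrm{Orb}(\mathfrak c_i)|$ be the orbit sizes and $\mathbf g=(g(\mathfrak c_0),\dots,g(\mathfrak c_{m-1}))^T$. Matrix $A_N$: writing $\mathfrak c_r=[a/c]$, $g=g(\mathfrak c_r)$, $A_N$ is the $m\times m$ matrix with rows indexed by $0\le r\le m-1$, columns by $1\le j\le m$, and entries $\frac g2B_2(\langle ja/g\rangle)$, where $B_2(x)=x^2-x+\frac16$ and $\langle x\rangle=x-\lfloor x\rfloor$. Matrix $B_N$: $B_5=\begin{pmatrix}16&-5\\-4&5\end{pmatrix}$. If $N\ge6$, put $M=N\gcd(2,N)$, let $r_N\in\{0,1,2\}$ with $r_N\equiv2M\pmod3$, $a_N=\frac{-M+5r_N}3$, $b_N=\frac{M-8r_N}3$, let $\mathbf e_1,\dots,\mathbf e_m$ be the standard basis of $\mathbb Z^m$, and let $j_1<\dots<j_r$ be the multiples of $3$ in $\{3,\dots,m\}$. The columns of $B_N$ are the $m$ vectors $16\mathbf e_1-4\mathbf e_2$; $\ a_N\mathbf e_1+b_N\mathbf e_2+r_N\mathbf e_3$; $\ \frac{j^2-4}3\mathbf e_1-\frac{j^2-1}3\mathbf e_2+\mathbf e_j$ for $3\le j\le m$, $3\nmid j$; $\ (j_1^2-4)\mathbf e_1-(j_1^2-1)\mathbf e_2+3\mathbf e_{j_1}$; and $\frac{j_t^2-j_1^2}3(\mathbf e_1-\mathbf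 e_2)-\mathbf e_{j_1}+\mathbf e_{j_t}$ for $2\le t\le r$. Class matrix: $V_N=A_NB_N$, an integer $m\times m$ matrix presenting the $\mathbb Q$-rational cuspidal divisor class group of $X_1(N)$. Vector $\mathbf a^{(1)}\in\mathbb Z^m$: $(-3,2)^T$ if $N=5$, and $(-3,3,-1,0,\dots,0)^T$ if $N\ge6$. The vector $\boldsymbol\alpha_N$ is integral. *)

theory Defs
  imports
    "HOL-Complex_Analysis.Complex_Analysis"
    "HOL-Number_Theory.Totient"
    "HOL-Algebra.Elementary_Groups"
    "HOL-Algebra.Product_Groups"
    "Jordan_Normal_Form.Matrix"
begin

unbundle no vec_syntax  (* so that $ is the indexing of Jordan_Normal_Form vectors *)

section \<open>Modular forms on \<open>\<Gamma>\<^sub>1(N)\<close>\<close>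

definition upper_half_plane :: "complex set" where
  "upper_half_plane = {\<tau>. Im \<tau> > 0}"

text \<open>The matrix with rows \<open>(a, b)\<close> and \<open>(c, d)\<close> is encoded as \<open>(a, b, c, d)\<close>.\<close>

definition SL2Z :: "(int \<times> int \<times> int \<times> int) set" where
  "SL2Z = {(a, b, c, d). a * d - b * c = 1}"

definition Gamma1 :: "nat \<Rightarrow> (int \<times> int \<times> int \<times> int) set" where
  "Gamma1 N = {(a, b, c, d) \<in> SL2Z.
     [a = 1] (mod int N) \<and> [d = 1] (mod int N) \<and> [c = 0] (mod int N)}"

definition slash ::
  "nat \<Rightarrow> (complex \<Rightarrow> complex) \<Rightarrow> int \<times> int \<times> int \<times> int \<Rightarrow> complex \<Rightarrow> complex" where
  "slash k f = (\<lambda>(a, b, c, d) \<tau>.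
     f ((of_int a * \<tau> + of_int b) / (of_int c * \<tau> + of_int d)) / (of_int c * \<tau> + of_int d) ^ k)"

text \<open>
  Holomorphy at the cusps is expressed in the usual way: for every \<open>\<gamma> \<in> SL\<^sub>2(\<int>)\<close>, the function
  \<open>f|\<^sub>k\<gamma>\<close> stays bounded as \<open>Im \<tau> \<rightarrow> \<infinity>\<close>.  Values of \<open>f\<close> off the upper half-plane are irrelevant.
\<close>

definition modular_forms_Gamma1 :: "nat \<Rightarrow> nat \<Rightarrow> (complex \<Rightarrow> complex) set" where
  "modular_forms_Gamma1 k N = {f.
     f holomorphic_on upper_half_plane \<and>
     (\<forall>\<gamma> \<in> Gamma1 N. \<forall>\<tau> \<in> upper_half_plane. slash k f \<gamma> \<tau> = f \<tau>) \<and>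
     (\<forall>\<gamma> \<in> SL2Z. \<exists>B Y. \<forall>\<tau> \<in> upper_half_plane. Im \<tau> \<ge> Y \<longrightarrow> norm (slash k f \<gamma> \<tau>) \<le> B)}"


section \<open>The products\<close>

definition q_pochhammer :: "complex \<Rightarrow> complex \<Rightarrow> complex" where
  "q_pochhammer x q = (\<Prod>n. 1 - x * q ^ n)"

text \<open>
  Vectors are indexed from \<open>0\<close>, so the exponent \<open>a\<^sub>j\<close> (\<open>1 \<le> j \<le> m\<close>) is \<open>a $ (j - 1)\<close>.
  The prefactor \<open>q\<^sup>e\<close> with rational exponent \<open>e\<close> means \<open>exp (2\<pi>i\<tau>e)\<close>.
\<close>

definition theta_product :: "nat \<Rightarrow> nat \<Rightarrow> int vec \<Rightarrow> complex \<Rightarrow> complex" where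
  "theta_product N a0 a \<tau> =
    (let m = N div 2;
         q = exp (2 * of_real pi * \<i> * \<tau>);
         S1 = int a0 + 2 * (\<Sum>j=1..m. a $ (j - 1));
         S2 = (\<Sum>j=1..m. int j * int (N - j) * a $ (j - 1))
     in exp (2 * of_real pi * \<i> * \<tau> *
             (of_nat N / 24 * of_int S1 - 1 / (2 * of_nat N) * of_int S2))
        * q_pochhammer (q ^ N) (q ^ N) ^ a0
        * (\<Prod>j=1..m. (q_pochhammer (q ^ j) (q ^ N) * q_pochhammer (q ^ (N - j)) (q ^ N))
                        powi (a $ (j - 1))))"

definition L_set :: "nat \<Rightarrow> nat \<Rightarrow> int vec set" where
  "L_set N k = {a \<in> carrier_vec (N div 2). theta_product N (2 * k) a \<in> modular_forms_Gamma1 k N}"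


section \<open>Cusps of \<open>X\<^sub>1(N)\<close> and the Galois action\<close>

text \<open>
  The fraction \<open>a/c\<close> (including \<open>1/0 = i\<infinity>\<close>) is given by a coprime pair \<open>(a, c)\<close>, unique up to
  a common sign; \<open>cusp N (a, c)\<close> is the set of all coprime pairs representing the class \<open>[a/c]\<close>.
\<close>

definition cusp :: "nat \<Rightarrow> int \<times> int \<Rightarrow> (int \<times> int) set" where
  "cusp N = (\<lambda>(a, c). {(a', c'). \<exists>(p, q, r, s) \<in> Gamma1 N. \<exists>e \<in> {1, -1}.
      a' = e * (p * a + q * c) \<and> c' = e * (r * a + s * c)})"

definition cusps :: "nat \<Rightarrow> (int \<times> int) set set" where
  "cusps N = {cusp N (a, c) | a c. coprime a c}"

text \<open>
  \<open>galois_related N x C C'\<close> is the graph of \<open>\<sigma>\<^sub>x\<close>, that is \<open>C' = \<sigma>\<^sub>x C\<close>, where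
  \<open>\<sigma>\<^sub>x [a/(gu)] = [a/(xgu)]\<close>.  Residue classes are given by integer representatives \<open>u\<close>, \<open>x\<close>, and
  these have to be chosen such that both fractions are reduced.
\<close>

definition galois_related :: "nat \<Rightarrow> int \<Rightarrow> (int \<times> int) set \<Rightarrow> (int \<times> int) set \<Rightarrow> bool" where
  "galois_related N x C C' \<longleftrightarrow>
     (\<exists>x' a g u. [x' = x] (mod int N) \<and> g > 0 \<and> g dvd int N \<and> coprime u (int N div g) \<and>
        coprime a (g * u) \<and> coprime a (x' * g * u) \<and>
        C = cusp N (a, g * u) \<and> C' = cusp N (a, x' * g * u))"

definition galois_orbit :: "nat \<Rightarrow> (int \<times> int) set \<Rightarrow> (int \<times> int) set set" where
  "galois_orbit N C = {C'. \<exists>x. coprime x (int N) \<and> galois_related N x C C'}"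

text \<open>
  \<open>c 0, \<dots>, c m\<close> are reduced fractions whose cusps represent each Galois orbit exactly once, the
  last cusp being \<open>[1/N] = [i\<infinity>]\<close>.
\<close>

definition cusp_orbit_representatives :: "nat \<Rightarrow> (nat \<Rightarrow> int \<times> int) \<Rightarrow> bool" where
  "cusp_orbit_representatives N c \<longleftrightarrow>
     (\<forall>i \<le> N div 2. coprime (fst (c i)) (snd (c i))) \<and>
     bij_betw (\<lambda>i. galois_orbit N (cusp N (c i))) {0..N div 2} (galois_orbit N ` cusps N) \<and>
     cusp N (c (N div 2)) = cusp N (1, int N)"

definition cusp_gcd :: "nat \<Rightarrow> int \<times> int \<Rightarrow> int" where
  "cusp_gcd N = (\<lambda>(a, c). gcd c (int N))"

definition orbit_size :: "nat \<Rightarrow> (nat \<Rightarrow> int \<times> int) \<Rightarrow> nat \<Rightarrow> nat" where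
  "orbit_size N c i = card (galois_orbit N (cusp N (c i)))"


section \<open>The matrices \<open>A\<^sub>N\<close>, \<open>B\<^sub>N\<close>, \<open>V\<^sub>N\<close> and related vectors\<close>

definition B2 :: "rat \<Rightarrow> rat" where
  "B2 x = x ^ 2 - x + 1 / 6"

definition A_mat :: "nat \<Rightarrow> (nat \<Rightarrow> int \<times> int) \<Rightarrow> rat mat" where
  "A_mat N c = mat (N div 2) (N div 2) (\<lambda>(r, j'). let j = j' + 1; a = fst (c r); g = cusp_gcd N (c r)
     in of_int g / 2 * B2 (frac (of_int (int j * a) / of_int g)))"

definition std_vec :: "nat \<Rightarrow> nat \<Rightarrow> int vec" where
  "std_vec m j = unit_vec m (j - 1)"

text \<open>All divisions by \<open>3\<close> below are exact.\<close>

definition B_mat :: "nat \<Rightarrow> int mat" where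
  "B_mat N =
    (if N = 5 then mat_of_rows_list 2 [[16, -5], [-4, 5]]
     else
       let m = N div 2;
           M = int (N * gcd 2 N);
           r = (2 * M) mod 3;
           a = (- M + 5 * r) div 3;
           b = (M - 8 * r) div 3;
           e = std_vec m;
           js = filter (\<lambda>j. 3 dvd j) [3..<m + 1];
           j1 = hd js
       in mat_of_cols m
         ([16 \<cdot>\<^sub>v e 1 - 4 \<cdot>\<^sub>v e 2,
           a \<cdot>\<^sub>v e 1 + b \<cdot>\<^sub>v e 2 + r \<cdot>\<^sub>v e 3]
          @ map (\<lambda>j. ((int j ^ 2 - 4) div 3) \<cdot>\<^sub>v e 1 - ((int j ^ 2 - 1) div 3) \<cdot>\<^sub>v e 2 + e j)
              (filter (\<lambda>j. \<not> 3 dvd j) [3..<m + 1])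
          @ [(int j1 ^ 2 - 4) \<cdot>\<^sub>v e 1 - (int j1 ^ 2 - 1) \<cdot>\<^sub>v e 2 + 3 \<cdot>\<^sub>v e j1]
          @ map (\<lambda>j. ((int j ^ 2 - int j1 ^ 2) div 3) \<cdot>\<^sub>v (e 1 - e 2) - e j1 + e j) (tl js)))"

definition V_mat :: "nat \<Rightarrow> (nat \<Rightarrow> int \<times> int) \<Rightarrow> rat mat" where
  "V_mat N c = A_mat N c * map_mat of_int (B_mat N)"

definition a_one :: "nat \<Rightarrow> int vec" where
  "a_one N = (if N = 5 then vec_of_list [-3, 2]
              else vec (N div 2) (\<lambda>i. if i = 0 then -3 else if i = 1 then 3 else if i = 2 then -1 else 0))"

definition g_vec :: "nat \<Rightarrow> (nat \<Rightarrow> int \<times> int) \<Rightarrow> rat vec" where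
  "g_vec N c = vec (N div 2) (\<lambda>i. of_int (cusp_gcd N (c i)))"

definition alpha_vec :: "nat \<Rightarrow> (nat \<Rightarrow> int \<times> int) \<Rightarrow> int mat \<Rightarrow> rat vec" where
  "alpha_vec N c P =
     - (map_mat of_int P *\<^sub>v ((1 / 12) \<cdot>\<^sub>v g_vec N c + A_mat N c *\<^sub>v map_vec of_int (a_one N)))"

definition R_num :: "nat \<Rightarrow> rat" where
  "R_num N = 1 / 24 * (\<Sum>d | d dvd N. of_nat (d * totient d * totient (N div d)))"


section \<open>Smith normal form and the group \<open>\<R>\<^sub>N\<close>\<close>

definition GL_int :: "nat \<Rightarrow> int mat set" where
  "GL_int m = {P \<in> carrier_mat m m. invertible_mat P}"

text \<open>
  The diagonal entries are determined up to sign, and no sign is imposed; this does not affect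
  \<open>\<int>/d\<^sub>i\<int>\<close>.  The matrix \<open>V\<close> has rational entries as a term, so the factorization is an equation
  of rational matrices (which forces \<open>V\<close> to be integral).
\<close>

definition smith_normal_form :: "nat \<Rightarrow> rat mat \<Rightarrow> int mat \<Rightarrow> int mat \<Rightarrow> int mat \<Rightarrow> bool" where
  "smith_normal_form m V P D Q \<longleftrightarrow>
     P \<in> GL_int m \<and> Q \<in> GL_int m \<and> D \<in> carrier_mat m m \<and> diagonal_mat D \<and>
     (\<forall>i. i + 1 < m \<longrightarrow> D $$ (i, i) dvd D $$ (i + 1, i + 1)) \<and>
     map_mat of_int P * V * map_mat of_int Q = map_mat of_int D"

text \<open>Here \<open>\<R>\<^sub>N\<close> is written multiplicatively, as is usual in \<open>HOL-Algebra\<close>.\<close>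

definition R_group :: "int mat \<Rightarrow> (nat \<Rightarrow> int) monoid" where
  "R_group D = product_group {..<dim_row D} (\<lambda>i. integer_mod_group (nat \<bar>D $$ (i, i)\<bar>))"

definition R_class :: "int mat \<Rightarrow> int vec \<Rightarrow> nat \<Rightarrow> int" where
  "R_class D v = (\<lambda>i \<in> {..<dim_row D}. v $ i mod \<bar>D $$ (i, i)\<bar>)"

definition gamma_class :: "int mat \<Rightarrow> int mat \<Rightarrow> nat \<Rightarrow> nat \<Rightarrow> int" where
  "gamma_class D P i = (if i < dim_row D then R_class D (col P i) else \<one>\<^bsub>R_group D\<^esub>)"

text \<open>The vector \<open>\<alpha>\<^sub>N\<close> is integral, so that taking floors only changes its type.\<close>

definition beta_class :: "nat \<Rightarrow> (nat \<Rightarrow> int \<times> int) \<Rightarrow> int mat \<Rightarrow> int mat \<Rightarrow> nat \<Rightarrow> int" where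
  "beta_class N c D P = R_class D (map_vec floor (alpha_vec N c P))"


section \<open>The recursion\<close>

text \<open>
  Arguments: the group, the step sizes \<open>\<mu>\<close>, the group elements \<open>\<gamma>\<close>, and then \<open>j\<close>, \<open>S\<close>, \<open>\<rho>\<close>.
  The orbit sizes \<open>\<mu> j\<close> are positive; the test \<open>\<mu> j = 0\<close> only makes the function total.
\<close>

function D_count ::
  "('g, 'b) monoid_scheme \<Rightarrow> (nat \<Rightarrow> nat) \<Rightarrow> (nat \<Rightarrow> 'g) \<Rightarrow> nat \<Rightarrow> int \<Rightarrow> 'g \<Rightarrow> nat" where
  "D_count G \<mu> \<gamma> 0 S \<rho> = (if S = 0 \<and> \<rho> = \<one>\<^bsub>G\<^esub> then 1 else 0)"
| "D_count G \<mu> \<gamma> (Suc j) S \<rho> =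
    (if S < 0 then 0
     else D_count G \<mu> \<gamma> j S \<rho> +
          (if \<mu> j = 0 then 0 else D_count G \<mu> \<gamma> (Suc j) (S - int (\<mu> j)) (\<rho> \<otimes>\<^bsub>G\<^esub> inv\<^bsub>G\<^esub> (\<gamma> j))))"
  by pat_completeness auto
termination
  by (relation "measures [\<lambda>(G, \<mu>, \<gamma>, j, S, \<rho>). j, \<lambda>(G, \<mu>, \<gamma>, j, S, \<rho>). nat (S + 1)]") auto

declare D_count.simps [simp del]

end

theory Submission
  imports Defs
begin

text \<open>
  Up to a constant, \<open>f\<^sub>a\<close> is a product of Klein forms at \<open>N\<close>-division points and of powers of \<open>\<eta>\<^sup>2\<close>.
  Their transformation under \<open>SL\<^sub>2(\<int>)\<close> shows that \<open>f\<^sub>a\<close> has weight \<open>k\<close> on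
  \<open>\<Gamma>\<^sub>1(N)\<close> if and only if \<open>12\<close> divides \<open>k + \<Sum> a\<^sub>j\<close> and \<open>2N\<close> divides \<open>\<Sum> j\<^sup>2a\<^sub>j - N \<Sum> j a\<^sub>j\<close>, and that the
  order of \<open>f\<^sub>a\<close> at a cusp \<open>[p/r]\<close> with \<open>g = gcd r N\<close> is \<open>k g / 12 + \<Sum> a\<^sub>j (g / 2) B\<^sub>2(\<langle>j p / g\<rangle>)\<close>.
  The exponents satisfying the congruences form the lattice coset \<open>k a\<^sup>(\<^sup>1\<^sup>) + B\<^sub>N \<int>\<^sup>m\<close>. The orders are integers,
  they sum to \<open>k R\<^sub>N\<close> over the cusps, and they determine \<open>a\<close>; in the coordinates of the Smith form, a vector
  of integers is the vector of orders of some \<open>a\<close> in the coset if and only if it satisfies a single equation in \<open>\<R>\<^sub>N\<close>.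
  Hence \<open>L\<^sub>N(k)\<close> corresponds to the nonnegative integral solutions of that equation with prescribed
  weighted sum, which are what the recursion counts.
\<close>

section \<open>The \<open>q\<close>-Pochhammer symbol\<close>

text \<open>The global analytic input is Liouville's theorem: it yields the inversion formula of the
  sigma function, and the behaviour of \<eta>^2 is then drawn from the Klein forms at the three
  half-periods. Since a_0 = 2k is even, \<eta> itself, with its half-integral weight and branch of
  the square root, never occurs. Each factor with base q^N is spread over the N division points with
  indices (j, l), l < N, on which a matrix acts as on row vectors. Modulo N, a matrix in
  \<Gamma>_1(N) only permutes the l belonging to a fixed j, so that invariance comes down to
  computing a root of unity. No valence formula is used: the sum of the orders over all cusps is
  evaluated by the distribution relation of B_2, and it recovers the order at i\<infinity>, whose
  Galois orbit is a single cusp. That the orders determine a is usually read off from the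
  non-vanishing of generalized Bernoulli numbers; here an elementary inequality between the finite
  Fourier coefficients of B_2 takes that place.\<close>

lemma geometric_sum_norm_bound:
  fixes x q :: complex
  assumes "norm q \<le> r" "norm x \<le> R"
  shows "norm (x * q ^ n) \<le> R * r ^ n"
proof -
  have "0 \<le> R" using assms(2) norm_ge_zero[of x] by linarith
  thus ?thesis unfolding norm_mult norm_power by (intro mult_mono power_mono assms) auto
qed

lemma abs_convergent_q_pochhammer:
  assumes "norm q < 1"
  shows "abs_convergent_prod (\<lambda>n. 1 - x * q ^ n :: complex)"
proof -
  have "summable (\<lambda>n. norm x * norm q ^ n)"
    using assms by (intro summable_mult summable_geometric) auto
  hence "summable (\<lambda>n. norm ((1 - x * q ^ n) - 1))"
    by (simp add: norm_mult norm_power)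
  thus ?thesis
    by (rule summable_imp_abs_convergent_prod)
qed

lemma q_pochhammer_has_prod:
  assumes "norm q < 1"
  shows "(\<lambda>n. 1 - x * q ^ n) has_prod q_pochhammer x q"
  unfolding q_pochhammer_def
  using abs_convergent_q_pochhammer[OF assms] abs_convergent_prod_imp_convergent_prod
  by (blast intro: convergent_prod_has_prod)

lemma q_pochhammer_LIMSEQ:
  assumes "norm q < 1"
  shows "(\<lambda>n. \<Prod>k<n. 1 - x * q ^ k) \<longlonglongrightarrow> q_pochhammer x q"
  using has_prod_imp_tendsto'[OF q_pochhammer_has_prod[OF assms]] .

lemma q_pochhammer_eq_0_iff:
  assumes "norm q < 1"
  shows "q_pochhammer x q = 0 \<longleftrightarrow> (\<exists>n. x * q ^ n = 1)"
  using has_prod_eq_0_iff[OF q_pochhammer_has_prod[OF assms, of x]] by auto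

lemma q_pochhammer_rec:
  assumes "norm q < 1"
  shows "q_pochhammer x q = (1 - x) * q_pochhammer (x * q) q"
proof -
  have "(\<lambda>n. \<Prod>k<Suc n. 1 - x * q ^ k) \<longlonglongrightarrow> q_pochhammer x q"
    using q_pochhammer_LIMSEQ[OF assms] by (rule LIMSEQ_Suc)
  moreover have "(\<Prod>k<Suc n. 1 - x * q ^ k) = (1 - x) * (\<Prod>k<n. 1 - (x * q) * q ^ k)" for n
    by (subst prod.lessThan_Suc_shift) (simp add: mult.assoc)
  ultimately have "(\<lambda>n. (1 - x) * (\<Prod>k<n. 1 - (x * q) * q ^ k)) \<longlonglongrightarrow> q_pochhammer x q"
    by simp
  moreover have "(\<lambda>n. (1 - x) * (\<Prod>k<n. 1 - (x * q) * q ^ k)) \<longlonglongrightarrow> (1 - x) * q_pochhammer (x * q) q"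
    by (intro tendsto_intros q_pochhammer_LIMSEQ assms)
  ultimately show ?thesis
    by (rule LIMSEQ_unique)
qed

lemma q_pochhammer_split:
  assumes "norm q < 1"
  shows "q_pochhammer x q = q_pochhammer x (q ^ 2) * q_pochhammer (x * q) (q ^ 2)"
proof -
  have q2: "norm (q ^ 2) < 1"
    using assms by (simp add: norm_power power_less_one_iff)
  have eq: "(\<Prod>k<2 * n. 1 - x * q ^ k) = (\<Prod>k<n. 1 - x * (q ^ 2) ^ k) * (\<Prod>k<n. 1 - x * q * (q ^ 2) ^ k)"
    for n
    by (induction n) (simp_all add: power_mult [symmetric] algebra_simps)
  have "(\<lambda>n. \<Prod>k<2 * n. 1 - x * q ^ k) \<longlonglongrightarrow> q_pochhammer x q"
    using LIMSEQ_subseq_LIMSEQ[OF q_pochhammer_LIMSEQ[OF assms], of "\<lambda>n. 2 * n"]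
    by (simp add: strict_mono_def o_def)
  moreover have "(\<lambda>n. \<Prod>k<2 * n. 1 - x * q ^ k)
      \<longlonglongrightarrow> q_pochhammer x (q ^ 2) * q_pochhammer (x * q) (q ^ 2)"
    unfolding eq by (intro tendsto_mult q_pochhammer_LIMSEQ q2)
  ultimately show ?thesis
    by (rule LIMSEQ_unique)
qed

text \<open>Both sides are polynomials in y of degree at most N, and they agree at the N + 1 points
  consisting of 0 and the inverses of the N-th roots of unity.\<close>

lemma prod_one_minus_roots_unity:
  fixes y :: complex
  assumes "N > 0"
  shows "(\<Prod>l<N. 1 - exp (2 * of_real pi * \<i> * of_nat l / of_nat N) * y) = 1 - y ^ N"
proof -
  define w where "w l = exp (2 * of_real pi * \<i> * of_nat l / of_nat N)" for l :: nat
  define p where "p = (\<Prod>l<N. [:1, - w l:])"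
  define r where "r = (1 - monom 1 N :: complex poly)"
  have inj: "inj_on (\<lambda>l. inverse (w l)) {..<N}"
  proof (rule inj_onI)
    fix k l assume kl: "k \<in> {..<N}" "l \<in> {..<N}" "inverse (w k) = inverse (w l)"
    have "inj_on w {..<N}"
      using bij_betw_roots_unity[of N] unfolding bij_betw_def w_def by auto
    moreover have "w k = w l" using kl by simp
    ultimately show "k = l" using kl by (auto dest: inj_onD)
  qed
  have wN: "w l ^ N = 1" for l
    using complex_root_unity[of N l] assms unfolding w_def by (simp add: mult_ac)
  have w0: "w l \<noteq> 0" for l unfolding w_def by simp
  let ?X = "insert 0 ((\<lambda>l. inverse (w l)) ` {..<N})"
  have "p = r"
  proof (rule poly_eqI_degree[of ?X])
    fix x assume "x \<in> ?X"
    thus "poly p x = poly r x"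
    proof
      assume "x = 0" thus ?thesis using assms by (simp add: p_def r_def poly_prod poly_monom)
    next
      assume "x \<in> (\<lambda>l. inverse (w l)) ` {..<N}"
      then obtain l where l: "l < N" "x = inverse (w l)" by auto
      have "poly p x = 0" unfolding p_def poly_prod
        by (rule prod_zero) (use l w0[of l] in \<open>auto intro!: bexI[of _ l]\<close>)
      moreover have "poly r x = 0"
        using l wN[of l] by (simp add: r_def poly_monom power_inverse)
      ultimately show ?thesis by simp
    qed
  next
    have card: "card ?X = Suc N"
      using w0 by (subst card_insert_disjoint) (auto simp: card_image[OF inj])
    have "degree p \<le> (\<Sum>l<N. (degree \<circ> (\<lambda>l. [:1, - w l:])) l)" unfolding p_def by (rule degree_prod_sum_le) auto
    also have "\<dots> \<le> (\<Sum>l<N. 1)" by (intro sum_mono) auto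
    finally show "degree p < card ?X" using card by simp
    have "degree r \<le> N" unfolding r_def
      by (rule degree_diff_le) (auto simp: degree_monom_le)
    thus "degree r < card ?X" using card by simp
  qed
  hence "poly p y = poly r y" by simp
  thus ?thesis by (simp add: p_def r_def poly_prod poly_monom w_def algebra_simps)
qed

text \<open>The bridge from base q to base q^N: the N division points with a common first coordinate
  combine into one symbol with base q^N. The identity holds for each factor of the partial products
  and passes to the limit.\<close>

lemma prod_q_pochhammer_roots_unity:
  assumes "norm q < 1" "N > 0"
  shows "(\<Prod>l<N. q_pochhammer (exp (2 * of_real pi * \<i> * of_nat l / of_nat N) * x) q)
           = q_pochhammer (x ^ N) (q ^ N)"
proof -
  let ?w = "\<lambda>l. exp (2 * of_real pi * \<i> * of_nat l / of_nat N)"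
  have qN: "norm (q ^ N) < 1"
    using assms by (simp add: norm_power power_less_one_iff)
  have "(\<lambda>n. \<Prod>l<N. \<Prod>k<n. 1 - (?w l * x) * q ^ k) \<longlonglongrightarrow> (\<Prod>l<N. q_pochhammer (?w l * x) q)"
    by (intro tendsto_prod q_pochhammer_LIMSEQ assms)
  moreover have "(\<Prod>l<N. \<Prod>k<n. 1 - (?w l * x) * q ^ k) = (\<Prod>k<n. 1 - x ^ N * (q ^ N) ^ k)" for n
  proof (subst prod.swap, rule prod.cong[OF refl])
    fix k
    show "(\<Prod>l<N. 1 - (?w l * x) * q ^ k) = 1 - x ^ N * (q ^ N) ^ k"
      using prod_one_minus_roots_unity[OF assms(2), of "x * q ^ k"]
      by (simp add: power_mult_distrib mult_ac flip: power_mult)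
  qed
  ultimately have "(\<lambda>n. \<Prod>k<n. 1 - x ^ N * (q ^ N) ^ k) \<longlonglongrightarrow> (\<Prod>l<N. q_pochhammer (?w l * x) q)"
    by simp
  from LIMSEQ_unique[OF this q_pochhammer_LIMSEQ[OF qN]] show ?thesis .
qed

lemma holomorphic_on_q_pochhammer:
  assumes "f holomorphic_on A" "g holomorphic_on A" "open A" "\<And>z. z \<in> A \<Longrightarrow> norm (g z) < 1"
  shows "(\<lambda>z. q_pochhammer (f z) (g z)) holomorphic_on A"
proof (rule holomorphic_uniform_sequence[OF assms(3), of "\<lambda>n z. \<Prod>k<n. 1 - f z * g z ^ k"])
  show "(\<lambda>z. \<Prod>k<n. 1 - f z * g z ^ k) holomorphic_on A" for n
    by (intro holomorphic_intros assms)
next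
  fix x assume x: "x \<in> A"
  obtain d where d: "d > 0" "cball x d \<subseteq> A"
    using x assms(3) open_contains_cball by blast
  have cont: "continuous_on (cball x d) f" "continuous_on (cball x d) g"
    using assms(1,2) d(2) holomorphic_on_imp_continuous_on holomorphic_on_subset by blast+
  \<comment> \<open>The maximum of the norm of \<open>g\<close> on the compact disc is attained,
    hence still below 1; this supplies a geometric majorant.\<close>
  obtain y where y: "y \<in> cball x d" "\<And>z. z \<in> cball x d \<Longrightarrow> norm (g z) \<le> norm (g y)"
    using continuous_attains_sup[of "cball x d" "\<lambda>z. norm (g z)"] d(1) continuous_on_norm[OF cont(2)]
    by (metis compact_cball cball_eq_empty less_le_not_le linorder_not_less order_le_less)
  obtain R where R: "\<And>z. z \<in> cball x d \<Longrightarrow> norm (f z) \<le> R"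
    using compact_continuous_image[OF cont(1)] compact_imp_bounded[of "f ` cball x d"]
    unfolding bounded_iff by (metis compact_cball imageI)
  have gy: "norm (g y) < 1" using y d assms(4) by auto
  have "uniformly_convergent_on (cball x d) (\<lambda>n z. \<Prod>k<n. 1 - f z * g z ^ k)"
  proof (rule uniformly_convergent_on_prod')
    show "uniformly_convergent_on (cball x d) (\<lambda>N z. \<Sum>n<N. norm (1 - f z * g z ^ n - 1))"
    proof (rule Weierstrass_m_test')
      show "summable (\<lambda>n. R * norm (g y) ^ n)"
        using gy by (intro summable_mult summable_geometric) auto
      show "norm (norm (1 - f z * g z ^ n - 1)) \<le> R * norm (g y) ^ n" if "z \<in> cball x d" for n z
        using geometric_sum_norm_bound[OF y(2)[OF that] R[OF that]] by (simp add: norm_minus_commute)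
    qed
  qed (auto intro!: continuous_intros cont)
  then obtain l where l: "uniform_limit (cball x d) (\<lambda>n z. \<Prod>k<n. 1 - f z * g z ^ k) l sequentially"
    by (auto simp: uniformly_convergent_on_def)
  have "l z = q_pochhammer (f z) (g z)" if "z \<in> cball x d" for z
    using tendsto_uniform_limitI[OF l that] q_pochhammer_LIMSEQ[of "g z" "f z"] assms(4) d(2) that
    by (blast intro: LIMSEQ_unique)
  hence "uniform_limit (cball x d) (\<lambda>n z. \<Prod>k<n. 1 - f z * g z ^ k) (\<lambda>z. q_pochhammer (f z) (g z)) sequentially"
    using l by (subst uniform_limit_cong'[of _ _ "\<lambda>n z. \<Prod>k<n. 1 - f z * g z ^ k" _ l]) auto
  thus "\<exists>d>0. cball x d \<subseteq> A \<and> uniform_limit (cball x d) (\<lambda>n z. \<Prod>k<n. 1 - f z * g z ^ k) (\<lambda>z. q_pochhammer (f z) (g z)) sequentially"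
    using d by blast
qed

text \<open>The bound is uniform in q, so it controls limits in which argument and base tend to 0
  together. The factor 2 is the sum of the geometric series with ratio 1/2.\<close>

lemma norm_q_pochhammer_minus_1_le:
  assumes "norm q \<le> 1 / 2"
  shows "norm (q_pochhammer x q - 1) \<le> exp (2 * norm x) - 1"
proof -
  have q: "norm q < 1" using assms by simp
  have "norm ((\<Prod>k<n. 1 - x * q ^ k) - 1) \<le> exp (2 * norm x) - 1" for n
  proof -
    have "norm ((\<Prod>k<n. 1 + - (x * q ^ k)) - 1) \<le> (\<Prod>k<n. 1 + norm (- (x * q ^ k))) - 1"
      by (rule norm_prod_minus1_le_prod_minus1)
    also have "(\<Prod>k<n. 1 + norm (- (x * q ^ k))) \<le> exp (\<Sum>k<n. norm (- (x * q ^ k)))"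
      by (rule prod_le_exp_sum) auto
    also have "(\<Sum>k<n. norm (- (x * q ^ k))) \<le> (\<Sum>k<n. norm x * (1 / 2) ^ k)"
      by (intro sum_mono) (use assms in \<open>auto simp: norm_mult norm_power intro!: mult_left_mono power_mono\<close>)
    also have "\<dots> = norm x * (\<Sum>k<n. (1 / 2) ^ k)"
      by (simp add: sum_distrib_left)
    also have "\<dots> \<le> norm x * 2"
      by (intro mult_left_mono) (simp_all add: sum_gp_strict del: power_one_over)
    finally show ?thesis by (simp add: mult.commute)
  qed
  moreover have "(\<lambda>n. norm ((\<Prod>k<n. 1 - x * q ^ k) - 1)) \<longlonglongrightarrow> norm (q_pochhammer x q - 1)"
    by (intro tendsto_intros q_pochhammer_LIMSEQ q)
  ultimately show ?thesis
    by (intro LIMSEQ_le_const2) auto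
qed

lemma tendsto_q_pochhammer_1:
  assumes "(f \<longlongrightarrow> 0) F" "(g \<longlongrightarrow> 0) F"
  shows "((\<lambda>z. q_pochhammer (f z) (g z)) \<longlongrightarrow> 1) F"
proof (rule Lim_transform_bound[THEN LIM_zero_cancel, rotated])
  have "((\<lambda>z. exp (2 * norm (f z)) - 1) \<longlongrightarrow> exp (2 * norm (0::complex)) - 1) F"
    by (intro tendsto_intros assms)
  thus "((\<lambda>z. exp (2 * norm (f z)) - 1) \<longlongrightarrow> 0) F" by simp
  have "eventually (\<lambda>z. norm (g z) < 1 / 2) F"
    using tendsto_norm[OF assms(2)] by (intro order_tendstoD(2)[of _ 0]) auto
  thus "eventually (\<lambda>z. norm (q_pochhammer (f z) (g z) - 1) \<le> norm (exp (2 * norm (f z)) - 1)) F"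
  proof eventually_elim
    case (elim z)
    thus ?case using norm_q_pochhammer_minus_1_le[of "g z" "f z"] by (simp)
  qed
qed

section \<open>The sigma function and its inversion formula\<close>

text \<open>exp(\<pi>iz) rather than exp(2\<pi>iz): signs become values at integers, q is
  \<open>expi (2 * \<tau>)\<close>, and all multipliers can be collected as exponents that matter
  only modulo 2.\<close>

definition expi :: "complex \<Rightarrow> complex" where
  "expi z = exp (of_real pi * \<i> * z)"

lemma expi_0 [simp]: "expi 0 = 1"
  by (simp add: expi_def)

lemma expi_nonzero [simp]: "expi z \<noteq> 0"
  by (simp add: expi_def)

lemma expi_add: "expi (x + y) = expi x * expi y"
  by (simp add: expi_def algebra_simps exp_add)

lemma expi_diff: "expi (x - y) = expi x / expi y"
  by (simp add: expi_def algebra_simps exp_diff)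

lemma expi_minus: "expi (- x) = inverse (expi x)"
  by (simp add: expi_def exp_minus)

lemma expi_power: "expi x ^ n = expi (of_nat n * x)"
  by (simp add: expi_def algebra_simps flip: exp_of_nat_mult)

lemma expi_power_int: "expi x powi n = expi (of_int n * x)"
  by (simp add: expi_def exp_power_int algebra_simps)

lemma expi_sum: "expi (sum f A) = (\<Prod>x\<in>A. expi (f x))"
  by (induction A rule: infinite_finite_induct) (simp_all add: expi_add)

lemma norm_expi: "norm (expi z) = exp (- pi * Im z)"
  by (simp add: expi_def)

lemma expi_1 [simp]: "expi 1 = -1"
  by (simp add: expi_def)

lemma expi_2 [simp]: "expi 2 = 1"
  by (metis expi_1 expi_add minus_mult_minus mult_1 one_add_one)

lemma expi_eq_1_iff: "expi z = 1 \<longleftrightarrow> (\<exists>n::int. z = 2 * of_int n)"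
proof -
  have "expi z = 1 \<longleftrightarrow> (\<exists>n::int. pi * Im z = 0 \<and> pi * Re z = of_int (2 * n) * pi)"
    unfolding expi_def exp_eq_1 by simp
  also have "\<dots> \<longleftrightarrow> (\<exists>n::int. z = 2 * of_int n)"
    by (auto simp: complex_eq_iff)
  finally show ?thesis .
qed

lemma expi_even_int [simp]: "expi (2 * of_int n) = 1"
  using expi_eq_1_iff by blast

lemma expi_of_int: "expi (of_int n) = (if even n then 1 else -1)"
proof (cases "even n")
  case True
  then obtain m where "n = 2 * m" by blast
  thus ?thesis by simp
next
  case False
  then obtain m where "n = 2 * m + 1" by (auto elim: oddE)
  thus ?thesis by (simp add: expi_add)
qed

lemma expi_cong: "x - y = 2 * of_int n \<Longrightarrow> expi x = expi y"
  using expi_even_int[of n] expi_nonzero[of y] by (metis expi_diff nonzero_eq_divide_eq mult_1)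

lemma holomorphic_on_expi [holomorphic_intros]:
  "f holomorphic_on A \<Longrightarrow> (\<lambda>z. expi (f z)) holomorphic_on A"
  unfolding expi_def by (intro holomorphic_intros)

lemma norm_expi_2_less_1: "Im \<tau> > 0 \<Longrightarrow> norm (expi (2 * \<tau>)) < 1"
  by (simp add: norm_expi)

text \<open>Up to a constant and a Gaussian factor, this is the Weierstrass \<open>\<sigma>\<close>-function of the lattice
  \<open>\<int>\<tau> + \<int>\<close>.\<close>

definition klein_sigma :: "complex \<Rightarrow> complex \<Rightarrow> complex" where
  "klein_sigma z \<tau> = - expi (- z) * q_pochhammer (expi (2 * z)) (expi (2 * \<tau>)) *
     q_pochhammer (expi (2 * \<tau> - 2 * z)) (expi (2 * \<tau>)) /
     q_pochhammer (expi (2 * \<tau>)) (expi (2 * \<tau>)) ^ 2"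

lemma q_pochhammer_self_nonzero:
  assumes "norm q < 1"
  shows "q_pochhammer q q \<noteq> 0"
proof -
  have "q * q ^ n \<noteq> 1" for n
  proof
    assume "q * q ^ n = 1"
    hence "norm q ^ Suc n = 1" by (metis norm_one norm_power power_Suc)
    moreover have "norm q ^ Suc n < 1" using assms power_strict_mono[of "norm q" 1 "Suc n"] by simp
    ultimately show False by simp
  qed
  thus ?thesis by (simp add: q_pochhammer_eq_0_iff[OF assms])
qed

lemma klein_sigma_holomorphic:
  assumes "f holomorphic_on A" "g holomorphic_on A" "open A" "\<And>z. z \<in> A \<Longrightarrow> Im (g z) > 0"
  shows "(\<lambda>z. klein_sigma (f z) (g z)) holomorphic_on A"
  unfolding klein_sigma_def
  by (intro holomorphic_intros holomorphic_on_q_pochhammer assms)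
     (use assms norm_expi_2_less_1 q_pochhammer_self_nonzero in auto)

lemma klein_sigma_eq_0_iff:
  assumes "Im \<tau> > 0"
  shows "klein_sigma z \<tau> = 0 \<longleftrightarrow> (\<exists>m n::int. z = of_int m * \<tau> + of_int n)"
proof -
  note q = norm_expi_2_less_1[OF assms]
  have *: "klein_sigma z \<tau> = 0 \<longleftrightarrow>
      (\<exists>k::nat. expi (2 * z + 2 * of_nat k * \<tau>) = 1) \<or> (\<exists>k::nat. expi (2 * of_nat (Suc k) * \<tau> - 2 * z) = 1)"
    using q_pochhammer_self_nonzero[OF q]
    by (simp add: klein_sigma_def q_pochhammer_eq_0_iff[OF q] expi_power flip: expi_add)
       (simp add: algebra_simps)
  show ?thesis
  proof
    assume "klein_sigma z \<tau> = 0"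
    with * consider k :: nat where "expi (2 * z + 2 * of_nat k * \<tau>) = 1"
      | k :: nat where "expi (2 * of_nat (Suc k) * \<tau> - 2 * z) = 1" by blast
    thus "\<exists>m n::int. z = of_int m * \<tau> + of_int n"
    proof cases
      case 1
      then obtain n :: int where "2 * z + 2 * of_nat k * \<tau> = 2 * of_int n"
        using expi_eq_1_iff by blast
      hence "2 * z = 2 * (of_int (- int k) * \<tau> + of_int n)" by (simp add: algebra_simps)
      hence "z = of_int (- int k) * \<tau> + of_int n" by (metis mult_cancel_left zero_neq_numeral)
      thus ?thesis by blast
    next
      case 2
      then obtain n :: int where "2 * of_nat (Suc k) * \<tau> - 2 * z = 2 * of_int n"
        using expi_eq_1_iff by blast
      hence "2 * z = 2 * (of_int (int (Suc k)) * \<tau> + of_int (- n))" by (simp add: algebra_simps)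
      hence "z = of_int (int (Suc k)) * \<tau> + of_int (- n)" by (metis mult_cancel_left zero_neq_numeral)
      thus ?thesis by blast
    qed
  next
    assume "\<exists>m n::int. z = of_int m * \<tau> + of_int n"
    then obtain m n :: int where mn: "z = of_int m * \<tau> + of_int n" by blast
    \<comment> \<open>The symbol with argument \<open>expi (2 * z)\<close> accounts for the zeros
      with m \<le> 0, the reflected symbol for those with m > 0.\<close>
    show "klein_sigma z \<tau> = 0"
    proof (cases "m \<le> 0")
      case True
      have "2 * z + 2 * of_nat (nat (- m)) * \<tau> = 2 * of_int n"
        using True by (simp add: mn algebra_simps)
      thus ?thesis using * expi_even_int by metis
    next
      case False
      have "2 * of_nat (Suc (nat (m - 1))) * \<tau> - 2 * z = 2 * of_int (- n)"
        using False by (simp add: mn algebra_simps)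
      thus ?thesis using * expi_even_int by metis
    qed
  qed
qed

lemma klein_sigma_add_1: "klein_sigma (z + 1) \<tau> = - klein_sigma z \<tau>"
  by (simp add: klein_sigma_def expi_add expi_diff expi_minus distrib_left field_simps)

lemma klein_sigma_tau_add_1: "klein_sigma z (\<tau> + 1) = klein_sigma z \<tau>"
  by (simp add: klein_sigma_def expi_add expi_diff algebra_simps)

lemma klein_sigma_add_tau:
  assumes "Im \<tau> > 0"
  shows "klein_sigma (z + \<tau>) \<tau> = - expi (- \<tau> - 2 * z) * klein_sigma z \<tau>"
proof -
  note q = norm_expi_2_less_1[OF assms]
  define w q where "w = expi (2 * z)" and "q = expi (2 * \<tau>)"
  have [simp]: "w \<noteq> 0" "q \<noteq> 0" by (auto simp: w_def q_def)
  have 1: "q_pochhammer w q = (1 - w) * q_pochhammer (w * q) q"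
    using q by (intro q_pochhammer_rec) (simp add: q_def)
  have "q_pochhammer (1 / w) q = (1 - 1 / w) * q_pochhammer (1 / w * q) q"
    using q by (intro q_pochhammer_rec) (simp add: q_def)
  hence 2: "q_pochhammer (1 / w) q = (1 - 1 / w) * q_pochhammer (q / w) q" by simp
  have e: "expi (2 * (z + \<tau>)) = w * q" "expi (2 * \<tau> - 2 * (z + \<tau>)) = 1 / w"
    "expi (2 * \<tau> - 2 * z) = q / w" "expi (2 * z) = w" "expi (2 * \<tau>) = q"
    by (simp_all add: w_def q_def expi_minus distrib_left field_simps flip: expi_add expi_diff)
  have e2: "expi (- (z + \<tau>)) = expi (- z) * expi (- \<tau>)" "expi (- \<tau> - 2 * z) = expi (- \<tau>) / w"
    by (simp_all add: w_def flip: expi_add expi_diff)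
  show ?thesis
    unfolding klein_sigma_def e e2 1 2 by (simp add: divide_simps) (simp add: algebra_simps)
qed

lemma klein_sigma_diff_tau:
  assumes "Im \<tau> > 0"
  shows "klein_sigma (z - \<tau>) \<tau> = - expi (2 * z - \<tau>) * klein_sigma z \<tau>"
proof -
  have "klein_sigma z \<tau> = - expi (- (2 * z - \<tau>)) * klein_sigma (z - \<tau>) \<tau>"
    using klein_sigma_add_tau[OF assms, of "z - \<tau>"] by (simp add: right_diff_distrib)
  thus ?thesis by (simp only: expi_minus) (simp add: field_simps)
qed

text \<open>The value is the same for every \<tau>, which is what fixes the constant in the
  inversion formula. The simple zero at 0 comes from the factor \<open>1 - expi (2 * z)\<close>, and
  the cofactor \<open>h\<close> is -1 there.\<close>

lemma klein_sigma_deriv_0: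
  assumes "Im \<tau> > 0"
  shows "((\<lambda>z. klein_sigma z \<tau>) has_field_derivative 2 * of_real pi * \<i>) (at 0)"
proof -
  note q = norm_expi_2_less_1[OF assms]
  define h where "h z = - expi (- z) * q_pochhammer (expi (2 * z + 2 * \<tau>)) (expi (2 * \<tau>)) *
     q_pochhammer (expi (2 * \<tau> - 2 * z)) (expi (2 * \<tau>)) /
     q_pochhammer (expi (2 * \<tau>)) (expi (2 * \<tau>)) ^ 2" for z
  have eq: "klein_sigma z \<tau> = (1 - expi (2 * z)) * h z" for z
    using q_pochhammer_rec[OF q, of "expi (2 * z)"]
    by (simp add: klein_sigma_def h_def expi_add)
  have h0: "h 0 = -1"
    using q_pochhammer_self_nonzero[OF q] by (simp add: h_def power2_eq_square)
  have "h holomorphic_on UNIV"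
    unfolding h_def
    by (intro holomorphic_intros holomorphic_on_q_pochhammer)
       (use q norm_expi_2_less_1 q_pochhammer_self_nonzero in auto)
  then obtain h' where h': "(h has_field_derivative h') (at 0)"
    using holomorphic_on_imp_differentiable_at[of h UNIV 0] by (auto simp: field_differentiable_def)
  have "((\<lambda>z. (1 - expi (2 * z)) * h z) has_field_derivative 2 * of_real pi * \<i>) (at 0)"
    unfolding expi_def
    by (rule derivative_eq_intros h' refl | simp)+ (simp add: h0)
  thus ?thesis by (simp add: eq)
qed

lemma complex_lattice_reduction:
  assumes "Im \<tau> > 0"
  obtains s t :: real and m n :: int where "s \<in> {0..1}" "t \<in> {0..1}"
    "z = of_real s * \<tau> + of_real t + of_int m * \<tau> + of_int n"
proof -
  define s where "s = Im z / Im \<tau>"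
  define t where "t = Re z - s * Re \<tau>"
  have s: "s * Im \<tau> = Im z"
    using assms by (simp add: s_def)
  have "z = of_real (frac s) * \<tau> + of_real (frac t) + of_int \<lfloor>s\<rfloor> * \<tau> + of_int \<lfloor>t\<rfloor>"
    using s by (simp add: complex_eq_iff frac_def algebra_simps t_def)
  thus ?thesis
    using that[of "frac s" "frac t"] frac_ge_0 frac_lt_1 by (metis atLeastAtMost_iff less_eq_real_def)
qed

text \<open>Both sides, as functions of \<open>z\<close>, have the same simple zeros and the same multipliers under
  translation by the lattice \<open>\<int>\<tau> + \<int>\<close>, so by Liouville's theorem their quotient is constant.\<close>

theorem klein_sigma_inversion:
  assumes "Im \<tau> > 0"
  shows "klein_sigma (z / \<tau>) (- 1 / \<tau>) = 1 / \<tau> * expi (z ^ 2 / \<tau>) * klein_sigma z \<tau>"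
proof -
  have \<tau>0 [simp]: "\<tau> \<noteq> 0" using assms by auto
  have \<tau>': "Im (- 1 / \<tau>) > 0"
    using assms by (simp add: Im_divide power2_eq_square sum_power2_gt_zero_iff zero_less_divide_iff
      complex_eq_iff) (metis \<tau>0 complex_eq_iff not_sum_squares_lt_zero not_less_iff_gr_or_eq sum_squares_eq_zero_iff zero_complex.sel)
  define F where "F z = expi (- (z ^ 2) / \<tau>) * klein_sigma (z / \<tau>) (- 1 / \<tau>) / klein_sigma z \<tau>" for z
  \<comment> \<open>At a zero of the denominator \<open>F\<close> has the form 0/0. Its limit at 0
    is 1/\<tau>, because the derivative at 0 is 2\<pi>i for both lattices, and periodicity carries
    this value to all lattice points.\<close>
  define G where "G z = (if klein_sigma z \<tau> = 0 then 1 / \<tau> else F z)" for z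
  have F1: "F (z + 1) = F z" for z
  proof -
    have "klein_sigma ((z + 1) / \<tau>) (- 1 / \<tau>) = klein_sigma (z / \<tau> - (- 1 / \<tau>)) (- 1 / \<tau>)"
      by (simp add: add_divide_distrib)
    also have "\<dots> = - expi (2 * z / \<tau> + 1 / \<tau>) * klein_sigma (z / \<tau>) (- 1 / \<tau>)"
      using klein_sigma_diff_tau[OF \<tau>', of "z / \<tau>"] by simp
    finally have 1: "klein_sigma ((z + 1) / \<tau>) (- 1 / \<tau>) = - expi (2 * z / \<tau> + 1 / \<tau>) * klein_sigma (z / \<tau>) (- 1 / \<tau>)" .
    have "- ((z + 1) ^ 2) / \<tau> = - (z ^ 2) / \<tau> - (2 * z / \<tau> + 1 / \<tau>)"
      by (simp add: field_simps power2_eq_square)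
    hence 2: "expi (- ((z + 1) ^ 2) / \<tau>) = expi (- (z ^ 2) / \<tau>) / expi (2 * z / \<tau> + 1 / \<tau>)"
      by (simp only: expi_diff)
    show ?thesis unfolding F_def klein_sigma_add_1 1 2 by simp
  qed
  have F2: "F (z + \<tau>) = F z" for z
  proof -
    have 1: "klein_sigma ((z + \<tau>) / \<tau>) (- 1 / \<tau>) = - klein_sigma (z / \<tau>) (- 1 / \<tau>)"
      using klein_sigma_add_1[of "z / \<tau>"] by (simp add: add_divide_distrib)
    have "- ((z + \<tau>) ^ 2) / \<tau> = - (z ^ 2) / \<tau> + (- \<tau> - 2 * z)"
      by (simp add: field_simps power2_eq_square)
    hence 2: "expi (- ((z + \<tau>) ^ 2) / \<tau>) = expi (- (z ^ 2) / \<tau>) * expi (- \<tau> - 2 * z)"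
      by (simp only: expi_add)
    show ?thesis unfolding F_def klein_sigma_add_tau[OF assms] 1 2 by simp
  qed
  have G1: "G (z + 1) = G z" and G2: "G (z + \<tau>) = G z" for z
    by (simp_all add: G_def F1 F2 klein_sigma_add_1 klein_sigma_add_tau[OF assms])
  have Gn: "G (z + of_int n) = G z" for z n
  proof (induction n rule: int_induct[of _ 0])
    case (step1 i) thus ?case using G1[of "z + of_int i"] by (simp add: algebra_simps)
  next
    case (step2 i) thus ?case using G1[of "z + of_int (i - 1)"] by (simp add: algebra_simps)
  qed simp
  have Gm: "G (z + of_int m * \<tau>) = G z" for z m
  proof (induction m rule: int_induct[of _ 0])
    case (step1 i) thus ?case using G2[of "z + of_int i * \<tau>"] by (simp add: algebra_simps)
  next
    case (step2 i) thus ?case using G2[of "z + of_int (i - 1) * \<tau>"] by (simp add: algebra_simps)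
  qed simp
  define k1 where "k1 \<sigma> z = (if z = 0 then 2 * of_real pi * \<i> else klein_sigma z \<sigma> / z)" for \<sigma> z
  have k1_hol: "k1 \<sigma> holomorphic_on UNIV" if "Im \<sigma> > 0" for \<sigma>
  proof -
    have "(\<lambda>z. klein_sigma z \<sigma>) holomorphic_on UNIV"
      by (rule klein_sigma_holomorphic) (use that in \<open>auto intro!: holomorphic_intros\<close>)
    from pole_lemma[OF this, of 0]
    have "(\<lambda>z. if z = 0 then deriv (\<lambda>z. klein_sigma z \<sigma>) 0
            else (klein_sigma z \<sigma> - klein_sigma 0 \<sigma>) / (z - 0)) holomorphic_on UNIV" by simp
    moreover have "klein_sigma 0 \<sigma> = 0"
      unfolding klein_sigma_eq_0_iff[OF that] by (rule exI[of _ 0], rule exI[of _ 0]) simp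
    ultimately show ?thesis
      unfolding k1_def using DERIV_imp_deriv[OF klein_sigma_deriv_0[OF that]]
      by (simp cong: if_cong)
  qed
  \<comment> \<open>Dividing numerator and denominator of \<open>F\<close> by z removes their common
    zero at 0, so that \<open>H\<close> is holomorphic near 0 and agrees with \<open>G\<close>
    there. The other lattice points are reduced to 0 by translation.\<close>
  define H where "H z = expi (- (z ^ 2) / \<tau>) * k1 (- 1 / \<tau>) (z / \<tau>) / (\<tau> * k1 \<tau> z)" for z
  have G_diff: "G field_differentiable (at z)" for z
  proof (cases "klein_sigma z \<tau> = 0")
    case False
    define A where "A = {z. klein_sigma z \<tau> \<noteq> 0}"
    have hol: "(\<lambda>z. klein_sigma z \<tau>) holomorphic_on A"
      and hol': "(\<lambda>z. klein_sigma z \<tau>) holomorphic_on UNIV"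
      by (rule holomorphic_on_subset[of _ UNIV], rule klein_sigma_holomorphic)
         (use assms in \<open>auto intro!: holomorphic_intros klein_sigma_holomorphic\<close>)
    have "open A" unfolding A_def
      using continuous_open_preimage[OF holomorphic_on_imp_continuous_on[OF hol'] open_UNIV, of "- {0}"]
      by (simp add: vimage_def open_Compl)
    have "F holomorphic_on A"
      unfolding F_def
      by (intro holomorphic_intros hol klein_sigma_holomorphic) (use \<open>open A\<close> \<tau>' in \<open>auto simp: A_def\<close>)
    hence "G holomorphic_on A"
      by (rule holomorphic_transform) (auto simp: A_def G_def)
    thus ?thesis using \<open>open A\<close> False by (intro holomorphic_on_imp_differentiable_at[of _ A]) (auto simp: A_def)
  next
    case True
    have k1c: "continuous_on UNIV (k1 \<tau>)"
      using k1_hol[OF assms] holomorphic_on_imp_continuous_on by blast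
    define A where "A = {z. k1 \<tau> z \<noteq> 0}"
    have oA: "open A" unfolding A_def
      using continuous_open_preimage[OF k1c open_UNIV, of "- {0}"] by (simp add: vimage_def open_Compl)
    have A0: "0 \<in> A" by (simp add: A_def k1_def)
    have k1A: "k1 \<tau> holomorphic_on A"
      using k1_hol[OF assms] holomorphic_on_subset by blast
    have k1A': "(\<lambda>z. k1 (- 1 / \<tau>) (z / \<tau>)) holomorphic_on A"
      by (rule holomorphic_on_compose_gen[of _ A "k1 (- 1 / \<tau>)" UNIV, unfolded o_def])
         (use k1_hol[OF \<tau>'] in \<open>auto intro!: holomorphic_intros\<close>)
    have "H holomorphic_on A"
      unfolding H_def
      by (intro holomorphic_intros k1A k1A') (auto simp: A_def)
    moreover have "H z = G z" if "z \<in> A" for z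
    proof (cases "z = 0")
      case True
      have "klein_sigma 0 \<tau> = 0"
        unfolding klein_sigma_eq_0_iff[OF assms] by (rule exI[of _ 0], rule exI[of _ 0]) simp
      thus ?thesis using True by (simp add: H_def G_def k1_def)
    next
      case False
      thus ?thesis using that by (simp add: H_def G_def k1_def A_def F_def)
    qed
    ultimately have "G holomorphic_on A" by (rule holomorphic_transform)
    hence G0: "G field_differentiable (at 0)"
      using oA A0 by (intro holomorphic_on_imp_differentiable_at[of _ A]) auto
    obtain m n :: int where mn: "z = of_int m * \<tau> + of_int n"
      using True klein_sigma_eq_0_iff[OF assms] by blast
    have eq: "G = G \<circ> (\<lambda>u. u - z)"
    proof
      fix u
      have "G (u - z + of_int m * \<tau> + of_int n) = G (u - z)" by (simp only: Gm Gn)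
      thus "G u = (G \<circ> (\<lambda>u. u - z)) u" by (simp add: mn)
    qed
    have "(G \<circ> (\<lambda>u. u - z)) field_differentiable (at z)"
      by (rule field_differentiable_compose) (use G0 in \<open>auto intro!: derivative_intros\<close>)
    thus ?thesis using eq by simp
  qed
  hence G_hol: "G holomorphic_on UNIV"
    by (simp add: holomorphic_on_def)
  define D where "D = (\<lambda>(s, t). of_real s * \<tau> + of_real t) ` ({0..1::real} \<times> {0..1::real})"
  have "compact D" unfolding D_def
    by (intro compact_continuous_image compact_Times)
       (auto simp: case_prod_unfold intro!: continuous_intros)
  hence "compact (G ` D)"
    by (intro compact_continuous_image continuous_on_subset[OF holomorphic_on_imp_continuous_on[OF G_hol]]) auto
  moreover have "range G \<subseteq> G ` D"
  proof safe
    fix z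
    obtain s t m n where st: "s \<in> {0..1}" "t \<in> {0..1}"
      "z = of_real s * \<tau> + of_real t + of_int m * \<tau> + of_int n"
      using complex_lattice_reduction[OF assms] by metis
    have "G z = G (of_real s * \<tau> + of_real t)"
      unfolding st(3) Gn Gm ..
    thus "G z \<in> G ` D" unfolding D_def using st(1,2) by force
  qed
  ultimately have "bounded (range G)"
    using bounded_subset compact_imp_bounded by blast
  from Liouville_theorem[OF G_hol this] obtain C where C: "\<And>z. G z = C"
    by (auto simp: constant_on_def)
  have "klein_sigma 0 \<tau> = 0"
    unfolding klein_sigma_eq_0_iff[OF assms] by (rule exI[of _ 0], rule exI[of _ 0]) simp
  hence "C = 1 / \<tau>" using C[of 0] by (simp add: G_def)
  hence G: "G z = 1 / \<tau>" using C by simp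
  show ?thesis
  proof (cases "klein_sigma z \<tau> = 0")
    case False
    hence "expi (- (z ^ 2) / \<tau>) * klein_sigma (z / \<tau>) (- 1 / \<tau>) = 1 / \<tau> * klein_sigma z \<tau>"
      using G by (simp add: G_def F_def field_simps)
    thus ?thesis by (simp add: expi_minus field_simps)
  next
    case True
    then obtain m n :: int where "z = of_int m * \<tau> + of_int n"
      using klein_sigma_eq_0_iff[OF assms] by blast
    hence "z / \<tau> = of_int (- n) * (- 1 / \<tau>) + of_int m"
      by (simp add: field_simps)
    hence "klein_sigma (z / \<tau>) (- 1 / \<tau>) = 0"
      using klein_sigma_eq_0_iff[OF \<tau>'] by blast
    thus ?thesis using True by simp
  qed
qed

section \<open>Klein forms and \<open>\<eta>\<^sup>2\<close> under \<open>SL\<^sub>2(\<int>)\<close>\<close>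

lemma klein_sigma_add_int: "klein_sigma (z + of_int n) \<tau> = expi (of_int n) * klein_sigma z \<tau>"
proof (induction n rule: int_induct[of _ 0])
  case (step1 i)
  thus ?case using klein_sigma_add_1[of "z + of_int i"] by (simp add: expi_add algebra_simps)
next
  case (step2 i)
  have "klein_sigma (z + of_int (i - 1)) \<tau> = - klein_sigma (z + of_int i) \<tau>"
    using klein_sigma_add_1[of "z + of_int (i - 1)" \<tau>] by simp
  thus ?case by (simp add: step2.IH expi_diff)
qed simp

lemma klein_sigma_add_int_tau:
  assumes "Im \<tau> > 0"
  shows "klein_sigma (z + of_int m * \<tau>) \<tau>
           = expi (of_int m - of_int m ^ 2 * \<tau> - 2 * of_int m * z) * klein_sigma z \<tau>"
proof (induction m rule: int_induct[of _ 0])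
  case (step1 i)
  have "klein_sigma (z + of_int (i + 1) * \<tau>) \<tau>
      = expi 1 * expi (- \<tau> - 2 * (z + of_int i * \<tau>)) * klein_sigma (z + of_int i * \<tau>) \<tau>"
    using klein_sigma_add_tau[OF assms, of "z + of_int i * \<tau>"] by (simp add: algebra_simps)
  also have "\<dots> = expi (1 + (- \<tau> - 2 * (z + of_int i * \<tau>)) +
      (of_int i - of_int i ^ 2 * \<tau> - 2 * of_int i * z)) * klein_sigma z \<tau>"
    by (simp only: step1.IH expi_add mult.assoc)
  also have "1 + (- \<tau> - 2 * (z + of_int i * \<tau>)) + (of_int i - of_int i ^ 2 * \<tau> - 2 * of_int i * z)
      = of_int (i + 1) - of_int (i + 1) ^ 2 * \<tau> - 2 * of_int (i + 1) * z"
    by (simp add: algebra_simps power2_eq_square)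
  finally show ?case .
next
  case (step2 i)
  have "klein_sigma (z + of_int (i - 1) * \<tau>) \<tau>
      = expi (-1) * expi (2 * (z + of_int i * \<tau>) - \<tau>) * klein_sigma (z + of_int i * \<tau>) \<tau>"
    using klein_sigma_diff_tau[OF assms, of "z + of_int i * \<tau>"] by (simp add: algebra_simps expi_minus)
  also have "\<dots> = expi (-1 + (2 * (z + of_int i * \<tau>) - \<tau>) +
      (of_int i - of_int i ^ 2 * \<tau> - 2 * of_int i * z)) * klein_sigma z \<tau>"
    by (simp only: step2.IH expi_add mult.assoc)
  also have "-1 + (2 * (z + of_int i * \<tau>) - \<tau>) + (of_int i - of_int i ^ 2 * \<tau> - 2 * of_int i * z)
      = of_int (i - 1) - of_int (i - 1) ^ 2 * \<tau> - 2 * of_int (i - 1) * z"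
    by (simp add: algebra_simps power2_eq_square)
  finally show ?case .
qed simp

text \<open>The Klein form of Kubert and Lang, up to a constant factor.\<close>

definition klein :: "real \<Rightarrow> real \<Rightarrow> complex \<Rightarrow> complex" where
  "klein x y \<tau> = expi (of_real x * (of_real x * \<tau> + of_real y)) *
     klein_sigma (of_real x * \<tau> + of_real y) \<tau>"

text \<open>The prefactor in \<open>klein\<close> is chosen to absorb the part of the multiplier of
  \<open>klein_sigma\<close> that depends on \<tau>. What is left is a constant, and a root of unity
  when x and y are rational.\<close>

lemma klein_shift:
  assumes "Im \<tau> > 0"
  shows "klein (x + of_int m) (y + of_int n) \<tau> =
    expi (of_int (m * n + m + n) + of_real (x * of_int n - y * of_int m)) * klein x y \<tau>"
proof -
  define z where "z = of_real x * \<tau> + of_real y"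
  have z: "of_real (x + of_int m) * \<tau> + of_real (y + of_int n) = z + of_int m * \<tau> + of_int n"
    by (simp add: z_def algebra_simps)
  have "klein (x + of_int m) (y + of_int n) \<tau> =
      expi (of_real (x + of_int m) * (z + of_int m * \<tau> + of_int n)) *
      (expi (of_int n) * (expi (of_int m - of_int m ^ 2 * \<tau> - 2 * of_int m * z) * klein_sigma z \<tau>))"
    unfolding klein_def z klein_sigma_add_int klein_sigma_add_int_tau[OF assms] ..
  also have "\<dots> = expi (of_real (x + of_int m) * (z + of_int m * \<tau> + of_int n) + of_int n +
      (of_int m - of_int m ^ 2 * \<tau> - 2 * of_int m * z)) * klein_sigma z \<tau>"
    by (simp only: expi_add mult.assoc)
  also have "of_real (x + of_int m) * (z + of_int m * \<tau> + of_int n) + of_int n +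
      (of_int m - of_int m ^ 2 * \<tau> - 2 * of_int m * z)
      = (of_int (m * n + m + n) + of_real (x * of_int n - y * of_int m)) + of_real x * z"
    unfolding z_def by (simp add: algebra_simps power2_eq_square)
  finally show ?thesis unfolding klein_def expi_add[symmetric] z_def
    by (simp add: expi_add)
qed

lemma klein_translate: "klein x y (\<tau> + 1) = klein x (x + y) \<tau>"
proof -
  have "of_real x * (\<tau> + 1) + of_real y = of_real x * \<tau> + (of_real (x + y) :: complex)"
    by (simp add: algebra_simps)
  thus ?thesis unfolding klein_def klein_sigma_tau_add_1 by (simp add: add.assoc)
qed

text \<open>The Gaussian factor of the inversion formula merges with the prefactor, so that only
  1/\<tau> remains, the automorphy factor of weight -1.\<close>

lemma klein_inversion:
  assumes "Im \<tau> > 0"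
  shows "klein x y (- 1 / \<tau>) = klein y (- x) \<tau> / \<tau>"
proof -
  have [simp]: "\<tau> \<noteq> 0" using assms by auto
  define z where "z = of_real y * \<tau> - of_real x"
  have z: "of_real x * (- 1 / \<tau>) + of_real y = z / \<tau>"
    by (simp add: z_def field_simps)
  have z': "of_real y * \<tau> + of_real (- x) = z" by (simp add: z_def)
  have "klein x y (- 1 / \<tau>) = expi (of_real x * (z / \<tau>) + z ^ 2 / \<tau>) * klein_sigma z \<tau> / \<tau>"
    unfolding klein_def z klein_sigma_inversion[OF assms] by (simp add: expi_add)
  also have "of_real x * (z / \<tau>) + z ^ 2 / \<tau> = of_real y * z"
    by (simp add: z_def field_simps power2_eq_square)
  finally show ?thesis unfolding klein_def z' .
qed

lemma klein_nonzero:
  assumes "Im \<tau> > 0" "x \<notin> \<int> \<or> y \<notin> \<int>"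
  shows "klein x y \<tau> \<noteq> 0"
proof
  assume "klein x y \<tau> = 0"
  then obtain m n :: int where mn: "of_real x * \<tau> + of_real y = of_int m * \<tau> + of_int n"
    using klein_sigma_eq_0_iff[OF assms(1)] by (auto simp: klein_def)
  hence "x * Im \<tau> = of_int m * Im \<tau>" by (simp add: complex_eq_iff)
  hence x: "x = of_int m" using assms(1) by simp
  hence "y = of_int n" using mn by (simp add: complex_eq_iff)
  with x show False using assms(2) by simp
qed

lemma klein_holomorphic: "klein x y holomorphic_on upper_half_plane"
  unfolding klein_def upper_half_plane_def
  by (intro holomorphic_intros klein_sigma_holomorphic open_halfspace_Im_gt) auto

section \<open>The square of Dedekind's eta function and its inversion\<close>

definition eta_sq :: "complex \<Rightarrow> complex" where
  "eta_sq \<tau> = expi (\<tau> / 6) * q_pochhammer (expi (2 * \<tau>)) (expi (2 * \<tau>)) ^ 2"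

lemma eta_sq_nonzero: "Im \<tau> > 0 \<Longrightarrow> eta_sq \<tau> \<noteq> 0"
  using q_pochhammer_self_nonzero[OF norm_expi_2_less_1] by (simp add: eta_sq_def)

lemma eta_sq_holomorphic: "eta_sq holomorphic_on upper_half_plane"
  unfolding eta_sq_def upper_half_plane_def
  by (intro holomorphic_intros holomorphic_on_q_pochhammer open_halfspace_Im_gt)
     (auto intro: norm_expi_2_less_1)

lemma eta_sq_translate: "eta_sq (\<tau> + 1) = expi (1 / 6) * eta_sq \<tau>"
  by (simp add: eta_sq_def add_divide_distrib distrib_left expi_add)

text \<open>Euler's identity between partitions into distinct parts and into odd parts, (-q; q)(q;
  q^2) = 1 for q = p^2, where (q; q^2) is split once more as (p; p^2)(-p; p^2).\<close>

lemma euler_odd_distinct: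
  assumes "norm p < 1"
  shows "q_pochhammer (- (p ^ 2)) (p ^ 2) * q_pochhammer p (p ^ 2) * q_pochhammer (- p) (p ^ 2) = 1"
proof -
  have two: "q_pochhammer x q * q_pochhammer (- x) q = q_pochhammer (x ^ 2) (q ^ 2)"
    if "norm q < 1" for x q :: complex
    using prod_q_pochhammer_roots_unity[OF that, of 2 x] by (simp add: numeral_2_eq_2 exp_pi_i')
  have p: "norm (p ^ 2) < 1" "norm ((p ^ 2) ^ 2) < 1"
    using assms by (simp_all add: norm_power power_less_one_iff flip: power_mult)
  have "q_pochhammer (- (p ^ 2)) (p ^ 2) * q_pochhammer (p ^ 2) ((p ^ 2) ^ 2) * q_pochhammer ((p ^ 2) ^ 2) ((p ^ 2) ^ 2)
      = q_pochhammer ((p ^ 2) ^ 2) ((p ^ 2) ^ 2)"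
    using two[OF p(1), of "p ^ 2"] q_pochhammer_split[OF p(1), of "p ^ 2"] by (simp add: mult_ac power2_eq_square)
  hence "q_pochhammer (- (p ^ 2)) (p ^ 2) * q_pochhammer (p ^ 2) ((p ^ 2) ^ 2) = 1"
    using q_pochhammer_self_nonzero[OF p(2)] by simp
  thus ?thesis using two[OF p(1), of p] by (simp add: mult.assoc)
qed

text \<open>The classical identity \<theta>_2 \<theta>_3 \<theta>_4 = 2 \<eta>^3 in terms of Klein
  forms. It ties \<eta>^2 to functions whose inversion is already known; the square of Euler's
  identity removes all infinite products.\<close>

lemma klein_half_periods:
  assumes "Im \<tau> > 0"
  shows "klein (1 / 2) 0 \<tau> * klein 0 (1 / 2) \<tau> * klein (1 / 2) (1 / 2) \<tau> * eta_sq \<tau> ^ 3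
           = - 2 * expi (- 3 / 4)"
proof -
  define p where "p = expi \<tau>"
  have p: "norm p < 1" using assms by (simp add: p_def norm_expi)
  have q: "norm (p ^ 2) < 1" using p by (simp add: norm_power power_less_one_iff)
  have q': "expi (2 * \<tau>) = p ^ 2" by (simp add: p_def expi_power)
  define D where "D = q_pochhammer (p ^ 2) (p ^ 2) ^ 2"
  have D0: "D \<noteq> 0" using q_pochhammer_self_nonzero[OF q] by (simp add: D_def)
  have rec: "q_pochhammer (- 1) (p ^ 2) = 2 * q_pochhammer (- (p ^ 2)) (p ^ 2)"
    using q_pochhammer_rec[OF q, of "- 1"] by simp
  have k1: "klein 0 (1 / 2) \<tau> = - expi (- (1 / 2)) * 2 * q_pochhammer (- (p ^ 2)) (p ^ 2) ^ 2 / D"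
    by (simp add: klein_def klein_sigma_def q' rec D_def expi_diff) (simp add: power2_eq_square)
  have k2: "klein (1 / 2) 0 \<tau> = - expi (\<tau> / 4 - \<tau> / 2) * q_pochhammer p (p ^ 2) ^ 2 / D"
  proof -
    have e: "of_real (1 / 2) * \<tau> + of_real 0 = \<tau> / 2" by simp
    have e1: "expi (2 * (\<tau> / 2)) = p" by (simp add: p_def)
    have e2: "expi (2 * \<tau> - 2 * (\<tau> / 2)) = p" by (simp add: p_def)
    have e3: "expi (\<tau> / 2) = expi (\<tau> / 4) * expi (\<tau> / 4)" by (simp flip: expi_add)
    show ?thesis
      unfolding klein_def klein_sigma_def e e1 e2 q'
      by (simp add: e3 D_def power2_eq_square expi_diff expi_minus field_simps)
  qed
  have k3: "klein (1 / 2) (1 / 2) \<tau> = - expi ((\<tau> + 1) / 4 - (\<tau> + 1) / 2) * q_pochhammer (- p) (p ^ 2) ^ 2 / D"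
  proof -
    have e: "of_real (1 / 2) * \<tau> + of_real (1 / 2) = (\<tau> + 1) / 2" by (simp add: field_simps)
    have "2 * ((\<tau> + 1) / 2) = \<tau> + 1" by simp
    hence e1: "expi (2 * ((\<tau> + 1) / 2)) = - p" by (simp only: p_def expi_add expi_1) simp
    have "expi (2 * \<tau> - 2 * ((\<tau> + 1) / 2)) = expi (\<tau> - 1)"
      by (rule arg_cong[of _ _ expi]) (simp add: field_simps)
    hence e2: "expi (2 * \<tau> - 2 * ((\<tau> + 1) / 2)) = - p" by (simp add: p_def expi_diff)
    have e3: "of_real (1 / 2) * ((\<tau> + 1) / 2) = (\<tau> + 1) / 4" by simp
    show ?thesis
      unfolding klein_def klein_sigma_def e e1 e2 e3 q'
      unfolding expi_diff expi_minus D_def power2_eq_square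
      by (simp only: divide_inverse mult_minus_left mult_minus_right mult_ac)
  qed
  have eta: "eta_sq \<tau> = expi (\<tau> / 6) * D" by (simp add: eta_sq_def D_def q')
  define E where "E = q_pochhammer (- (p ^ 2)) (p ^ 2) * q_pochhammer p (p ^ 2) * q_pochhammer (- p) (p ^ 2)"
  have "klein (1 / 2) 0 \<tau> * klein 0 (1 / 2) \<tau> * klein (1 / 2) (1 / 2) \<tau> * eta_sq \<tau> ^ 3
      = - 2 * (expi (\<tau> / 4 - \<tau> / 2) * expi (- (1 / 2)) * expi ((\<tau> + 1) / 4 - (\<tau> + 1) / 2) * expi (\<tau> / 6) ^ 3) * E ^ 2"
    unfolding k1 k2 k3 eta E_def using D0 by (simp add: field_simps power2_eq_square power3_eq_cube)
  also have "expi (\<tau> / 4 - \<tau> / 2) * expi (- (1 / 2)) * expi ((\<tau> + 1) / 4 - (\<tau> + 1) / 2) * expi (\<tau> / 6) ^ 3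
      = expi (- 3 / 4)"
    unfolding expi_power expi_add[symmetric] by (rule arg_cong[of _ _ expi]) (simp add: field_simps)
  also have "E = 1" unfolding E_def by (rule euler_odd_distinct[OF p])
  finally show ?thesis by simp
qed

lemma Im_minus_inverse_pos:
  assumes "Im \<tau> > 0"
  shows "Im (- 1 / \<tau>) > 0"
proof -
  have "\<tau> \<noteq> 0" using assms by auto
  hence "Re \<tau> ^ 2 + Im \<tau> ^ 2 > 0" using assms by (simp add: add_nonneg_pos)
  thus ?thesis using assms by (simp add: Im_divide)
qed

text \<open>Inversion permutes the three half-periods up to translation by the lattice, so the
  identity for their product determines the cube of the quotient \<open>h\<close> of the two sides:
  it is constant. At the fixed point i the quotient is 1. Hence \<open>h\<close> takes values in the
  cube roots of unity, and being continuous on a connected set it is constantly 1.\<close>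

theorem eta_sq_inversion:
  assumes "Im \<tau> > 0"
  shows "eta_sq (- 1 / \<tau>) = - \<i> * \<tau> * eta_sq \<tau>"
proof -
  define h where "h \<tau> = eta_sq (- 1 / \<tau>) / (- \<i> * \<tau> * eta_sq \<tau>)" for \<tau>
  have aux: "E = R * inverse e" if "e \<noteq> 0" "e * E = R" for e E R :: complex
    using that by (simp add: field_simps)
  \<comment> \<open>The right-hand side is left unevaluated: only its independence of \<tau>
    matters, since it is compared with the value at i.\<close>
  have h3: "h \<tau> ^ 3 = - inverse (- expi (- 3 / 2)) / (- \<i>) ^ 3 * - 1" if \<tau>: "Im \<tau> > 0" for \<tau>
  proof -
    have [simp]: "\<tau> \<noteq> 0" using \<tau> by auto
    define P where "P \<tau> = klein (1 / 2) 0 \<tau> * klein 0 (1 / 2) \<tau> * klein (1 / 2) (1 / 2) \<tau>" for \<tau>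
    have "klein 0 (- (1 / 2)) \<tau> = - klein 0 (1 / 2) \<tau>"
      using klein_shift[OF \<tau>, of 0 0 "1 / 2" "- 1"] by (simp add: expi_minus)
    moreover have "klein (1 / 2) (- (1 / 2)) \<tau> = expi (- 3 / 2) * klein (1 / 2) (1 / 2) \<tau>"
      using klein_shift[OF \<tau>, of "1 / 2" 0 "1 / 2" "- 1"] by simp
    ultimately have P: "P (- 1 / \<tau>) = - expi (- 3 / 2) * P \<tau> / \<tau> ^ 3"
      unfolding P_def klein_inversion[OF \<tau>] by (simp add: power3_eq_cube)
    have "P (- 1 / \<tau>) * eta_sq (- 1 / \<tau>) ^ 3 = P \<tau> * eta_sq \<tau> ^ 3"
      unfolding P_def klein_half_periods[OF \<tau>] klein_half_periods[OF Im_minus_inverse_pos[OF \<tau>]] ..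
    moreover have "P \<tau> \<noteq> 0"
      using klein_half_periods[OF \<tau>] by (auto simp: P_def)
    moreover have "P \<tau> * (- expi (- 3 / 2) * eta_sq (- 1 / \<tau>) ^ 3) = P \<tau> * (\<tau> ^ 3 * eta_sq \<tau> ^ 3)"
      if "- expi (- 3 / 2) * P \<tau> / \<tau> ^ 3 * eta_sq (- 1 / \<tau>) ^ 3 = P \<tau> * eta_sq \<tau> ^ 3"
      using that by (simp add: field_simps)
    ultimately have "- expi (- 3 / 2) * eta_sq (- 1 / \<tau>) ^ 3 = \<tau> ^ 3 * eta_sq \<tau> ^ 3"
      unfolding P using mult_left_cancel by blast
    hence "eta_sq (- 1 / \<tau>) ^ 3 = \<tau> ^ 3 * eta_sq \<tau> ^ 3 * inverse (- expi (- 3 / 2))"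
      by (rule aux[rotated]) simp
    thus ?thesis using eta_sq_nonzero[OF \<tau>]
      by (simp add: h_def power_divide power_mult_distrib field_simps)
  qed
  have hi: "h \<i> = 1"
  proof -
    have "- 1 / \<i> = \<i>" by (simp add: complex_eq_iff Re_divide Im_divide)
    thus ?thesis using eta_sq_nonzero[of \<i>] unfolding h_def by simp
  qed
  have h31: "h \<tau> ^ 3 = 1" if "Im \<tau> > 0" for \<tau>
    using h3[OF that] h3[of \<i>] hi by simp
  have "\<exists>a. \<forall>x\<in>upper_half_plane. h x = a"
  proof (rule continuous_finite_range_constant[unfolded constant_on_def])
    show "connected upper_half_plane"
      unfolding upper_half_plane_def by (intro convex_connected convex_halfspace_Im_gt)
    show "continuous_on upper_half_plane h"
    proof -
      have "(\<lambda>\<tau>. eta_sq (- 1 / \<tau>)) holomorphic_on upper_half_plane"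
        by (rule holomorphic_on_compose_gen[OF _ eta_sq_holomorphic, unfolded o_def])
           (use Im_minus_inverse_pos in \<open>auto intro!: holomorphic_intros simp: upper_half_plane_def\<close>)
      hence "h holomorphic_on upper_half_plane"
        unfolding h_def by (intro holomorphic_intros eta_sq_holomorphic)
          (use eta_sq_nonzero in \<open>auto simp: upper_half_plane_def\<close>)
      thus ?thesis by (rule holomorphic_on_imp_continuous_on)
    qed
    show "finite (h ` upper_half_plane)"
      by (rule finite_subset[OF _ finite_roots_unity[of 3]]) (use h31 in \<open>auto simp: upper_half_plane_def\<close>)
  qed
  hence "h \<tau> = h \<i>" using assms by (auto simp: upper_half_plane_def)
  hence "h \<tau> = 1" using hi by simp
  thus ?thesis unfolding h_def divide_eq_1_iff by blast
qed

text \<open>Euclid's algorithm on the bottom row (c, d). The generators multiply from the right,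
  that is, they act first on \<tau>, so that each induction step applies the known law of T or S at
  \<tau>.\<close>

lemma SL2Z_induct [consumes 1, case_names one T T_inv S]:
  assumes "(a, b, c, d) \<in> SL2Z"
  assumes one: "P 1 0 0 1"
    and T: "\<And>a b c d. P a b c d \<Longrightarrow> P a (a + b) c (c + d)"
    and T_inv: "\<And>a b c d. P a b c d \<Longrightarrow> P a (b - a) c (d - c)"
    and S: "\<And>a b c d. P a b c d \<Longrightarrow> P b (- a) d (- c)"
  shows "P a b c d"
proof -
  have Tn: "P a (b + t * a) c (d + t * c)" if "P a b c d" for a b c d t :: int
  proof (induction t rule: int_induct[of _ 0])
    case base thus ?case using that by simp
  next
    case (step1 i) thus ?case using T[OF step1.IH] by (simp add: algebra_simps)
  next
    case (step2 i) thus ?case using T_inv[OF step2.IH] by (simp add: algebra_simps)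
  qed
  have "a * d - b * c = 1 \<Longrightarrow> P a b c d"
  proof (induction "nat \<bar>c\<bar>" arbitrary: a b c d rule: less_induct)
    case less
    show ?case
    proof (cases "c = 0")
      case True
      hence "a * d = 1" using less.prems by simp
      hence "a = 1 \<and> d = 1 \<or> a = -1 \<and> d = -1"
        using zmult_eq_1_iff by blast
      thus ?thesis
      proof
        assume "a = 1 \<and> d = 1"
        thus ?thesis using Tn[OF one, of b] True by simp
      next
        assume "a = -1 \<and> d = -1"
        \<comment> \<open>Minus the identity is reached as the square of S.\<close>
        thus ?thesis using Tn[OF S[OF S[OF one]], of "- b"] True by simp
      qed
    next
      case False
      define t r where "t = d div c" and "r = d mod c"
      have d: "d = t * c + r" by (simp add: t_def r_def)
      \<comment> \<open>Stripping T^t and then S from the right leaves the bottom row (-r, c) with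
        |r| < |c|.\<close>
      have "P (- (b - t * a)) a (- r) c"
      proof (rule less.hyps)
        show "nat \<bar>- r\<bar> < nat \<bar>c\<bar>" using False by (simp add: r_def abs_mod_less)
        show "- (b - t * a) * c - a * - r = 1" using less.prems by (simp add: d algebra_simps)
      qed
      from Tn[OF S[OF this], of t] show ?thesis by (simp add: d algebra_simps)
    qed
  qed
  thus ?thesis using assms(1) by (simp add: SL2Z_def)
qed

lemma moebius_denom_nonzero:
  assumes "(a, b, c, d) \<in> SL2Z" "Im \<tau> > 0"
  shows "of_int c * \<tau> + of_int d \<noteq> 0"
proof
  assume "of_int c * \<tau> + of_int d = 0"
  hence "c = 0" "d = 0" using assms(2) by (auto simp: complex_eq_iff)
  thus False using assms(1) by (simp add: SL2Z_def)
qed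

lemma moebius_upper_half_plane:
  assumes "(a, b, c, d) \<in> SL2Z" "Im \<tau> > 0"
  shows "Im ((of_int a * \<tau> + of_int b) / (of_int c * \<tau> + of_int d)) > 0"
proof -
  let ?D = "of_int c * \<tau> + of_int d"
  have D: "?D \<noteq> 0" by (rule moebius_denom_nonzero[OF assms])
  have det: "real_of_int a * of_int d - of_int b * of_int c = 1"
    using assms(1) unfolding SL2Z_def by (simp flip: of_int_mult of_int_diff)
  have "Im ((of_int a * \<tau> + of_int b) / ?D) = (real_of_int a * of_int d - of_int b * of_int c) * Im \<tau> / (norm ?D)\<^sup>2"
    unfolding Im_divide cmod_power2 by (simp add: algebra_simps)
  thus ?thesis using D assms(2) unfolding det by simp
qed

text \<open>The index (x, y) is multiplied from the right, as a row vector, and changes at every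
  generator; the induction therefore runs over all x, y and \<tau> at once.\<close>

theorem klein_SL2Z:
  assumes "(a, b, c, d) \<in> SL2Z" "Im \<tau> > 0"
  shows "klein x y ((of_int a * \<tau> + of_int b) / (of_int c * \<tau> + of_int d)) =
    klein (of_int a * x + of_int c * y) (of_int b * x + of_int d * y) \<tau> / (of_int c * \<tau> + of_int d)"
proof -
  have "\<forall>x y \<tau>. Im \<tau> > 0 \<longrightarrow> klein x y ((of_int a * \<tau> + of_int b) / (of_int c * \<tau> + of_int d)) =
    klein (of_int a * x + of_int c * y) (of_int b * x + of_int d * y) \<tau> / (of_int c * \<tau> + of_int d)"
    using assms(1)
  proof (induction rule: SL2Z_induct)
    case (T a b c d)
    show ?case
    proof (intro allI impI)
      fix x y \<tau> assume \<tau>: "Im \<tau> > 0"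
      have *: "of_int a * \<tau> + of_int (a + b) = of_int a * (\<tau> + 1) + of_int b"
        "of_int c * \<tau> + of_int (c + d) = of_int c * (\<tau> + 1) + of_int d" by (simp_all add: algebra_simps)
      show "klein x y ((of_int a * \<tau> + of_int (a + b)) / (of_int c * \<tau> + of_int (c + d))) =
        klein (of_int a * x + of_int c * y) (of_int (a + b) * x + of_int (c + d) * y) \<tau> /
        (of_int c * \<tau> + of_int (c + d))"
        unfolding * using T[rule_format, of "\<tau> + 1" x y] \<tau> unfolding klein_translate
        by (simp add: algebra_simps)
    qed
  next
    case (T_inv a b c d)
    show ?case
    proof (intro allI impI)
      fix x y \<tau> assume \<tau>: "Im \<tau> > 0"
      have *: "of_int a * \<tau> + of_int (b - a) = of_int a * (\<tau> - 1) + of_int b"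
        "of_int c * \<tau> + of_int (d - c) = of_int c * (\<tau> - 1) + of_int d" by (simp_all add: algebra_simps)
      have "klein X Y (\<tau> - 1) = klein X (Y - X) \<tau>" for X Y
        using klein_translate[of X "Y - X" "\<tau> - 1"] by simp
      thus "klein x y ((of_int a * \<tau> + of_int (b - a)) / (of_int c * \<tau> + of_int (d - c))) =
        klein (of_int a * x + of_int c * y) (of_int (b - a) * x + of_int (d - c) * y) \<tau> /
        (of_int c * \<tau> + of_int (d - c))"
        unfolding * using T_inv[rule_format, of "\<tau> - 1" x y] \<tau> by (simp add: algebra_simps)
    qed
  next
    case (S a b c d)
    show ?case
    proof (intro allI impI)
      fix x y \<tau> assume \<tau>: "Im \<tau> > 0"
      have \<tau>0: "\<tau> \<noteq> 0" using \<tau> by auto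
      have *: "(of_int a * (- 1 / \<tau>) + of_int b) / (of_int c * (- 1 / \<tau>) + of_int d) =
          (of_int b * \<tau> + of_int (- a)) / (of_int d * \<tau> + of_int (- c))"
        using \<tau>0 by (simp add: divide_simps)
      have **: "X / \<tau> / (of_int c * (- 1 / \<tau>) + of_int d) = X / (of_int d * \<tau> + of_int (- c))" for X
        using \<tau>0 by (simp add: divide_simps)
      show "klein x y ((of_int b * \<tau> + of_int (- a)) / (of_int d * \<tau> + of_int (- c))) =
        klein (of_int b * x + of_int d * y) (of_int (- a) * x + of_int (- c) * y) \<tau> /
        (of_int d * \<tau> + of_int (- c))"
        using S[rule_format, OF Im_minus_inverse_pos[OF \<tau>], of x y]
        unfolding * klein_inversion[OF \<tau>] ** by simp
    qed
  qed simp
  thus ?thesis using assms(2) by blast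
qed

text \<open>Only C^12 = 1 is recorded. The precise multiplier, given by Dedekind sums, never enters:
  it is cancelled by the congruence modulo 12, and for growth only C \<noteq> 0 counts.\<close>

theorem eta_sq_SL2Z:
  assumes "(a, b, c, d) \<in> SL2Z"
  obtains C where "C ^ 12 = 1"
    "\<And>\<tau>. Im \<tau> > 0 \<Longrightarrow> eta_sq ((of_int a * \<tau> + of_int b) / (of_int c * \<tau> + of_int d)) =
        C * (of_int c * \<tau> + of_int d) * eta_sq \<tau>"
proof -
  have "\<exists>C. C ^ 12 = 1 \<and> (\<forall>\<tau>. Im \<tau> > 0 \<longrightarrow> eta_sq ((of_int a * \<tau> + of_int b) / (of_int c * \<tau> + of_int d)) =
        C * (of_int c * \<tau> + of_int d) * eta_sq \<tau>)"
    using assms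
  proof (induction rule: SL2Z_induct)
    case one
    show ?case by (rule exI[of _ 1]) simp
  next
    case (T a b c d)
    then obtain C where C: "C ^ 12 = 1" "\<And>\<tau>. Im \<tau> > 0 \<Longrightarrow>
      eta_sq ((of_int a * \<tau> + of_int b) / (of_int c * \<tau> + of_int d)) = C * (of_int c * \<tau> + of_int d) * eta_sq \<tau>"
      by blast
    show ?case
    proof (intro exI conjI allI impI)
      show "(C * expi (1 / 6)) ^ 12 = 1" using C(1) by (simp add: power_mult_distrib expi_power)
      fix \<tau> assume "Im \<tau> > 0"
      thus "eta_sq ((of_int a * \<tau> + of_int (a + b)) / (of_int c * \<tau> + of_int (c + d))) =
          C * expi (1 / 6) * (of_int c * \<tau> + of_int (c + d)) * eta_sq \<tau>"
        using C(2)[of "\<tau> + 1"] unfolding eta_sq_translate by (simp add: algebra_simps)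
    qed
  next
    case (T_inv a b c d)
    then obtain C where C: "C ^ 12 = 1" "\<And>\<tau>. Im \<tau> > 0 \<Longrightarrow>
      eta_sq ((of_int a * \<tau> + of_int b) / (of_int c * \<tau> + of_int d)) = C * (of_int c * \<tau> + of_int d) * eta_sq \<tau>"
      by blast
    show ?case
    proof (intro exI conjI allI impI)
      show "(C / expi (1 / 6)) ^ 12 = 1" using C(1) by (simp add: power_divide expi_power)
      fix \<tau> assume "Im \<tau> > 0"
      moreover have "eta_sq (\<tau> - 1) = eta_sq \<tau> / expi (1 / 6)"
        using eta_sq_translate[of "\<tau> - 1"] by simp
      ultimately show "eta_sq ((of_int a * \<tau> + of_int (b - a)) / (of_int c * \<tau> + of_int (d - c))) =
          C / expi (1 / 6) * (of_int c * \<tau> + of_int (d - c)) * eta_sq \<tau>"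
        using C(2)[of "\<tau> - 1"] by (simp add: algebra_simps add_divide_distrib diff_divide_distrib)
    qed
  next
    case (S a b c d)
    then obtain C where C: "C ^ 12 = 1" "\<And>\<tau>. Im \<tau> > 0 \<Longrightarrow>
      eta_sq ((of_int a * \<tau> + of_int b) / (of_int c * \<tau> + of_int d)) = C * (of_int c * \<tau> + of_int d) * eta_sq \<tau>"
      by blast
    show ?case
    proof (intro exI conjI allI impI)
      have "(- \<i>) ^ 12 = ((- \<i>) ^ 2) ^ 6" by (simp flip: power_mult)
      also have "\<dots> = 1" by simp
      finally show "(C * (- \<i>)) ^ 12 = 1" using C(1) by (simp only: power_mult_distrib mult_1)
      fix \<tau> :: complex assume \<tau>: "Im \<tau> > 0"
      have \<tau>0: "\<tau> \<noteq> 0" using \<tau> by auto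
      have *: "(of_int a * (- 1 / \<tau>) + of_int b) / (of_int c * (- 1 / \<tau>) + of_int d) =
          (of_int b * \<tau> + of_int (- a)) / (of_int d * \<tau> + of_int (- c))"
        using \<tau>0 by (simp add: divide_simps)
      have **: "(of_int c * (- 1 / \<tau>) + of_int d) * (- \<i> * \<tau> * X) = (of_int d * \<tau> + of_int (- c)) * - \<i> * X" for X
        using \<tau>0 by (simp add: field_simps)
      show "eta_sq ((of_int b * \<tau> + of_int (- a)) / (of_int d * \<tau> + of_int (- c))) =
          C * (- \<i>) * (of_int d * \<tau> + of_int (- c)) * eta_sq \<tau>"
        using C(2)[OF Im_minus_inverse_pos[OF \<tau>]] ** unfolding * eta_sq_inversion[OF \<tau>]
        by (simp add: mult_ac)
    qed
  qed
  thus ?thesis using that by blast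
qed

section \<open>Products of Siegel functions\<close>

lemma prod_power_int_const:
  fixes C :: complex
  assumes "C \<noteq> 0"
  shows "(\<Prod>j\<in>A. C powi f j) = C powi sum f A"
  by (induction A rule: infinite_finite_induct) (use assms in \<open>auto simp: power_int_add\<close>)

text \<open>Up to a constant, the Siegel function at the division point (p/N, r/N): the weight -1 of
  the Klein form cancels against the weight 1 of \<eta>^2.\<close>

definition siegel :: "nat \<Rightarrow> int \<Rightarrow> int \<Rightarrow> complex \<Rightarrow> complex" where
  "siegel N p r \<tau> = klein (of_int p / of_nat N) (of_int r / of_nat N) \<tau> * eta_sq \<tau>"

lemma of_int_div_of_nat_in_Ints_iff:
  assumes "N > 0"
  shows "(of_int p / of_nat N :: real) \<in> \<int> \<longleftrightarrow> int N dvd p"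
proof
  assume "(of_int p / of_nat N :: real) \<in> \<int>"
  then obtain k where "of_int p / of_nat N = (of_int k :: real)" by (auto elim: Ints_cases)
  hence "of_int p = (of_int (k * int N) :: real)" using assms by (simp add: field_simps)
  hence "p = k * int N" by (simp only: of_int_eq_iff)
  thus "int N dvd p" by simp
next
  assume "int N dvd p"
  then obtain k where "p = int N * k" by blast
  thus "(of_int p / of_nat N :: real) \<in> \<int>" using assms by simp
qed

lemma siegel_nonzero:
  assumes "Im \<tau> > 0" "N > 0" "\<not> (int N dvd p \<and> int N dvd r)"
  shows "siegel N p r \<tau> \<noteq> 0"
  using klein_nonzero[OF assms(1)] eta_sq_nonzero[OF assms(1)] assms(3)
    of_int_div_of_nat_in_Ints_iff[OF assms(2)] by (simp add: siegel_def)

lemma siegel_holomorphic: "siegel N p r holomorphic_on upper_half_plane"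
  unfolding siegel_def by (intro holomorphic_intros klein_holomorphic eta_sq_holomorphic)

lemma siegel_shift:
  assumes "Im \<tau> > 0" "N > 0"
  shows "siegel N (p + int N * m) (r + int N * n) \<tau> =
    expi (of_real (of_int (m * n + m + n) + of_int (p * n - r * m) / of_nat N)) * siegel N p r \<tau>"
proof -
  have *: "of_int (p + int N * m) / of_nat N = of_int p / of_nat N + (of_int m :: real)" for p m
    using assms(2) by (simp add: field_simps)
  show ?thesis
    unfolding siegel_def * klein_shift[OF assms(1)]
    by (simp add: diff_divide_distrib)
qed

lemma siegel_translate:
  "siegel N p r (\<tau> + of_nat n) = expi (of_nat n / 6) * siegel N p (r + int n * p) \<tau>"
proof (induction n arbitrary: r)
  case (Suc n)
  have "siegel N p r (\<tau> + of_nat (Suc n)) = siegel N p r ((\<tau> + of_nat n) + 1)"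
    by (simp add: algebra_simps)
  also have "\<dots> = expi (1 / 6) * siegel N p (r + p) (\<tau> + of_nat n)"
    unfolding siegel_def klein_translate eta_sq_translate by (simp add: add_divide_distrib add.commute)
  also have "\<dots> = expi (1 / 6) * expi (of_nat n / 6) * siegel N p (r + int (Suc n) * p) \<tau>"
    unfolding Suc.IH by (simp add: algebra_simps)
  also have "expi (1 / 6) * expi (of_nat n / 6) = expi (of_nat (Suc n) / 6)"
    by (simp add: add_divide_distrib flip: expi_add)
  finally show ?case .
qed simp

lemma eta_sq_translate_nat: "eta_sq (\<tau> + of_nat n) = expi (of_nat n / 6) * eta_sq \<tau>"
proof (induction n)
  case (Suc n)
  have "eta_sq (\<tau> + of_nat (Suc n)) = eta_sq ((\<tau> + of_nat n) + 1)"
    by (simp add: algebra_simps)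
  also have "\<dots> = expi (1 / 6) * expi (of_nat n / 6) * eta_sq \<tau>"
    unfolding eta_sq_translate Suc.IH by simp
  also have "expi (1 / 6) * expi (of_nat n / 6) = expi (of_nat (Suc n) / 6)"
    by (simp add: add_divide_distrib flip: expi_add)
  finally show ?case .
qed simp

lemma siegel_SL2Z:
  assumes "(a, b, c, d) \<in> SL2Z" "Im \<tau> > 0"
    and C: "eta_sq ((of_int a * \<tau> + of_int b) / (of_int c * \<tau> + of_int d)) = C * (of_int c * \<tau> + of_int d) * eta_sq \<tau>"
  shows "siegel N p r ((of_int a * \<tau> + of_int b) / (of_int c * \<tau> + of_int d)) =
           C * siegel N (p * a + r * c) (p * b + r * d) \<tau>"
proof -
  have "of_int (p * a + r * c) / of_nat N = of_int a * (of_int p / of_nat N) + of_int c * (of_int r / (of_nat N :: real))"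
    for a c by (simp add: field_simps add_divide_distrib)
  thus ?thesis
    unfolding siegel_def C klein_SL2Z[OF assms(1,2)] using moebius_denom_nonzero[OF assms(1,2)]
    by (simp add: field_simps)
qed

text \<open>The leading exponent is B_2(x), the source of the Bernoulli polynomials in the orders at
  the cusps. The formula holds for all p, but the two symbols have nonzero limits at i\<infinity> in
  general only for 0 \<le> x < 1.\<close>

lemma siegel_q_product:
  fixes p r :: int
  assumes "Im \<tau> > 0" "N > 0"
  defines "x \<equiv> of_int p / of_nat N :: complex" and "y \<equiv> of_int r / of_nat N :: complex"
  shows "siegel N p r \<tau> = - expi (((x ^ 2 - x + 1 / 6) * \<tau>) + (x - 1) * y) *
     q_pochhammer (expi (2 * x * \<tau>) * expi (2 * y)) (expi (2 * \<tau>)) *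
     q_pochhammer (expi (2 * (1 - x) * \<tau>) * expi (- 2 * y)) (expi (2 * \<tau>))"
proof -
  define z where "z = x * \<tau> + y"
  define D where "D = q_pochhammer (expi (2 * \<tau>)) (expi (2 * \<tau>))"
  have D: "D \<noteq> 0" using q_pochhammer_self_nonzero[OF norm_expi_2_less_1[OF assms(1)]] by (simp add: D_def)
  have e1: "expi (2 * z) = expi (2 * x * \<tau>) * expi (2 * y)"
    unfolding expi_add[symmetric] by (rule arg_cong[of _ _ expi]) (simp add: z_def algebra_simps)
  have e2: "expi (2 * \<tau> - 2 * z) = expi (2 * (1 - x) * \<tau>) * expi (- 2 * y)"
    unfolding expi_add[symmetric] by (rule arg_cong[of _ _ expi]) (simp add: z_def algebra_simps)
  have xy: "of_real (of_int p / of_nat N) = x" "of_real (of_int r / of_nat N) = y" by (simp_all add: x_def y_def)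
  have e3: "expi (x * z) * expi (- z) * expi (\<tau> / 6) = expi ((x ^ 2 - x + 1 / 6) * \<tau> + (x - 1) * y)"
    unfolding expi_add[symmetric]
    by (rule arg_cong[of _ _ expi]) (simp add: z_def algebra_simps power2_eq_square)
  have "siegel N p r \<tau> = - (expi (x * z) * expi (- z) * expi (\<tau> / 6)) *
      q_pochhammer (expi (2 * z)) (expi (2 * \<tau>)) * q_pochhammer (expi (2 * \<tau> - 2 * z)) (expi (2 * \<tau>))"
    using D unfolding siegel_def klein_def klein_sigma_def eta_sq_def xy z_def[symmetric] D_def[symmetric]
    by simp
  thus ?thesis unfolding e1 e2 e3 .
qed

text \<open>The shape of the product, separated from its factors. It is multiplicative in (e, G),
  with \<open>siegel_exponent\<close> as its logarithm, so that multipliers and growth rates become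
  computations with exponents. The slot e stands in for the excluded index (0, 0), where the Klein
  form vanishes.\<close>

definition siegel_prod :: "nat \<Rightarrow> nat \<Rightarrow> int vec \<Rightarrow> complex \<Rightarrow> (nat \<Rightarrow> nat \<Rightarrow> complex) \<Rightarrow> complex" where
  "siegel_prod N k a e G = e ^ k * (\<Prod>l=1..<N. G 0 l) ^ k * (\<Prod>j=1..N div 2. (\<Prod>l<N. G j l) powi (a $ (j - 1)))"

definition siegel_exponent :: "nat \<Rightarrow> nat \<Rightarrow> int vec \<Rightarrow> 'a::field \<Rightarrow> (nat \<Rightarrow> nat \<Rightarrow> 'a) \<Rightarrow> 'a" where
  "siegel_exponent N k a e G = of_nat k * e + of_nat k * (\<Sum>l=1..<N. G 0 l) +
     (\<Sum>j=1..N div 2. of_int (a $ (j - 1)) * (\<Sum>l<N. G j l))"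

lemma siegel_prod_mult:
  "siegel_prod N k a (e * e') (\<lambda>j l. G j l * G' j l) = siegel_prod N k a e G * siegel_prod N k a e' G'"
  unfolding siegel_prod_def by (simp add: prod.distrib power_mult_distrib power_int_mult_distrib mult_ac)

lemma siegel_prod_expi:
  "siegel_prod N k a (expi e) (\<lambda>j l. expi (G j l)) = expi (siegel_exponent N k a e G)"
  unfolding siegel_prod_def siegel_exponent_def expi_sum[symmetric] expi_power expi_power_int expi_add ..

lemma siegel_prod_cong:
  assumes "e = e'" "(\<Prod>l=1..<N. G 0 l) = (\<Prod>l=1..<N. G' 0 l)"
    "\<And>j. j \<in> {1..N div 2} \<Longrightarrow> (\<Prod>l<N. G j l) = (\<Prod>l<N. G' j l)"
  shows "siegel_prod N k a e G = siegel_prod N k a e' G'"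
  unfolding siegel_prod_def assms(1,2) using assms(3) by simp

lemma siegel_prod_const:
  assumes "C \<noteq> 0" "N > 0"
  shows "siegel_prod N k a C (\<lambda>_ _. C) = C powi (int N * (int k + (\<Sum>j=1..N div 2. a $ (j - 1))))"
proof -
  have "C ^ k * (C ^ (N - 1)) ^ k = (C * C ^ (N - 1)) ^ k"
    by (simp add: power_mult_distrib)
  also have "C * C ^ (N - 1) = C ^ N" using assms(2) by (cases N) auto
  also have "(C ^ N) ^ k = C powi (int N * int k)"
    by (simp flip: power_mult of_nat_mult)
  finally have 1: "C ^ k * (C ^ (N - 1)) ^ k = C powi (int N * int k)" .
  have 2: "(C ^ N) powi n = C powi (int N * n)" for n
    by (simp add: power_int_mult)
  show ?thesis
    unfolding siegel_prod_def
    by (simp add: 1[simplified] 2 prod_power_int_const[OF assms(1)] power_int_add assms(1) ring_distribs sum_distrib_left)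
qed

lemma siegel_prod_nonzero:
  assumes "e \<noteq> 0" "\<And>j l. l < N \<Longrightarrow> j \<le> N div 2 \<Longrightarrow> j > 0 \<or> l > 0 \<Longrightarrow> G j l \<noteq> 0"
  shows "siegel_prod N k a e G \<noteq> 0"
  using assms by (auto simp: siegel_prod_def)

definition siegel_row :: "nat \<Rightarrow> int \<times> int \<times> int \<times> int \<Rightarrow> complex \<Rightarrow> nat \<Rightarrow> nat \<Rightarrow> complex" where
  "siegel_row N = (\<lambda>(p, q, r, s) \<tau> j l. siegel N (int j * p + int l * r) (int j * q + int l * s) \<tau>)"

definition theta_siegel :: "nat \<Rightarrow> nat \<Rightarrow> int vec \<Rightarrow> int \<times> int \<times> int \<times> int \<Rightarrow> complex \<Rightarrow> complex" where
  "theta_siegel N k a \<gamma> \<tau> = siegel_prod N k a (eta_sq \<tau>) (siegel_row N \<gamma> \<tau>)"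

lemma SL2Z_primitive_mod:
  assumes "(p, q, r, s) \<in> SL2Z" "int N dvd j * p + l * r" "int N dvd j * q + l * s"
  shows "int N dvd j" "int N dvd l"
proof -
  have det: "p * s - q * r = 1" using assms(1) by (simp add: SL2Z_def)
  have "j = s * (j * p + l * r) - r * (j * q + l * s)"
    using arg_cong[OF det, of "\<lambda>x. j * x"] by (simp add: algebra_simps)
  thus "int N dvd j" using assms(2,3) by (metis dvd_diff dvd_mult)
  have "l = p * (j * q + l * s) - q * (j * p + l * r)"
    using arg_cong[OF det, of "\<lambda>x. l * x"] by (simp add: algebra_simps)
  thus "int N dvd l" using assms(2,3) by (metis dvd_diff dvd_mult)
qed

lemma siegel_row_index:
  assumes "\<gamma> \<in> SL2Z" "l < N" "j \<le> N div 2" "j > 0 \<or> l > 0" "\<gamma> = (p, q, r, s)"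
  shows "\<not> (int N dvd int j * p + int l * r \<and> int N dvd int j * q + int l * s)"
proof
  assume "int N dvd int j * p + int l * r \<and> int N dvd int j * q + int l * s"
  hence "int N dvd int j" "int N dvd int l" using SL2Z_primitive_mod assms(1,5) by blast+
  hence "N dvd j" "N dvd l" by (simp_all only: int_dvd_int_iff)
  moreover have "j < N" using assms(2,3) by linarith
  ultimately have "j = 0" "l = 0" using assms(2) by (auto dest: dvd_imp_le)
  thus False using assms(4) by simp
qed

lemma siegel_row_nonzero:
  assumes "\<gamma> \<in> SL2Z" "Im \<tau> > 0" "l < N" "j \<le> N div 2" "j > 0 \<or> l > 0"
  shows "siegel_row N \<gamma> \<tau> j l \<noteq> 0"
proof -
  obtain p q r s where g: "\<gamma> = (p, q, r, s)" by (metis prod_cases4)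
  show ?thesis unfolding g siegel_row_def using siegel_nonzero[OF assms(2)] siegel_row_index[OF assms(1,3-5) g] assms(3) by auto
qed

lemma theta_siegel_nonzero:
  assumes "\<gamma> \<in> SL2Z" "Im \<tau> > 0"
  shows "theta_siegel N k a \<gamma> \<tau> \<noteq> 0"
  unfolding theta_siegel_def using assms
  by (intro siegel_prod_nonzero eta_sq_nonzero siegel_row_nonzero) auto

lemma theta_siegel_holomorphic:
  assumes "\<gamma> \<in> SL2Z"
  shows "theta_siegel N k a \<gamma> holomorphic_on upper_half_plane"
proof -
  obtain p q r s where g: "\<gamma> = (p, q, r, s)" by (metis prod_cases4)
  have "(\<lambda>\<tau>. siegel_row N \<gamma> \<tau> j l) holomorphic_on upper_half_plane" for j l
    unfolding g siegel_row_def using siegel_holomorphic by simp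
  thus ?thesis unfolding theta_siegel_def siegel_prod_def
    by (intro holomorphic_intros eta_sq_holomorphic)
       (use siegel_row_nonzero[OF assms] in \<open>auto simp: upper_half_plane_def\<close>)
qed

text \<open>The weight k comes from the slot e = \<eta>^2 alone, since Siegel functions have weight
  0. Every factor contributes one C, and counted with multiplicity there are N (k + \<Sum> a_j) of
  them.\<close>

theorem theta_siegel_SL2Z:
  assumes "\<gamma> = (a, b, c, d)" "\<gamma> \<in> SL2Z" "N > 0"
  obtains C where "C ^ 12 = 1"
    "\<And>\<tau>. Im \<tau> > 0 \<Longrightarrow> slash k (theta_siegel N k v (1, 0, 0, 1)) \<gamma> \<tau> =
       C powi (int N * (int k + (\<Sum>j=1..N div 2. v $ (j - 1)))) * theta_siegel N k v \<gamma> \<tau>"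
proof -
  obtain C where C: "C ^ 12 = 1"
    "\<And>\<tau>. Im \<tau> > 0 \<Longrightarrow> eta_sq ((of_int a * \<tau> + of_int b) / (of_int c * \<tau> + of_int d)) =
        C * (of_int c * \<tau> + of_int d) * eta_sq \<tau>"
    using eta_sq_SL2Z assms(1,2) by blast
  have C0: "C \<noteq> 0" using C(1) by auto
  show ?thesis
  proof (rule that[OF C(1)])
    fix \<tau> :: complex assume \<tau>: "Im \<tau> > 0"
    let ?D = "of_int c * \<tau> + of_int d"
    have D: "?D \<noteq> 0" using moebius_denom_nonzero assms(1,2) \<tau> by blast
    have row: "siegel_row N (1, 0, 0, 1) ((of_int a * \<tau> + of_int b) / ?D) = (\<lambda>j l. C * siegel_row N \<gamma> \<tau> j l)"
      unfolding siegel_row_def assms(1)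
      using siegel_SL2Z[OF assms(2)[unfolded assms(1)] \<tau> C(2)[OF \<tau>], of N] by (intro ext) simp
    have "slash k (theta_siegel N k v (1, 0, 0, 1)) \<gamma> \<tau> =
        siegel_prod N k v (C * (?D * eta_sq \<tau>)) (\<lambda>j l. C * siegel_row N \<gamma> \<tau> j l) / ?D ^ k"
      unfolding slash_def assms(1) theta_siegel_def prod.case row[unfolded assms(1)] C(2)[OF \<tau>]
      by (simp add: mult.assoc)
    also have "\<dots> = siegel_prod N k v C (\<lambda>_ _. C) * siegel_prod N k v (?D * eta_sq \<tau>) (siegel_row N \<gamma> \<tau>) / ?D ^ k"
      by (simp only: siegel_prod_mult)
    also have "siegel_prod N k v (?D * eta_sq \<tau>) (siegel_row N \<gamma> \<tau>) = ?D ^ k * theta_siegel N k v \<gamma> \<tau>"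
      by (simp add: siegel_prod_def theta_siegel_def power_mult_distrib)
    finally show "slash k (theta_siegel N k v (1, 0, 0, 1)) \<gamma> \<tau> =
       C powi (int N * (int k + (\<Sum>j=1..N div 2. v $ (j - 1)))) * theta_siegel N k v \<gamma> \<tau>"
      using D unfolding siegel_prod_const[OF C0 assms(3)] by simp
  qed
qed

section \<open>Comparison of the Siegel products with the theta products\<close>

lemma prod_q_pochhammer_roots_unity':
  assumes "norm q < 1" "N > 0"
  shows "(\<Prod>l<N. q_pochhammer (x * expi (2 * (of_nat l / of_nat N))) q) = q_pochhammer (x ^ N) (q ^ N)"
    and "(\<Prod>l<N. q_pochhammer (x * expi (- 2 * (of_nat l / of_nat N))) q) = q_pochhammer (x ^ N) (q ^ N)"
proof -
  have *: "(\<Prod>l<N. q_pochhammer (x * expi (2 * (of_nat l / of_nat N))) q) = q_pochhammer (x ^ N) (q ^ N)" for x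
    using prod_q_pochhammer_roots_unity[OF assms, of x] by (simp add: expi_def mult_ac)
  from * show "(\<Prod>l<N. q_pochhammer (x * expi (2 * (of_nat l / of_nat N))) q) = q_pochhammer (x ^ N) (q ^ N)" .
  \<comment> \<open>Reversing the order of the factors makes the powers of the root of unity
    positive, up to a common factor \<open>expi (2 / of_nat N)\<close> that disappears in the N-th
    power.\<close>
  have "(\<Prod>l<N. q_pochhammer (x * expi (- 2 * (of_nat l / of_nat N))) q)
      = (\<Prod>l<N. q_pochhammer (x * expi (- 2 * (of_nat (N - Suc l) / of_nat N))) q)"
    by (rule prod.nat_diff_reindex[symmetric])
  also have "\<dots> = (\<Prod>l<N. q_pochhammer (x * expi (2 / of_nat N) * expi (2 * (of_nat l / of_nat N))) q)"
  proof (intro prod.cong refl)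
    fix l assume l: "l \<in> {..<N}"
    have "expi (- 2 * (of_nat (N - Suc l) / of_nat N)) = expi (2 / of_nat N + 2 * (of_nat l / of_nat N))"
      by (rule expi_cong[of _ _ "- 1"]) (use l assms(2) in \<open>simp add: of_nat_diff field_simps\<close>)
    thus "q_pochhammer (x * expi (- 2 * (of_nat (N - Suc l) / of_nat N))) q =
        q_pochhammer (x * expi (2 / of_nat N) * expi (2 * (of_nat l / of_nat N))) q"
      by (simp add: expi_add mult.assoc)
  qed
  also have "\<dots> = q_pochhammer ((x * expi (2 / of_nat N)) ^ N) (q ^ N)" by (rule *)
  also have "(x * expi (2 / of_nat N)) ^ N = x ^ N" using assms(2) by (simp add: power_mult_distrib expi_power)
  finally show "(\<Prod>l<N. q_pochhammer (x * expi (- 2 * (of_nat l / of_nat N))) q) = q_pochhammer (x ^ N) (q ^ N)" .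
qed

text \<open>The N leading exponents add up to N B_2(j/N) = N/6 - j(N - j)/N. In powers of q this is
  halved, which is exactly the contribution of one unit of a_j to the prefactor of
  \<open>theta_product\<close>.\<close>

lemma siegel_column_product:
  assumes "0 < j" "j < N"
  obtains C where "C \<noteq> 0"
    "\<And>\<tau>. Im \<tau> > 0 \<Longrightarrow> (\<Prod>l<N. siegel N (int j) (int l) \<tau>) = C *
       (expi ((of_nat N / 6 - of_nat j * of_nat (N - j) / of_nat N) * \<tau>) *
       (q_pochhammer (expi (2 * \<tau>) ^ j) (expi (2 * \<tau>) ^ N) * q_pochhammer (expi (2 * \<tau>) ^ (N - j)) (expi (2 * \<tau>) ^ N)))"
proof -
  have N: "N > 0" using assms by simp
  define x where "x = (of_nat j / of_nat N :: complex)"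
  define y where "y l = (of_nat l / of_nat N :: complex)" for l
  define C where "C = (\<Prod>l<N. - expi ((x - 1) * y l))"
  show ?thesis
  proof (rule that[of C])
    show "C \<noteq> 0" by (simp add: C_def)
    fix \<tau> :: complex assume \<tau>: "Im \<tau> > 0"
    let ?q = "expi (2 * \<tau>)"
    have "(\<Prod>l<N. siegel N (int j) (int l) \<tau>) = (\<Prod>l<N. (- expi ((x - 1) * y l)) * expi ((x ^ 2 - x + 1 / 6) * \<tau>) *
        q_pochhammer (expi (2 * x * \<tau>) * expi (2 * y l)) ?q *
        q_pochhammer (expi (2 * (1 - x) * \<tau>) * expi (- 2 * y l)) ?q)"
      by (intro prod.cong refl) (simp add: siegel_q_product[OF \<tau> N] x_def y_def expi_add)
    also have "\<dots> = C * expi ((x ^ 2 - x + 1 / 6) * \<tau>) ^ N *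
        (\<Prod>l<N. q_pochhammer (expi (2 * x * \<tau>) * expi (2 * y l)) ?q) *
        (\<Prod>l<N. q_pochhammer (expi (2 * (1 - x) * \<tau>) * expi (- 2 * y l)) ?q)"
      by (simp only: prod.distrib C_def prod_constant card_lessThan)
    also have "(\<Prod>l<N. q_pochhammer (expi (2 * x * \<tau>) * expi (2 * y l)) ?q) =
        q_pochhammer (expi (2 * x * \<tau>) ^ N) (?q ^ N)"
      unfolding y_def by (rule prod_q_pochhammer_roots_unity'(1)[OF norm_expi_2_less_1[OF \<tau>] N])
    also have "(\<Prod>l<N. q_pochhammer (expi (2 * (1 - x) * \<tau>) * expi (- 2 * y l)) ?q) =
        q_pochhammer (expi (2 * (1 - x) * \<tau>) ^ N) (?q ^ N)"
      unfolding y_def by (rule prod_q_pochhammer_roots_unity'(2)[OF norm_expi_2_less_1[OF \<tau>] N])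
    also have "expi (2 * x * \<tau>) ^ N = ?q ^ j" unfolding expi_power using N by (simp add: x_def mult_ac)
    also have "expi (2 * (1 - x) * \<tau>) ^ N = ?q ^ (N - j)"
      unfolding expi_power by (rule arg_cong[of _ _ expi]) (use N assms in \<open>simp add: x_def of_nat_diff field_simps\<close>)
    also have "expi ((x ^ 2 - x + 1 / 6) * \<tau>) ^ N = expi ((of_nat N / 6 - of_nat j * of_nat (N - j) / of_nat N) * \<tau>)"
      unfolding expi_power by (rule arg_cong[of _ _ expi])
        (use N assms in \<open>simp add: x_def of_nat_diff field_simps power2_eq_square\<close>)
    finally show "(\<Prod>l<N. siegel N (int j) (int l) \<tau>) = C *
       (expi ((of_nat N / 6 - of_nat j * of_nat (N - j) / of_nat N) * \<tau>) *
       (q_pochhammer (?q ^ j) (?q ^ N) * q_pochhammer (?q ^ (N - j)) (?q ^ N)))"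
      by (simp add: mult_ac)
  qed
qed

text \<open>For j = 0 the index l = 0 is missing, and \<eta>^2 supplies the two symbols (q; q) that
  complete the products over roots of unity. The constant collects the factors 1 - \<zeta>^l, split
  off because the symbol starts at q^0.\<close>

lemma siegel_zero_column_product:
  assumes "N > 0"
  obtains C where "C \<noteq> 0"
    "\<And>\<tau>. Im \<tau> > 0 \<Longrightarrow> eta_sq \<tau> * (\<Prod>l=1..<N. siegel N 0 (int l) \<tau>) =
       C * (expi (of_nat N / 6 * \<tau>) * q_pochhammer (expi (2 * \<tau>) ^ N) (expi (2 * \<tau>) ^ N) ^ 2)"
proof -
  define y where "y l = (of_nat l / of_nat N :: complex)" for l
  define C where "C = (\<Prod>l=1..<N. - expi (- y l) * (1 - expi (2 * y l)))"
  have "expi (2 * y l) \<noteq> 1" if "0 < l" "l < N" for l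
  proof
    assume "expi (2 * y l) = 1"
    then obtain n :: int where "2 * y l = 2 * of_int n" using expi_eq_1_iff by blast
    hence "of_nat l = (of_int (n * int N) :: complex)" using assms by (simp add: y_def field_simps)
    hence "int l = n * int N" by (metis of_int_eq_iff of_int_of_nat_eq)
    hence "N dvd l" by (metis dvd_triv_right int_dvd_int_iff)
    thus False using that by (auto dest: dvd_imp_le)
  qed
  hence C0: "C \<noteq> 0" by (simp add: C_def)
  have split: "(\<Prod>l<N. f l) = f 0 * (\<Prod>l=1..<N. f l)" for f :: "nat \<Rightarrow> complex"
    using prod.atLeast_Suc_lessThan[of 0 N f] assms by (simp add: lessThan_atLeast0)
  show ?thesis
  proof (rule that[OF C0])
    fix \<tau> :: complex assume \<tau>: "Im \<tau> > 0"
    let ?q = "expi (2 * \<tau>)"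
    note q = norm_expi_2_less_1[OF \<tau>]
    define D where "D = q_pochhammer ?q ?q"
    define DN where "DN = q_pochhammer (?q ^ N) (?q ^ N)"
    have D: "D \<noteq> 0" unfolding D_def by (rule q_pochhammer_self_nonzero[OF q])
    have p1: "D * (\<Prod>l=1..<N. q_pochhammer (?q * expi (2 * y l)) ?q) = DN"
      using prod_q_pochhammer_roots_unity'(1)[OF q assms, of ?q] unfolding split by (simp add: D_def DN_def y_def)
    have p2: "D * (\<Prod>l=1..<N. q_pochhammer (?q * expi (- 2 * y l)) ?q) = DN"
      using prod_q_pochhammer_roots_unity'(2)[OF q assms, of ?q] unfolding split by (simp add: D_def DN_def y_def)
    have "(\<Prod>l=1..<N. siegel N 0 (int l) \<tau>) = (\<Prod>l=1..<N. (- expi (- y l) * (1 - expi (2 * y l))) * expi (\<tau> / 6) *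
        q_pochhammer (?q * expi (2 * y l)) ?q * q_pochhammer (?q * expi (- 2 * y l)) ?q)"
    proof (intro prod.cong refl)
      fix l
      have "q_pochhammer (expi (2 * y l)) ?q = (1 - expi (2 * y l)) * q_pochhammer (?q * expi (2 * y l)) ?q"
        using q_pochhammer_rec[OF q, of "expi (2 * y l)"] by (simp add: mult.commute)
      moreover have "siegel N 0 (int l) \<tau> = - expi (\<tau> / 6 - y l) * q_pochhammer (expi (2 * y l)) ?q *
          q_pochhammer (?q * expi (- 2 * y l)) ?q"
        using siegel_q_product[OF \<tau> assms, of 0 "int l"] by (simp flip: y_def)
      moreover have "expi (\<tau> / 6 - y l) = expi (- y l) * expi (\<tau> / 6)"
        by (simp flip: expi_add)
      ultimately show "siegel N 0 (int l) \<tau> = (- expi (- y l) * (1 - expi (2 * y l))) * expi (\<tau> / 6) *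
        q_pochhammer (?q * expi (2 * y l)) ?q * q_pochhammer (?q * expi (- 2 * y l)) ?q"
        by (simp only: mult_minus_left mult_minus_right mult_ac)
    qed
    also have "\<dots> = C * expi (\<tau> / 6) ^ (N - 1) * (\<Prod>l=1..<N. q_pochhammer (?q * expi (2 * y l)) ?q) *
        (\<Prod>l=1..<N. q_pochhammer (?q * expi (- 2 * y l)) ?q)"
      by (simp only: prod.distrib prod_constant card_atLeastLessThan C_def)
    finally have "eta_sq \<tau> * (\<Prod>l=1..<N. siegel N 0 (int l) \<tau>) = C * (expi (\<tau> / 6) * expi (\<tau> / 6) ^ (N - 1)) *
        (D * (\<Prod>l=1..<N. q_pochhammer (?q * expi (2 * y l)) ?q)) * (D * (\<Prod>l=1..<N. q_pochhammer (?q * expi (- 2 * y l)) ?q))"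
      by (simp add: eta_sq_def D_def power2_eq_square mult_ac)
    also have "expi (\<tau> / 6) * expi (\<tau> / 6) ^ (N - 1) = expi (of_nat N / 6 * \<tau>)"
    proof -
      have "expi (\<tau> / 6) * expi (\<tau> / 6) ^ (N - 1) = expi (\<tau> / 6) ^ N"
        using assms by (cases N) auto
      thus ?thesis by (simp add: expi_power)
    qed
    finally show "eta_sq \<tau> * (\<Prod>l=1..<N. siegel N 0 (int l) \<tau>) = C * (expi (of_nat N / 6 * \<tau>) * DN ^ 2)"
      unfolding p1 p2 by (simp add: power2_eq_square mult.assoc)
  qed
qed

theorem theta_product_eq_siegel:
  assumes "N > 0"
  obtains C where "C \<noteq> 0"
    "\<And>\<tau>. Im \<tau> > 0 \<Longrightarrow> theta_product N (2 * k) a \<tau> = C * theta_siegel N k a (1, 0, 0, 1) \<tau>"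
proof -
  define m where "m = N div 2"
  obtain C0 where C0: "C0 \<noteq> 0" "\<And>\<tau>. Im \<tau> > 0 \<Longrightarrow> eta_sq \<tau> * (\<Prod>l=1..<N. siegel N 0 (int l) \<tau>) =
       C0 * (expi (of_nat N / 6 * \<tau>) * q_pochhammer (expi (2 * \<tau>) ^ N) (expi (2 * \<tau>) ^ N) ^ 2)"
    using siegel_zero_column_product[OF assms] by blast
  define P where "P j C \<longleftrightarrow> C \<noteq> 0 \<and> (\<forall>\<tau>. Im \<tau> > 0 \<longrightarrow> (\<Prod>l<N. siegel N (int j) (int l) \<tau>) = C *
       (expi ((of_nat N / 6 - of_nat j * of_nat (N - j) / of_nat N) * \<tau>) *
       (q_pochhammer (expi (2 * \<tau>) ^ j) (expi (2 * \<tau>) ^ N) * q_pochhammer (expi (2 * \<tau>) ^ (N - j)) (expi (2 * \<tau>) ^ N))))" for j C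
  have "\<forall>j\<in>{1..m}. \<exists>C. P j C"
  proof
    fix j assume j: "j \<in> {1..m}"
    hence "0 < j" "j < N" using assms unfolding m_def by auto
    from siegel_column_product[OF this] show "\<exists>C. P j C"
      unfolding P_def by blast
  qed
  from bchoice[OF this] obtain C where "\<forall>j\<in>{1..m}. P j (C j)" by blast
  hence C: "\<And>j. j \<in> {1..m} \<Longrightarrow> C j \<noteq> 0"
    "\<And>j \<tau>. j \<in> {1..m} \<Longrightarrow> Im \<tau> > 0 \<Longrightarrow> (\<Prod>l<N. siegel N (int j) (int l) \<tau>) = C j *
       (expi ((of_nat N / 6 - of_nat j * of_nat (N - j) / of_nat N) * \<tau>) *
       (q_pochhammer (expi (2 * \<tau>) ^ j) (expi (2 * \<tau>) ^ N) * q_pochhammer (expi (2 * \<tau>) ^ (N - j)) (expi (2 * \<tau>) ^ N)))"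
    unfolding P_def by blast+
  define K where "K = C0 ^ k * (\<Prod>j=1..m. C j powi (a $ (j - 1)))"
  have K: "K \<noteq> 0" using C0(1) C(1) by (auto simp: K_def)
  have main: "theta_siegel N k a (1, 0, 0, 1) \<tau> = K * theta_product N (2 * k) a \<tau>" if \<tau>: "Im \<tau> > 0" for \<tau>
  proof -
    let ?q = "expi (2 * \<tau>)"
    define F where "F j = q_pochhammer (?q ^ j) (?q ^ N) * q_pochhammer (?q ^ (N - j)) (?q ^ N)" for j
    define D where "D = q_pochhammer (?q ^ N) (?q ^ N)"
    define E where "E j = (of_nat N / 6 - of_nat j * of_nat (N - j) / of_nat N) * \<tau>" for j
    have "theta_siegel N k a (1, 0, 0, 1) \<tau> = (eta_sq \<tau> * (\<Prod>l=1..<N. siegel N 0 (int l) \<tau>)) ^ k *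
        (\<Prod>j=1..m. (\<Prod>l<N. siegel N (int j) (int l) \<tau>) powi (a $ (j - 1)))"
      by (simp add: theta_siegel_def siegel_prod_def siegel_row_def m_def power_mult_distrib)
    also have "eta_sq \<tau> * (\<Prod>l=1..<N. siegel N 0 (int l) \<tau>) = C0 * (expi (of_nat N / 6 * \<tau>) * D ^ 2)"
      unfolding C0(2)[OF \<tau>] D_def ..
    also have "(\<Prod>j=1..m. (\<Prod>l<N. siegel N (int j) (int l) \<tau>) powi (a $ (j - 1))) =
        (\<Prod>j=1..m. (C j * (expi (E j) * F j)) powi (a $ (j - 1)))"
      using C(2)[OF _ \<tau>] by (intro prod.cong refl) (simp only: E_def F_def)
    also have "\<dots> = (\<Prod>j=1..m. C j powi (a $ (j - 1))) * expi (\<Sum>j=1..m. of_int (a $ (j - 1)) * E j) * (\<Prod>j=1..m. F j powi (a $ (j - 1)))"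
      by (simp add: power_int_mult_distrib prod.distrib expi_sum expi_power_int)
    finally have 1: "theta_siegel N k a (1, 0, 0, 1) \<tau> = K *
        (expi (of_nat k * (of_nat N / 6 * \<tau>) + (\<Sum>j=1..m. of_int (a $ (j - 1)) * E j)) * D ^ (2 * k) * (\<Prod>j=1..m. F j powi (a $ (j - 1))))"
      unfolding K_def power_mult_distrib expi_add expi_power[symmetric] power_mult by (simp only: mult_ac)
    define S1 where "S1 = int (2 * k) + 2 * (\<Sum>j=1..m. a $ (j - 1))"
    define S2 where "S2 = (\<Sum>j=1..m. int j * int (N - j) * a $ (j - 1))"
    \<comment> \<open>The factor 2 on the right translates exponents of \<open>expi\<close> into
      exponents of q.\<close>
    have "of_nat k * (of_nat N / 6 * \<tau>) + (\<Sum>j=1..m. of_int (a $ (j - 1)) * E j) =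
        2 * \<tau> * (of_nat N / 24 * of_int S1 - 1 / (2 * of_nat N) * of_int S2)"
      by (simp add: S1_def S2_def E_def ring_distribs sum_distrib_left sum_subtractf sum_distrib_right sum_divide_distrib mult_ac)
    hence 2: "theta_product N (2 * k) a \<tau> = expi (of_nat k * (of_nat N / 6 * \<tau>) + (\<Sum>j=1..m. of_int (a $ (j - 1)) * E j)) *
        D ^ (2 * k) * (\<Prod>j=1..m. F j powi (a $ (j - 1)))"
      unfolding theta_product_def Let_def m_def[symmetric] S1_def[symmetric] S2_def[symmetric]
      by (simp add: D_def F_def expi_def mult_ac)
    show ?thesis unfolding 1 2 ..
  qed
  show ?thesis
    by (rule that[of "1 / K"]) (use K main in auto)
qed

section \<open>The periodic Bernoulli polynomial\<close>

definition periodic_B2 :: "nat \<Rightarrow> int \<Rightarrow> rat" where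
  "periodic_B2 N n = B2 (of_int (n mod int N) / of_nat N)"

lemma periodic_B2_mod: "n mod int N = n' mod int N \<Longrightarrow> periodic_B2 N n = periodic_B2 N n'"
  by (simp add: periodic_B2_def)

lemma periodic_B2_add_mult [simp]: "periodic_B2 N (n + int N * m) = periodic_B2 N n"
  by (simp add: periodic_B2_def)

lemma periodic_B2_0 [simp]: "periodic_B2 N 0 = 1 / 6"
  by (simp add: periodic_B2_def B2_def)

lemma periodic_B2_minus:
  assumes "N > 0"
  shows "periodic_B2 N (- n) = periodic_B2 N n"
proof (cases "n mod int N = 0")
  case True
  thus ?thesis by (simp add: periodic_B2_def zmod_zminus1_eq_if)
next
  case False
  thus ?thesis using assms
    by (simp add: periodic_B2_def zmod_zminus1_eq_if B2_def field_simps power2_eq_square)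
qed

lemma frac_of_int_div:
  assumes "g > 0"
  shows "frac (of_int n / of_int g :: rat) = of_int (n mod g) / of_int g"
proof -
  have "(of_int n / of_int g :: rat) = of_int (n div g) + of_int (n mod g) / of_int g"
    using assms by (simp add: field_simps flip: of_int_mult of_int_add)
  moreover have "frac (of_int (n mod g) / of_int g :: rat) = of_int (n mod g) / of_int g"
    using assms by (simp add: frac_eq)
  ultimately show ?thesis
    by (simp add: frac_def)
qed

lemma B2_frac_eq_periodic_B2:
  assumes "g > 0"
  shows "B2 (frac (of_int n / of_int g)) = periodic_B2 (nat g) n"
  unfolding periodic_B2_def frac_of_int_div[OF assms] using assms by simp

lemma sum_periodic_affine:
  fixes h :: "int \<Rightarrow> 'a::comm_monoid_add"
  assumes "n > 0" "coprime u (int n)" "\<And>x. h (x mod int n) = h x"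
  shows "(\<Sum>l<n. h (u * int l + t)) = (\<Sum>l<n. h (int l))"
proof -
  define f where "f l = nat ((u * int l + t) mod int n)" for l
  have inj: "inj_on f {..<n}"
  proof (rule inj_onI)
    fix x y assume xy: "x \<in> {..<n}" "y \<in> {..<n}" "f x = f y"
    hence "(u * int x + t) mod int n = (u * int y + t) mod int n"
      unfolding f_def using assms(1) by (simp add: nat_eq_iff)
    hence "[u * int x + t = u * int y + t] (mod int n)" by (simp add: cong_def)
    hence "[u * int x = u * int y] (mod int n)" by (simp add: cong_add_rcancel)
    hence "[int x = int y] (mod int n)" using assms(2) by (simp add: cong_mult_lcancel coprime_commute)
    thus "x = y" using xy by (simp add: cong_def)
  qed
  have "f ` {..<n} = {..<n}"
    by (rule endo_inj_surj) (use inj assms(1) in \<open>auto simp: f_def nat_less_iff\<close>)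
  hence "bij_betw f {..<n} {..<n}" using inj by (simp add: bij_betw_def)
  hence "(\<Sum>l<n. h (int (f l))) = (\<Sum>l<n. h (int l))"
    by (rule sum.reindex_bij_betw)
  moreover have "h (int (f l)) = h (u * int l + t)" for l
    using assms(1) assms(3)[of "u * int l + t"] by (simp add: f_def)
  ultimately show ?thesis by simp
qed

lemma sum_quadratic:
  fixes A B C :: "'a::field_char_0"
  shows "(\<Sum>l<N. A + B * of_nat l + C * of_nat l ^ 2) =
    of_nat N * A + B * (of_nat N * (of_nat N - 1) / 2) + C * (of_nat N * (of_nat N - 1) * (2 * of_nat N - 1) / 6)"
  by (induction N) (simp_all add: field_simps power2_eq_square)

lemma B2_multiplication:
  assumes "n > 0"
  shows "(\<Sum>i<n. B2 ((x + of_nat i) / of_nat n)) = B2 x / of_nat n"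
proof -
  have "(\<Sum>i<n. B2 ((x + of_nat i) / of_nat n)) =
      (\<Sum>i<n. (x ^ 2 / of_nat n ^ 2 - x / of_nat n + 1 / 6) +
        (2 * x / of_nat n ^ 2 - 1 / of_nat n) * of_nat i + (1 / of_nat n ^ 2) * of_nat i ^ 2)"
    using assms by (intro sum.cong refl) (simp add: B2_def field_simps power2_eq_square)
  also have "\<dots> = B2 x / of_nat n"
    unfolding sum_quadratic using assms by (simp add: B2_def field_simps power2_eq_square)
  finally show ?thesis .
qed

lemma sum_lessThan_mult:
  fixes f :: "nat \<Rightarrow> 'a::comm_monoid_add"
  shows "(\<Sum>l<g * n. f l) = (\<Sum>t<g. \<Sum>i<n. f (t * n + i))"
proof (induction g)
  case (Suc g)
  have "(\<Sum>l<Suc g * n. f l) = (\<Sum>l<g * n + n. f l)" by (simp add: add.commute)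
  also have "\<dots> = (\<Sum>l<g * n. f l) + (\<Sum>i<n. f (g * n + i))"
    by (simp add: lessThan_atLeast0 sum.atLeastLessThan_concat[of 0 "g * n" "g * n + n", symmetric]
      sum.atLeastLessThan_shift_0[of f "g * n"] del: sum.op_ivl_Suc)
  finally show ?case using Suc.IH by simp
qed simp

text \<open>Write c = g u and N = g n with u prime to n. While l runs modulo N, the product l c
  meets every multiple of g modulo N exactly g times, and the multiplication theorem for n points
  contributes 1/n; together g/n = g^2/N.\<close>

theorem periodic_B2_distribution:
  fixes c x :: int
  assumes "N > 0"
  defines "g \<equiv> nat (gcd c (int N))"
  shows "(\<Sum>l<N. periodic_B2 N (x + int l * c)) = of_nat g ^ 2 / of_nat N * periodic_B2 g x"
proof -
  have g0: "g > 0" and gN: "int g = gcd c (int N)" using assms by (auto simp: g_def)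
  have "int g dvd int N" by (simp add: gN)
  hence "g dvd N" by (simp only: int_dvd_int_iff)
  then obtain n where n: "N = g * n" by blast
  have n0: "n > 0" using assms(1) n by simp
  obtain u where u: "c = int g * u" by (metis dvd_def gN gcd_dvd1)
  have cop: "coprime u (int n)"
  proof -
    have "int g * gcd u (int n) = int g" using gN n u by (simp add: gcd_mult_distrib_int[symmetric] abs_mult)
    thus ?thesis using g0 by (simp add: coprime_iff_gcd_eq_1)
  qed
  define h where "h i = periodic_B2 N (x + int g * i)" for i
  have hper: "h (i mod int n) = h i" for i
  proof -
    have "x + int g * i = (x + int g * (i mod int n)) + int N * (i div int n)"
      by (simp add: n algebra_simps) (metis distrib_left mod_mult_div_eq mult.commute)
    thus ?thesis by (simp only: h_def periodic_B2_add_mult)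
  qed
  have "(\<Sum>l<N. periodic_B2 N (x + int l * c)) = (\<Sum>l<g * n. h (u * int l))"
    by (simp add: h_def n u mult_ac)
  also have "\<dots> = (\<Sum>t<g. \<Sum>i<n. h (u * int i + u * int (t * n)))"
    unfolding sum_lessThan_mult by (simp add: algebra_simps)
  also have "\<dots> = of_nat g * (\<Sum>i<n. h (int i))"
    using sum_periodic_affine[of n u h, OF n0 cop hper] by simp
  \<comment> \<open>Shifting i by x div g moves all arguments into the interval from 0 to N, where
    no reduction modulo N is left.\<close>
  also have "(\<Sum>i<n. h (int i)) = (\<Sum>i<n. h (1 * int i + - (x div int g)))"
    by (rule sum_periodic_affine[symmetric]) (use n0 hper in auto)
  also have "\<dots> = (\<Sum>i<n. B2 ((of_int (x mod int g) / of_nat g + of_nat i) / of_nat n))"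
  proof (intro sum.cong refl)
    fix i assume i: "i \<in> {..<n}"
    have a: "x + int g * (1 * int i + - (x div int g)) = x mod int g + int g * int i"
      by (simp add: algebra_simps minus_mult_div_eq_mod[symmetric])
    have b: "(x mod int g + int g * int i) mod int N = x mod int g + int g * int i"
    proof (rule mod_pos_pos_trivial)
      show "0 \<le> x mod int g + int g * int i" using g0 by simp
      have "x mod int g < int g" using g0 by simp
      moreover have "int g * (int i + 1) \<le> int g * int n" using i by (intro mult_left_mono) auto
      ultimately show "x mod int g + int g * int i < int N" by (simp add: n algebra_simps)
    qed
    show "h (1 * int i + - (x div int g)) = B2 ((of_int (x mod int g) / of_nat g + of_nat i) / of_nat n)"
      unfolding h_def periodic_B2_def a b using g0 n0 by (simp add: n field_simps)
  qed
  also have "\<dots> = periodic_B2 g x / of_nat n"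
    unfolding B2_multiplication[OF n0] by (simp add: periodic_B2_def)
  finally show ?thesis using g0 n0 by (simp add: n power2_eq_square)
qed

definition cusp_order :: "nat \<Rightarrow> nat \<Rightarrow> int vec \<Rightarrow> int \<times> int \<Rightarrow> rat" where
  "cusp_order N k a = (\<lambda>(p, r). let g = nat (gcd r (int N)) in
     of_nat k * of_nat g / 12 + (\<Sum>j=1..N div 2. of_int (a $ (j - 1)) * (of_nat g / 2 * periodic_B2 g (int j * p))))"

text \<open>The factor 2 translates from \<open>expi\<close> to q. The factor g/N is the reciprocal
  of the width N/g of the cusp: orders are measured in the local parameter q^(g/N).\<close>

lemma siegel_exponent_eq_cusp_order:
  assumes "N > 0"
  shows "siegel_exponent N k a (1 / 6) (\<lambda>j l. periodic_B2 N (int j * p + int l * r)) =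
    2 * of_int (gcd r (int N)) / of_nat N * cusp_order N k a (p, r)"
proof -
  define g where "g = nat (gcd r (int N))"
  have g: "of_int (gcd r (int N)) = (of_nat g :: rat)"
    unfolding g_def by (metis gcd_ge_0_int of_int_of_nat_eq int_nat_eq)
  note dist = periodic_B2_distribution[OF assms, of _ r, folded g_def]
  have "(\<Sum>l<N. periodic_B2 N (int l * r)) = periodic_B2 N 0 + (\<Sum>l=1..<N. periodic_B2 N (int l * r))"
    using sum.atLeast_Suc_lessThan[of 0 N "\<lambda>l. periodic_B2 N (int l * r)"] assms by (simp add: lessThan_atLeast0)
  hence 1: "1 / 6 + (\<Sum>l=1..<N. periodic_B2 N (int l * r)) = of_nat g ^ 2 / of_nat N * (1 / 6)"
    using dist[of 0] by simp
  have "siegel_exponent N k a (1 / 6) (\<lambda>j l. periodic_B2 N (int j * p + int l * r)) =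
      of_nat k * (1 / 6 + (\<Sum>l=1..<N. periodic_B2 N (int l * r))) +
      (\<Sum>j=1..N div 2. of_int (a $ (j - 1)) * (of_nat g ^ 2 / of_nat N * periodic_B2 g (int j * p)))"
    unfolding siegel_exponent_def dist by (simp add: ring_distribs)
  also have "\<dots> = 2 * of_nat g / of_nat N * cusp_order N k a (p, r)"
    unfolding 1 cusp_order_def g_def[symmetric] Let_def prod.case
    by (simp add: ring_distribs sum_distrib_left power2_eq_square mult_ac)
  finally show ?thesis unfolding g .
qed

section \<open>Growth at the cusps\<close>

abbreviation at_ii_inf :: "complex filter" where
  "at_ii_inf \<equiv> filtercomap Im at_top"

lemma eventually_at_ii_inf_upper: "eventually (\<lambda>\<tau>. Im \<tau> > 0) at_ii_inf"
  unfolding eventually_filtercomap_at_top_linorder by (rule exI[of _ 1]) auto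

lemma tendsto_expi_at_ii_inf:
  assumes "c > 0"
  shows "((\<lambda>\<tau>. expi (of_real c * \<tau>)) \<longlongrightarrow> 0) at_ii_inf"
proof (rule tendsto_norm_zero_cancel)
  have "filterlim (\<lambda>t::real. - (pi * c) * t) at_bot at_top"
    using assms by (intro filterlim_tendsto_neg_mult_at_bot[OF tendsto_const _ filterlim_ident]) auto
  hence "((\<lambda>t::real. exp (- (pi * c) * t)) \<longlongrightarrow> 0) at_top"
    by (rule filterlim_compose[OF exp_at_bot])
  from filterlim_compose[OF this filterlim_filtercomap[of Im]]
  show "((\<lambda>\<tau>. norm (expi (of_real c * \<tau>))) \<longlongrightarrow> 0) at_ii_inf"
    by (simp add: norm_expi mult.assoc)
qed

lemma eta_sq_bigtheta: "eta_sq \<in> \<Theta>[at_ii_inf](\<lambda>\<tau>. expi (1 / 6 * \<tau>))"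
proof (rule bigthetaI_tendsto_norm)
  have q: "((\<lambda>\<tau>. expi (2 * \<tau>)) \<longlongrightarrow> 0) at_ii_inf" using tendsto_expi_at_ii_inf[of 2] by simp
  have "((\<lambda>\<tau>. norm (q_pochhammer (expi (2 * \<tau>)) (expi (2 * \<tau>)) ^ 2)) \<longlongrightarrow> norm (1 ^ 2 :: complex)) at_ii_inf"
    by (intro tendsto_intros tendsto_q_pochhammer_1 q)
  thus "((\<lambda>\<tau>. norm (eta_sq \<tau> / expi (1 / 6 * \<tau>))) \<longlongrightarrow> 1) at_ii_inf"
    by (simp add: eta_sq_def)
qed simp

text \<open>Reducing p modulo N changes the function by a constant of modulus 1. Afterwards the
  arguments of both symbols tend to 0, except for the first one when p is divisible by N; there the
  factor 1 - \<zeta> is split off, and it is nonzero because r is then not divisible by N.\<close>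

lemma siegel_bigtheta:
  assumes "N > 0" "\<not> (int N dvd p \<and> int N dvd r)"
  shows "siegel N p r \<in> \<Theta>[at_ii_inf](\<lambda>\<tau>. expi (of_rat (periodic_B2 N p) * \<tau>))"
proof -
  define p0 where "p0 = p mod int N"
  define m where "m = p div int N"
  have p: "p = p0 + int N * m" by (simp add: p0_def m_def)
  have p0: "0 \<le> p0" "p0 < int N" using assms(1) by (auto simp: p0_def)
  define x where "x = (of_int p0 / of_nat N :: real)"
  define y where "y = (of_int r / of_nat N :: complex)"
  have x: "0 \<le> x" "x < 1" using p0 assms(1) by (auto simp: x_def field_simps)
  have xc: "of_int p0 / of_nat N = (of_real x :: complex)" by (simp add: x_def)
  define e where "e = (of_rat (periodic_B2 N p) :: complex)"
  have e: "e = (of_real x) ^ 2 - of_real x + 1 / 6"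
    by (simp add: e_def periodic_B2_def p0_def[symmetric] B2_def of_rat_add of_rat_diff of_rat_power of_rat_divide x_def)
  define c where "c = - expi ((of_real x - 1) * y) * (if x = 0 then 1 - expi (2 * y) else 1)"
  have c0: "c \<noteq> 0"
  proof (cases "x = 0")
    case True
    hence "p0 = 0" using assms(1) by (simp add: x_def)
    hence "\<not> int N dvd r" using assms p by auto
    have "expi (2 * y) \<noteq> 1"
    proof
      assume "expi (2 * y) = 1"
      then obtain n :: int where "2 * y = 2 * of_int n" using expi_eq_1_iff by blast
      hence "of_int r = (of_int (n * int N) :: complex)" using assms(1) by (simp add: y_def field_simps)
      hence "r = n * int N" by (simp only: of_int_eq_iff)
      thus False using \<open>\<not> int N dvd r\<close> by simp
    qed
    thus ?thesis by (simp add: c_def)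
  qed (simp add: c_def)
  have q: "((\<lambda>\<tau>. expi (2 * \<tau>)) \<longlongrightarrow> 0) at_ii_inf" using tendsto_expi_at_ii_inf[of 2] by simp
  define A where "A \<tau> = expi (2 * of_real x * \<tau>) * expi (2 * y) * (if x = 0 then expi (2 * \<tau>) else 1)" for \<tau>
  define B where "B \<tau> = expi (2 * (1 - of_real x) * \<tau>) * expi (- 2 * y)" for \<tau>
  have A: "(A \<longlongrightarrow> 0) at_ii_inf"
  proof (cases "x = 0")
    case True
    thus ?thesis using tendsto_mult[OF tendsto_const q, of "expi (2 * y)"] by (simp add: A_def[abs_def])
  next
    case False
    hence "((\<lambda>\<tau>. expi (of_real (2 * x) * \<tau>)) \<longlongrightarrow> 0) at_ii_inf"
      using x by (intro tendsto_expi_at_ii_inf) simp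
    from tendsto_mult[OF this tendsto_const, of "expi (2 * y)"] False show ?thesis by (simp add: A_def[abs_def])
  qed
  have B: "(B \<longlongrightarrow> 0) at_ii_inf"
  proof -
    have "((\<lambda>\<tau>. expi (of_real (2 * (1 - x)) * \<tau>)) \<longlongrightarrow> 0) at_ii_inf"
      using x by (intro tendsto_expi_at_ii_inf) simp
    from tendsto_mult[OF this tendsto_const, of "expi (- 2 * y)"] show ?thesis by (simp add: B_def[abs_def])
  qed
  have eq: "siegel N p0 r \<tau> / expi (e * \<tau>) = c * q_pochhammer (A \<tau>) (expi (2 * \<tau>)) * q_pochhammer (B \<tau>) (expi (2 * \<tau>))"
    if \<tau>: "Im \<tau> > 0" for \<tau>
  proof -
    have "q_pochhammer (expi (2 * of_real x * \<tau>) * expi (2 * y)) (expi (2 * \<tau>)) =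
        (if x = 0 then 1 - expi (2 * y) else 1) * q_pochhammer (A \<tau>) (expi (2 * \<tau>))"
      using q_pochhammer_rec[OF norm_expi_2_less_1[OF \<tau>], of "expi (2 * y)"] by (simp add: A_def)
    thus ?thesis
      using siegel_q_product[OF \<tau> assms(1), of p0 r] unfolding xc y_def[symmetric] e[symmetric]
      by (simp add: c_def B_def expi_add)
  qed
  have lim: "((\<lambda>\<tau>. norm (siegel N p r \<tau> / expi (e * \<tau>))) \<longlongrightarrow> norm c) at_ii_inf"
  proof (rule Lim_transform_eventually)
    have "((\<lambda>\<tau>. norm (c * q_pochhammer (A \<tau>) (expi (2 * \<tau>)) * q_pochhammer (B \<tau>) (expi (2 * \<tau>)))) \<longlongrightarrow> norm (c * 1 * 1)) at_ii_inf"
      by (intro tendsto_intros tendsto_q_pochhammer_1 A B q)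
    thus "((\<lambda>\<tau>. norm (c * q_pochhammer (A \<tau>) (expi (2 * \<tau>)) * q_pochhammer (B \<tau>) (expi (2 * \<tau>)))) \<longlongrightarrow> norm c) at_ii_inf"
      by simp
    show "\<forall>\<^sub>F \<tau> in at_ii_inf. norm (c * q_pochhammer (A \<tau>) (expi (2 * \<tau>)) * q_pochhammer (B \<tau>) (expi (2 * \<tau>))) =
        norm (siegel N p r \<tau> / expi (e * \<tau>))"
      using eventually_at_ii_inf_upper
    proof eventually_elim
      case (elim \<tau>)
      have "siegel N p r \<tau> = expi (of_real (of_int m - of_int (r * m) / of_nat N)) * siegel N p0 r \<tau>"
        using siegel_shift[OF elim assms(1), of p0 m r 0] by (simp add: p)
      hence "norm (siegel N p r \<tau>) = norm (siegel N p0 r \<tau>)"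
        by (simp only: norm_mult norm_expi) simp
      thus ?case unfolding eq[OF elim, symmetric] by (simp add: norm_divide)
    qed
  qed
  show ?thesis
    using bigthetaI_tendsto_norm[OF _ lim] c0 by (simp add: e_def)
qed

lemma bigtheta_prod:
  assumes "\<And>x. x \<in> A \<Longrightarrow> f x \<in> \<Theta>[F](g x)"
  shows "(\<lambda>y. \<Prod>x\<in>A. f x y) \<in> \<Theta>[F](\<lambda>y. \<Prod>x\<in>A. g x y)"
  using assms by (induction A rule: infinite_finite_induct) (auto intro!: landau_theta.mult)

lemma bigtheta_power:
  assumes "f \<in> \<Theta>[F](g)"
  shows "(\<lambda>y. f y ^ n) \<in> \<Theta>[F](\<lambda>y. g y ^ n)"
  by (induction n) (auto intro!: landau_theta.mult assms)

lemma bigtheta_power_int: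
  assumes "f \<in> \<Theta>[F](g)"
  shows "(\<lambda>y. f y powi n) \<in> \<Theta>[F](\<lambda>y. g y powi n)"
  by (cases "n \<ge> 0") (simp_all add: power_int_def power_inverse bigtheta_power assms)

lemma theta_siegel_bigtheta:
  assumes "N > 0" "(p, q, r, s) \<in> SL2Z"
  shows "theta_siegel N k a (p, q, r, s) \<in> \<Theta>[at_ii_inf](\<lambda>\<tau>. expi (of_rat
    (2 * of_int (gcd r (int N)) / of_nat N * cusp_order N k a (p, r)) * \<tau>))"
proof -
  define G where "G j l = (of_rat (periodic_B2 N (int j * p + int l * r)) :: complex)" for j l :: nat
  have row: "(\<lambda>\<tau>. siegel_row N (p, q, r, s) \<tau> j l) \<in> \<Theta>[at_ii_inf](\<lambda>\<tau>. expi (G j l * \<tau>))"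
    if "l < N" "j \<le> N div 2" "j > 0 \<or> l > 0" for j l
    unfolding siegel_row_def prod.case G_def
    by (rule siegel_bigtheta[OF assms(1)]) (rule siegel_row_index[OF assms(2) that refl])
  have "(\<lambda>\<tau>. siegel_prod N k a (eta_sq \<tau>) (siegel_row N (p, q, r, s) \<tau>)) \<in>
      \<Theta>[at_ii_inf](\<lambda>\<tau>. siegel_prod N k a (expi (1 / 6 * \<tau>)) (\<lambda>j l. expi (G j l * \<tau>)))"
    unfolding siegel_prod_def
    by (intro landau_theta.mult bigtheta_prod bigtheta_power bigtheta_power_int eta_sq_bigtheta row) auto
  moreover have "siegel_exponent N k a (1 / 6 * \<tau>) (\<lambda>j l. G j l * \<tau>) =
      of_rat (siegel_exponent N k a (1 / 6) (\<lambda>j l. periodic_B2 N (int j * p + int l * r))) * \<tau>" for \<tau>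
    by (simp add: siegel_exponent_def G_def of_rat_add of_rat_mult of_rat_sum of_rat_divide ring_distribs
      sum_distrib_left sum_distrib_right mult_ac)
  ultimately show ?thesis
    unfolding theta_siegel_def[abs_def] siegel_prod_expi siegel_exponent_eq_cusp_order[OF assms(1)] by simp
qed

lemma of_rat_complex_eq: "(of_rat e :: complex) = of_real (of_rat e)"
  by (cases e) (simp add: of_rat_rat)

text \<open>The estimate is two-sided for a reason: the upper bound gives boundedness when e \<ge>
  0, the lower bound gives growth along the imaginary axis when e < 0.\<close>

lemma bounded_iff_exponent_nonneg:
  assumes "f \<in> \<Theta>[at_ii_inf](\<lambda>\<tau>. expi (of_rat e * \<tau>))"
  shows "(\<exists>B Y. \<forall>\<tau>\<in>upper_half_plane. Im \<tau> \<ge> Y \<longrightarrow> norm (f \<tau>) \<le> B) \<longleftrightarrow> e \<ge> 0"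
proof
  assume e: "e \<ge> 0"
  obtain c where c: "c > 0" "eventually (\<lambda>\<tau>. norm (f \<tau>) \<le> c * norm (expi (of_rat e * \<tau>))) at_ii_inf"
    using bigthetaD1[OF assms] by (elim landau_o.bigE)
  then obtain Y where Y: "\<And>\<tau>. Im \<tau> \<ge> Y \<Longrightarrow> norm (f \<tau>) \<le> c * norm (expi (of_rat e * \<tau>))"
    unfolding eventually_filtercomap_at_top_linorder by blast
  show "\<exists>B Y. \<forall>\<tau>\<in>upper_half_plane. Im \<tau> \<ge> Y \<longrightarrow> norm (f \<tau>) \<le> B"
  proof (intro exI ballI impI)
    fix \<tau> assume \<tau>: "\<tau> \<in> upper_half_plane" "Im \<tau> \<ge> Y"
    have "norm (expi (of_rat e * \<tau>)) = exp (- (pi * (of_rat e * Im \<tau>)))"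
      by (simp only: of_rat_complex_eq norm_expi) (simp add: mult.assoc)
    also have "\<dots> \<le> 1" using e \<tau>(1) by (simp add: upper_half_plane_def)
    finally show "norm (f \<tau>) \<le> c"
      using Y[OF \<tau>(2)] c(1) by (smt (verit) mult_left_le)
  qed
next
  assume "\<exists>B Y. \<forall>\<tau>\<in>upper_half_plane. Im \<tau> \<ge> Y \<longrightarrow> norm (f \<tau>) \<le> B"
  then obtain B Y where BY: "\<And>\<tau>. Im \<tau> > 0 \<Longrightarrow> Im \<tau> \<ge> Y \<Longrightarrow> norm (f \<tau>) \<le> B"
    by (auto simp: upper_half_plane_def)
  show "e \<ge> 0"
  proof (rule ccontr)
    assume "\<not> e \<ge> 0"
    hence e: "e < 0" by simp
    have "(\<lambda>\<tau>. expi (of_rat e * \<tau>)) \<in> O[at_ii_inf](f)"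
      using assms bigthetaD1 bigtheta_sym by blast
    then obtain c where c: "c > 0" "eventually (\<lambda>\<tau>. norm (expi (of_rat e * \<tau>)) \<le> c * norm (f \<tau>)) at_ii_inf"
      by (elim landau_o.bigE)
    then obtain Y' where Y': "\<And>\<tau>. Im \<tau> \<ge> Y' \<Longrightarrow> norm (expi (of_rat e * \<tau>)) \<le> c * norm (f \<tau>)"
      unfolding eventually_filtercomap_at_top_linorder by blast
    define d where "d = - pi * (of_rat e :: real)"
    have d: "d > 0" using e by (simp add: d_def mult_pos_neg)
    \<comment> \<open>The last entry makes d T exceed c B, and exp(d T) > d T then contradicts the
      bound; the other entries reach the range where both estimates hold.\<close>
    define T where "T = Max {1, Y, Y', (c * B + 1) / d}"
    have T: "T \<ge> 1" "T \<ge> Y" "T \<ge> Y'" "T \<ge> (c * B + 1) / d" by (auto simp: T_def)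
    have "norm (expi (of_rat e * (of_real T * \<i>))) = exp (d * T)"
      by (simp only: of_rat_complex_eq norm_expi) (simp add: d_def mult.assoc)
    hence "exp (d * T) \<le> c * norm (f (of_real T * \<i>))" using Y'[of "of_real T * \<i>"] T by simp
    also have "\<dots> \<le> c * B" using BY[of "of_real T * \<i>"] T c(1) by simp
    also have "\<dots> < d * T" using T(4) d by (simp add: field_simps)
    also have "\<dots> < exp (d * T)" using exp_ge_add_one_self[of "d * T"] by linarith
    finally show False .
  qed
qed

section \<open>Modularity of the products\<close>

text \<open>Moving the window of l by one replaces the index t by t + N, which costs the factor
  \<open>expi (1 + j / N)\<close>. Since the factors do not vanish, the common ones can be
  cancelled.\<close>

lemma siegel_column_shift:
  assumes "Im \<tau> > 0" "N > 0" "0 < j" "j < int N"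
  shows "(\<Prod>l<N. siegel N j (t + int l) \<tau>) =
    expi (of_int t + of_int (j * t) / of_nat N) * (\<Prod>l<N. siegel N j (int l) \<tau>)"
proof -
  have nz: "siegel N j r \<tau> \<noteq> 0" for r
    using assms siegel_nonzero zdvd_not_zless by blast
  have step: "(\<Prod>l<N. siegel N j (t + 1 + int l) \<tau>) =
      expi (1 + of_int j / of_nat N) * (\<Prod>l<N. siegel N j (t + int l) \<tau>)" for t
  proof -
    have sh: "siegel N j (t + int N) \<tau> = expi (1 + of_int j / of_nat N) * siegel N j t \<tau>"
      using siegel_shift[OF assms(1,2), of j 0 t 1] by simp
    have "siegel N j t \<tau> * (\<Prod>l<N. siegel N j (t + 1 + int l) \<tau>) = (\<Prod>l<Suc N. siegel N j (t + int l) \<tau>)"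
      by (subst prod.lessThan_Suc_shift) (simp add: algebra_simps)
    also have "\<dots> = siegel N j t \<tau> * (expi (1 + of_int j / of_nat N) * (\<Prod>l<N. siegel N j (t + int l) \<tau>))"
      by (simp add: sh)
    finally show ?thesis using nz[of t] by simp
  qed
  show ?thesis
  proof (induction t rule: int_induct[of _ 0])
    case (step1 i)
    have "(\<Prod>l<N. siegel N j (i + 1 + int l) \<tau>) =
        expi ((1 + of_int j / of_nat N) + (of_int i + of_int (j * i) / of_nat N)) * (\<Prod>l<N. siegel N j (int l) \<tau>)"
      unfolding step step1.IH by (simp add: expi_add)
    also have "(1 + of_int j / of_nat N) + (of_int i + of_int (j * i) / of_nat N) =
        of_int (i + 1) + of_int (j * (i + 1)) / (of_nat N :: complex)"
      by (simp add: algebra_simps add_divide_distrib)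
    finally show ?case .
  next
    case (step2 i)
    have e: "(of_int i + of_int (j * i) / of_nat N :: complex) =
        (1 + of_int j / of_nat N) + (of_int (i - 1) + of_int (j * (i - 1)) / of_nat N)"
      by (simp add: algebra_simps add_divide_distrib diff_divide_distrib)
    have "expi (1 + of_int j / of_nat N) * (\<Prod>l<N. siegel N j (i - 1 + int l) \<tau>) = (\<Prod>l<N. siegel N j (i + int l) \<tau>)"
      using step[of "i - 1", symmetric] by simp
    also have "\<dots> = expi (of_int i + of_int (j * i) / of_nat N) * (\<Prod>l<N. siegel N j (int l) \<tau>)"
      by (rule step2.IH)
    also have "\<dots> = expi (1 + of_int j / of_nat N) *
        (expi (of_int (i - 1) + of_int (j * (i - 1)) / of_nat N) * (\<Prod>l<N. siegel N j (int l) \<tau>))"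
      by (simp only: e expi_add mult.assoc)
    finally have "expi (1 + of_int j / of_nat N) * (\<Prod>l<N. siegel N j (i - 1 + int l) \<tau>) =
        expi (1 + of_int j / of_nat N) *
        (expi (of_int (i - 1) + of_int (j * (i - 1)) / of_nat N) * (\<Prod>l<N. siegel N j (int l) \<tau>))" .
    thus ?case by (simp only: mult_left_cancel[OF expi_nonzero])
  qed simp
qed

definition exponent_sum :: "nat \<Rightarrow> nat \<Rightarrow> int vec \<Rightarrow> int" where
  "exponent_sum N n a = (\<Sum>j=1..N div 2. int j ^ n * a $ (j - 1))"

definition weight_congruences :: "nat \<Rightarrow> nat \<Rightarrow> int vec \<Rightarrow> bool" where
  "weight_congruences N k a \<longleftrightarrow>
     12 dvd int k + exponent_sum N 0 a \<and> 2 * int N dvd exponent_sum N 2 a - int N * exponent_sum N 1 a"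

lemma even_exponent_sum_diff: "even (exponent_sum N 2 a - exponent_sum N 1 a)"
proof -
  have "exponent_sum N 2 a - exponent_sum N 1 a = (\<Sum>j=1..N div 2. int j * (int j - 1) * a $ (j - 1))"
    by (simp add: exponent_sum_def sum_subtractf[symmetric] algebra_simps power2_eq_square)
  thus ?thesis by (simp add: dvd_sum)
qed

text \<open>Column sums that are quadratic in j turn the total exponent into a combination of the
  moments of order 0, 1 and 2 of a. As the entry at (0, 0) is 0, the column j = 0 may be summed from
  l = 0.\<close>

lemma siegel_exponent_quadratic:
  fixes \<alpha> \<beta> \<delta> \<epsilon> :: complex
  assumes "N > 0" "G 0 0 = 0" "(\<Sum>l<N. G 0 l) = \<delta> - \<epsilon>"
    "\<And>j. (\<Sum>l<N. G j l) = \<delta> - \<epsilon> + \<alpha> * of_nat j + \<beta> * of_nat j ^ 2"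
  shows "siegel_exponent N k a 0 G = (of_nat k + of_int (exponent_sum N 0 a)) * (\<delta> - \<epsilon>) +
    \<alpha> * of_int (exponent_sum N 1 a) + \<beta> * of_int (exponent_sum N 2 a)"
proof -
  have "(\<Sum>l=1..<N. G 0 l) = \<delta> - \<epsilon>"
    using sum.atLeast_Suc_lessThan[of 0 N "G 0"] assms(1-3) by (simp add: lessThan_atLeast0)
  thus ?thesis
    by (simp add: siegel_exponent_def assms(4) exponent_sum_def ring_distribs sum.distrib sum_subtractf
      sum_distrib_left sum_distrib_right mult_ac)
qed

text \<open>Modulo N the matrix has rows (1, q) and (0, 1), so it sends the index (j, l) to (j, j q
  + l) plus N times an integer vector. \<open>siegel_shift\<close> pays for that vector and
  \<open>siegel_column_shift\<close> for moving the window by j q. The accumulated exponents are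
  quadratic in l, their sums over l quadratic in j, and the two congruences make the total an even
  integer.\<close>

theorem theta_siegel_Gamma1:
  assumes N: "N > 0" and "weight_congruences N k a" and g: "(p, q, r, s) \<in> Gamma1 N" and \<tau>: "Im \<tau> > 0"
  shows "theta_siegel N k a (p, q, r, s) \<tau> = theta_siegel N k a (1, 0, 0, 1) \<tau>"
proof -
  have det: "p * s - q * r = 1" using g by (simp add: Gamma1_def SL2Z_def)
  have "int N dvd p - 1" "int N dvd s - 1"
    using g by (simp_all add: Gamma1_def cong_iff_dvd_diff)
  then obtain p' s' where "p - 1 = int N * p'" "s - 1 = int N * s'"
    by (auto elim!: dvdE)
  hence p: "p = 1 + int N * p'" and s: "s = 1 + int N * s'" by simp_all
  obtain r' where r: "r = int N * r'" using g unfolding Gamma1_def by (auto simp: cong_0_iff)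
  have "int N * (p' + s' + int N * p' * s' - q * r') = 0" using det by (simp add: p s r algebra_simps)
  hence "p' + s' + int N * p' * s' - q * r' = 0" using N by simp
  hence det': "s' = q * r' - p' - int N * p' * s'" by (simp add: algebra_simps)
  define m where "m j l = int j * p' + int l * r'" for j l
  define n where "n l = int l * s'" for l :: nat
  \<comment> \<open>The cost of moving the window belongs to a whole column. It is divided evenly
    among its N entries, hence the last division by N, so that the multiplier has the shape required
    by \<open>siegel_prod\<close>.\<close>
  define R where "R j l = (of_int (m j l * n l + m j l + n l) +
      of_int (int j * n l - (int j * q + int l) * m j l) / of_nat N +
      (of_int (int j * q) + of_int (int j * (int j * q)) / of_nat N) / of_nat N :: complex)" for j l
  have row: "siegel_row N (p, q, r, s) \<tau> j l = expi (of_int (m j l * n l + m j l + n l) +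
      of_int (int j * n l - (int j * q + int l) * m j l) / of_nat N) * siegel N (int j) (int j * q + int l) \<tau>" for j l
  proof -
    have e: "int j * p + int l * r = int j + int N * m j l" "int j * q + int l * s = (int j * q + int l) + int N * n l"
      by (simp_all add: p r s m_def n_def algebra_simps)
    show ?thesis unfolding siegel_row_def prod.case e siegel_shift[OF \<tau> N] by simp
  qed
  have "theta_siegel N k a (p, q, r, s) \<tau> =
      siegel_prod N k a (expi 0 * eta_sq \<tau>) (\<lambda>j l. expi (R j l) * siegel_row N (1, 0, 0, 1) \<tau> j l)"
    unfolding theta_siegel_def
  proof (rule siegel_prod_cong)
    show "(\<Prod>l=1..<N. siegel_row N (p, q, r, s) \<tau> 0 l) = (\<Prod>l=1..<N. expi (R 0 l) * siegel_row N (1, 0, 0, 1) \<tau> 0 l)"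
      unfolding row by (simp add: R_def siegel_row_def)
  next
    fix j assume j: "j \<in> {1..N div 2}"
    hence "j < N" using N by auto
    have "(\<Prod>l<N. siegel_row N (p, q, r, s) \<tau> j l) =
        (\<Prod>l<N. expi (of_int (m j l * n l + m j l + n l) + of_int (int j * n l - (int j * q + int l) * m j l) / of_nat N)) *
        (expi (of_int (int j * q) + of_int (int j * (int j * q)) / of_nat N) * (\<Prod>l<N. siegel N (int j) (int l) \<tau>))"
      unfolding row prod.distrib using siegel_column_shift[OF \<tau> N, of "int j" "int j * q"] j \<open>j < N\<close> by simp
    also have "expi (of_int (int j * q) + of_int (int j * (int j * q)) / of_nat N) =
        (\<Prod>l<N. expi ((of_int (int j * q) + of_int (int j * (int j * q)) / of_nat N) / of_nat N))"
      using N by (simp add: expi_power)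
    finally show "(\<Prod>l<N. siegel_row N (p, q, r, s) \<tau> j l) = (\<Prod>l<N. expi (R j l) * siegel_row N (1, 0, 0, 1) \<tau> j l)"
      by (simp add: R_def siegel_row_def prod.distrib expi_add power_mult_distrib)
  qed simp
  also have "\<dots> = expi (siegel_exponent N k a 0 R) * theta_siegel N k a (1, 0, 0, 1) \<tau>"
    unfolding siegel_prod_mult siegel_prod_expi theta_siegel_def ..
  also have "expi (siegel_exponent N k a 0 R) = 1"
  proof -
    define u t where "u = exponent_sum N 1 a" and "t = exponent_sum N 2 a"
    obtain w where w: "t = int N * u + 2 * int N * w"
      using assms(2) unfolding weight_congruences_def u_def t_def by (metis add.commute diff_add_cancel dvd_def)
    obtain v where v: "int k + exponent_sum N 0 a = 12 * v"
      using assms(2) unfolding weight_congruences_def by blast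
    have v': "of_nat k + of_int (exponent_sum N 0 a) = (12 * of_int v :: complex)"
      using arg_cong[OF v, of "of_int :: int \<Rightarrow> complex"] by simp
    define \<sigma>0 \<sigma>2 where "\<sigma>0 = (of_nat N * (of_nat N - 1) / 2 :: complex)"
      and "\<sigma>2 = (of_nat N * (of_nat N - 1) * (2 * of_nat N - 1) / 6 :: complex)"
    define K where "K = of_int (r' * s') * \<sigma>2 + of_int (r' + s') * \<sigma>0"
    define L where "L = of_int r' * ((of_nat N - 1) * (2 * of_nat N - 1) / 6 :: complex)"
    have NL: "of_int r' * \<sigma>2 / of_nat N = L" using N by (simp add: \<sigma>2_def L_def)
    have s'c: "of_int s' = (of_int q * of_int r' - of_int p' - of_nat N * of_int p' * of_int s' :: complex)"
      by (subst det') simp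
    have sumR: "(\<Sum>l<N. R j l) = K - L + (of_int p' + of_int q) * of_nat j +
        (of_int q / of_nat N - of_int (q * p')) * of_nat j ^ 2" for j
    proof -
      define A B C where "A = (of_nat j * of_int p' - of_nat j ^ 2 * of_int q * of_int p' / of_nat N +
          (of_nat j * of_int q + of_nat j ^ 2 * of_int q / of_nat N) / of_nat N :: complex)"
        and "B = (of_nat j * of_int p' * of_int s' + of_int r' + of_int s' +
          of_nat j * (of_int s' - of_int q * of_int r' - of_int p') / of_nat N :: complex)"
        and "C = (of_int r' * of_int s' - of_int r' / of_nat N :: complex)"
      have "R j l = A + B * of_nat l + C * of_nat l ^ 2" for l
        using N by (simp add: R_def A_def B_def C_def m_def n_def field_simps power2_eq_square)
      hence S: "(\<Sum>l<N. R j l) = of_nat N * A + B * \<sigma>0 + C * \<sigma>2"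
        unfolding \<sigma>0_def \<sigma>2_def by (simp add: sum_quadratic)
      have "of_int s' - of_int q * of_int r' - of_int p' = (- 2 * of_int p' - of_nat N * of_int p' * of_int s' :: complex)"
        by (subst (1) s'c) (simp add: algebra_simps)
      hence "B = of_nat j * of_int p' * of_int s' + of_int r' + of_int s' +
          of_nat j * (- 2 * of_int p' - of_nat N * of_int p' * of_int s') / of_nat N"
        by (simp add: B_def)
      hence B: "B = of_int r' + of_int s' - 2 * of_nat j * of_int p' / of_nat N"
        using N by (simp add: field_simps)
      have B: "B * \<sigma>0 = of_int (r' + s') * \<sigma>0 - of_nat j * of_int p' * (of_nat N - 1)"
        unfolding B \<sigma>0_def using N by (simp add: field_simps)
      have C: "C * \<sigma>2 = of_int (r' * s') * \<sigma>2 - L"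
        by (simp add: C_def NL[symmetric] algebra_simps)
      have A: "of_nat N * A = of_nat N * of_nat j * of_int p' - of_nat j ^ 2 * of_int q * of_int p' +
          (of_nat j * of_int q + of_nat j ^ 2 * of_int q / of_nat N)"
        using N by (simp add: A_def field_simps)
      show ?thesis unfolding S A B C by (simp add: K_def algebra_simps)
    qed
    have R00: "R 0 0 = 0" by (simp add: R_def m_def n_def)
    have sumR0: "(\<Sum>l<N. R 0 l) = K - L" using sumR[of 0] by simp
    have "siegel_exponent N k a 0 R = 12 * of_int v * (K - L) + (of_int p' + of_int q) * of_int u +
        (of_int q / of_nat N - of_int (q * p')) * of_int t"
      using siegel_exponent_quadratic[of N R K L, OF N R00 sumR0 sumR, of k a] by (simp add: v' u_def t_def)
    also have "(of_int q / of_nat N - of_int (q * p')) * of_int t =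
        (of_int q * (of_int u + 2 * of_int w) - of_int (q * p' * t) :: complex)"
      using N by (simp add: w left_diff_distrib) (simp add: field_simps)
    also have "12 * of_int v * (K - L) + (of_int p' + of_int q) * of_int u + \<dots> =
        of_int (2 * (v * (r' * s' * (int N * (int N - 1) * (2 * int N - 1)) + 3 * (r' + s') * (int N * (int N - 1))
          - r' * ((int N - 1) * (2 * int N - 1))) + q * (u + w)) + p' * (u - q * t))"
      by (simp add: K_def L_def \<sigma>0_def \<sigma>2_def field_simps)
    finally have X: "siegel_exponent N k a 0 R = of_int (2 * (v * (r' * s' * (int N * (int N - 1) * (2 * int N - 1)) + 3 * (r' + s') * (int N * (int N - 1))
          - r' * ((int N - 1) * (2 * int N - 1))) + q * (u + w)) + p' * (u - q * t))" .
    have ut: "even (t - u)" unfolding u_def t_def by (rule even_exponent_sum_diff)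
    \<comment> \<open>Always u \<equiv> t modulo 2. For even N the second congruence makes t even.
      For odd N and odd p' the determinant relation reads 1 \<equiv> q r' modulo 2, so q is odd and
      u - q t is even.\<close>
    have "even (p' * (u - q * t))"
    proof (cases "even N")
      case True
      hence "even t" using w by simp
      thus ?thesis using ut by simp
    next
      case False
      have "even (p' + s' + int N * p' * s' - q * r')" using det' by (simp add: algebra_simps)
      thus ?thesis using ut False by auto
    qed
    thus ?thesis unfolding X expi_of_int by simp
  qed
  finally show ?thesis by simp
qed

lemma theta_siegel_translate:
  assumes "N > 0" "Im \<tau> > 0"
  shows "theta_siegel N k a (1, 0, 0, 1) (\<tau> + 1) =
    expi (of_nat N * of_int (int k + exponent_sum N 0 a) / 6 + of_int (exponent_sum N 1 a) + of_int (exponent_sum N 2 a) / of_nat N) *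
    theta_siegel N k a (1, 0, 0, 1) \<tau>"
proof -
  define R where "R j l = (1 / 6 + (of_nat j + of_nat j ^ 2 / of_nat N) / of_nat N :: complex)" for j l :: nat
  have row: "siegel_row N (1, 0, 0, 1) (\<tau> + 1) j l = expi (1 / 6) * siegel N (int j) (int j + int l) \<tau>" for j l
    using siegel_translate[of N "int j" "int l" \<tau> 1] by (simp add: siegel_row_def add.commute)
  have "theta_siegel N k a (1, 0, 0, 1) (\<tau> + 1) =
      siegel_prod N k a (expi (1 / 6) * eta_sq \<tau>) (\<lambda>j l. expi (R j l) * siegel_row N (1, 0, 0, 1) \<tau> j l)"
    unfolding theta_siegel_def eta_sq_translate
  proof (rule siegel_prod_cong)
    show "(\<Prod>l=1..<N. siegel_row N (1, 0, 0, 1) (\<tau> + 1) 0 l) = (\<Prod>l=1..<N. expi (R 0 l) * siegel_row N (1, 0, 0, 1) \<tau> 0 l)"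
      unfolding row by (simp add: R_def siegel_row_def)
  next
    fix j assume j: "j \<in> {1..N div 2}"
    hence "j < N" using assms(1) by auto
    have "(\<Prod>l<N. siegel_row N (1, 0, 0, 1) (\<tau> + 1) j l) =
        (\<Prod>l<N. expi (1 / 6)) * (expi (of_nat j + of_nat j ^ 2 / of_nat N) * (\<Prod>l<N. siegel N (int j) (int l) \<tau>))"
      unfolding row prod.distrib using siegel_column_shift[OF assms(2,1), of "int j" "int j"] j \<open>j < N\<close>
      by (simp add: power2_eq_square)
    also have "expi (of_nat j + of_nat j ^ 2 / of_nat N) = (\<Prod>l<N. expi ((of_nat j + of_nat j ^ 2 / of_nat N) / of_nat N))"
      using assms(1) by (simp add: expi_power)
    finally show "(\<Prod>l<N. siegel_row N (1, 0, 0, 1) (\<tau> + 1) j l) = (\<Prod>l<N. expi (R j l) * siegel_row N (1, 0, 0, 1) \<tau> j l)"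
      by (simp add: R_def siegel_row_def prod.distrib expi_add power_mult_distrib)
  qed simp
  also have "\<dots> = expi (siegel_exponent N k a (1 / 6) R) * theta_siegel N k a (1, 0, 0, 1) \<tau>"
    unfolding siegel_prod_mult siegel_prod_expi theta_siegel_def ..
  also have "siegel_exponent N k a (1 / 6) R = of_nat N * of_int (int k + exponent_sum N 0 a) / 6 +
      of_int (exponent_sum N 1 a) + of_int (exponent_sum N 2 a) / of_nat N"
  proof -
    have 1: "(\<Sum>l<N. R j l) = of_nat N / 6 + of_nat j + of_nat j ^ 2 / of_nat N" for j
      using assms(1) by (simp add: R_def field_simps)
    have 2: "(\<Sum>l=1..<N. R 0 l) = (of_nat N - 1) / 6" using assms(1) by (simp add: R_def of_nat_diff)
    show ?thesis
      unfolding siegel_exponent_def 1 2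
      by (simp add: exponent_sum_def distrib_left distrib_right right_diff_distrib sum.distrib sum_distrib_left
        sum_distrib_right sum_divide_distrib add_divide_distrib diff_divide_distrib mult_ac)
  qed
  finally show ?thesis .
qed

text \<open>Translation by N seen from the cusp 0 is the matrix with rows (1, 0) and (-N, 1) of
  \<Gamma>_1(N). Its multiplier depends only on k + \<Sum> a_j and thus isolates the congruence
  modulo 12.\<close>

lemma theta_siegel_inversion_translate:
  assumes "N > 0" "Im \<tau> > 0"
  shows "theta_siegel N k a (0, - 1, 1, 0) (\<tau> + of_nat N) =
    expi (of_int (int k + exponent_sum N 0 a) * (of_int (int N * (int N - 1)) + 1 / 6)) * theta_siegel N k a (0, - 1, 1, 0) \<tau>"
proof -
  define R where "R j l = (of_nat N / 6 + 1 * of_nat l + (1 / of_nat N) * of_nat l ^ 2 :: complex)" for j l :: nat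
  have row: "siegel_row N (0, - 1, 1, 0) (\<tau> + of_nat N) j l = expi (R j l) * siegel_row N (0, - 1, 1, 0) \<tau> j l" for j l
  proof -
    have "siegel_row N (0, - 1, 1, 0) (\<tau> + of_nat N) j l = expi (of_nat N / 6) * siegel N (int l + int N * 0) (- int j + int N * int l) \<tau>"
      unfolding siegel_row_def by (simp add: siegel_translate)
    also have "\<dots> = expi (of_nat N / 6) * expi (of_nat l + of_nat l ^ 2 / of_nat N) * siegel_row N (0, - 1, 1, 0) \<tau> j l"
      unfolding siegel_shift[OF assms(2,1)] by (simp add: siegel_row_def power2_eq_square)
    finally show ?thesis by (simp add: R_def expi_add)
  qed
  have "theta_siegel N k a (0, - 1, 1, 0) (\<tau> + of_nat N) =
      siegel_prod N k a (expi (of_nat N / 6) * eta_sq \<tau>) (\<lambda>j l. expi (R j l) * siegel_row N (0, - 1, 1, 0) \<tau> j l)"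
    unfolding theta_siegel_def eta_sq_translate_nat row[abs_def] ..
  also have "\<dots> = expi (siegel_exponent N k a (of_nat N / 6) R) * theta_siegel N k a (0, - 1, 1, 0) \<tau>"
    unfolding siegel_prod_mult siegel_prod_expi theta_siegel_def ..
  also have "siegel_exponent N k a (of_nat N / 6) R =
      of_int (int k + exponent_sum N 0 a) * (of_int (int N * (int N - 1)) + 1 / 6)"
  proof -
    define X where "X = (of_int (int N * (int N - 1)) + 1 / 6 :: complex)"
    have 1: "(\<Sum>l<N. R j l) = X" for j
      unfolding X_def R_def sum_quadratic using assms(1) by (simp add: field_simps)
    have "(\<Sum>l<N. R 0 l) = R 0 0 + (\<Sum>l=1..<N. R 0 l)"
      using sum.atLeast_Suc_lessThan[of 0 N "R 0"] assms(1) by (simp add: lessThan_atLeast0)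
    hence 2: "of_nat N / 6 + (\<Sum>l=1..<N. R 0 l) = X"
      using 1[of 0] by (simp add: R_def)
    have "siegel_exponent N k a (of_nat N / 6) R = of_nat k * (of_nat N / 6 + (\<Sum>l=1..<N. R 0 l)) +
        (\<Sum>j=1..N div 2. of_int (a $ (j - 1)) * (\<Sum>l<N. R j l))"
      unfolding siegel_exponent_def by (simp add: ring_distribs)
    thus ?thesis unfolding 1 2 X_def[symmetric]
      by (simp add: exponent_sum_def distrib_right sum_distrib_right)
  qed
  finally show ?thesis .
qed

text \<open>Necessity of the congruences is tested on two elements of \<Gamma>_1(N): the unipotent
  matrix fixing the cusp 0 gives the one modulo 12, and given that one, \<tau> \<mapsto> \<tau> + 1
  gives the one modulo 2N. Growth at each cusp is equivalent to a condition on one order, so it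
  separates from the congruences.\<close>

theorem theta_product_modular_iff:
  assumes N: "N > 0"
  shows "theta_product N (2 * k) a \<in> modular_forms_Gamma1 k N \<longleftrightarrow>
    weight_congruences N k a \<and> (\<forall>(p, q, r, s) \<in> SL2Z. cusp_order N k a (p, r) \<ge> 0)"
proof -
  let ?f = "theta_product N (2 * k) a" and ?\<Phi> = "theta_siegel N k a"
  define S where "S = int N * (int k + (\<Sum>j=1..N div 2. a $ (j - 1)))"
  have S: "S = int N * (int k + exponent_sum N 0 a)" by (simp add: S_def exponent_sum_def)
  obtain C0 where C0: "C0 \<noteq> 0" "\<And>\<tau>. Im \<tau> > 0 \<Longrightarrow> ?f \<tau> = C0 * ?\<Phi> (1, 0, 0, 1) \<tau>"
    using theta_product_eq_siegel[OF N] by metis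
  have id: "(1, 0, 0, 1) \<in> SL2Z" and inv: "(0, - 1, 1, 0) \<in> SL2Z" by (simp_all add: SL2Z_def)
  have slash: "\<exists>C. C ^ 12 = 1 \<and> (\<forall>\<tau>. Im \<tau> > 0 \<longrightarrow> slash k ?f \<gamma> \<tau> = C0 * C powi S * ?\<Phi> \<gamma> \<tau>)" if \<gamma>: "\<gamma> \<in> SL2Z" for \<gamma>
  proof -
    obtain p q r s where g: "\<gamma> = (p, q, r, s)" by (metis prod_cases4)
    obtain C where C: "C ^ 12 = 1" "\<And>\<tau>. Im \<tau> > 0 \<Longrightarrow> slash k (?\<Phi> (1, 0, 0, 1)) \<gamma> \<tau> = C powi S * ?\<Phi> \<gamma> \<tau>"
      using theta_siegel_SL2Z[OF g \<gamma> N, of k a] unfolding S_def by metis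
    have "slash k ?f \<gamma> \<tau> = C0 * slash k (?\<Phi> (1, 0, 0, 1)) \<gamma> \<tau>" if "Im \<tau> > 0" for \<tau>
      using C0(2)[OF moebius_upper_half_plane[OF _ that]] \<open>\<gamma> \<in> SL2Z\<close> unfolding slash_def g by auto
    thus ?thesis using C by (auto simp: mult.assoc)
  qed
  have bdd: "(\<exists>B Y. \<forall>\<tau>\<in>upper_half_plane. Im \<tau> \<ge> Y \<longrightarrow> norm (slash k ?f (p, q, r, s) \<tau>) \<le> B) \<longleftrightarrow> cusp_order N k a (p, r) \<ge> 0"
    if g: "(p, q, r, s) \<in> SL2Z" for p q r s
  proof -
    obtain C where C: "C ^ 12 = 1" "\<And>\<tau>. Im \<tau> > 0 \<Longrightarrow> slash k ?f (p, q, r, s) \<tau> = C0 * C powi S * ?\<Phi> (p, q, r, s) \<tau>"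
      using slash[OF g] by blast
    have nz: "C0 * C powi S \<noteq> 0" using C0(1) C(1) by auto
    have ev: "eventually (\<lambda>\<tau>. slash k ?f (p, q, r, s) \<tau> = C0 * C powi S * ?\<Phi> (p, q, r, s) \<tau>) at_ii_inf"
      using eventually_at_ii_inf_upper by eventually_elim (rule C(2))
    have "slash k ?f (p, q, r, s) \<in> \<Theta>[at_ii_inf](\<lambda>\<tau>. C0 * C powi S * ?\<Phi> (p, q, r, s) \<tau>)"
      by (rule bigthetaI_cong[OF ev])
    also have "(\<lambda>\<tau>. C0 * C powi S * ?\<Phi> (p, q, r, s) \<tau>) \<in> \<Theta>[at_ii_inf](?\<Phi> (p, q, r, s))"
      using nz by simp
    also note theta_siegel_bigtheta[OF N g, of k a]
    finally have "(\<exists>B Y. \<forall>\<tau>\<in>upper_half_plane. Im \<tau> \<ge> Y \<longrightarrow> norm (slash k ?f (p, q, r, s) \<tau>) \<le> B) \<longleftrightarrow>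
        2 * of_int (gcd r (int N)) / of_nat N * cusp_order N k a (p, r) \<ge> 0"
      by (rule bounded_iff_exponent_nonneg)
    moreover have "2 * of_int (gcd r (int N)) / of_nat N > (0 :: rat)" using N by simp
    note mult_le_cancel_left_pos[OF this, of 0 "cusp_order N k a (p, r)", unfolded mult_zero_right]
    ultimately show ?thesis by (simp only:)
  qed
  show ?thesis
  proof
    assume f: "?f \<in> modular_forms_Gamma1 k N"
    have inv_f: "slash k ?f \<gamma> \<tau> = ?f \<tau>" if "\<gamma> \<in> Gamma1 N" "Im \<tau> > 0" for \<gamma> \<tau>
      using f that by (auto simp: modular_forms_Gamma1_def upper_half_plane_def)
    have "\<forall>(p, q, r, s) \<in> SL2Z. cusp_order N k a (p, r) \<ge> 0"
      using f bdd by (auto simp: modular_forms_Gamma1_def)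
    moreover have "12 dvd int k + exponent_sum N 0 a"
    proof -
      define \<tau> :: complex where "\<tau> = \<i>"
      have \<tau>: "Im \<tau> > 0" "Im (\<tau> + of_nat N) > 0" by (simp_all add: \<tau>_def)
      obtain C where C: "C ^ 12 = 1" "\<And>\<tau>. Im \<tau> > 0 \<Longrightarrow> slash k ?f (0, - 1, 1, 0) \<tau> = C0 * C powi S * ?\<Phi> (0, - 1, 1, 0) \<tau>"
        using slash[OF inv] by blast
      have nz: "C0 * C powi S * ?\<Phi> (0, - 1, 1, 0) \<tau> \<noteq> 0"
        using C0(1) C(1) theta_siegel_nonzero[OF inv \<tau>(1)] by auto
      have Cnz: "C \<noteq> 0" using C(1) by auto
      have nz': "\<tau> \<noteq> 0" "\<tau> + of_nat N \<noteq> 0" using \<tau> by (auto simp: complex_eq_iff)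
      have "(1, 0, - int N, 1) \<in> Gamma1 N"
        by (simp add: Gamma1_def SL2Z_def cong_0_iff)
      from inv_f[OF this Im_minus_inverse_pos[OF \<tau>(1)]]
      have "?f ((- 1 / \<tau>) / (- of_nat N * (- 1 / \<tau>) + 1)) / (- of_nat N * (- 1 / \<tau>) + 1) ^ k = ?f (- 1 / \<tau>)"
        by (simp add: slash_def add.commute)
      also have "- of_nat N * (- 1 / \<tau>) + 1 = (\<tau> + of_nat N) / \<tau>" using nz' by (simp add: field_simps)
      also have "(- 1 / \<tau>) / ((\<tau> + of_nat N) / \<tau>) = - 1 / (\<tau> + of_nat N)" using nz' by (simp add: field_simps)
      finally have "slash k ?f (0, - 1, 1, 0) (\<tau> + of_nat N) = slash k ?f (0, - 1, 1, 0) \<tau>"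
        using nz' by (simp add: slash_def power_divide field_simps)
      hence "expi (of_int (int k + exponent_sum N 0 a) * (of_int (int N * (int N - 1)) + 1 / 6)) = 1"
        unfolding C(2)[OF \<tau>(1)] C(2)[OF \<tau>(2)] theta_siegel_inversion_translate[OF N \<tau>(1)]
        using nz Cnz by simp
      then obtain n :: int where "of_int (int k + exponent_sum N 0 a) * (of_int (int N * (int N - 1)) + 1 / 6) = (2 * of_int n :: complex)"
        using expi_eq_1_iff by blast
      hence "of_int ((int k + exponent_sum N 0 a) * (6 * (int N * (int N - 1)) + 1)) = (of_int (12 * n) :: complex)"
        by (simp add: field_simps)
      hence eq: "(int k + exponent_sum N 0 a) * (6 * (int N * (int N - 1)) + 1) = 12 * n"
        by (simp only: of_int_eq_iff)
      \<comment> \<open>Since N(N - 1) is even, the cofactor 6N(N - 1) + 1 is 1 modulo 12.\<close>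
      have "even (int N * (int N - 1))" by simp
      then obtain z where "int N * (int N - 1) = 2 * z" by blast
      hence "int k + exponent_sum N 0 a = 12 * (n - (int k + exponent_sum N 0 a) * z)"
        using eq by (simp add: algebra_simps)
      thus ?thesis by (rule dvdI)
    qed
    moreover have "2 * int N dvd exponent_sum N 2 a - int N * exponent_sum N 1 a"
      if dv: "12 dvd int k + exponent_sum N 0 a"
    proof -
      define \<tau> :: complex where "\<tau> = \<i>"
      have \<tau>: "Im \<tau> > 0" "Im (\<tau> + 1) > 0" by (simp_all add: \<tau>_def)
      obtain v where v: "int k + exponent_sum N 0 a = 12 * v" using dv by blast
      have "(1, 1, 0, 1) \<in> Gamma1 N" by (simp add: Gamma1_def SL2Z_def)
      from inv_f[OF this \<tau>(1)] have "?f (\<tau> + 1) = ?f \<tau>" by (simp add: slash_def)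
      hence "expi (of_nat N * of_int (int k + exponent_sum N 0 a) / 6 + of_int (exponent_sum N 1 a) +
          of_int (exponent_sum N 2 a) / of_nat N) = 1"
        unfolding C0(2)[OF \<tau>(1)] C0(2)[OF \<tau>(2)] theta_siegel_translate[OF N \<tau>(1)]
        using C0(1) theta_siegel_nonzero[OF id \<tau>(1)] by simp
      then obtain n :: int where "of_nat N * of_int (int k + exponent_sum N 0 a) / 6 + of_int (exponent_sum N 1 a) +
          of_int (exponent_sum N 2 a) / of_nat N = (2 * of_int n :: complex)"
        using expi_eq_1_iff by blast
      hence "of_int (2 * int N * int N * v + int N * exponent_sum N 1 a + exponent_sum N 2 a) = (of_int (2 * int N * n) :: complex)"
        unfolding v using N by (simp add: field_simps)
      hence "2 * int N * int N * v + int N * exponent_sum N 1 a + exponent_sum N 2 a = 2 * int N * n"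
        by (simp only: of_int_eq_iff)
      hence "exponent_sum N 2 a - int N * exponent_sum N 1 a = 2 * int N * (n - int N * v - exponent_sum N 1 a)"
        by (simp add: algebra_simps)
      thus ?thesis by (rule dvdI)
    qed
    ultimately show "weight_congruences N k a \<and> (\<forall>(p, q, r, s) \<in> SL2Z. cusp_order N k a (p, r) \<ge> 0)"
      by (simp add: weight_congruences_def)
  next
    assume A: "weight_congruences N k a \<and> (\<forall>(p, q, r, s) \<in> SL2Z. cusp_order N k a (p, r) \<ge> 0)"
    have "?f holomorphic_on upper_half_plane"
    proof (rule holomorphic_transform)
      show "(\<lambda>\<tau>. C0 * ?\<Phi> (1, 0, 0, 1) \<tau>) holomorphic_on upper_half_plane"
        by (intro holomorphic_intros theta_siegel_holomorphic id)
    qed (use C0(2) in \<open>auto simp: upper_half_plane_def\<close>)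
    moreover have "slash k ?f \<gamma> \<tau> = ?f \<tau>" if g: "\<gamma> \<in> Gamma1 N" and \<tau>: "Im \<tau> > 0" for \<gamma> \<tau>
    proof -
      have "\<gamma> \<in> SL2Z" using g by (auto simp: Gamma1_def)
      then obtain C where C: "C ^ 12 = 1" "slash k ?f \<gamma> \<tau> = C0 * C powi S * ?\<Phi> \<gamma> \<tau>"
        using slash \<tau> by blast
      obtain v where v: "int k + exponent_sum N 0 a = 12 * v"
        using A unfolding weight_congruences_def by blast
      have "C powi S = C powi (12 * (int N * v))" unfolding S v by (simp add: mult_ac)
      also have "\<dots> = (C ^ 12) powi (int N * v)" by (simp add: power_int_mult)
      also have "\<dots> = 1" unfolding C(1) by simp
      finally have "slash k ?f \<gamma> \<tau> = C0 * ?\<Phi> \<gamma> \<tau>" using C(2) by simp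
      also have "?\<Phi> \<gamma> \<tau> = ?\<Phi> (1, 0, 0, 1) \<tau>"
        using theta_siegel_Gamma1[OF N _ _ \<tau>] A g by (metis prod_cases4)
      finally show ?thesis using C0(2)[OF \<tau>] by simp
    qed
    ultimately show "?f \<in> modular_forms_Gamma1 k N"
      using A bdd unfolding modular_forms_Gamma1_def upper_half_plane_def by auto
  qed
qed

section \<open>Cusps and Galois orbits\<close>

text \<open>Take for t the product of the primes of n that do not divide a. A prime of n dividing a
  divides neither g nor t; any other prime of n divides t but not a. In both cases it does not
  divide a + g t.\<close>

lemma coprime_shift_exists:
  fixes a g n :: int
  assumes "coprime a g" "n \<noteq> 0"
  shows "\<exists>t. coprime (a + g * t) n"
proof
  define S where "S = {p \<in> prime_factors n. \<not> p dvd a}"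
  define t where "t = \<Prod>S"
  have fin: "finite S" by (simp add: S_def)
  show "coprime (a + g * t) n"
  proof (rule ccontr)
    assume "\<not> coprime (a + g * t) n"
    hence "\<not> is_unit (gcd (a + g * t) n)" by (simp add: coprime_iff_gcd_eq_1)
    then obtain p where p: "prime p" "p dvd gcd (a + g * t) n"
      using prime_divisor_exists[of "gcd (a + g * t) n"] assms(2) by auto
    hence pa: "p dvd a + g * t" and pn: "p dvd n" by auto
    hence pf: "p \<in> prime_factors n" using p(1) assms(2) by (simp add: prime_factors_dvd)
    show False
    proof (cases "p dvd a")
      case True
      hence "p dvd g * t" using pa by (simp add: dvd_add_right_iff)
      moreover have "\<not> p dvd g" using True assms(1) p(1) by (meson coprime_common_divisor not_prime_unit)
      ultimately have "p dvd t" using p(1) prime_dvd_mult_iff by blast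
      then obtain q where q: "q \<in> S" "p dvd q"
        unfolding t_def using prime_dvd_prod_iff[OF fin p(1)] by auto
      hence "prime q" by (auto simp: S_def)
      hence "p = q" using p(1) q(2) primes_dvd_imp_eq by blast
      thus False using q(1) True by (simp add: S_def)
    next
      case False
      hence "p dvd t" unfolding t_def using pf fin by (intro dvd_prodI) (simp_all add: S_def)
      thus False using pa False by (metis dvd_add_left_iff dvd_mult)
    qed
  qed
qed

text \<open>Equivalence of cusps in terms of congruences. In contrast to \<open>cusp\<close> the
  argument need not be a reduced fraction: it makes sense for a mere pair of residues with a prime
  to gcd(c, N).\<close>

definition cusp_class :: "nat \<Rightarrow> int \<times> int \<Rightarrow> (int \<times> int) set" where
  "cusp_class N = (\<lambda>(a, c). {(a', c'). coprime a' c' \<and>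
     (\<exists>e\<in>{1, -1}. [c' = e * c] (mod int N) \<and> [a' = e * a] (mod gcd c (int N)))})"

lemma cusp_class_iff:
  "(a', c') \<in> cusp_class N (a, c) \<longleftrightarrow> coprime a' c' \<and>
     (\<exists>e\<in>{1, -1}. [c' = e * c] (mod int N) \<and> [a' = e * a] (mod gcd c (int N)))"
  by (simp add: cusp_class_def)

lemma cusp_iff:
  "(a', c') \<in> cusp N (a, c) \<longleftrightarrow> (\<exists>p q r s e. (p, q, r, s) \<in> Gamma1 N \<and> e \<in> {1, -1} \<and>
     a' = e * (p * a + q * c) \<and> c' = e * (r * a + s * c))"
  unfolding cusp_def mem_Collect_eq prod.case Bex_def split_paired_Ex by blast

lemma gcd_cong_int: "[c = c'] (mod int N) \<Longrightarrow> gcd c (int N) = gcd c' (int N)"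
  by (rule cong_gcd_eq)

lemma gcd_mod_int: "gcd (c mod int N) (int N) = gcd c (int N)"
  by (rule gcd_cong_int) simp

lemma gcd_cong_uminus: "e \<in> {1, -1} \<Longrightarrow> [c' = e * c] (mod int N) \<Longrightarrow> gcd c' (int N) = gcd c (int N)"
  using cong_gcd_eq by fastforce

lemma cong_sign_flip: "e \<in> {1, -1 :: int} \<Longrightarrow> [x = e * y] (mod n) \<Longrightarrow> [e * x = y] (mod n)"
  by (auto simp: cong_minus_minus_iff[of x "- y" n, symmetric])

text \<open>Complete both columns to matrices of determinant 1. The second column of one completion
  is free up to adding t times the first, and the quotient of the two lies in \<Gamma>_1(N) once c t
  \<equiv> d - d' modulo N. This is solvable because d and d' both invert a modulo gcd(c,
  N).\<close>

lemma Gamma1_transitive: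
  assumes "coprime a c" "coprime a' c'" "[c' = c] (mod int N)" "[a' = a] (mod gcd c (int N))"
  obtains p q r s where "(p, q, r, s) \<in> Gamma1 N" "p * a + q * c = a'" "r * a + s * c = c'"
proof -
  define g where "g = gcd c (int N)"
  obtain d b where db: "d * a + b * c = 1" using bezout_int[of a c] assms(1) by (auto simp: coprime_iff_gcd_eq_1)
  obtain d' b' where db': "d' * a' + b' * c' = 1" using bezout_int[of a' c'] assms(2) by (auto simp: coprime_iff_gcd_eq_1)
  have gc: "g dvd c" "g dvd c'" using gcd_cong_int[OF assms(3)] unfolding g_def by (metis gcd_dvd1)+
  have "[d * a + b * c = d * a + 0] (mod g)" using gc by (intro cong_add cong_refl) (simp add: cong_0_iff)
  hence 1: "[d * a = 1] (mod g)" using db by (simp add: cong_sym_eq)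
  have "[d' * a' + b' * c' = d' * a + 0] (mod g)" using gc assms(4)
    by (intro cong_add cong_mult cong_refl) (simp_all add: cong_0_iff g_def)
  hence 2: "[d' * a = 1] (mod g)" using db' by (simp add: cong_sym_eq)
  have "coprime a g" using assms(1) gc(1) by (meson coprime_divisors dvd_refl)
  hence "[d = d'] (mod g)" using cong_trans[OF 1 cong_sym[OF 2]] by (simp add: cong_mult_rcancel coprime_commute)
  hence "gcd c (int N) dvd d - d'" by (simp add: cong_iff_dvd_diff g_def)
  then obtain t where t: "[c * t = d - d'] (mod int N)" using cong_solve_dvd_int by blast
  \<comment> \<open>The matrix with columns (a', c') and (t a' - b', d' + t c'), times the inverse
    of the one with columns (a, c) and (-b, d).\<close>
  define p q r s where "p = a' * d + (b' - t * a') * c" and "q = a' * b - (b' - t * a') * a"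
    and "r = c' * d - (d' + t * c') * c" and "s = c' * b + (d' + t * c') * a"
  have pa: "p * a + q * c = a'"
  proof -
    have "p * a + q * c = a' * (d * a + b * c)" by (simp add: p_def q_def algebra_simps)
    thus ?thesis using db by simp
  qed
  have rc: "r * a + s * c = c'"
  proof -
    have "r * a + s * c = c' * (d * a + b * c)" by (simp add: r_def s_def algebra_simps)
    thus ?thesis using db by simp
  qed
  have det: "p * s - q * r = 1"
  proof -
    have "p * s - q * r = (d' * a' + b' * c') * (d * a + b * c)"
      by (simp add: p_def q_def r_def s_def algebra_simps)
    thus ?thesis using db db' by simp
  qed
  have r0: "[r = 0] (mod int N)"
  proof -
    have "[c' * d - (d' + t * c') * c = c * d - (d' + t * c) * c] (mod int N)"
      by (intro cong_diff cong_mult cong_add cong_refl assms(3))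
    also have "c * d - (d' + t * c) * c = c * (d - d' - c * t)" by (simp add: algebra_simps)
    also have "[c * (d - d' - c * t) = c * (d - d' - (d - d'))] (mod int N)"
      by (intro cong_mult cong_diff cong_refl t)
    finally show ?thesis by (simp add: r_def)
  qed
  have s1: "[s = 1] (mod int N)"
  proof -
    have "[c' * b + (d' + t * c') * a = c * b + (d' + t * c) * a] (mod int N)"
      by (intro cong_mult cong_add cong_refl assms(3))
    also have "c * b + (d' + t * c) * a = c * b + (d' + c * t) * a" by (simp add: algebra_simps)
    also have "[c * b + (d' + c * t) * a = c * b + (d' + (d - d')) * a] (mod int N)"
      by (intro cong_mult cong_add cong_refl t)
    finally show ?thesis using db by (simp add: s_def algebra_simps)
  qed
  have p1: "[p = 1] (mod int N)"
  proof -
    have "[p * s - q * r = p * 1 - q * 0] (mod int N)" by (intro cong_diff cong_mult cong_refl r0 s1)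
    thus ?thesis using det by (simp add: cong_sym_eq)
  qed
  show ?thesis
    by (rule that[of p q r s]) (use pa rc det r0 s1 p1 in \<open>auto simp: Gamma1_def SL2Z_def\<close>)
qed

lemma cusp_eq_class:
  assumes "coprime a c"
  shows "cusp N (a, c) = cusp_class N (a, c)"
proof (intro equalityI subsetI)
  fix x assume "x \<in> cusp N (a, c)"
  then obtain p q r s e where x: "(p, q, r, s) \<in> Gamma1 N" "e \<in> {1, -1 :: int}"
    "x = (e * (p * a + q * c), e * (r * a + s * c))"
    using cusp_iff[of "fst x" "snd x" N a c] by (metis prod.collapse)
  have det: "p * s - q * r = 1" and cong: "[p = 1] (mod int N)" "[s = 1] (mod int N)" "[r = 0] (mod int N)"
    using x(1) by (auto simp: Gamma1_def SL2Z_def)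
  define g where "g = gcd c (int N)"
  have "[r * a + s * c = 0 * a + 1 * c] (mod int N)" by (intro cong_add cong_mult cong_refl cong)
  hence 1: "[e * (r * a + s * c) = e * c] (mod int N)" by (intro cong_mult cong_refl) simp
  have "[p * a + q * c = 1 * a + q * 0] (mod g)"
    using cong_dvd_modulus[OF cong(1), of g] by (intro cong_add cong_mult cong_refl) (auto simp: g_def cong_0_iff)
  hence 2: "[e * (p * a + q * c) = e * a] (mod g)" by (intro cong_mult cong_refl) simp
  have "coprime (p * a + q * c) (r * a + s * c)"
  proof (rule coprimeI)
    fix z assume z: "z dvd p * a + q * c" "z dvd r * a + s * c"
    have "z dvd s * (p * a + q * c) - q * (r * a + s * c)" using z by (intro dvd_diff dvd_mult)
    also have "s * (p * a + q * c) - q * (r * a + s * c) = (p * s - q * r) * a" by (simp add: algebra_simps)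
    finally have za: "z dvd a" using det by simp
    have "z dvd p * (r * a + s * c) - r * (p * a + q * c)" using z by (intro dvd_diff dvd_mult)
    also have "p * (r * a + s * c) - r * (p * a + q * c) = (p * s - q * r) * c" by (simp add: algebra_simps)
    finally have "z dvd c" using det by simp
    with za show "is_unit z" using assms coprime_common_divisor by blast
  qed
  hence "coprime (e * (p * a + q * c)) (e * (r * a + s * c))" using x(2) by auto
  thus "x \<in> cusp_class N (a, c)" using 1 2 x(2,3) unfolding cusp_class_def g_def by auto
next
  fix x assume "x \<in> cusp_class N (a, c)"
  then obtain a' c' e where x: "x = (a', c')" "coprime a' c'" "e \<in> {1, -1 :: int}"
    "[c' = e * c] (mod int N)" "[a' = e * a] (mod gcd c (int N))"
    using cusp_class_iff[of "fst x" "snd x"] by (metis prod.collapse)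
  have "coprime (e * a') (e * c')" using x(2,3) by auto
  from Gamma1_transitive[OF assms this cong_sign_flip[OF x(3,4)] cong_sign_flip[OF x(3,5)]]
  obtain p q r s where pq: "(p, q, r, s) \<in> Gamma1 N" "p * a + q * c = e * a'" "r * a + s * c = e * c'" by blast
  have "a' = e * (p * a + q * c)" "c' = e * (r * a + s * c)" using x(3) pq(2,3) by auto
  thus "x \<in> cusp N (a, c)" using pq(1) x(1,3) unfolding cusp_def by blast
qed

lemma cusp_class_cong:
  assumes "e \<in> {1, -1}" "[c' = e * c] (mod int N)" "[a' = e * a] (mod gcd c (int N))"
  shows "cusp_class N (a', c') = cusp_class N (a, c)"
proof -
  have sub: "cusp_class N (a', c') \<subseteq> cusp_class N (a, c)"
    if e: "e \<in> {1, -1}" and c: "[c' = e * c] (mod int N)" and a: "[a' = e * a] (mod gcd c (int N))" for e a c a' c' :: int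
  proof
    fix x assume "x \<in> cusp_class N (a', c')"
    then obtain a'' c'' e' where x: "x = (a'', c'')" "coprime a'' c''" "e' \<in> {1, -1 :: int}"
      "[c'' = e' * c'] (mod int N)" "[a'' = e' * a'] (mod gcd c' (int N))"
      using cusp_class_iff[of "fst x" "snd x"] by (metis prod.collapse)
    have 1: "[c'' = (e' * e) * c] (mod int N)"
      using cong_trans[OF x(4) cong_mult[OF cong_refl c, of e']] by (simp add: mult.assoc)
    have 2: "[a'' = (e' * e) * a] (mod gcd c (int N))"
      using cong_trans[OF x(5)[unfolded gcd_cong_uminus[OF e c]] cong_mult[OF cong_refl a, of e']] by (simp add: mult.assoc)
    have "e' * e \<in> {1, -1}" using e x(3) by auto
    thus "x \<in> cusp_class N (a, c)" using 1 2 x(1,2) unfolding cusp_class_def by blast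
  qed
  show ?thesis
  proof
    show "cusp_class N (a', c') \<subseteq> cusp_class N (a, c)" by (rule sub[OF assms])
    show "cusp_class N (a, c) \<subseteq> cusp_class N (a', c')"
    proof (rule sub[OF assms(1)])
      show "[c = e * c'] (mod int N)" using cong_sign_flip[OF assms(1,2)] by (rule cong_sym)
      show "[a = e * a'] (mod gcd c' (int N))"
        using cong_sign_flip[OF assms(1,3)] unfolding gcd_cong_uminus[OF assms(1,2)] by (rule cong_sym)
    qed
  qed
qed

section \<open>Finitely many residue labels for the cusps\<close>

definition cusp_residues :: "nat \<Rightarrow> (int \<times> int) set" where
  "cusp_residues N = {(a, c). c \<in> {0..<int N} \<and> a \<in> {0..<gcd c (int N)} \<and> coprime a (gcd c (int N))}"

definition cusp_residue :: "nat \<Rightarrow> int \<times> int \<Rightarrow> int \<times> int" where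
  "cusp_residue N = (\<lambda>(a, c). (a mod gcd c (int N), c mod int N))"

lemma finite_cusp_residues: "finite (cusp_residues N)"
proof (rule finite_subset)
  show "cusp_residues N \<subseteq> {0..int N} \<times> {0..<int N}"
  proof
    fix x assume "x \<in> cusp_residues N"
    then obtain a c where x: "x = (a, c)" "c \<in> {0..<int N}" "a \<in> {0..<gcd c (int N)}"
      unfolding cusp_residues_def by auto
    have "gcd c (int N) \<le> int N" using x(2) by (intro zdvd_imp_le) auto
    hence "a \<le> int N" using x(3) unfolding atLeastLessThan_iff by linarith
    thus "x \<in> {0..int N} \<times> {0..<int N}" using x by auto
  qed
qed simp

lemma cusp_residue_in_residues:
  assumes "N > 0" "coprime a (gcd c (int N))"
  shows "cusp_residue N (a, c) \<in> cusp_residues N"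
proof -
  note g = gcd_mod_int[of c N]
  have "gcd c (int N) > 0" using assms(1) by simp
  thus ?thesis using assms unfolding cusp_residues_def cusp_residue_def by (simp add: g)
qed

lemma cusp_class_residue: "cusp_class N (cusp_residue N (a, c)) = cusp_class N (a, c)"
  unfolding cusp_residue_def prod.case
  by (rule cusp_class_cong[of 1]) simp_all

lemma residue_lift:
  assumes "N > 0" "coprime a (gcd c (int N))"
  obtains a' c' where "coprime a' c'" "[c' = c] (mod int N)" "[a' = a] (mod gcd c (int N))" "c' \<noteq> 0"
proof -
  \<comment> \<open>The residue 0 is represented by N, because the shift to a coprime numerator
    needs a nonzero denominator.\<close>
  define c' where "c' = (if c = 0 then int N else c)"
  have c': "c' \<noteq> 0" "[c' = c] (mod int N)" using assms(1) by (auto simp: c'_def cong_0_iff)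
  obtain t where "coprime (a + gcd c (int N) * t) c'" using coprime_shift_exists[OF assms(2) c'(1)] by blast
  thus ?thesis using that[OF _ c'(2) _ c'(1), of "a + gcd c (int N) * t"] by (simp add: cong_iff_dvd_diff)
qed

lemma cusps_eq: 
  assumes "N > 0"
  shows "cusps N = cusp_class N ` cusp_residues N"
proof (intro equalityI subsetI)
  fix C assume "C \<in> cusps N"
  then obtain a c where ac: "coprime a c" "C = cusp N (a, c)" unfolding cusps_def by blast
  have "coprime a (gcd c (int N))" using ac(1) by (meson coprime_divisors dvd_refl gcd_dvd1)
  from cusp_residue_in_residues[OF assms this] show "C \<in> cusp_class N ` cusp_residues N"
    using ac cusp_eq_class cusp_class_residue by (metis imageI)
next
  fix C assume "C \<in> cusp_class N ` cusp_residues N"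
  then obtain a c where ac: "coprime a (gcd c (int N))" "C = cusp_class N (a, c)"
    unfolding cusp_residues_def by auto
  from residue_lift[OF assms ac(1)] obtain a' c' where l: "coprime a' c'" "[c' = c] (mod int N)" "[a' = a] (mod gcd c (int N))" by metis
  have "C = cusp_class N (a', c')" unfolding ac(2) by (rule cusp_class_cong[of 1, symmetric]) (use l in auto)
  thus "C \<in> cusps N" using l(1) cusp_eq_class unfolding cusps_def by blast
qed

lemma cusp_class_eq_imp:
  assumes "N > 0" "coprime a (gcd c (int N))" "cusp_class N (a, c) = cusp_class N (a', c')"
  obtains e where "e \<in> {1, -1}" "[c = e * c'] (mod int N)" "[a = e * a'] (mod gcd c' (int N))" "gcd c (int N) = gcd c' (int N)"
proof -
  from residue_lift[OF assms(1,2)] obtain a1 c1 where l: "coprime a1 c1" "[c1 = c] (mod int N)" "[a1 = a] (mod gcd c (int N))" by metis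
  have "(a1, c1) \<in> cusp_class N (a, c)" using l unfolding cusp_class_def by (auto intro!: bexI[of _ 1])
  hence "(a1, c1) \<in> cusp_class N (a', c')" using assms(3) by simp
  then obtain e where e: "e \<in> {1, -1}" "[c1 = e * c'] (mod int N)" "[a1 = e * a'] (mod gcd c' (int N))"
    unfolding cusp_class_iff by blast
  have g: "gcd c (int N) = gcd c' (int N)"
    using gcd_cong_int[OF l(2)] gcd_cong_uminus[OF e(1,2)] by simp
  show ?thesis
    by (rule that[OF e(1) cong_trans[OF cong_sym[OF l(2)] e(2)] cong_trans[OF cong_sym[OF l(3)[unfolded g]] e(3)] g])
qed

text \<open>The labels of (a, c) and (-a, -c) give the same cusp. They coincide only if g divides 2
  and N divides 2g, which would force N \<le> 4.\<close>

lemma cusp_class_fiber_card: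
  assumes "N \<ge> 5" "x \<in> cusp_residues N"
  shows "card {y \<in> cusp_residues N. cusp_class N y = cusp_class N x} = 2"
proof -
  obtain a c where x: "x = (a, c)" by (cases x)
  define g where "g = gcd c (int N)"
  have c: "c \<in> {0..<int N}" and a: "a \<in> {0..<g}" "coprime a g"
    using assms(2) by (auto simp: x cusp_residues_def g_def)
  define y where "y = cusp_residue N (- a, - c)"
  have yI: "y \<in> cusp_residues N"
    unfolding y_def using assms(1) a(2) by (intro cusp_residue_in_residues) (simp_all add: g_def)
  have yc: "cusp_class N y = cusp_class N x"
    unfolding y_def cusp_class_residue x by (rule cusp_class_cong[of "- 1"]) simp_all
  have "y \<noteq> x"
  proof
    assume "y = x"
    hence *: "(- a) mod g = a" "(- c) mod int N = c" by (auto simp: y_def x cusp_residue_def g_def)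
    hence "[- a = a] (mod g)" "[- c = c] (mod int N)" using a c by (simp_all add: cong_def)
    hence d: "g dvd 2 * a" "int N dvd 2 * c" by (simp_all add: cong_iff_dvd_diff)
    hence "g dvd 2" using a(2) by (simp add: coprime_dvd_mult_left_iff coprime_commute)
    hence "g \<le> 2" by (rule zdvd_imp_le) simp
    have "int N dvd gcd (2 * c) (2 * int N)" using d(2) by simp
    hence "int N dvd 2 * g" by (simp add: g_def gcd_mult_distrib_int[symmetric] abs_mult)
    moreover have "g > 0" using assms(1) by (simp add: g_def)
    ultimately have "int N \<le> 2 * g" by (intro zdvd_imp_le) auto
    thus False using \<open>g \<le> 2\<close> assms(1) by simp
  qed
  moreover have "{z \<in> cusp_residues N. cusp_class N z = cusp_class N x} = {x, y}"
  proof (intro equalityI subsetI)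
    fix z assume z: "z \<in> {z \<in> cusp_residues N. cusp_class N z = cusp_class N x}"
    obtain a' c' where zz: "z = (a', c')" by (cases z)
    have z': "c' \<in> {0..<int N}" "a' \<in> {0..<gcd c' (int N)}" "coprime a' (gcd c' (int N))"
      using z by (auto simp: zz cusp_residues_def)
    have "cusp_class N (a', c') = cusp_class N (a, c)" using z by (simp add: zz x)
    from cusp_class_eq_imp[OF _ z'(3) this] assms(1)
    obtain e where e: "e \<in> {1, -1}" "[c' = e * c] (mod int N)" "[a' = e * a] (mod g)" "gcd c' (int N) = g"
      unfolding g_def by auto
    have "c' = (e * c) mod int N" using e(2) z'(1) by (simp add: cong_def)
    moreover have "a' = (e * a) mod g" using e(3,4) z'(2) by (simp add: cong_def)
    ultimately show "z \<in> {x, y}"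
      using e(1) a(1) c by (auto simp: zz x y_def cusp_residue_def g_def)
  qed (use assms(2) yI yc in auto)
  ultimately show ?thesis by simp
qed

section \<open>Galois orbits in explicit form\<close>

definition orbit_set :: "nat \<Rightarrow> int \<Rightarrow> int \<Rightarrow> (int \<times> int) set set" where
  "orbit_set N a g = cusp_class N ` {(a', c') \<in> cusp_residues N. gcd c' (int N) = g \<and> (\<exists>e\<in>{1, -1}. [a' = e * a] (mod g))}"

lemma orbit_set_iff:
  "C \<in> orbit_set N a g \<longleftrightarrow> (\<exists>a1 c1 e. (a1, c1) \<in> cusp_residues N \<and> C = cusp_class N (a1, c1) \<and>
     gcd c1 (int N) = g \<and> e \<in> {1, -1} \<and> [a1 = e * a] (mod g))"
  unfolding orbit_set_def image_iff Bex_def mem_Collect_eq split_paired_Ex prod.case by blast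

lemma gcd_mult_unit:
  fixes g u :: int
  assumes "g > 0" "int N = g * n" "coprime u n"
  shows "gcd (g * u) (int N) = g"
  using assms by (simp add: gcd_mult_distrib_int[symmetric] coprime_iff_gcd_eq_1)

text \<open>Multiplying the denominator by a unit keeps its gcd with N and the numerator modulo g.
  Conversely two denominators g u and g u' differ by the unit u'/u modulo N/g; it lifts to a unit
  modulo N, and then a numerator prime to both denominators has to be found, as the definition of
  the action requires.\<close>

theorem galois_orbit_eq:
  assumes N: "N > 0" and cop: "coprime a (gcd c (int N))"
  shows "galois_orbit N (cusp_class N (a, c)) = orbit_set N a (gcd c (int N))"
proof (intro equalityI subsetI)
  fix C' assume "C' \<in> galois_orbit N (cusp_class N (a, c))"
  then obtain x x' A g u where *: "coprime x (int N)" "[x' = x] (mod int N)" "g > 0" "g dvd int N"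
    "coprime u (int N div g)" "coprime A (g * u)" "coprime A (x' * g * u)"
    "cusp_class N (a, c) = cusp N (A, g * u)" "C' = cusp N (A, x' * g * u)"
    unfolding galois_orbit_def galois_related_def by auto
  obtain n where n: "int N = g * n" using *(4) by blast
  have un: "coprime u n" using *(3,5) n by simp
  have "coprime x' (int N)" using *(1,2) cong_imp_coprime cong_sym by blast
  hence "coprime x' n" using n by (metis coprime_mult_right_iff)
  hence xun: "coprime (x' * u) n" using un by simp
  have g1: "gcd (g * u) (int N) = g" by (rule gcd_mult_unit[OF *(3) n un])
  have g2: "gcd (x' * g * u) (int N) = g" using gcd_mult_unit[OF *(3) n xun] by (simp add: mult_ac)
  have "cusp_class N (a, c) = cusp_class N (A, g * u)" using *(6,8) cusp_eq_class by simp
  from cusp_class_eq_imp[OF N cop this] obtain e where e: "e \<in> {1, -1}" "[a = e * A] (mod g)" "gcd c (int N) = g"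
    unfolding g1 by metis
  have Ag: "coprime A g" using *(6) by simp
  define y where "y = cusp_residue N (A, x' * g * u)"
  have yI: "y \<in> cusp_residues N" unfolding y_def by (rule cusp_residue_in_residues[OF N]) (simp add: g2 Ag)
  have yv: "y = (A mod g, (x' * g * u) mod int N)" by (simp add: y_def cusp_residue_def g2)
  have "gcd ((x' * g * u) mod int N) (int N) = g" using g2 by (simp only: gcd_mod_int)
  moreover have "[A mod g = e * a] (mod g)" using cong_sign_flip[OF e(1,2)] by (simp add: cong_sym_eq)
  ultimately have "cusp_class N y \<in> orbit_set N a g"
    unfolding orbit_set_def using yI e(1) by (intro imageI) (auto simp: yv)
  moreover have "C' = cusp_class N y" unfolding y_def cusp_class_residue using *(7,9) cusp_eq_class by simp
  ultimately show "C' \<in> orbit_set N a (gcd c (int N))" using e(3) by simp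
next
  define g where "g = gcd c (int N)"
  fix C' assume "C' \<in> orbit_set N a (gcd c (int N))"
  then obtain a1 c1 e where C': "(a1, c1) \<in> cusp_residues N" "C' = cusp_class N (a1, c1)" "gcd c1 (int N) = g"
    "e \<in> {1, -1 :: int}" "[a1 = e * a] (mod g)" unfolding orbit_set_iff g_def by blast
  define a' c' where "a' = e * a1" and "c' = e * c1"
  have aa: "[a' = a] (mod g)" unfolding a'_def by (rule cong_sign_flip[OF C'(4,5)])
  have gc': "gcd c' (int N) = g" using C'(3,4) by (auto simp: c'_def)
  have C'': "C' = cusp_class N (a', c')" unfolding C'(2)
    by (rule cusp_class_cong[OF C'(4), symmetric]) (simp_all add: a'_def c'_def)
  have g0: "g > 0" using N by (simp add: g_def)
  have "g dvd int N" by (simp add: g_def)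
  then obtain n where n: "int N = g * n" by (rule dvdE)
  \<comment> \<open>Again N replaces the residue 0, so that the denominators to which the numerator
    is made coprime are nonzero.\<close>
  define c2 where "c2 = (if c = 0 then int N else c)"
  have c2: "c2 \<noteq> 0" "[c2 = c] (mod int N)" using N by (auto simp: c2_def cong_0_iff)
  have gc2: "gcd c2 (int N) = g" unfolding g_def by (rule gcd_cong_int[OF c2(2)])
  have unit: "\<exists>u. z = g * u \<and> coprime u n" if "gcd z (int N) = g" for z
  proof -
    have "g dvd z" using gcd_dvd1[of z "int N"] unfolding that .
    then obtain u where u: "z = g * u" by (rule dvdE)
    have "g * gcd u n = g" using that g0 by (simp add: u n gcd_mult_distrib_int[symmetric] abs_mult)
    thus ?thesis using u g0 by (auto simp: coprime_iff_gcd_eq_1)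
  qed
  obtain u where u: "c2 = g * u" "coprime u n" using unit[OF gc2] by blast
  obtain u' where u': "c' = g * u'" "coprime u' n" using unit[OF gc'] by blast
  obtain w where w: "[u * w = 1] (mod n)" using cong_solve_coprime_int[OF u(2)] by blast
  have "coprime (u * w) n" using cong_imp_coprime[OF cong_sym[OF w]] by simp
  hence "coprime w n" by simp
  hence "coprime (u' * w) n" using u'(2) by simp
  \<comment> \<open>A unit modulo n = N/g becomes a unit modulo N after adding a suitable multiple
    of n.\<close>
  then obtain t where t: "coprime (u' * w + n * t) (int N)" using coprime_shift_exists[of "u' * w" n "int N"] N by auto
  define x where "x = u' * w + n * t"
  have "[x * u = u' * (u * w)] (mod n)" unfolding x_def by (simp add: cong_iff_dvd_diff algebra_simps)
  also have "[u' * (u * w) = u' * 1] (mod n)" by (intro cong_mult cong_refl w)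
  finally have xu: "[x * u = u'] (mod n)" by simp
  show "C' \<in> galois_orbit N (cusp_class N (a, c))"
  \<comment> \<open>The representative 0 is a unit only for N = 1; it is treated apart because it
    would make the new denominator vanish.\<close>
  proof (cases "x = 0")
    case True
    hence "N = 1" using t by (simp add: x_def)
    hence "\<And>a c. cusp_class N (a, c) = cusp_class N (1, 1)"
      by (intro cusp_class_cong[of 1]) simp_all
    hence eq: "C' = cusp N (1, 1)" "cusp_class N (a, c) = cusp N (1, 1)"
      using C'' cusp_eq_class[of 1 1 N] by simp_all
    have "galois_related N 1 (cusp N (1, 1)) (cusp N (1, 1))"
      unfolding galois_related_def using \<open>N = 1\<close>
      by (intro exI[of _ 1] exI[of _ "1::int"]) simp
    thus ?thesis unfolding eq galois_orbit_def by (auto intro!: exI[of _ 1])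
  next
    case False
    have "coprime a g" using cop by (simp add: g_def)
    moreover have "x * g * u \<noteq> 0" using False g0 c2(1) u(1) by auto
    ultimately obtain v where "coprime (a + g * v) (x * g * u)" using coprime_shift_exists by blast
    moreover have "[a + g * v = a] (mod g)" by (simp add: cong_iff_dvd_diff)
    ultimately obtain A where A: "coprime A (x * g * u)" "[A = a] (mod g)" by blast
    have A': "coprime A (g * u)" using A(1) by simp
    have "cusp_class N (a, c) = cusp N (A, g * u)"
      unfolding cusp_eq_class[OF A'] unfolding u(1)[symmetric]
      by (rule cusp_class_cong[of 1, symmetric]) (use c2(2) A(2) in \<open>simp_all add: g_def\<close>)
    moreover have "C' = cusp N (A, x * g * u)"
      unfolding cusp_eq_class[OF A(1)] C''
    proof (rule cusp_class_cong[of 1, symmetric])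
      have "[g * (x * u) = g * u'] (mod g * n)" using xu by (simp add: cong_iff_dvd_diff flip: right_diff_distrib)
      thus "[x * g * u = 1 * c'] (mod int N)" by (simp add: n u'(1) mult_ac)
      show "[A = 1 * a'] (mod gcd c' (int N))" unfolding gc' using cong_trans[OF A(2) cong_sym[OF aa]] by simp
    qed simp
    ultimately have "galois_related N x (cusp_class N (a, c)) C'"
      unfolding galois_related_def using A A' g0 u(2) n
      by (intro exI[of _ x] exI[of _ A] exI[of _ g] exI[of _ u]) simp
    moreover have "coprime x (int N)" using t by (simp add: x_def)
    ultimately show ?thesis unfolding galois_orbit_def by blast
  qed
qed

lemma orbit_set_self:
  assumes "(a, c) \<in> cusp_residues N"
  shows "cusp_class N (a, c) \<in> orbit_set N a (gcd c (int N))"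
proof -
  have "[a = 1 * a] (mod gcd c (int N))" by simp
  thus ?thesis unfolding orbit_set_iff using assms by blast
qed

lemma cusp_residues_coprime: "(a, c) \<in> cusp_residues N \<Longrightarrow> coprime a (gcd c (int N))"
  by (simp add: cusp_residues_def)

lemma orbit_set_mem:
  assumes "N > 0" "(a', c') \<in> cusp_residues N" "cusp_class N (a', c') \<in> orbit_set N a g"
  obtains e where "e \<in> {1, -1}" "gcd c' (int N) = g" "[a' = e * a] (mod g)"
proof -
  obtain a1 c1 e where 1: "(a1, c1) \<in> cusp_residues N" "cusp_class N (a', c') = cusp_class N (a1, c1)"
    "gcd c1 (int N) = g" "e \<in> {1, -1}" "[a1 = e * a] (mod g)"
    using assms(3) unfolding orbit_set_iff by blast
  from cusp_class_eq_imp[OF assms(1) cusp_residues_coprime[OF assms(2)] 1(2)]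
  obtain e' where e': "e' \<in> {1, -1}" "[a' = e' * a1] (mod g)" "gcd c' (int N) = g" unfolding 1(3) by metis
  have "[a' = e' * e * a] (mod g)"
    using cong_trans[OF e'(2) cong_mult[OF cong_refl 1(5), of e']] by (simp add: mult.assoc)
  moreover have "e' * e \<in> {1, -1}" using e'(1) 1(4) by auto
  ultimately show ?thesis using that e'(3) by blast
qed

lemma orbit_set_cong:
  assumes "e \<in> {1, -1}" "[a' = e * a] (mod g)"
  shows "orbit_set N a' g = orbit_set N a g"
proof -
  have sub: "orbit_set N a' g \<subseteq> orbit_set N a g" if e: "e \<in> {1, -1}" "[a' = e * a] (mod g)" for a a' e
  proof
    fix C assume "C \<in> orbit_set N a' g"
    then obtain a1 c1 e1 where 1: "(a1, c1) \<in> cusp_residues N" "C = cusp_class N (a1, c1)"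
      "gcd c1 (int N) = g" "e1 \<in> {1, -1}" "[a1 = e1 * a'] (mod g)" unfolding orbit_set_iff by blast
    have "[a1 = e1 * e * a] (mod g)"
      using cong_trans[OF 1(5) cong_mult[OF cong_refl e(2), of e1]] by (simp add: mult.assoc)
    moreover have "e1 * e \<in> {1, -1}" using e(1) 1(4) by auto
    ultimately show "C \<in> orbit_set N a g" unfolding orbit_set_iff using 1(1-3) by blast
  qed
  show ?thesis
    using sub[OF assms] sub[OF assms(1) cong_sym[OF cong_sign_flip[OF assms]]] by blast
qed

lemma finite_orbit_set: "finite (orbit_set N a g)"
  unfolding orbit_set_def
  by (rule finite_imageI, rule finite_subset[OF _ finite_cusp_residues[of N]]) auto

lemma card_orbit_preimage:
  assumes "N \<ge> 5"
  shows "card {y \<in> cusp_residues N. cusp_class N y \<in> orbit_set N a g} = 2 * card (orbit_set N a g)"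
proof -
  let ?S = "{y \<in> cusp_residues N. cusp_class N y \<in> orbit_set N a g}"
  have fin: "finite ?S" using finite_cusp_residues by simp
  have "card ?S = (\<Sum>y\<in>?S. 1)" by simp
  also have "\<dots> = (\<Sum>C\<in>orbit_set N a g. \<Sum>y\<in>{y \<in> ?S. cusp_class N y = C}. 1)"
    by (rule sum.group[symmetric]) (use fin finite_orbit_set in auto)
  also have "\<dots> = (\<Sum>C\<in>orbit_set N a g. 2)"
  proof (rule sum.cong[OF refl])
    fix C assume C: "C \<in> orbit_set N a g"
    then obtain x where x: "x \<in> cusp_residues N" "C = cusp_class N x" unfolding orbit_set_iff by blast
    have "{y \<in> ?S. cusp_class N y = C} = {y \<in> cusp_residues N. cusp_class N y = cusp_class N x}"
      using C x by auto
    thus "(\<Sum>y\<in>{y \<in> ?S. cusp_class N y = C}. 1) = (2 :: nat)"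
      using cusp_class_fiber_card[OF assms x(1)] by simp
  qed
  finally show ?thesis by simp
qed

lemma galois_orbit_representative:
  assumes "N \<ge> 5" "cusp_orbit_representatives N c" "i \<le> N div 2"
  shows "galois_orbit N (cusp N (c i)) = orbit_set N (fst (c i)) (cusp_gcd N (c i))"
proof -
  obtain a b where ab: "c i = (a, b)" by (cases "c i")
  have cop: "coprime a b" using assms(2,3) ab unfolding cusp_orbit_representatives_def by (metis fst_conv snd_conv)
  hence "coprime a (gcd b (int N))" by (meson coprime_divisors dvd_refl gcd_dvd1)
  from galois_orbit_eq[OF _ this] assms(1) show ?thesis
    by (simp add: ab cusp_eq_class[OF cop] cusp_gcd_def)
qed

lemma orbit_attained:
  assumes "N \<ge> 5" "cusp_orbit_representatives N c" "(a, b) \<in> cusp_residues N"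
  shows "\<exists>i\<le>N div 2. cusp_class N (a, b) \<in> orbit_set N (fst (c i)) (cusp_gcd N (c i))"
proof -
  have "cusp_class N (a, b) \<in> cusps N" using assms cusps_eq[of N] by auto
  hence "galois_orbit N (cusp_class N (a, b)) \<in> galois_orbit N ` cusps N" by blast
  also have "\<dots> = (\<lambda>i. galois_orbit N (cusp N (c i))) ` {0..N div 2}"
    using assms(2) unfolding cusp_orbit_representatives_def bij_betw_def by auto
  finally obtain i where i: "i \<le> N div 2" "galois_orbit N (cusp_class N (a, b)) = galois_orbit N (cusp N (c i))"
    by auto
  have "orbit_set N a (gcd b (int N)) = orbit_set N (fst (c i)) (cusp_gcd N (c i))"
    using i(2) galois_orbit_representative[OF assms(1,2) i(1)] galois_orbit_eq[OF _ cusp_residues_coprime[OF assms(3)]] assms(1)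
    by simp
  thus ?thesis using orbit_set_self[OF assms(3)] i(1) by auto
qed

text \<open>A sum over the chosen representatives, weighted by orbit sizes, is a sum over residue
  labels in which the choice no longer appears. The factor 2 counts the two labels of each
  cusp.\<close>

theorem sum_over_orbits:
  fixes F :: "int \<Rightarrow> int \<Rightarrow> 'a::field_char_0"
  assumes N: "N \<ge> 5" and c: "cusp_orbit_representatives N c"
    and F: "\<And>g a a' e. e \<in> {1, -1} \<Longrightarrow> g > 0 \<Longrightarrow> [a' = e * a] (mod g) \<Longrightarrow> F g a' = F g a"
  shows "2 * (\<Sum>i\<le>N div 2. of_nat (orbit_size N c i) * F (cusp_gcd N (c i)) (fst (c i))) =
    (\<Sum>(a, b)\<in>cusp_residues N. F (gcd b (int N)) a)"
proof -
  let ?O = "\<lambda>i. orbit_set N (fst (c i)) (cusp_gcd N (c i))"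
  define P where "P i = {y \<in> cusp_residues N. cusp_class N y \<in> ?O i}" for i
  have cover: "cusp_residues N = \<Union> (P ` {..N div 2})"
    using orbit_attained[OF N c] unfolding P_def by fastforce
  have disj: "P i \<inter> P j = {}" if "i \<le> N div 2" "j \<le> N div 2" "i \<noteq> j" for i j
  proof (rule ccontr)
    assume "P i \<inter> P j \<noteq> {}"
    then obtain a b where ab: "(a, b) \<in> cusp_residues N" "cusp_class N (a, b) \<in> ?O i" "cusp_class N (a, b) \<in> ?O j"
      unfolding P_def by auto
    have eq: "orbit_set N a (gcd b (int N)) = ?O k" if k: "cusp_class N (a, b) \<in> ?O k" for k
    proof -
      obtain e where "e \<in> {1, -1}" "gcd b (int N) = cusp_gcd N (c k)" "[a = e * fst (c k)] (mod cusp_gcd N (c k))"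
        using orbit_set_mem[OF _ ab(1) k] N by auto
      thus ?thesis using orbit_set_cong by metis
    qed
    hence "?O i = ?O j" using ab by metis
    hence "galois_orbit N (cusp N (c i)) = galois_orbit N (cusp N (c j))"
      using galois_orbit_representative[OF N c] that by simp
    moreover have "inj_on (\<lambda>i. galois_orbit N (cusp N (c i))) {0..N div 2}"
      using c unfolding cusp_orbit_representatives_def bij_betw_def by blast
    ultimately show False using that by (auto dest: inj_onD)
  qed
  have "(\<Sum>(a, b)\<in>cusp_residues N. F (gcd b (int N)) a) = (\<Sum>i\<le>N div 2. \<Sum>(a, b)\<in>P i. F (gcd b (int N)) a)"
    unfolding cover by (rule sum.UNION_disjoint) (use disj finite_cusp_residues in \<open>auto simp: P_def\<close>)
  also have "\<dots> = (\<Sum>i\<le>N div 2. 2 * (of_nat (orbit_size N c i) * F (cusp_gcd N (c i)) (fst (c i))))"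
  proof (rule sum.cong[OF refl])
    fix i assume i: "i \<in> {..N div 2}"
    have "(case y of (a, b) \<Rightarrow> F (gcd b (int N)) a) = F (cusp_gcd N (c i)) (fst (c i))" if y: "y \<in> P i" for y
    proof -
      obtain a b where ab: "y = (a, b)" by (cases y)
      have y': "(a, b) \<in> cusp_residues N" "cusp_class N (a, b) \<in> ?O i" using y by (auto simp: ab P_def)
      obtain e where e: "e \<in> {1, -1}" "gcd b (int N) = cusp_gcd N (c i)" "[a = e * fst (c i)] (mod cusp_gcd N (c i))"
        using orbit_set_mem[OF _ y'] N by auto
      have "cusp_gcd N (c i) > 0" unfolding e(2)[symmetric] using N by simp
      from F[OF e(1) this e(3)] show ?thesis by (simp add: ab e(2))
    qed
    hence "(\<Sum>(a, b)\<in>P i. F (gcd b (int N)) a) = of_nat (card (P i)) * F (cusp_gcd N (c i)) (fst (c i))"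
      by simp
    also have "card (P i) = 2 * orbit_size N c i"
      unfolding P_def card_orbit_preimage[OF N] orbit_size_def using galois_orbit_representative[OF N c] i by simp
    finally show "(\<Sum>(a, b)\<in>P i. F (gcd b (int N)) a) = 2 * (of_nat (orbit_size N c i) * F (cusp_gcd N (c i)) (fst (c i)))"
      by simp
  qed
  finally show ?thesis by (simp add: sum_distrib_left)
qed

lemma orbit_size_pos:
  assumes "N \<ge> 5" "cusp_orbit_representatives N c" "i \<le> N div 2"
  shows "orbit_size N c i > 0"
proof -
  obtain a b where ab: "c i = (a, b)" by (cases "c i")
  have "coprime a b" using assms(2,3) ab unfolding cusp_orbit_representatives_def by (metis fst_conv snd_conv)
  hence "coprime a (gcd b (int N))" by (meson coprime_divisors dvd_refl gcd_dvd1)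
  from cusp_residue_in_residues[OF _ this] assms(1) have r: "cusp_residue N (a, b) \<in> cusp_residues N" by simp
  have "[a mod gcd b (int N) = 1 * a] (mod gcd b (int N))" by simp
  hence "cusp_class N (cusp_residue N (a, b)) \<in> orbit_set N a (gcd b (int N))"
    using r unfolding orbit_set_iff cusp_residue_def prod.case using gcd_mod_int by blast
  hence "orbit_set N a (gcd b (int N)) \<noteq> {}" by blast
  thus ?thesis unfolding orbit_size_def galois_orbit_representative[OF assms]
    using finite_orbit_set by (simp add: ab cusp_gcd_def card_gt_0_iff)
qed

text \<open>With weight 1 the order at i\<infinity> is recovered from the weighted sum and the other
  orders without any divisibility condition.\<close>

lemma orbit_size_infinity:
  assumes "N \<ge> 5" "cusp_orbit_representatives N c"
  shows "orbit_size N c (N div 2) = 1"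
proof -
  have "cusp N (c (N div 2)) = cusp_class N (1, int N)"
    using assms(2) cusp_eq_class[of 1 "int N" N] unfolding cusp_orbit_representatives_def by simp
  moreover have "galois_orbit N (cusp_class N (1, int N)) = orbit_set N 1 (int N)"
    using galois_orbit_eq[of N 1 "int N"] assms(1) by simp
  moreover have "orbit_set N 1 (int N) = {cusp_class N (1, int N)}"
  proof (intro equalityI subsetI)
    fix C assume "C \<in> orbit_set N 1 (int N)"
    then obtain a1 c1 e where *: "(a1, c1) \<in> cusp_residues N" "C = cusp_class N (a1, c1)"
      "gcd c1 (int N) = int N" "e \<in> {1, -1}" "[a1 = e * 1] (mod int N)" unfolding orbit_set_iff by blast
    have "int N dvd c1" using *(3) by (metis gcd_dvd1)
    hence "[c1 = e * int N] (mod int N)" by (simp add: cong_iff_dvd_diff)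
    hence "C = cusp_class N (1, int N)" unfolding *(2) using *(4,5) by (intro cusp_class_cong[of e]) simp_all
    thus "C \<in> {cusp_class N (1, int N)}" by simp
  next
    fix C assume "C \<in> {cusp_class N (1, int N)}"
    moreover have "cusp_class N (1, int N) = cusp_class N (1, 0)"
      by (rule cusp_class_cong[of 1]) (simp_all add: cong_0_iff)
    moreover have "(1, 0) \<in> cusp_residues N" using assms(1) by (simp add: cusp_residues_def)
    ultimately show "C \<in> orbit_set N 1 (int N)" using orbit_set_self[of 1 0 N] by simp
  qed
  ultimately show ?thesis by (simp add: orbit_size_def)
qed

section \<open>Sums over cusps as sums over divisors\<close>

lemma bij_betw_totatives_residues:
  assumes "n > 0"
  shows "bij_betw (\<lambda>k. int k mod int n) (totatives n) {a \<in> {0..<int n}. coprime a (int n)}"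
proof (rule bij_betwI')
  fix x y assume x: "x \<in> totatives n" and y: "y \<in> totatives n"
  show "(int x mod int n = int y mod int n) = (x = y)"
  proof
    assume eq: "int x mod int n = int y mod int n"
    hence eq': "x mod n = y mod n" by (metis of_nat_eq_iff zmod_int)
    have "0 < x" "x \<le> n" "0 < y" "y \<le> n" using x y by (auto simp: totatives_def)
    thus "x = y" using eq' by (metis le_neq_implies_less mod_less mod_self neq0_conv)
  qed simp
next
  fix x assume x: "x \<in> totatives n"
  have "coprime (int x) (int n)" using x by (simp add: totatives_def)
  thus "int x mod int n \<in> {a \<in> {0..<int n}. coprime a (int n)}"
    using assms by (simp add: coprime_iff_gcd_eq_1 gcd_mod_int)
next
  fix a assume a: "a \<in> {a \<in> {0..<int n}. coprime a (int n)}"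
  define x where "x = (if a = 0 then n else nat a)"
  have "coprime x n"
  proof (cases "a = 0")
    case False
    have "coprime (int (nat a)) (int n)" using a by simp
    thus ?thesis using False by (simp only: x_def coprime_int_iff if_False)
  qed (use a in \<open>simp add: x_def\<close>)
  hence "x \<in> totatives n" using a assms by (auto simp: x_def totatives_def)
  moreover have "a = int x mod int n" using a by (simp add: x_def)
  ultimately show "\<exists>x\<in>totatives n. a = int x mod int n" by blast
qed

lemma bij_betw_mod_interval:
  assumes "N > 0"
  shows "bij_betw (\<lambda>c. int c mod int N) {0<..N} {0..<int N}"
proof (rule bij_betwI')
  fix x y assume x: "x \<in> {0<..N}" and y: "y \<in> {0<..N}"
  show "(int x mod int N = int y mod int N) = (x = y)"
  proof
    assume "int x mod int N = int y mod int N"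
    hence eq': "x mod N = y mod N" by (metis of_nat_eq_iff zmod_int)
    have "0 < x" "x \<le> N" "0 < y" "y \<le> N" using x y by auto
    thus "x = y" using eq' by (metis le_neq_implies_less mod_less mod_self neq0_conv)
  qed simp
next
  fix a assume a: "a \<in> {0..<int N}"
  define x where "x = (if a = 0 then N else nat a)"
  have "x \<in> {0<..N}" "a = int x mod int N" using a assms by (auto simp: x_def)
  thus "\<exists>x\<in>{0<..N}. a = int x mod int N" by blast
qed (use assms in auto)

text \<open>Among the residues modulo N exactly \<phi>(N/g) have gcd g with N, and the labels over
  each of them are the units modulo g.\<close>

theorem sum_cusp_residues:
  fixes F :: "int \<Rightarrow> int \<Rightarrow> 'a::field_char_0"
  assumes N: "N > 0" and F: "\<And>g a. g > 0 \<Longrightarrow> F g (a mod g) = F g a"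
  shows "(\<Sum>(a, b)\<in>cusp_residues N. F (gcd b (int N)) a) =
    (\<Sum>g | g dvd N. of_nat (totient (N div g)) * (\<Sum>k\<in>totatives g. F (int g) (int k)))"
proof -
  define A where "A g = {a \<in> {0..<g}. coprime a g}" for g :: int
  define H where "H g = (\<Sum>k\<in>totatives g. F (int g) (int k))" for g :: nat
  have HA: "(\<Sum>a\<in>A (int g). F (int g) a) = H g" if "g > 0" for g
    unfolding A_def H_def sum.reindex_bij_betw[OF bij_betw_totatives_residues[OF that], symmetric]
    using F[of "int g"] that by simp
  have finA: "finite (A g)" for g by (rule finite_subset[of _ "{0..<g}"]) (auto simp: A_def)
  have "(\<Sum>(a, b)\<in>cusp_residues N. F (gcd b (int N)) a) =
      (\<Sum>(b, a)\<in>(SIGMA b:{0..<int N}. A (gcd b (int N))). F (gcd b (int N)) a)"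
    by (rule sum.reindex_bij_witness[of _ "\<lambda>(b, a). (a, b)" "\<lambda>(a, b). (b, a)"])
       (auto simp: cusp_residues_def A_def)
  also have "\<dots> = (\<Sum>b\<in>{0..<int N}. \<Sum>a\<in>A (gcd b (int N)). F (gcd b (int N)) a)"
    by (rule sum.Sigma[symmetric]) (use finA in auto)
  also have "\<dots> = (\<Sum>c\<in>{0<..N}. \<Sum>a\<in>A (int (gcd c N)). F (int (gcd c N)) a)"
    unfolding sum.reindex_bij_betw[OF bij_betw_mod_interval[OF N], symmetric] gcd_mod_int by (simp add: gcd_int_int_eq)
  also have "\<dots> = (\<Sum>c\<in>{0<..N}. H (gcd c N))"
    using N by (intro sum.cong refl HA) simp
  also have "\<dots> = (\<Sum>g | g dvd N. \<Sum>c\<in>{c \<in> {0<..N}. gcd c N = g}. H (gcd c N))"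
    by (rule sum.group[symmetric]) (use N in auto)
  also have "\<dots> = (\<Sum>g | g dvd N. of_nat (totient (N div g)) * H g)"
  proof (rule sum.cong[OF refl])
    fix g assume g: "g \<in> {g. g dvd N}"
    have "(\<Sum>c\<in>{c \<in> {0<..N}. gcd c N = g}. H (gcd c N)) = of_nat (card {c \<in> {0<..N}. gcd c N = g}) * H g"
      by simp
    thus "(\<Sum>c\<in>{c \<in> {0<..N}. gcd c N = g}. H (gcd c N)) = of_nat (totient (N div g)) * H g"
      using card_gcd_eq_totient[OF N] g by simp
  qed
  finally show ?thesis by (simp add: H_def)
qed

text \<open>The divisor sum of a Dirichlet convolution, rearranged by n = g d.\<close>

lemma sum_divisors_swap:
  fixes f h :: "nat \<Rightarrow> 'a::comm_semiring_1"
  assumes "N > 0"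
  shows "(\<Sum>n | n dvd N. \<Sum>g | g dvd n. f (n div g) * h g) = (\<Sum>g | g dvd N. h g * (\<Sum>d | d dvd N div g. f d))"
proof -
  have fin: "finite {d. d dvd n}" if "n dvd N" for n using that assms by (auto intro: finite_divisors_nat dvd_pos_nat)
  have fin': "finite {d. d dvd N div g}" if "g dvd N" for g using that assms by (intro finite_divisors_nat) (auto elim: dvdE)
  have "(\<Sum>n | n dvd N. \<Sum>g | g dvd n. f (n div g) * h g) =
      (\<Sum>(n, g)\<in>(SIGMA n:{n. n dvd N}. {g. g dvd n}). f (n div g) * h g)"
    by (rule sum.Sigma) (use fin assms in auto)
  also have "\<dots> = (\<Sum>(g, d)\<in>(SIGMA g:{g. g dvd N}. {d. d dvd N div g}). h g * f d)"
  proof (rule sum.reindex_bij_witness[of _ "\<lambda>(g, d). (g * d, g)" "\<lambda>(n, g). (g, n div g)"])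
    fix x assume "x \<in> (SIGMA n:{n. n dvd N}. {g. g dvd n})"
    then obtain n g where x: "x = (n, g)" "n dvd N" "g dvd n" by auto
    then obtain d e where "n = g * d" "N = g * d * e" by (metis dvdE)
    thus "(\<lambda>(n, g). (g, n div g)) x \<in> (SIGMA g:{g. g dvd N}. {d. d dvd N div g})"
      "(\<lambda>(g, d). (g * d, g)) ((\<lambda>(n, g). (g, n div g)) x) = x"
      using x assms by (auto simp: mult.assoc)
    show "(case (case x of (n, g) \<Rightarrow> (g, n div g)) of (g, d) \<Rightarrow> h g * f d) = (case x of (n, g) \<Rightarrow> f (n div g) * h g)"
      by (simp add: x mult.commute)
  next
    fix x assume "x \<in> (SIGMA g:{g. g dvd N}. {d. d dvd N div g})"
    then obtain g d where x: "x = (g, d)" "g dvd N" "d dvd N div g" by auto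
    then obtain n where n: "N = g * n" by blast
    hence "g > 0" "d dvd n" using x assms by auto
    thus "(\<lambda>(g, d). (g * d, g)) x \<in> (SIGMA n:{n. n dvd N}. {g. g dvd n})"
      "(\<lambda>(n, g). (g, n div g)) ((\<lambda>(g, d). (g * d, g)) x) = x"
      using x n by (auto simp: mult_dvd_mono)
  qed
  also have "\<dots> = (\<Sum>g | g dvd N. \<Sum>d | d dvd N div g. h g * f d)"
    by (rule sum.Sigma[symmetric]) (use fin' assms in auto)
  finally show ?thesis by (simp add: sum_distrib_left)
qed

section \<open>The sum of the orders over all cusps\<close>

lemma periodic_B2_mult_right:
  assumes "d > 0"
  shows "periodic_B2 (g * d) (x * int d) = periodic_B2 g x"
  using assms by (simp add: periodic_B2_def)

text \<open>The left-hand side is the sum over a complete residue system modulo n, sorted by the gcd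
  with n: a residue a = d k with gcd d is a unit k modulo n/d. The complete sum is given by the
  distribution relation.\<close>

lemma sum_totatives_periodic_B2:
  assumes "n > 0"
  shows "(\<Sum>d | d dvd n. \<Sum>k\<in>totatives d. periodic_B2 d (int j * int k)) = of_nat (gcd j n) ^ 2 / (6 * of_nat n)"
proof -
  have "(\<Sum>a<n. periodic_B2 n (int a * int j)) = of_nat (nat (gcd (int j) (int n))) ^ 2 / of_nat n * (1 / 6)"
    using periodic_B2_distribution[OF assms, of 0 "int j"] by simp
  hence "of_nat (gcd j n) ^ 2 / (6 * of_nat n) = (\<Sum>a<n. periodic_B2 n (int j * int a))"
    by (simp add: mult.commute)
  also have "\<dots> = (\<Sum>b\<in>{0..<int n}. periodic_B2 n (int j * b))"
    by (rule sum.reindex_bij_witness[of _ nat int]) auto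
  also have "\<dots> = (\<Sum>a\<in>{0<..n}. periodic_B2 n (int j * int a))"
    unfolding sum.reindex_bij_betw[OF bij_betw_mod_interval[OF assms], symmetric]
    by (intro sum.cong refl periodic_B2_mod) (simp add: mod_mult_right_eq)
  also have "\<dots> = (\<Sum>d | d dvd n. \<Sum>a\<in>{a \<in> {0<..n}. gcd a n = d}. periodic_B2 n (int j * int a))"
    by (rule sum.group[symmetric]) (use assms in auto)
  also have "\<dots> = (\<Sum>d | d dvd n. \<Sum>k\<in>totatives (n div d). periodic_B2 (n div d) (int j * int k))"
  proof (rule sum.cong[OF refl])
    fix d assume d: "d \<in> {d. d dvd n}"
    hence d0: "d > 0" and dn: "n div d * d = n" using assms by (auto intro: dvd_pos_nat)
    have "(\<Sum>a\<in>{a \<in> {0<..n}. gcd a n = d}. periodic_B2 n (int j * int a)) =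
        (\<Sum>k\<in>totatives (n div d). periodic_B2 n (int j * int (k * d)))"
      by (rule sum.reindex_bij_betw[OF bij_betw_totatives_gcd_eq, symmetric]) (use d assms in auto)
    also have "\<dots> = (\<Sum>k\<in>totatives (n div d). periodic_B2 (n div d) (int j * int k))"
    proof (rule sum.cong[OF refl])
      fix k
      show "periodic_B2 n (int j * int (k * d)) = periodic_B2 (n div d) (int j * int k)"
        using periodic_B2_mult_right[OF d0, of "n div d" "int j * int k"] unfolding dn by (simp add: mult.assoc)
    qed
    finally show "(\<Sum>a\<in>{a \<in> {0<..n}. gcd a n = d}. periodic_B2 n (int j * int a)) =
        (\<Sum>k\<in>totatives (n div d). periodic_B2 (n div d) (int j * int k))" .
  qed
  also have "\<dots> = (\<Sum>d | d dvd n. \<Sum>k\<in>totatives d. periodic_B2 d (int j * int k))"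
    by (rule sum.reindex_bij_witness[of _ "\<lambda>d. n div d" "\<lambda>d. n div d"]) (use assms in \<open>auto elim!: dvdE\<close>)
  finally show ?thesis ..
qed

text \<open>Up to a constant factor, the coefficient of a_j in the sum of the orders over all cusps:
  \<phi>(N/g) counts the denominators and the totatives are the numerators.\<close>

definition orbit_B2_sum :: "nat \<Rightarrow> nat \<Rightarrow> rat" where
  "orbit_B2_sum j N = (\<Sum>g | g dvd N. of_nat (totient (N div g)) * (of_nat g * (\<Sum>k\<in>totatives g. periodic_B2 g (int j * int k))))"

text \<open>Summing over the divisors of N replaces \<phi>(N/g) by N/g, after which the weight of
  every g is the constant N.\<close>

lemma sum_orbit_B2_sum:
  assumes "N > 0"
  shows "(\<Sum>n | n dvd N. orbit_B2_sum j n) = of_nat (gcd j N) ^ 2 / 6"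
proof -
  let ?b = "\<lambda>g. \<Sum>k\<in>totatives g. periodic_B2 g (int j * int k)"
  have "(\<Sum>n | n dvd N. orbit_B2_sum j n) = (\<Sum>g | g dvd N. (of_nat g * ?b g) * (\<Sum>d | d dvd N div g. of_nat (totient d)))"
    unfolding orbit_B2_sum_def by (rule sum_divisors_swap[OF assms])
  also have "\<dots> = (\<Sum>g | g dvd N. of_nat N * ?b g)"
  proof (rule sum.cong[OF refl])
    fix g assume "g \<in> {g. g dvd N}"
    hence "of_nat g * of_nat (N div g) = (of_nat N :: rat)" by (simp flip: of_nat_mult)
    moreover have "(\<Sum>d | d dvd N div g. of_nat (totient d)) = (of_nat (N div g) :: rat)"
      by (simp only: totient_divisor_sum flip: of_nat_sum)
    ultimately show "(of_nat g * ?b g) * (\<Sum>d | d dvd N div g. of_nat (totient d)) = of_nat N * ?b g"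
      by (metis mult.assoc mult.commute)
  qed
  also have "\<dots> = of_nat (gcd j N) ^ 2 / 6"
    unfolding sum_distrib_left[symmetric] sum_totatives_periodic_B2[OF assms] using assms by simp
  finally show ?thesis .
qed

text \<open>The contribution of the divisors \<open>n\<close> of \<open>j\<close> to \<open>\<Sum>\<^bsub>n dvd N\<^esub>\<close> is already the whole sum,
  by the same formula applied to \<open>gcd j N\<close>.\<close>

theorem orbit_B2_sum_eq_0:
  assumes "N > 0" "\<not> N dvd j"
  shows "orbit_B2_sum j N = 0"
  using assms
proof (induction N rule: less_induct)
  case (less N)
  define h where "h = gcd j N"
  have h: "h > 0" "h dvd N" "h dvd j" using less.prems by (auto simp: h_def)
  have fin: "finite {n. n dvd N}" using less.prems by simp
  have set: "{n. n dvd N} = {n. n dvd h} \<union> {n. n dvd N \<and> \<not> n dvd j}"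
    by (auto simp: h_def)
  have "(\<Sum>n | n dvd N. orbit_B2_sum j n) = (\<Sum>n | n dvd h. orbit_B2_sum j n) + (\<Sum>n | n dvd N \<and> \<not> n dvd j. orbit_B2_sum j n)"
    unfolding set by (rule sum.union_disjoint) (use fin h in \<open>auto simp: h_def\<close>)
  moreover have "gcd j h = h" using h(3) by (simp add: gcd_proj2_iff)
  ultimately have "(\<Sum>n | n dvd N \<and> \<not> n dvd j. orbit_B2_sum j n) = 0"
    using sum_orbit_B2_sum[OF less.prems(1), of j] sum_orbit_B2_sum[OF h(1), of j] by (simp add: h_def)
  moreover have "(\<Sum>n | n dvd N \<and> \<not> n dvd j. orbit_B2_sum j n) = (\<Sum>n\<in>{N}. orbit_B2_sum j n)"
  proof (rule sum.mono_neutral_right)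
    show "\<forall>n\<in>{n. n dvd N \<and> \<not> n dvd j} - {N}. orbit_B2_sum j n = 0"
    proof
      fix n assume n: "n \<in> {n. n dvd N \<and> \<not> n dvd j} - {N}"
      hence "n > 0" "n < N" using less.prems(1) by (auto intro: dvd_pos_nat le_neq_implies_less dvd_imp_le)
      thus "orbit_B2_sum j n = 0" using n by (intro less.IH) auto
    qed
  qed (use fin less.prems in auto)
  ultimately show ?case by simp
qed

text \<open>The substitute for the valence formula, valid for every a. The exponents drop out
  because \<open>orbit_B2_sum\<close> vanishes for 0 < j < N. There remain the terms k g/12 over
  \<phi>(g) \<phi>(N/g) labels for each g; as every cusp has two labels, this is k R_N with its
  factor 1/24.\<close>

theorem cusp_order_sum:
  assumes N: "N \<ge> 5" and c: "cusp_orbit_representatives N c"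
  shows "(\<Sum>i\<le>N div 2. of_nat (orbit_size N c i) * cusp_order N k a (c i)) = of_nat k * R_num N"
proof -
  define F where "F g b = (of_nat k * of_int g / 12 +
    (\<Sum>j=1..N div 2. of_int (a $ (j - 1)) * (of_int g / 2 * periodic_B2 (nat g) (int j * b))) :: rat)" for g b
  have Fper: "F g b' = F g b" if e: "e \<in> {1, -1}" "g > 0" "[b' = e * b] (mod g)" for g b b' e
  proof -
    have "periodic_B2 (nat g) (int j * b') = periodic_B2 (nat g) (int j * b)" for j
    proof -
      have "[int j * b' = e * (int j * b)] (mod int (nat g))"
        using cong_mult[OF cong_refl e(3), of "int j"] e(2) by (simp add: mult_ac)
      hence "periodic_B2 (nat g) (int j * b') = periodic_B2 (nat g) (e * (int j * b))"
        by (intro periodic_B2_mod) (simp add: cong_def)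
      thus ?thesis using e(1,2) periodic_B2_minus[of "nat g" "int j * b"] by auto
    qed
    thus ?thesis by (simp add: F_def)
  qed
  have ord: "cusp_order N k a (c i) = F (cusp_gcd N (c i)) (fst (c i))" for i
  proof -
    obtain p r where pr: "c i = (p, r)" by (cases "c i")
    have "of_nat (nat (gcd r (int N))) = (of_int (gcd r (int N)) :: rat)" by simp
    thus ?thesis unfolding pr cusp_order_def F_def Let_def prod.case cusp_gcd_def fst_conv by simp
  qed
  have "2 * (\<Sum>i\<le>N div 2. of_nat (orbit_size N c i) * cusp_order N k a (c i)) =
      (\<Sum>(b, d)\<in>cusp_residues N. F (gcd d (int N)) b)"
    unfolding ord by (rule sum_over_orbits[OF N c Fper])
  also have "\<dots> = (\<Sum>g | g dvd N. of_nat (totient (N div g)) * (\<Sum>l\<in>totatives g. F (int g) (int l)))"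
    by (rule sum_cusp_residues) (use N Fper[of 1] in auto)
  also have "\<dots> = (\<Sum>g | g dvd N. of_nat k / 12 * of_nat (g * totient g * totient (N div g)) +
      (\<Sum>j=1..N div 2. of_int (a $ (j - 1)) / 2 * (of_nat (totient (N div g)) * (of_nat g * (\<Sum>l\<in>totatives g. periodic_B2 g (int j * int l))))))"
  proof (rule sum.cong[OF refl])
    fix g
    have "(\<Sum>l\<in>totatives g. F (int g) (int l)) = of_nat (totient g) * (of_nat k * of_nat g / 12) +
        (\<Sum>l\<in>totatives g. \<Sum>j=1..N div 2. of_int (a $ (j - 1)) * (of_nat g / 2 * periodic_B2 g (int j * int l)))"
      by (simp add: F_def sum.distrib totient_def)
    also have "(\<Sum>l\<in>totatives g. \<Sum>j=1..N div 2. of_int (a $ (j - 1)) * (of_nat g / 2 * periodic_B2 g (int j * int l))) =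
        (\<Sum>j=1..N div 2. of_int (a $ (j - 1)) / 2 * (of_nat g * (\<Sum>l\<in>totatives g. periodic_B2 g (int j * int l))))"
      by (subst sum.swap) (simp add: sum_distrib_left mult_ac)
    finally show "of_nat (totient (N div g)) * (\<Sum>l\<in>totatives g. F (int g) (int l)) =
        of_nat k / 12 * of_nat (g * totient g * totient (N div g)) +
      (\<Sum>j=1..N div 2. of_int (a $ (j - 1)) / 2 * (of_nat (totient (N div g)) * (of_nat g * (\<Sum>l\<in>totatives g. periodic_B2 g (int j * int l)))))"
      by (simp add: distrib_left sum_distrib_left mult_ac)
  qed
  also have "\<dots> = of_nat k / 12 * (\<Sum>g | g dvd N. of_nat (g * totient g * totient (N div g))) +
      (\<Sum>j=1..N div 2. of_int (a $ (j - 1)) / 2 * orbit_B2_sum j N)"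
    unfolding sum.distrib orbit_B2_sum_def by (subst sum.swap) (simp only: sum_distrib_left)
  also have "(\<Sum>j=1..N div 2. of_int (a $ (j - 1)) / 2 * orbit_B2_sum j N) = 0"
  proof (rule sum.neutral, rule ballI)
    fix j assume j: "j \<in> {1..N div 2}"
    hence "\<not> N dvd j" using N by (auto dest!: dvd_imp_le)
    thus "of_int (a $ (j - 1)) / 2 * orbit_B2_sum j N = 0" using orbit_B2_sum_eq_0[of N j] N by simp
  qed
  finally show ?thesis by (simp add: R_num_def)
qed

section \<open>Injectivity of the order map\<close>

definition root_unity :: "nat \<Rightarrow> int \<Rightarrow> complex" where
  "root_unity N n = expi (2 * of_int n / of_nat N)"

lemma root_unity_add: "root_unity N (a + b) = root_unity N a * root_unity N b"
  by (simp add: root_unity_def add_divide_distrib distrib_left expi_add)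

lemma root_unity_0 [simp]: "root_unity N 0 = 1"
  by (simp add: root_unity_def)

lemma root_unity_power: "root_unity N x ^ k = root_unity N (x * int k)"
  by (simp add: root_unity_def expi_power mult_ac)

lemma root_unity_eq_1_iff:
  assumes "N > 0"
  shows "root_unity N n = 1 \<longleftrightarrow> int N dvd n"
proof
  assume "root_unity N n = 1"
  then obtain k :: int where "2 * of_int n / of_nat N = (2 * of_int k :: complex)"
    unfolding root_unity_def expi_eq_1_iff by blast
  hence "of_int n = (of_int (int N * k) :: complex)" using assms by (simp add: field_simps)
  hence "n = int N * k" by (simp only: of_int_eq_iff)
  thus "int N dvd n" by simp
next
  assume "int N dvd n"
  then obtain k where "n = int N * k" by blast
  hence "2 * of_int n / of_nat N = (2 * of_int k :: complex)" using assms by simp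
  thus "root_unity N n = 1" unfolding root_unity_def expi_eq_1_iff by blast
qed

lemma root_unity_mod:
  assumes "N > 0"
  shows "root_unity N (n mod int N) = root_unity N n"
proof -
  have "root_unity N n = root_unity N (n mod int N) * root_unity N (int N * (n div int N))"
    unfolding root_unity_add[symmetric] by simp
  moreover have "root_unity N (int N * (n div int N)) = 1" using root_unity_eq_1_iff[OF assms] by simp
  ultimately show ?thesis by simp
qed

lemma root_unity_cos: "root_unity N n + root_unity N (- n) = of_real (2 * cos (2 * pi * of_int n / of_nat N))"
proof -
  have "root_unity N n = cis (2 * pi * of_int n / of_nat N)" for n
    by (simp add: root_unity_def expi_def cis_conv_exp mult_ac)
  thus ?thesis by (simp add: complex_eq_iff)
qed

lemma sum_root_unity:
  assumes "N > 0"
  shows "(\<Sum>t<N. root_unity N (x * int t)) = (if int N dvd x then of_nat N else 0)"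
proof (cases "int N dvd x")
  case True
  hence "root_unity N (x * int t) = 1" for t using root_unity_eq_1_iff[OF assms] by simp
  thus ?thesis using True by simp
next
  case False
  hence "root_unity N x \<noteq> 1" using root_unity_eq_1_iff[OF assms] by simp
  hence "(\<Sum>t<N. root_unity N x ^ t) = (root_unity N x ^ N - 1) / (root_unity N x - 1)"
    by (rule geometric_sum)
  also have "root_unity N x ^ N = 1" unfolding root_unity_power using root_unity_eq_1_iff[OF assms] by simp
  finally show ?thesis using False by (simp add: root_unity_power)
qed

lemma sum_periodic_delta:
  fixes f :: "int \<Rightarrow> 'a::comm_ring_1"
  assumes "N > 0" "\<And>x. f (x mod int N) = f x"
  shows "(\<Sum>y<N. if int N dvd x - int y then f (int y) else 0) = f x"
proof -
  define y0 where "y0 = nat (x mod int N)"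
  have y0: "int y0 = x mod int N" "y0 < N" using assms(1) by (auto simp: y0_def nat_less_iff)
  have "int N dvd x - int y \<longleftrightarrow> y = y0" if "y < N" for y
  proof -
    have "int N dvd x - int y \<longleftrightarrow> x mod int N = int y mod int N" by (simp add: mod_eq_dvd_iff)
    thus ?thesis using that y0 by auto
  qed
  hence "(\<Sum>y<N. if int N dvd x - int y then f (int y) else 0) = (\<Sum>y<N. if y = y0 then f (int y) else 0)"
    by (intro sum.cong) auto
  thus ?thesis using y0 assms(2) by (simp add: sum.delta)
qed

definition dft :: "nat \<Rightarrow> (int \<Rightarrow> complex) \<Rightarrow> int \<Rightarrow> complex" where
  "dft N h t = (\<Sum>y<N. h (int y) * root_unity N (- (t * int y))) / of_nat N"

lemma dft_inversion:
  assumes N: "N > 0" and h: "\<And>x. h (x mod int N) = h x"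
  shows "(\<Sum>t<N. dft N h (int t) * root_unity N (int t * x)) = h x"
proof -
  have "(\<Sum>t<N. dft N h (int t) * root_unity N (int t * x)) =
      (\<Sum>t<N. \<Sum>y<N. h (int y) / of_nat N * root_unity N ((x - int y) * int t))"
  proof (rule sum.cong[OF refl])
    fix t
    have "root_unity N ((x - int y) * int t) = root_unity N (- (int t * int y)) * root_unity N (int t * x)" for y
      unfolding root_unity_add[symmetric] by (rule arg_cong[of _ _ "root_unity N"]) (simp add: algebra_simps)
    thus "dft N h (int t) * root_unity N (int t * x) = (\<Sum>y<N. h (int y) / of_nat N * root_unity N ((x - int y) * int t))"
      by (simp add: dft_def sum_divide_distrib sum_distrib_right mult.assoc)
  qed
  also have "\<dots> = (\<Sum>y<N. h (int y) / of_nat N * (\<Sum>t<N. root_unity N ((x - int y) * int t)))"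
    by (subst sum.swap) (simp add: sum_distrib_left)
  also have "\<dots> = (\<Sum>y<N. if int N dvd x - int y then h (int y) else 0)"
    unfolding sum_root_unity[OF N] using N by (intro sum.cong) auto
  also have "\<dots> = h x" by (rule sum_periodic_delta[of N h x, OF N h])
  finally show ?thesis .
qed

section \<open>Fourier coefficients of the periodic Bernoulli polynomial\<close>

definition B2_coeff :: "nat \<Rightarrow> nat \<Rightarrow> real" where
  "B2_coeff N n = (if n = 0 then 1 / (6 * real N ^ 2) else 2 / real N ^ 2 / (2 - 2 * cos (2 * pi * real n / real N)))"

text \<open>A quadratic polynomial has constant second difference; the correction comes from the
  kink of the periodic extension at multiples of N.\<close>

lemma periodic_B2_second_difference:
  assumes "N \<ge> 2"
  shows "periodic_B2 N (r + 1) - 2 * periodic_B2 N r + periodic_B2 N (r - 1) =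
    2 / of_nat N ^ 2 - (if int N dvd r then 2 / of_nat N else 0)"
proof -
  define r0 where "r0 = r mod int N"
  have r0: "0 \<le> r0" "r0 < int N" using assms by (auto simp: r0_def)
  have B: "periodic_B2 N x = B2 (of_int x / of_nat N)" if "0 \<le> x" "x \<le> int N" for x
    using that assms by (cases "x = int N") (auto simp: periodic_B2_def B2_def)
  have p: "periodic_B2 N (r + e) = periodic_B2 N (r0 + e)" for e
    by (rule periodic_B2_mod) (simp add: r0_def mod_add_left_eq)
  have dv: "int N dvd r \<longleftrightarrow> r0 = 0" by (simp add: r0_def dvd_eq_mod_eq_0)
  show ?thesis
  proof (cases "r0 = 0")
    case True
    have "periodic_B2 N (- 1) = periodic_B2 N 1" using periodic_B2_minus[of N 1] assms by simp
    hence v: "periodic_B2 N (r + 1) = B2 (1 / of_nat N)" "periodic_B2 N (r - 1) = B2 (1 / of_nat N)" "periodic_B2 N r = 1 / 6"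
      using p[of 1] p[of 0] p[of "- 1"] B[of 1] assms True by simp_all
    show ?thesis
      unfolding v using assms True dv by (simp add: B2_def field_simps power2_eq_square)
  next
    case False
    hence v: "periodic_B2 N (r + 1) = B2 (of_int (r0 + 1) / of_nat N)" "periodic_B2 N (r - 1) = B2 (of_int (r0 - 1) / of_nat N)"
      "periodic_B2 N r = B2 (of_int r0 / of_nat N)"
      using p[of 1] p[of 0] p[of "- 1"] B[of "r0 + 1"] B[of r0] B[of "r0 - 1"] r0 by simp_all
    show ?thesis
      unfolding v using assms False dv by (simp add: B2_def field_simps power2_eq_square)
  qed
qed

text \<open>The transform multiplies second differences by 2 cos(2\<pi>n/N) - 2. For n \<noteq> 0
  the constant part of the second difference transforms to 0 and the kink gives a constant, so the
  coefficient follows by division. For n = 0 it is the mean value, given by the multiplication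
  theorem.\<close>

lemma dft_periodic_B2:
  assumes N: "N \<ge> 2" and n: "n < N"
  shows "dft N (\<lambda>x. of_rat (periodic_B2 N x)) (int n) = of_real (B2_coeff N n)"
proof (cases "n = 0")
  case True
  have "(\<Sum>y<N. periodic_B2 N (int y)) = (\<Sum>y<N. B2 ((0 + of_nat y) / of_nat N))"
    by (intro sum.cong) (simp_all add: periodic_B2_def)
  also have "\<dots> = 1 / (6 * of_nat N)" using N by (subst B2_multiplication) (simp_all add: B2_def)
  finally have "(\<Sum>y<N. periodic_B2 N (int y)) = 1 / (6 * of_nat N)" .
  hence "of_rat (\<Sum>y<N. periodic_B2 N (int y)) = (1 / (6 * of_nat N) :: complex)" by (simp add: of_rat_divide of_rat_mult)
  thus ?thesis using True by (simp add: dft_def B2_coeff_def of_rat_sum power2_eq_square)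
next
  case False
  have N0: "N > 0" using N by simp
  define b where "b x = (of_rat (periodic_B2 N x) :: complex)" for x
  have b_mod: "b (x mod int N) = b x" for x by (simp add: b_def periodic_B2_def)
  have shift: "(\<Sum>y<N. b (int y + e) * root_unity N (- (int n * int y))) = root_unity N (int n * e) * (\<Sum>y<N. b (int y) * root_unity N (- (int n * int y)))"
    for e
  proof -
    define h where "h y = b y * root_unity N (- (int n * (y - e)))" for y
    have h: "h (x mod int N) = h x" for x
    proof -
      have "root_unity N (- (int n * (x mod int N - e))) = root_unity N (- (int n * (x - e)))"
        by (subst (1 2) root_unity_mod[OF N0, symmetric], rule arg_cong[of _ _ "root_unity N"])
           (metis mod_diff_left_eq mod_minus_cong mod_mult_right_eq)
      thus ?thesis by (simp add: h_def b_mod)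
    qed
    have "(\<Sum>y<N. b (int y + e) * root_unity N (- (int n * int y))) = (\<Sum>y<N. h (1 * int y + e))"
      by (simp add: h_def)
    also have "\<dots> = (\<Sum>y<N. h (int y))" by (rule sum_periodic_affine) (use N0 h in auto)
    also have "\<dots> = root_unity N (int n * e) * (\<Sum>y<N. b (int y) * root_unity N (- (int n * int y)))"
    proof -
      have "root_unity N (- (int n * (int y - e))) = root_unity N (int n * e) * root_unity N (- (int n * int y))" for y
        unfolding root_unity_add[symmetric] by (rule arg_cong[of _ _ "root_unity N"]) (simp add: algebra_simps)
      thus ?thesis by (simp add: h_def sum_distrib_left mult_ac)
    qed
    finally show ?thesis .
  qed
  define D where "D = (\<Sum>y<N. b (int y) * root_unity N (- (int n * int y)))"
  have "(root_unity N (int n) + root_unity N (- int n) - 2) * D =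
      (\<Sum>y<N. (b (int y + 1) - 2 * b (int y) + b (int y + (- 1))) * root_unity N (- (int n * int y)))"
    using shift[of 1] shift[of "- 1"] shift[of 0]
    by (simp add: D_def algebra_simps sum.distrib sum_subtractf sum_distrib_left)
  also have "\<dots> = (\<Sum>y<N. 2 / of_nat N ^ 2 * root_unity N (- int n * int y)) - (\<Sum>y<N. if y = 0 then 2 / of_nat N else 0)"
    unfolding sum_subtractf[symmetric]
  proof (rule sum.cong[OF refl])
    fix y assume y: "y \<in> {..<N}"
    have "int N dvd int y \<longleftrightarrow> y = 0" using y by (auto simp: int_dvd_int_iff dest: dvd_imp_le)
    hence "of_rat (periodic_B2 N (int y + 1) - 2 * periodic_B2 N (int y) + periodic_B2 N (int y - 1)) =
        (2 / of_nat N ^ 2 - (if y = 0 then 2 / of_nat N else 0) :: complex)"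
      unfolding periodic_B2_second_difference[OF N] by (simp add: of_rat_diff of_rat_divide of_rat_power)
    hence eq: "b (int y + 1) - 2 * b (int y) + b (int y + (- 1)) = 2 / of_nat N ^ 2 - (if y = 0 then 2 / of_nat N else 0)"
      by (simp add: b_def of_rat_add of_rat_diff of_rat_mult)
    show "(b (int y + 1) - 2 * b (int y) + b (int y + (- 1))) * root_unity N (- (int n * int y)) =
        2 / of_nat N ^ 2 * root_unity N (- int n * int y) - (if y = 0 then 2 / of_nat N else 0)"
      unfolding eq by (cases "y = 0") simp_all
  qed
  also have "(\<Sum>y<N. 2 / of_nat N ^ 2 * root_unity N (- int n * int y)) = 0"
  proof -
    have "\<not> int N dvd - int n" using n False by (auto simp: int_dvd_int_iff dest: dvd_imp_le)
    thus ?thesis unfolding sum_distrib_left[symmetric] sum_root_unity[OF N0] by simp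
  qed
  also have "(\<Sum>y<N. if y = 0 then 2 / of_nat N else 0) = (2 / of_nat N :: complex)" using N0 by simp
  finally have "(2 - 2 * of_real (cos (2 * pi * real n / real N))) * D = 2 / of_nat N"
    unfolding root_unity_cos by (simp add: algebra_simps)
  hence eq: "of_real (2 - 2 * cos (2 * pi * real n / real N)) * D = 2 / of_nat N" by simp
  hence "of_real (2 - 2 * cos (2 * pi * real n / real N)) \<noteq> (0 :: complex)" using N0 by auto
  hence "D = 2 / of_nat N / of_real (2 - 2 * cos (2 * pi * real n / real N))" using eq by (metis nonzero_mult_div_cancel_left)
  thus ?thesis using False by (simp add: dft_def D_def b_def B2_coeff_def power2_eq_square)
qed

lemma B2_coeff_nonneg: "B2_coeff N n \<ge> 0"
  by (simp add: B2_coeff_def)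

lemma B2_coeff_expansion:
  assumes "N \<ge> 2"
  shows "(\<Sum>n<N. of_real (B2_coeff N n) * root_unity N (int n * x)) = of_rat (periodic_B2 N x)"
proof -
  have "(\<Sum>n<N. of_real (B2_coeff N n) * root_unity N (int n * x)) =
      (\<Sum>n<N. dft N (\<lambda>x. of_rat (periodic_B2 N x)) (int n) * root_unity N (int n * x))"
    by (intro sum.cong refl) (simp add: dft_periodic_B2[OF assms])
  also have "\<dots> = of_rat (periodic_B2 N x)"
    by (rule dft_inversion) (use assms in \<open>auto simp: periodic_B2_def\<close>)
  finally show ?thesis .
qed

lemma sum_B2_coeff:
  assumes "N \<ge> 2"
  shows "(\<Sum>n<N. B2_coeff N n) = 1 / 6"
proof -
  have "(of_real (\<Sum>n<N. B2_coeff N n) :: complex) = of_real (1 / 6)"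
    using B2_coeff_expansion[OF assms, of 0] by (simp add: of_rat_divide)
  thus ?thesis by (simp only: of_real_eq_iff)
qed

text \<open>From 2 - 2 cos x \<le> x^2 the coefficient is at least 1/(2\<pi>^2), and \<pi>^2 < 12.
  The threshold 1/24 is a quarter of the sum 1/6 of all coefficients: beyond it, the two frequencies
  \<plusminus>1 outweigh all others together.\<close>

lemma B2_coeff_1:
  assumes "N \<ge> 2"
  shows "B2_coeff N 1 > 1 / 24"
proof -
  define x where "x = 2 * pi / real N"
  have "cos x = 1 - 2 * sin (x / 2) ^ 2" using cos_double_sin[of "x / 2"] by simp
  moreover have "sin (x / 2) ^ 2 \<le> (x / 2) ^ 2"
    using abs_sin_x_le_abs_x[of "x / 2"] by (simp only: abs_le_square_iff)
  ultimately have le: "2 - 2 * cos x \<le> x ^ 2" by (simp add: power_divide)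
  have "0 < x" "x \<le> pi" using assms by (auto simp: x_def field_simps)
  have "2 - 2 * cos x > 0"
  proof -
    have "cos x < cos 0" using \<open>0 < x\<close> \<open>x \<le> pi\<close> by (intro cos_monotone_0_pi) auto
    thus ?thesis by simp
  qed
  have "pi \<le> 3.2" using pi_approx by simp
  hence "pi ^ 2 \<le> 3.2 ^ 2" by (intro power_mono) auto
  hence pi2: "pi ^ 2 < 12" by (simp add: power2_eq_square)
  have "1 / 24 < 1 / (2 * pi ^ 2)" using pi2 by (simp add: field_simps)
  also have "\<dots> = 2 / real N ^ 2 / x ^ 2" using assms by (simp add: x_def field_simps power2_eq_square)
  also have "\<dots> \<le> 2 / real N ^ 2 / (2 - 2 * cos x)"
    using le \<open>2 - 2 * cos x > 0\<close> \<open>0 < x\<close> by (intro divide_left_mono mult_pos_pos) auto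
  finally show ?thesis by (simp add: B2_coeff_def x_def)
qed

lemma B2_coeff_reflect:
  assumes "N \<ge> 2"
  shows "B2_coeff N (N - 1) = B2_coeff N 1"
proof -
  have "2 * pi * real (N - 1) / real N = 2 * pi - 2 * pi * real 1 / real N"
    using assms by (simp add: of_nat_diff field_simps)
  hence "cos (2 * pi * real (N - 1) / real N) = cos (2 * pi * real 1 / real N)"
    by (simp only: cos_2pi_minus)
  thus ?thesis using assms by (simp add: B2_coeff_def)
qed

text \<open>In the Fourier expansion of the periodic Bernoulli polynomial all coefficients are nonnegative
  and those of the frequencies \<open>\<plusminus>1\<close> exceed the sum of all others. Testing against the sign of the
  even extension \<open>A\<close> of \<open>\<alpha>\<close> isolates these two frequencies.\<close>

theorem periodic_B2_independent:
  fixes \<alpha> :: "nat \<Rightarrow> rat"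
  assumes N: "N \<ge> 3"
    and zero: "\<And>r. (\<Sum>j=1..N div 2. \<alpha> j * periodic_B2 N (int j * r)) = 0"
    and j: "j \<in> {1..N div 2}"
  shows "\<alpha> j = 0"
proof -
  have N0: "N > 0" and N2: "N \<ge> 2" using N by auto
  define a where "a j = (of_rat (\<alpha> j) :: real)" for j
  \<comment> \<open>Written with divisibility, the function is periodic by construction. For j = N/2
    the two classes coincide and the value is 2 a_j.\<close>
  define A where "A x = (\<Sum>j=1..N div 2. a j * ((if int N dvd int j - x then 1 else 0) + (if int N dvd - int j - x then 1 else 0)))" for x
  have sumA: "(\<Sum>x<N. of_real (A (int x)) * f (int x)) = (\<Sum>j=1..N div 2. of_real (a j) * (f (int j) + f (- int j)))"
    if f: "\<And>x. f (x mod int N) = f x" for f :: "int \<Rightarrow> complex"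
  proof -
    have "(\<Sum>x<N. of_real (A (int x)) * f (int x)) =
        (\<Sum>x<N. \<Sum>j=1..N div 2. of_real (a j) * ((if int N dvd int j - int x then f (int x) else 0) + (if int N dvd - int j - int x then f (int x) else 0)))"
      unfolding A_def of_real_sum sum_distrib_right by (intro sum.cong refl) auto
    also have "\<dots> = (\<Sum>j=1..N div 2. of_real (a j) * ((\<Sum>x<N. if int N dvd int j - int x then f (int x) else 0) +
        (\<Sum>x<N. if int N dvd - int j - int x then f (int x) else 0)))"
      by (subst sum.swap) (simp only: sum_distrib_left sum.distrib distrib_left)
    finally show ?thesis using sum_periodic_delta[of N f, OF N0 f] by simp
  qed
  have A_mod: "A (x mod int N) = A x" for x
  proof -
    have "int N dvd y - x mod int N \<longleftrightarrow> int N dvd y - x" for y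
      by (simp add: mod_eq_dvd_iff[symmetric])
    thus ?thesis by (simp add: A_def)
  qed
  have A_even: "A (- x) = A x" for x
  proof -
    have "int j - - x = - (- int j - x)" "- int j - - x = - (int j - x)" for j by simp_all
    hence "int N dvd int j - - x \<longleftrightarrow> int N dvd - int j - x" "int N dvd - int j - - x \<longleftrightarrow> int N dvd int j - x" for j
      by (simp_all only: dvd_minus_iff)
    thus ?thesis unfolding A_def by (simp only: add.commute)
  qed
  \<comment> \<open>The hypothesis in terms of \<open>A\<close>: it is orthogonal to x \<mapsto>
    B_2(<t x/N>) for every t.\<close>
  have char: "(\<Sum>x<N. of_real (A (int x)) * of_rat (periodic_B2 N (t * int x))) = (0 :: complex)" for t
  proof -
    have "periodic_B2 N (t * (x mod int N)) = periodic_B2 N (t * x)" for x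
      by (rule periodic_B2_mod) (simp add: mod_mult_right_eq)
    hence "(\<Sum>x<N. of_real (A (int x)) * of_rat (periodic_B2 N (t * int x))) =
        (\<Sum>j=1..N div 2. of_real (a j) * (of_rat (periodic_B2 N (t * int j)) + of_rat (periodic_B2 N (t * - int j))) :: complex)"
      by (intro sumA) simp
    also have "\<dots> = (\<Sum>j=1..N div 2. 2 * of_rat (\<alpha> j * periodic_B2 N (int j * t)))"
    proof (intro sum.cong refl)
      fix j
      have "periodic_B2 N (t * - int j) = periodic_B2 N (t * int j)" using periodic_B2_minus[OF N0, of "t * int j"] by simp
      moreover have "(of_real (a j) :: complex) = of_rat (\<alpha> j)" by (simp add: a_def of_rat_complex_eq)
      ultimately show "of_real (a j) * (of_rat (periodic_B2 N (t * int j)) + of_rat (periodic_B2 N (t * - int j))) =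
          (2 * of_rat (\<alpha> j * periodic_B2 N (int j * t)) :: complex)"
        by (simp add: of_rat_mult mult.commute)
    qed
    also have "\<dots> = 2 * of_rat (\<Sum>j=1..N div 2. \<alpha> j * periodic_B2 N (int j * t))"
      by (simp add: of_rat_sum sum_distrib_left)
    finally show ?thesis using zero[of t] by simp
  qed
  \<comment> \<open>Fourier inversion writes \<sigma> as a combination of characters. For each
    character the sum over n collapses, by \<open>B2_coeff_expansion\<close>, to one of the sums
    that vanish by \<open>char\<close>.\<close>
  have test: "(\<Sum>n<N. of_real (B2_coeff N n) * (\<Sum>x<N. of_real (A (int x)) * \<sigma> (int n * int x))) = 0"
    if \<sigma>: "\<And>x. \<sigma> (x mod int N) = \<sigma> x" for \<sigma> :: "int \<Rightarrow> complex"
  proof -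
    have "(\<Sum>n<N. of_real (B2_coeff N n) * (\<Sum>x<N. of_real (A (int x)) * \<sigma> (int n * int x))) =
        (\<Sum>n<N. \<Sum>x<N. \<Sum>t<N. of_real (B2_coeff N n) * (of_real (A (int x)) * (dft N \<sigma> (int t) * root_unity N (int n * (int t * int x)))))"
    proof -
      have "\<sigma> (int n * int x) = (\<Sum>t<N. dft N \<sigma> (int t) * root_unity N (int n * (int t * int x)))" for n x
      proof -
        have "int t * (int n * int x) = int n * (int t * int x)" for t by simp
        thus ?thesis using dft_inversion[of N \<sigma> "int n * int x", OF N0 \<sigma>] by (simp only:)
      qed
      thus ?thesis by (simp only: sum_distrib_left)
    qed
    also have "\<dots> = (\<Sum>n<N. \<Sum>t<N. \<Sum>x<N. of_real (B2_coeff N n) * (of_real (A (int x)) * (dft N \<sigma> (int t) * root_unity N (int n * (int t * int x)))))"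
      by (rule sum.cong[OF refl], rule sum.swap)
    also have "\<dots> = (\<Sum>t<N. \<Sum>n<N. \<Sum>x<N. of_real (B2_coeff N n) * (of_real (A (int x)) * (dft N \<sigma> (int t) * root_unity N (int n * (int t * int x)))))"
      by (rule sum.swap)
    also have "\<dots> = (\<Sum>t<N. \<Sum>x<N. \<Sum>n<N. of_real (B2_coeff N n) * (of_real (A (int x)) * (dft N \<sigma> (int t) * root_unity N (int n * (int t * int x)))))"
      by (rule sum.cong[OF refl], rule sum.swap)
    also have "\<dots> = (\<Sum>t<N. dft N \<sigma> (int t) * (\<Sum>x<N. of_real (A (int x)) *
        (\<Sum>n<N. of_real (B2_coeff N n) * root_unity N (int n * (int t * int x)))))"
      by (simp add: sum_distrib_left mult_ac)
    also have "\<dots> = 0" unfolding B2_coeff_expansion[OF N2] char by simp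
    finally show ?thesis .
  qed
  \<comment> \<open>With this choice \<open>T n\<close> equals L at n = 1 and, because
    \<open>A\<close> is even, at n = N - 1, and it is at least -L everywhere.\<close>
  define \<sigma> where "\<sigma> x = sgn (A x)" for x
  define L where "L = (\<Sum>x<N. \<bar>A (int x)\<bar>)"
  define T where "T n = (\<Sum>x<N. A (int x) * \<sigma> (int n * int x))" for n
  have "complex_of_real (\<Sum>n<N. B2_coeff N n * T n) = 0"
    using test[of "\<lambda>x. of_real (\<sigma> x)"] by (simp add: T_def \<sigma>_def A_mod)
  hence sum0: "(\<Sum>n<N. B2_coeff N n * T n) = 0" by (simp only: of_real_eq_0_iff)
  have T1: "T 1 = L" unfolding T_def L_def \<sigma>_def by (simp add: abs_sgn)
  have TN: "T (N - 1) = L"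
  proof -
    have H: "A (int (N - 1) * int x) = A (int x)" for x
    proof -
      have "(int (N - 1) * int x) mod int N = (- int x) mod int N"
        using N0 by (simp add: of_nat_diff left_diff_distrib mod_eq_dvd_iff)
      hence "A (int (N - 1) * int x) = A (- int x)" using A_mod by metis
      thus ?thesis using A_even by simp
    qed
    show ?thesis unfolding T_def L_def \<sigma>_def H abs_sgn ..
  qed
  have Tge: "T n \<ge> - L" for n
  proof -
    have "- \<bar>A (int x)\<bar> \<le> A (int x) * \<sigma> (int n * int x)" for x
      unfolding \<sigma>_def by (auto simp: sgn_if)
    hence "(\<Sum>x<N. - \<bar>A (int x)\<bar>) \<le> T n" unfolding T_def by (intro sum_mono)
    thus ?thesis by (simp add: L_def sum_negf)
  qed
  \<comment> \<open>N \<ge> 3 makes the two frequencies 1 and N - 1 distinct.\<close>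
  have split: "(\<Sum>n<N. f n) = f 1 + f (N - 1) + (\<Sum>n\<in>{..<N} - {1, N - 1}. f n)" for f :: "nat \<Rightarrow> real"
  proof -
    have "(\<Sum>n<N. f n) = (\<Sum>n\<in>{..<N} - {1, N - 1}. f n) + (\<Sum>n\<in>{1, N - 1}. f n)"
      by (rule sum.subset_diff) (use N in auto)
    thus ?thesis using N by simp
  qed
  define c where "c = B2_coeff N 1"
  have S: "(\<Sum>n\<in>{..<N} - {1, N - 1}. B2_coeff N n) = 1 / 6 - 2 * c"
    using sum_B2_coeff[OF N2] split[of "B2_coeff N"] B2_coeff_reflect[OF N2] by (simp add: c_def)
  have "- L * (1 / 6 - 2 * c) = (\<Sum>n\<in>{..<N} - {1, N - 1}. B2_coeff N n * - L)"
    unfolding sum_distrib_right[symmetric] S by (rule mult.commute)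
  also have "\<dots> \<le> (\<Sum>n\<in>{..<N} - {1, N - 1}. B2_coeff N n * T n)"
    by (intro sum_mono mult_left_mono Tge B2_coeff_nonneg)
  also have "\<dots> = - (2 * c * L)"
    using sum0 split[of "\<lambda>n. B2_coeff N n * T n"] unfolding B2_coeff_reflect[OF N2] T1 TN c_def by linarith
  finally have "(4 * c - 1 / 6) * L \<le> 0" by (simp add: algebra_simps)
  moreover have "4 * c - 1 / 6 > 0" using B2_coeff_1[OF N2] by (simp add: c_def)
  moreover have "L \<ge> 0" unfolding L_def by (intro sum_nonneg) auto
  ultimately have "L = 0" by (simp add: mult_le_0_iff)
  hence A0: "A (int x) = 0" if "x < N" for x
    using that unfolding L_def by (subst (asm) sum_nonneg_eq_0_iff) auto
  have jN: "j < N" using j N by auto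
  have "A (int j) = (\<Sum>i=1..N div 2. if i = j then a j * (1 + (if int N dvd - int j - int j then 1 else 0)) else 0)"
    unfolding A_def
  proof (rule sum.cong[OF refl])
    fix i assume i: "i \<in> {1..N div 2}"
    have 1: "int N dvd int i - int j \<longleftrightarrow> i = j"
    proof -
      have "i < N" using i N by auto
      hence "int i mod int N = int i" "int j mod int N = int j" using jN by auto
      thus ?thesis by (simp add: mod_eq_dvd_iff[symmetric])
    qed
    have 2: "i = j" if d: "int N dvd - int i - int j"
    proof -
      have "- int i - int j = - int (i + j)" by simp
      hence "int N dvd int (i + j)" using d by (simp only: dvd_minus_iff)
      hence "N \<le> i + j" using i by (intro dvd_imp_le) (simp_all only: int_dvd_int_iff, auto)
      thus ?thesis using i j by auto
    qed
    show "a i * ((if int N dvd int i - int j then 1 else 0) + (if int N dvd - int i - int j then 1 else 0)) =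
        (if i = j then a j * (1 + (if int N dvd - int j - int j then 1 else 0)) else 0)"
      using 1 2 by auto
  qed
  also have "\<dots> = a j * (1 + (if int N dvd - int j - int j then 1 else 0))" using j by simp
  finally have "a j = 0" using A0[OF jN] by (auto split: if_splits)
  thus ?thesis by (simp add: a_def)
qed

text \<open>Every fraction r/N in lowest terms b'/g belongs to a cusp with gcd g, hence to one of
  the orbits. Equality of the orders at all representatives therefore says that the difference of
  the exponents annihilates B_2(<j r/N>) for every r, a relation at the single level N.\<close>

theorem cusp_order_inj:
  fixes a b :: "int vec"
  assumes N: "N \<ge> 5" and c: "cusp_orbit_representatives N c"
    and eq: "\<And>i. i \<le> N div 2 \<Longrightarrow> cusp_order N k a (c i) = cusp_order N k b (c i)"
    and j: "j \<in> {1..N div 2}"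
  shows "a $ (j - 1) = b $ (j - 1)"
proof -
  define \<alpha> where "\<alpha> j = (of_int (a $ (j - 1)) - of_int (b $ (j - 1)) :: rat)" for j
  have N0: "N > 0" using N by simp
  have "(\<Sum>j=1..N div 2. \<alpha> j * periodic_B2 N (int j * r)) = 0" for r
  proof -
    define d where "d = gcd r (int N)"
    have d0: "d > 0" using N0 by (simp add: d_def)
    have "d dvd r" "d dvd int N" by (simp_all add: d_def)
    then obtain b' g where b': "r = d * b'" and g: "int N = d * g" by (elim dvdE)
    have "d * g > 0" using N0 g by simp
    hence g0: "g > 0" using d0 by (simp add: zero_less_mult_iff)
    have "d * gcd b' g = gcd (d * b') (d * g)" using d0 by (simp add: gcd_mult_distrib_int[symmetric])
    also have "\<dots> = d" by (simp only: b'[symmetric] g[symmetric] d_def[symmetric])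
    finally have "d * gcd b' g = d" .
    hence cop: "coprime b' g" using d0 by (simp add: coprime_iff_gcd_eq_1)
    have gN: "gcd g (int N) = g" using g g0 by (simp add: gcd_proj1_iff)
    have cop': "coprime b' (gcd g (int N))" using cop gN by simp
    from cusp_residue_in_residues[OF N0 cop']
    have res: "(b' mod g, g mod int N) \<in> cusp_residues N" by (simp add: cusp_residue_def gN)
    obtain i where i: "i \<le> N div 2" "cusp_class N (b' mod g, g mod int N) \<in> orbit_set N (fst (c i)) (cusp_gcd N (c i))"
      using orbit_attained[OF N c res] by blast
    obtain e where e: "e \<in> {1, -1}" "gcd (g mod int N) (int N) = cusp_gcd N (c i)" "[b' mod g = e * fst (c i)] (mod cusp_gcd N (c i))"
      using orbit_set_mem[OF N0 res i(2)] by blast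
    have gi: "cusp_gcd N (c i) = g" using e(2) unfolding gcd_mod_int gN by simp
    have pB: "periodic_B2 N (int j * r) = periodic_B2 (nat g) (int j * fst (c i))" for j
    proof -
      have Neq: "N = nat g * nat d" using g g0 d0 by (simp add: nat_mult_distrib[symmetric] mult.commute)
      have "periodic_B2 N (int j * r) = periodic_B2 (nat g * nat d) ((int j * b') * int (nat d))"
      proof -
        have "int j * r = (int j * b') * int (nat d)" using d0 by (simp add: b' mult_ac)
        thus ?thesis by (simp only: Neq[symmetric])
      qed
      also have "\<dots> = periodic_B2 (nat g) (int j * b')" by (rule periodic_B2_mult_right) (use d0 in simp)
      also have "\<dots> = periodic_B2 (nat g) (e * (int j * fst (c i)))"
      proof (rule periodic_B2_mod)
        have "[b' = e * fst (c i)] (mod g)" using e(3) unfolding gi by simp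
        from cong_mult[OF cong_refl this, of "int j"]
        show "(int j * b') mod int (nat g) = (e * (int j * fst (c i))) mod int (nat g)"
          using g0 by (simp add: cong_def mult_ac)
      qed
      also have "\<dots> = periodic_B2 (nat g) (int j * fst (c i))"
        using e(1) g0 periodic_B2_minus[of "nat g" "int j * fst (c i)"] by auto
      finally show ?thesis .
    qed
    obtain p s where ps: "c i = (p, s)" by (cases "c i")
    have gs: "gcd s (int N) = g" using gi by (simp add: ps cusp_gcd_def)
    have "(\<Sum>j=1..N div 2. of_int (a $ (j - 1)) * (of_nat (nat g) / 2 * periodic_B2 (nat g) (int j * p))) =
        (\<Sum>j=1..N div 2. of_int (b $ (j - 1)) * (of_nat (nat g) / 2 * periodic_B2 (nat g) (int j * p)))"
      using eq[OF i(1)] unfolding ps cusp_order_def prod.case Let_def gs by simp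
    hence "(\<Sum>j=1..N div 2. of_nat (nat g) / 2 * (\<alpha> j * periodic_B2 (nat g) (int j * p))) = 0"
      by (simp add: \<alpha>_def algebra_simps sum_subtractf)
    hence "(\<Sum>j=1..N div 2. \<alpha> j * periodic_B2 (nat g) (int j * p)) = 0"
      unfolding sum_distrib_left[symmetric] using g0 by simp
    thus ?thesis unfolding pB by (simp add: ps)
  qed
  hence "\<alpha> j = 0" using periodic_B2_independent[of N \<alpha>, OF _ _ j] N by simp
  thus ?thesis by (simp add: \<alpha>_def)
qed

section \<open>The lattice of exponent vectors\<close>

lemma exponent_sum_add:
  assumes "a \<in> carrier_vec (N div 2)" "b \<in> carrier_vec (N div 2)"
  shows "exponent_sum N n (a + b) = exponent_sum N n a + exponent_sum N n b"
proof -
  have "(a + b) $ (j - 1) = a $ (j - 1) + b $ (j - 1)" if "j \<in> {1..N div 2}" for j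
    using assms that by auto
  thus ?thesis by (simp add: exponent_sum_def sum.distrib distrib_left)
qed

lemma exponent_sum_smult:
  assumes "a \<in> carrier_vec (N div 2)"
  shows "exponent_sum N n (c \<cdot>\<^sub>v a) = c * exponent_sum N n a"
proof -
  have "(c \<cdot>\<^sub>v a) $ (j - 1) = c * a $ (j - 1)" if "j \<in> {1..N div 2}" for j
    using assms that by auto
  thus ?thesis by (simp add: exponent_sum_def sum_distrib_left mult_ac)
qed

lemma exponent_sum_mult_mat_vec:
  assumes "B \<in> carrier_mat (N div 2) l" "x \<in> carrier_vec l"
  shows "exponent_sum N n (B *\<^sub>v x) = (\<Sum>c<l. x $ c * exponent_sum N n (col B c))"
proof -
  have "(B *\<^sub>v x) $ (j - 1) = (\<Sum>c<l. col B c $ (j - 1) * x $ c)" if "j \<in> {1..N div 2}" for j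
    unfolding lessThan_atLeast0 using assms that by (auto simp: scalar_prod_def intro!: sum.cong)
  hence "exponent_sum N n (B *\<^sub>v x) = (\<Sum>j=1..N div 2. \<Sum>c<l. int j ^ n * (col B c $ (j - 1) * x $ c))"
    by (simp add: exponent_sum_def sum_distrib_left)
  also have "\<dots> = (\<Sum>c<l. \<Sum>j=1..N div 2. int j ^ n * (col B c $ (j - 1) * x $ c))"
    by (rule sum.swap)
  finally show ?thesis by (simp add: exponent_sum_def sum_distrib_left mult_ac)
qed

text \<open>The moments of order 1 and 2 have the same parity. For odd N this makes the factor 2
  automatic; for even N an even second moment makes the first one even, so that N times it is
  divisible by 2N. This is where the modulus M = N gcd(2, N) of B_N comes from.\<close>

lemma weight_congruences_iff_dvd:
  "weight_congruences N k a \<longleftrightarrow> 12 dvd int k + exponent_sum N 0 a \<and> int (N * gcd 2 N) dvd exponent_sum N 2 a"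
proof -
  define t u where "t = exponent_sum N 2 a" and "u = exponent_sum N 1 a"
  have tu: "even (t - u)" unfolding t_def u_def by (rule even_exponent_sum_diff)
  have "2 * int N dvd t - int N * u \<longleftrightarrow> int (N * gcd 2 N) dvd t"
  proof (cases "even N")
    case True
    hence "even (int N)" by simp
    then obtain n where n: "int N = 2 * n" by (elim evenE)
    have M: "int (N * gcd 2 N) = 2 * int N" using True by (simp add: gcd_proj1_iff)
    have d: "2 * int N dvd int N * u" if "even t"
    proof -
      have "even u" using tu \<open>even t\<close> by simp
      then obtain w where "u = 2 * w" by (elim evenE)
      thus ?thesis by simp
    qed
    show ?thesis unfolding M
    proof
      assume A: "2 * int N dvd t - int N * u"
      hence "2 dvd t - int N * u" by (rule dvd_trans[rotated]) simp
      hence "even t" using n by simp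
      from dvd_add[OF A d[OF this]] show "2 * int N dvd t" by simp
    next
      assume A: "2 * int N dvd t"
      hence "2 dvd t" by (rule dvd_trans[rotated]) simp
      from dvd_diff[OF A d[OF this]] show "2 * int N dvd t - int N * u" .
    qed
  next
    case False
    hence cop: "coprime 2 (int N)" by simp
    have "coprime 2 N" using False by simp
    hence M: "int (N * gcd 2 N) = int N" by simp
    have e: "even (t - int N * u)" using tu False by simp
    show ?thesis unfolding M
    proof
      assume "2 * int N dvd t - int N * u"
      hence "int N dvd t - int N * u" by (rule dvd_mult_right)
      from dvd_add[OF this, of "int N * u"] show "int N dvd t" by simp
    next
      assume "int N dvd t"
      hence "int N dvd t - int N * u" by simp
      thus "2 * int N dvd t - int N * u" using e cop by (intro divides_mult) auto
    qed
  qed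
  thus ?thesis by (simp add: weight_congruences_def t_def u_def)
qed

lemma sum_delta_int: "(j :: nat) \<in> {1..m} \<Longrightarrow> (\<Sum>i=1..m. f i * (if i = j then c else 0)) = (f j * c :: int)"
proof -
  assume j: "j \<in> {1..m}"
  have "(\<Sum>i=1..m. f i * (if i = j then c else 0)) = (\<Sum>i=1..m. if i = j then f i * c else 0)"
    by (intro sum.cong) auto
  also have "\<dots> = f j * c" using j by (subst sum.delta) auto
  finally show ?thesis .
qed

lemma exponent_sum_std_vec:
  assumes "j \<in> {1..N div 2}"
  shows "exponent_sum N n (std_vec (N div 2) j) = int j ^ n"
proof -
  have "exponent_sum N n (std_vec (N div 2) j) = (\<Sum>i=1..N div 2. int i ^ n * (if i = j then 1 else 0))"
    unfolding exponent_sum_def std_vec_def by (intro sum.cong refl) (use assms in auto)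
  thus ?thesis using sum_delta_int[OF assms] by simp
qed

lemma std_vec_carrier [simp]: "std_vec m j \<in> carrier_vec m"
  by (simp add: std_vec_def)

lemma std_vec_index: "i < m \<Longrightarrow> j \<ge> 1 \<Longrightarrow> std_vec m j $ i = (if Suc i = j then 1 else 0)"
  by (cases j) (simp_all add: std_vec_def unit_vec_def)

lemma a_one_carrier: "a_one N \<in> carrier_vec (N div 2)"
proof (cases "N = 5")
  case True
  thus ?thesis by (intro carrier_vecI) (simp add: a_one_def)
next
  case False
  thus ?thesis unfolding a_one_def by (simp only: if_False vec_carrier)
qed

lemma exponent_sum_a_one:
  assumes "N \<ge> 5"
  shows "exponent_sum N 0 (a_one N) = - 1"
    "exponent_sum N 1 (a_one N) = (if N = 5 then 1 else 0)" "exponent_sum N 2 (a_one N) = (if N = 5 then 5 else 0)"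
proof -
  have *: "exponent_sum N n (a_one N) = (if N = 5 then - 3 + 2 * 2 ^ n else - 3 + 3 * 2 ^ n - 3 ^ n)" for n
  proof (cases "N = 5")
    case True
    have "{1..2 :: nat} = {1, 2}" by auto
    thus ?thesis using True by (simp add: exponent_sum_def a_one_def)
  next
    case False
    hence m: "N div 2 \<ge> 3" using assms by simp
    have "exponent_sum N n (a_one N) = (\<Sum>j\<in>{1, 2, 3}. int j ^ n * a_one N $ (j - 1))"
      unfolding exponent_sum_def
    proof (rule sum.mono_neutral_right)
      show "\<forall>j\<in>{1..N div 2} - {1, 2, 3}. int j ^ n * a_one N $ (j - 1) = 0"
      proof
        fix j assume "j \<in> {1..N div 2} - {1, 2, 3}"
        hence "j - 1 < N div 2" "j - 1 \<noteq> 0" "j - 1 \<noteq> 1" "j - 1 \<noteq> 2" by auto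
        thus "int j ^ n * a_one N $ (j - 1) = 0" using False by (simp add: a_one_def)
      qed
    qed (use m in auto)
    thus ?thesis using m False by (simp add: a_one_def)
  qed
  show "exponent_sum N 0 (a_one N) = - 1" "exponent_sum N 1 (a_one N) = (if N = 5 then 1 else 0)"
    "exponent_sum N 2 (a_one N) = (if N = 5 then 5 else 0)" by (simp_all add: *)
qed

text \<open>The vector k a^(1) cancels the inhomogeneous part exactly, not merely modulo 12 and 2N:
  its moment of order 0 is -k, and its second moment minus N times the first is 0, for N = 5 in the
  form 5 - 5.\<close>

lemma weight_congruences_shift:
  assumes "N \<ge> 5" "b \<in> carrier_vec (N div 2)"
  shows "weight_congruences N k (int k \<cdot>\<^sub>v a_one N + b) \<longleftrightarrow> weight_congruences N 0 b"
proof -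
  have c: "int k \<cdot>\<^sub>v a_one N \<in> carrier_vec (N div 2)" using a_one_carrier by simp
  have e: "exponent_sum N n (int k \<cdot>\<^sub>v a_one N + b) = int k * exponent_sum N n (a_one N) + exponent_sum N n b" for n
    using exponent_sum_add[OF c assms(2)] exponent_sum_smult[OF a_one_carrier] by simp
  show ?thesis
    unfolding weight_congruences_def e exponent_sum_a_one[OF assms(1)]
    by (cases "N = 5") (simp_all add: algebra_simps)
qed

section \<open>Lattices spanned by the columns of a matrix\<close>

definition lattice_span :: "int mat \<Rightarrow> int vec set" where
  "lattice_span B = {B *\<^sub>v x | x. x \<in> carrier_vec (dim_col B)}"

lemma lattice_spanI: "B *\<^sub>v x = v \<Longrightarrow> x \<in> carrier_vec (dim_col B) \<Longrightarrow> v \<in> lattice_span B"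
  unfolding lattice_span_def by blast

lemma lattice_span_carrier: "v \<in> lattice_span B \<Longrightarrow> v \<in> carrier_vec (dim_row B)"
  unfolding lattice_span_def by (elim CollectE exE conjE) (rule carrier_vecI, simp)

lemma lattice_span_zero: "0\<^sub>v (dim_row B) \<in> lattice_span B"
proof -
  have "B *\<^sub>v 0\<^sub>v (dim_col B) = 0\<^sub>v (dim_row B)"
    by (rule eq_vecI) auto
  thus ?thesis by (rule lattice_spanI) simp
qed

lemma lattice_span_add:
  assumes "v \<in> lattice_span B" "w \<in> lattice_span B"
  shows "v + w \<in> lattice_span B"
proof -
  obtain x y where "v = B *\<^sub>v x" "w = B *\<^sub>v y" "x \<in> carrier_vec (dim_col B)" "y \<in> carrier_vec (dim_col B)"
    using assms unfolding lattice_span_def by blast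
  hence "v + w = B *\<^sub>v (x + y)" "x + y \<in> carrier_vec (dim_col B)"
    using mult_add_distrib_mat_vec[of B "dim_row B" "dim_col B" x y] by auto
  thus ?thesis unfolding lattice_span_def by blast
qed

lemma lattice_span_smult:
  assumes "v \<in> lattice_span B"
  shows "c \<cdot>\<^sub>v v \<in> lattice_span B"
proof -
  obtain x where x: "v = B *\<^sub>v x" "x \<in> carrier_vec (dim_col B)"
    using assms unfolding lattice_span_def by blast
  have "B *\<^sub>v (c \<cdot>\<^sub>v x) = c \<cdot>\<^sub>v v"
    unfolding x(1) by (rule eq_vecI) (use x(2) in auto)
  thus ?thesis by (rule lattice_spanI) (use x(2) in auto)
qed

lemma lattice_span_col:
  assumes "c < dim_col B"
  shows "col B c \<in> lattice_span B"
proof -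
  have "B *\<^sub>v unit_vec (dim_col B) c = col B c"
    by (rule eq_vecI) (use assms in auto)
  thus ?thesis by (rule lattice_spanI) simp
qed

lemma lattice_span_sum:
  fixes f :: "'a \<Rightarrow> int vec"
  assumes "finite S" "\<And>s. s \<in> S \<Longrightarrow> f s \<in> lattice_span B"
  shows "vec (dim_row B) (\<lambda>i. \<Sum>s\<in>S. c s * f s $ i) \<in> lattice_span B"
  using assms
proof (induction S rule: finite_induct)
  case empty
  have "vec (dim_row B) (\<lambda>i. \<Sum>s\<in>{}. c s * f s $ i) = 0\<^sub>v (dim_row B)" by (rule eq_vecI) auto
  thus ?case using lattice_span_zero by simp
next
  case (insert s S)
  have "dim_vec (f s) = dim_row B" using lattice_span_carrier insert.prems[of s] by auto
  hence "vec (dim_row B) (\<lambda>i. \<Sum>s\<in>insert s S. c s * f s $ i) =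
      c s \<cdot>\<^sub>v f s + vec (dim_row B) (\<lambda>i. \<Sum>s\<in>S. c s * f s $ i)"
    by (intro eq_vecI) (use insert.hyps in auto)
  thus ?case using insert by (simp add: lattice_span_add lattice_span_smult)
qed

lemma three_dvd_square_diff:
  fixes j :: nat
  shows "\<not> 3 dvd j \<Longrightarrow> 3 dvd int j ^ 2 - 4" "\<not> 3 dvd j \<Longrightarrow> 3 dvd int j ^ 2 - 1"
    "3 dvd j \<Longrightarrow> 3 dvd int j ^ 2 - int 3 ^ 2"
proof -
  show 1: "3 dvd int j ^ 2 - 1" if "\<not> 3 dvd j"
  proof -
    have "j mod 3 = 1 \<or> j mod 3 = 2" using that by presburger
    hence "int j mod 3 = 1 \<or> int j mod 3 = 2" by presburger
    moreover have "int j = 3 * (int j div 3) + int j mod 3" by simp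
    ultimately obtain q where "int j = 3 * q + 1 \<or> int j = 3 * q + 2" by metis
    thus ?thesis
    proof
      assume "int j = 3 * q + 1"
      hence "int j ^ 2 - 1 = 3 * (3 * q ^ 2 + 2 * q)" by (simp add: power2_eq_square algebra_simps)
      thus ?thesis by simp
    next
      assume "int j = 3 * q + 2"
      hence "int j ^ 2 - 1 = 3 * (3 * q ^ 2 + 4 * q + 1)" by (simp add: power2_eq_square algebra_simps)
      thus ?thesis by simp
    qed
  qed
  show "3 dvd int j ^ 2 - 4" if "\<not> 3 dvd j" using 1[OF that] by presburger
  show "3 dvd int j ^ 2 - int 3 ^ 2" if "3 dvd j"
  proof -
    from that obtain q where "j = 3 * q" by blast
    thus ?thesis by (simp add: power2_eq_square)
  qed
qed

text \<open>The columns of B_N for N \<ge> 6, where the first multiple of 3 in the range is 3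
  itself.\<close>

definition B_cols :: "nat \<Rightarrow> int vec list" where
  "B_cols N = (let m = N div 2; M = int (N * gcd 2 N); r = (2 * M) mod 3;
     a = (- M + 5 * r) div 3; b = (M - 8 * r) div 3; e = std_vec m in
     [16 \<cdot>\<^sub>v e 1 - 4 \<cdot>\<^sub>v e 2, a \<cdot>\<^sub>v e 1 + b \<cdot>\<^sub>v e 2 + r \<cdot>\<^sub>v e 3]
     @ map (\<lambda>j. ((int j ^ 2 - 4) div 3) \<cdot>\<^sub>v e 1 - ((int j ^ 2 - 1) div 3) \<cdot>\<^sub>v e 2 + e j) (filter (\<lambda>j. \<not> 3 dvd j) [3..<m + 1])
     @ [(int 3 ^ 2 - 4) \<cdot>\<^sub>v e 1 - (int 3 ^ 2 - 1) \<cdot>\<^sub>v e 2 + 3 \<cdot>\<^sub>v e 3]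
     @ map (\<lambda>j. ((int j ^ 2 - int 3 ^ 2) div 3) \<cdot>\<^sub>v (e 1 - e 2) - e 3 + e j) (filter (\<lambda>j. 3 dvd j) [4..<m + 1]))"

lemma B_mat_eq:
  assumes "N \<ge> 6"
  shows "B_mat N = mat_of_cols (N div 2) (B_cols N)" "length (B_cols N) = N div 2"
    "\<And>v. v \<in> set (B_cols N) \<Longrightarrow> v \<in> carrier_vec (N div 2)"
proof -
  have m: "N div 2 \<ge> 3" using assms by simp
  have u: "[3..<N div 2 + 1] = 3 # [4..<N div 2 + 1]" using m by (simp add: upt_conv_Cons)
  have js: "filter (\<lambda>j. 3 dvd j) [3..<N div 2 + 1] = 3 # filter (\<lambda>j. 3 dvd j) [4..<N div 2 + 1]"
    unfolding u by simp
  show "B_mat N = mat_of_cols (N div 2) (B_cols N)"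
    using assms unfolding B_mat_def B_cols_def Let_def js by simp
  have "length (filter (\<lambda>j. 3 dvd j) [3..<N div 2 + 1]) + length (filter (\<lambda>j. \<not> 3 dvd j) [3..<N div 2 + 1]) = N div 2 + 1 - 3"
    by (subst sum_length_filter_compl) (simp only: length_upt)
  thus "length (B_cols N) = N div 2"
    unfolding js using m by (simp add: B_cols_def Let_def del: upt_Suc)
  show "\<And>v. v \<in> set (B_cols N) \<Longrightarrow> v \<in> carrier_vec (N div 2)"
    unfolding B_cols_def Let_def by auto
qed

lemma B_mat_carrier:
  assumes "N \<ge> 5"
  shows "B_mat N \<in> carrier_mat (N div 2) (N div 2)"
proof (cases "N = 5")
  case True
  thus ?thesis by (intro carrier_matI) (simp_all add: B_mat_def mat_of_rows_list_def)
next
  case False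
  hence "N \<ge> 6" using assms by simp
  thus ?thesis using B_mat_eq(1,2)[of N] by (metis mat_of_cols_carrier(1))
qed

lemma exponent_sum_diff:
  assumes "a \<in> carrier_vec (N div 2)" "b \<in> carrier_vec (N div 2)"
  shows "exponent_sum N n (a - b) = exponent_sum N n a - exponent_sum N n b"
proof -
  have "(a - b) $ (j - 1) = a $ (j - 1) - b $ (j - 1)" if "j \<in> {1..N div 2}" for j
    using assms that by auto
  thus ?thesis by (simp add: exponent_sum_def sum_subtractf right_diff_distrib)
qed

lemma exponent_sum_vec_sum:
  fixes f :: "'a \<Rightarrow> int vec"
  shows "exponent_sum N n (vec (N div 2) (\<lambda>i. \<Sum>s\<in>S. c s * f s $ i)) = (\<Sum>s\<in>S. c s * exponent_sum N n (f s))"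
proof -
  have "exponent_sum N n (vec (N div 2) (\<lambda>i. \<Sum>s\<in>S. c s * f s $ i)) =
      (\<Sum>j=1..N div 2. \<Sum>s\<in>S. int j ^ n * (c s * f s $ (j - 1)))"
    unfolding exponent_sum_def by (intro sum.cong refl) (auto simp: sum_distrib_left)
  also have "\<dots> = (\<Sum>s\<in>S. \<Sum>j=1..N div 2. int j ^ n * (c s * f s $ (j - 1)))" by (rule sum.swap)
  finally show ?thesis by (simp add: exponent_sum_def sum_distrib_left mult_ac)
qed

text \<open>The moments of order 0 and 2 of the columns are (12, 0) for the first, (0, M) for the
  second and (0, 0) for all others: two columns realize the generators of the admissible moments,
  the rest lie in the common kernel.\<close>

lemma B_col_generators:
  fixes M :: int
  assumes N: "N \<ge> 6"
  defines "e \<equiv> std_vec (N div 2)" and "r \<equiv> (2 * M) mod 3"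
  shows "exponent_sum N 0 (16 \<cdot>\<^sub>v e 1 - 4 \<cdot>\<^sub>v e 2) = 12" "exponent_sum N 2 (16 \<cdot>\<^sub>v e 1 - 4 \<cdot>\<^sub>v e 2) = 0"
    "exponent_sum N 0 (((- M + 5 * r) div 3) \<cdot>\<^sub>v e 1 + ((M - 8 * r) div 3) \<cdot>\<^sub>v e 2 + r \<cdot>\<^sub>v e 3) = 0"
    "exponent_sum N 2 (((- M + 5 * r) div 3) \<cdot>\<^sub>v e 1 + ((M - 8 * r) div 3) \<cdot>\<^sub>v e 2 + r \<cdot>\<^sub>v e 3) = M"
    "exponent_sum N 0 ((int 3 ^ 2 - 4) \<cdot>\<^sub>v e 1 - (int 3 ^ 2 - 1) \<cdot>\<^sub>v e 2 + 3 \<cdot>\<^sub>v e 3) = 0"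
    "exponent_sum N 2 ((int 3 ^ 2 - 4) \<cdot>\<^sub>v e 1 - (int 3 ^ 2 - 1) \<cdot>\<^sub>v e 2 + 3 \<cdot>\<^sub>v e 3) = 0"
    "\<And>j. j \<in> {3..N div 2} \<Longrightarrow> \<not> 3 dvd j \<Longrightarrow> exponent_sum N 0 (((int j ^ 2 - 4) div 3) \<cdot>\<^sub>v e 1 - ((int j ^ 2 - 1) div 3) \<cdot>\<^sub>v e 2 + e j) = 0"
    "\<And>j. j \<in> {3..N div 2} \<Longrightarrow> \<not> 3 dvd j \<Longrightarrow> exponent_sum N 2 (((int j ^ 2 - 4) div 3) \<cdot>\<^sub>v e 1 - ((int j ^ 2 - 1) div 3) \<cdot>\<^sub>v e 2 + e j) = 0"
    "\<And>j. j \<in> {3..N div 2} \<Longrightarrow> 3 dvd j \<Longrightarrow> exponent_sum N 0 (((int j ^ 2 - int 3 ^ 2) div 3) \<cdot>\<^sub>v (e 1 - e 2) - e 3 + e j) = 0"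
    "\<And>j. j \<in> {3..N div 2} \<Longrightarrow> 3 dvd j \<Longrightarrow> exponent_sum N 2 (((int j ^ 2 - int 3 ^ 2) div 3) \<cdot>\<^sub>v (e 1 - e 2) - e 3 + e j) = 0"
proof -
  have ec: "e j \<in> carrier_vec (N div 2)" for j by (simp add: e_def)
  have ee: "exponent_sum N n (e j) = int j ^ n" if "j \<in> {1..N div 2}" for j n
    unfolding e_def by (rule exponent_sum_std_vec[OF that])
  have e123: "exponent_sum N n (e 1) = 1" "exponent_sum N n (e 2) = 2 ^ n" "exponent_sum N n (e 3) = 3 ^ n" for n
    using N by (simp_all add: ee)
  note ex = exponent_sum_add exponent_sum_diff exponent_sum_smult ec e123
  show "exponent_sum N 0 (16 \<cdot>\<^sub>v e 1 - 4 \<cdot>\<^sub>v e 2) = 12" "exponent_sum N 2 (16 \<cdot>\<^sub>v e 1 - 4 \<cdot>\<^sub>v e 2) = 0"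
    "exponent_sum N 0 ((int 3 ^ 2 - 4) \<cdot>\<^sub>v e 1 - (int 3 ^ 2 - 1) \<cdot>\<^sub>v e 2 + 3 \<cdot>\<^sub>v e 3) = 0"
    "exponent_sum N 2 ((int 3 ^ 2 - 4) \<cdot>\<^sub>v e 1 - (int 3 ^ 2 - 1) \<cdot>\<^sub>v e 2 + 3 \<cdot>\<^sub>v e 3) = 0"
    by (simp_all add: ex del: One_nat_def)
  have dv: "3 dvd - M + 5 * r" "3 dvd M - 8 * r" unfolding r_def by presburger+
  define p q where "p = (- M + 5 * r) div 3" and "q = (M - 8 * r) div 3"
  have pq: "3 * p = - M + 5 * r" "3 * q = M - 8 * r" using dv by (simp_all add: p_def q_def)
  have "exponent_sum N n (p \<cdot>\<^sub>v e 1 + q \<cdot>\<^sub>v e 2 + r \<cdot>\<^sub>v e 3) = p + q * 2 ^ n + r * 3 ^ n" for n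
    by (simp add: ex del: One_nat_def)
  from this[of 0] this[of 2] show "exponent_sum N 0 (((- M + 5 * r) div 3) \<cdot>\<^sub>v e 1 + ((M - 8 * r) div 3) \<cdot>\<^sub>v e 2 + r \<cdot>\<^sub>v e 3) = 0"
    "exponent_sum N 2 (((- M + 5 * r) div 3) \<cdot>\<^sub>v e 1 + ((M - 8 * r) div 3) \<cdot>\<^sub>v e 2 + r \<cdot>\<^sub>v e 3) = M"
    unfolding p_def[symmetric] q_def[symmetric] using pq by simp_all
  fix j assume j: "j \<in> {3..N div 2}"
  have ej: "exponent_sum N n (e j) = int j ^ n" for n using j by (intro ee) auto
  {
    assume d: "\<not> 3 dvd j"
    define s t where "s = (int j ^ 2 - 4) div 3" and "t = (int j ^ 2 - 1) div 3"
    have st: "3 * s = int j ^ 2 - 4" "3 * t = int j ^ 2 - 1"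
      using three_dvd_square_diff(1,2)[OF d] by (simp_all add: s_def t_def)
    have "exponent_sum N n (s \<cdot>\<^sub>v e 1 - t \<cdot>\<^sub>v e 2 + e j) = s - t * 2 ^ n + int j ^ n" for n
      by (simp add: ex ej del: One_nat_def)
    from this[of 0] this[of 2]
    show "exponent_sum N 0 (((int j ^ 2 - 4) div 3) \<cdot>\<^sub>v e 1 - ((int j ^ 2 - 1) div 3) \<cdot>\<^sub>v e 2 + e j) = 0"
      "exponent_sum N 2 (((int j ^ 2 - 4) div 3) \<cdot>\<^sub>v e 1 - ((int j ^ 2 - 1) div 3) \<cdot>\<^sub>v e 2 + e j) = 0"
      unfolding s_def[symmetric] t_def[symmetric] using st by simp_all
  }
  {
    assume d: "3 dvd j"
    define s where "s = (int j ^ 2 - int 3 ^ 2) div 3"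
    have st: "3 * s = int j ^ 2 - 9" using three_dvd_square_diff(3)[OF d] by (simp add: s_def)
    have "exponent_sum N n (s \<cdot>\<^sub>v (e 1 - e 2) - e 3 + e j) = s * (1 - 2 ^ n) - 3 ^ n + int j ^ n" for n
      by (simp add: ex ej del: One_nat_def)
    from this[of 0] this[of 2]
    show "exponent_sum N 0 (((int j ^ 2 - int 3 ^ 2) div 3) \<cdot>\<^sub>v (e 1 - e 2) - e 3 + e j) = 0"
      "exponent_sum N 2 (((int j ^ 2 - int 3 ^ 2) div 3) \<cdot>\<^sub>v (e 1 - e 2) - e 3 + e j) = 0"
      unfolding s_def[symmetric] using st by simp_all
  }
qed

lemma B_cols_exponent_sums:
  assumes N: "N \<ge> 6" and v: "v \<in> set (B_cols N)"
  shows "12 dvd exponent_sum N 0 v" "int (N * gcd 2 N) dvd exponent_sum N 2 v"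
proof -
  define m M where "m = N div 2" and "M = int (N * gcd 2 N)"
  define e where "e = std_vec m"
  define r where "r = (2 * M) mod 3"
  define C1 where "C1 = 16 \<cdot>\<^sub>v e 1 - 4 \<cdot>\<^sub>v e 2"
  define C2 where "C2 = ((- M + 5 * r) div 3) \<cdot>\<^sub>v e 1 + ((M - 8 * r) div 3) \<cdot>\<^sub>v e 2 + r \<cdot>\<^sub>v e 3"
  define C3 where "C3 j = ((int j ^ 2 - 4) div 3) \<cdot>\<^sub>v e 1 - ((int j ^ 2 - 1) div 3) \<cdot>\<^sub>v e 2 + e j" for j
  define C4 where "C4 = (int 3 ^ 2 - 4) \<cdot>\<^sub>v e 1 - (int 3 ^ 2 - 1) \<cdot>\<^sub>v e 2 + 3 \<cdot>\<^sub>v e 3"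
  define C5 where "C5 j = ((int j ^ 2 - int 3 ^ 2) div 3) \<cdot>\<^sub>v (e 1 - e 2) - e 3 + e j" for j
  note gen = B_col_generators(1,2)[OF N, folded m_def, folded e_def r_def, folded C1_def C2_def C4_def, folded C3_def C5_def]
    B_col_generators(3,4)[OF N, where M = M, folded m_def, folded e_def r_def, folded C1_def C2_def C4_def, folded C3_def C5_def]
    B_col_generators(5-10)[OF N, folded m_def, folded e_def r_def, folded C1_def C2_def C4_def, folded C3_def C5_def]
  have cols: "B_cols N = [C1, C2] @ map C3 (filter (\<lambda>j. \<not> 3 dvd j) [3..<m + 1]) @ [C4] @ map C5 (filter (\<lambda>j. 3 dvd j) [4..<m + 1])"
    unfolding B_cols_def Let_def C1_def C2_def C3_def C4_def C5_def e_def r_def M_def m_def by (simp only: append_assoc)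
  have "v = C1 \<or> v = C2 \<or> v = C4 \<or> (\<exists>j\<in>{3..m}. \<not> 3 dvd j \<and> v = C3 j) \<or> (\<exists>j\<in>{3..m}. 3 dvd j \<and> v = C5 j)"
    using v unfolding cols by (auto simp del: upt_Suc)
  hence "12 dvd exponent_sum N 0 v \<and> M dvd exponent_sum N 2 v"
    by (elim disjE bexE conjE) (simp_all add: gen)
  thus "12 dvd exponent_sum N 0 v" "int (N * gcd 2 N) dvd exponent_sum N 2 v" by (simp_all add: M_def)
qed

text \<open>For the converse, the moments 12 w and M y prescribe the coefficients of the first two
  columns, and the entries of b at positions j > 3, or not divisible by 3, those of the columns
  containing \<open>e j\<close>. The entry at 3 fixes the remaining coefficient z, provided that a
  divisibility by 3 holds. The resulting combination agrees with b from position 3 on and in both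
  moments.\<close>

lemma B_mat_span_iff:
  assumes N: "N \<ge> 6" and b: "b \<in> carrier_vec (N div 2)"
  shows "b \<in> lattice_span (B_mat N) \<longleftrightarrow> 12 dvd exponent_sum N 0 b \<and> int (N * gcd 2 N) dvd exponent_sum N 2 b"
proof
  note B = B_mat_eq[OF N]
  have carr: "B_mat N \<in> carrier_mat (N div 2) (N div 2)" using B_mat_carrier N by simp
  have colmem: "col (B_mat N) c \<in> set (B_cols N)" if "c < N div 2" for c
    using that B(2,3) unfolding B(1) by (metis col_mat_of_cols nth_mem)
  assume "b \<in> lattice_span (B_mat N)"
  then obtain x where x: "b = B_mat N *\<^sub>v x" "x \<in> carrier_vec (N div 2)"
    using carr unfolding lattice_span_def by auto
  show "12 dvd exponent_sum N 0 b \<and> int (N * gcd 2 N) dvd exponent_sum N 2 b"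
    unfolding x(1) exponent_sum_mult_mat_vec[OF carr x(2)]
    by (intro conjI dvd_sum dvd_mult B_cols_exponent_sums[OF N] colmem) auto
next
  note B = B_mat_eq[OF N]
  define m M where "m = N div 2" and "M = int (N * gcd 2 N)"
  have m3: "m \<ge> 3" using N by (simp add: m_def)
  assume "12 dvd exponent_sum N 0 b \<and> int (N * gcd 2 N) dvd exponent_sum N 2 b"
  then obtain w y where w: "exponent_sum N 0 b = 12 * w" and y: "exponent_sum N 2 b = M * y"
    unfolding M_def by (auto elim!: dvdE)
  define e where "e = std_vec m"
  define r where "r = (2 * M) mod 3"
  define C1 where "C1 = 16 \<cdot>\<^sub>v e 1 - 4 \<cdot>\<^sub>v e 2"
  define C2 where "C2 = ((- M + 5 * r) div 3) \<cdot>\<^sub>v e 1 + ((M - 8 * r) div 3) \<cdot>\<^sub>v e 2 + r \<cdot>\<^sub>v e 3"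
  define C3 where "C3 j = ((int j ^ 2 - 4) div 3) \<cdot>\<^sub>v e 1 - ((int j ^ 2 - 1) div 3) \<cdot>\<^sub>v e 2 + e j" for j
  define C4 where "C4 = (int 3 ^ 2 - 4) \<cdot>\<^sub>v e 1 - (int 3 ^ 2 - 1) \<cdot>\<^sub>v e 2 + 3 \<cdot>\<^sub>v e 3"
  define C5 where "C5 j = ((int j ^ 2 - int 3 ^ 2) div 3) \<cdot>\<^sub>v (e 1 - e 2) - e 3 + e j" for j
  define J where "J = {j \<in> {3..m}. \<not> 3 dvd j}"
  define K where "K = {j \<in> {4..m}. 3 dvd j}"
  have fin: "finite J" "finite K" by (simp_all add: J_def K_def)
  have J3: "j \<in> {3..m}" "\<not> 3 dvd j" if "j \<in> J" for j using that by (simp_all add: J_def)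
  have K3: "j \<in> {3..m}" "3 dvd j" if "j \<in> K" for j using that by (simp_all add: K_def)
  note gen = B_col_generators(1,2)[OF N, folded m_def, folded e_def r_def, folded C1_def C2_def C4_def, folded C3_def C5_def]
    B_col_generators(3,4)[OF N, where M = M, folded m_def, folded e_def r_def, folded C1_def C2_def C4_def, folded C3_def C5_def]
    B_col_generators(5-10)[OF N, folded m_def, folded e_def r_def, folded C1_def C2_def C4_def, folded C3_def C5_def]
  have cols: "B_cols N = [C1, C2] @ map C3 (filter (\<lambda>j. \<not> 3 dvd j) [3..<m + 1]) @ [C4] @ map C5 (filter (\<lambda>j. 3 dvd j) [4..<m + 1])"
    unfolding B_cols_def Let_def C1_def C2_def C3_def C4_def C5_def e_def r_def M_def m_def by (simp only: append_assoc)
  have span: "v \<in> lattice_span (B_mat N)" if v: "v \<in> set (B_cols N)" for v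
  proof -
    obtain c where c: "c < length (B_cols N)" "v = B_cols N ! c" using v by (metis in_set_conv_nth)
    have "col (B_mat N) c = v" unfolding B(1) c(2) using c B(3) by (intro col_mat_of_cols) auto
    moreover have "c < dim_col (B_mat N)" using c(1) unfolding B(1) by simp
    ultimately show ?thesis using lattice_span_col by metis
  qed
  have mem: "C1 \<in> set (B_cols N)" "C2 \<in> set (B_cols N)" "C4 \<in> set (B_cols N)"
    "\<And>j. j \<in> J \<Longrightarrow> C3 j \<in> set (B_cols N)" "\<And>j. j \<in> K \<Longrightarrow> C5 j \<in> set (B_cols N)"
    unfolding cols by (auto simp: J_def K_def simp del: upt_Suc)
  have dim: "dim_row (B_mat N) = m" using B_mat_carrier[of N] N by (simp add: m_def)
  define \<beta> where "\<beta> j = b $ (j - 1)" for j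
  define VJ where "VJ = vec m (\<lambda>i. \<Sum>j\<in>J. \<beta> j * C3 j $ i)"
  define VK where "VK = vec m (\<lambda>i. \<Sum>j\<in>K. \<beta> j * C5 j $ i)"
  have VJ: "VJ \<in> lattice_span (B_mat N)" unfolding VJ_def dim[symmetric]
    by (intro lattice_span_sum fin span mem)
  have VK: "VK \<in> lattice_span (B_mat N)" unfolding VK_def dim[symmetric]
    by (intro lattice_span_sum fin span mem)
  \<comment> \<open>Modulo 3, j^2 - 1 is -1 if 3 divides j and 0 otherwise. So the entries of b at
    multiples of 3 add up to moment 0 minus moment 2, which is 12 w - M y \<equiv> r y because M + r
    \<equiv> 3M \<equiv> 0. This explains the choice of r_N.\<close>
  have Z: "3 dvd b $ 2 + (\<Sum>j\<in>K. \<beta> j) - r * y"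
  proof -
    have "(\<Sum>j\<in>{j \<in> {1..m}. 3 dvd j}. \<beta> j) = b $ 2 + (\<Sum>j\<in>K. \<beta> j)"
    proof -
      have "{j \<in> {1..m}. 3 dvd j} = insert 3 K"
      proof (intro equalityI subsetI)
        fix j assume j: "j \<in> {j \<in> {1..m}. 3 dvd j}"
        hence "j = 3 \<or> j \<ge> 4" by (auto dest: dvd_imp_le)
        thus "j \<in> insert 3 K" using j by (auto simp: K_def)
      qed (use m3 in \<open>auto simp: K_def\<close>)
      moreover have "3 \<notin> K" by (simp add: K_def)
      ultimately show ?thesis using fin by (simp add: \<beta>_def numeral_2_eq_2)
    qed
    moreover have "(\<Sum>j\<in>{j \<in> {1..m}. 3 dvd j}. \<beta> j) = (\<Sum>j=1..m. if 3 dvd j then \<beta> j else 0)"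
      by (rule sum.inter_filter) simp
    ultimately have "exponent_sum N 2 b - exponent_sum N 0 b + (b $ 2 + (\<Sum>j\<in>K. \<beta> j)) =
        (\<Sum>j=1..m. (int j ^ 2 - 1) * \<beta> j + (if 3 dvd j then \<beta> j else 0))"
      by (simp add: exponent_sum_def m_def[symmetric] \<beta>_def sum.distrib sum_subtractf left_diff_distrib)
    moreover have "3 dvd (\<Sum>j=1..m. (int j ^ 2 - 1) * \<beta> j + (if 3 dvd j then \<beta> j else 0))"
    proof (rule dvd_sum)
      fix j
      show "3 dvd (int j ^ 2 - 1) * \<beta> j + (if 3 dvd j then \<beta> j else 0)"
      proof (cases "3 dvd j")
        case True
        then obtain q where "j = 3 * q" by blast
        thus ?thesis using True by (simp add: algebra_simps power2_eq_square)
      next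
        case False
        thus ?thesis using three_dvd_square_diff(2)[OF False] by simp
      qed
    qed
    ultimately have 1: "3 dvd M * y - 12 * w + (b $ 2 + (\<Sum>j\<in>K. \<beta> j))" by (simp add: w y)
    have "3 dvd M + r" unfolding r_def by presburger
    hence "3 dvd (M + r) * y" by simp
    from dvd_add[OF dvd_diff[OF 1 this], of "12 * w"]
    have "3 dvd (M * y - 12 * w + (b $ 2 + (\<Sum>j\<in>K. \<beta> j))) - (M + r) * y + 12 * w" by simp
    thus ?thesis by (simp add: algebra_simps)
  qed
  then obtain z where z: "b $ 2 + (\<Sum>j\<in>K. \<beta> j) - r * y = 3 * z" by blast
  define V where "V = w \<cdot>\<^sub>v C1 + y \<cdot>\<^sub>v C2 + z \<cdot>\<^sub>v C4 + VJ + VK"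
  have V: "V \<in> lattice_span (B_mat N)" unfolding V_def
    by (intro lattice_span_add lattice_span_smult span mem VJ VK)
  have Vc: "V \<in> carrier_vec (N div 2)" using lattice_span_carrier[OF V] dim by (simp add: m_def)
  have cc: "C1 \<in> carrier_vec m" "C2 \<in> carrier_vec m" "C4 \<in> carrier_vec m" "VJ \<in> carrier_vec m" "VK \<in> carrier_vec m"
    using mem(1-3) B(3) by (auto simp: m_def VJ_def VK_def)
  have exV: "exponent_sum N n V = w * exponent_sum N n C1 + y * exponent_sum N n C2 + z * exponent_sum N n C4 +
      (\<Sum>j\<in>J. \<beta> j * exponent_sum N n (C3 j)) + (\<Sum>j\<in>K. \<beta> j * exponent_sum N n (C5 j))" for n
    unfolding V_def using cc
    by (simp add: m_def exponent_sum_add exponent_sum_smult VJ_def VK_def exponent_sum_vec_sum)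
  have ex0: "exponent_sum N 0 V = exponent_sum N 0 b"
    unfolding exV gen w using gen(7)[OF J3] gen(9)[OF K3] by simp
  have ex2: "exponent_sum N 2 V = exponent_sum N 2 b"
    unfolding exV gen y using gen(8)[OF J3] gen(10)[OF K3] by simp
  have ei: "e j $ i = (if Suc i = j then 1 else 0)" if "i < m" "j \<ge> 1" for i j
    unfolding e_def by (rule std_vec_index[OF that])
  have ed: "dim_vec (e j) = m" for j unfolding e_def using std_vec_carrier[of m j] by (simp only: carrier_vecD)
  have comp: "V $ i = b $ i" if i: "i < m" "i \<ge> 2" for i
  proof -
    have c: "C1 $ i = 0" "C2 $ i = (if i = 2 then r else 0)" "C4 $ i = (if i = 2 then 3 else 0)"
      using i by (auto simp: C1_def C2_def C4_def ed ei)
    have c3: "C3 j $ i = (if j = Suc i then 1 else 0)" if "j \<in> J" for j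
      using i J3[OF that] by (auto simp: C3_def ed ei)
    have c5: "C5 j $ i = (if j = Suc i then 1 else 0) - (if i = 2 then 1 else 0)" if "j \<in> K" for j
      using i K3[OF that] by (auto simp: C5_def ed ei)
    have "VJ $ i = (\<Sum>j\<in>J. if j = Suc i then \<beta> j else 0)"
      unfolding VJ_def using i by (auto intro!: sum.cong simp: c3)
    hence vj: "VJ $ i = (if Suc i \<in> J then b $ i else 0)" using fin by (simp add: \<beta>_def)
    have "VK $ i = (\<Sum>j\<in>K. (if j = Suc i then \<beta> j else 0) - (if i = 2 then \<beta> j else 0))"
      unfolding VK_def using i by (auto intro!: sum.cong simp: c5)
    hence vk: "VK $ i = (if Suc i \<in> K then b $ i else 0) - (if i = 2 then (\<Sum>j\<in>K. \<beta> j) else 0)"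
      using fin by (simp add: \<beta>_def sum_subtractf)
    have "V $ i = w * C1 $ i + y * C2 $ i + z * C4 $ i + VJ $ i + VK $ i"
      unfolding V_def using i cc by simp
    also have "\<dots> = b $ i"
    proof (cases "i = 2")
      case True
      thus ?thesis using z unfolding c vj vk by (simp add: J_def K_def algebra_simps)
    next
      case False
      hence "(Suc i \<in> J) \<noteq> (Suc i \<in> K)" using i by (auto simp: J_def K_def)
      thus ?thesis using False unfolding c vj vk by auto
    qed
    finally show ?thesis .
  qed
  \<comment> \<open>The difference lives on the first two positions, where the moments of order 0
    and 2 form a system of determinant 3.\<close>
  define d where "d = b - V"
  have exd: "exponent_sum N n d = d $ 0 + 2 ^ n * d $ 1" for n
  proof -
    have "exponent_sum N n d = (\<Sum>j\<in>{1, 2}. int j ^ n * d $ (j - 1))"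
      unfolding exponent_sum_def
    proof (rule sum.mono_neutral_right)
      show "\<forall>j\<in>{1..N div 2} - {1, 2}. int j ^ n * d $ (j - 1) = 0"
      proof
        fix j assume "j \<in> {1..N div 2} - {1, 2}"
        hence "j - 1 < m" "j - 1 \<ge> 2" by (auto simp: m_def)
        thus "int j ^ n * d $ (j - 1) = 0" using comp[of "j - 1"] b Vc by (simp add: d_def m_def)
      qed
    qed (use m3 in \<open>auto simp: m_def\<close>)
    thus ?thesis by simp
  qed
  have "exponent_sum N n d = exponent_sum N n b - exponent_sum N n V" for n
    unfolding d_def by (rule exponent_sum_diff[OF b Vc])
  hence "d $ 0 + 2 ^ 0 * d $ 1 = 0" "d $ 0 + 2 ^ 2 * d $ 1 = 0"
    using ex0 ex2 exd[of 0] exd[of 2] by simp_all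
  hence d0: "d $ 0 = 0" "d $ 1 = 0" by simp_all
  have "b = V"
  proof (rule eq_vecI)
    fix i assume "i < dim_vec V"
    hence i: "i < m" using Vc by (simp add: m_def)
    show "b $ i = V $ i"
    proof (cases "i \<ge> 2")
      case True
      thus ?thesis using comp[OF i] by simp
    next
      case False
      hence "i = 0 \<or> i = 1" by auto
      hence "d $ i = 0" using d0 by auto
      thus ?thesis using i b Vc by (simp add: d_def m_def)
    qed
  qed (use b Vc in simp)
  thus "b \<in> lattice_span (B_mat N)" using V by simp
qed

text \<open>For N = 5 there is no third position to absorb a residue modulo 3. Subtracting the two
  moments shows instead that the quotient of the second one by 5 is divisible by 3, which matches
  the determinant 60 of the matrix.\<close>

lemma B_mat_span_iff_5:
  assumes b: "b \<in> carrier_vec 2"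
  shows "b \<in> lattice_span (B_mat 5) \<longleftrightarrow> 12 dvd exponent_sum 5 0 b \<and> 5 dvd exponent_sum 5 2 b"
proof -
  have B: "B_mat 5 = mat_of_rows_list 2 [[16, -5], [-4, 5]]" by (simp add: B_mat_def)
  have dims: "dim_row (B_mat 5) = 2" "dim_col (B_mat 5) = 2" unfolding B by (simp_all add: mat_of_rows_list_def)
  have "{1..2 :: nat} = {1, 2}" by auto
  hence ex: "exponent_sum 5 n b = b $ 0 + 2 ^ n * b $ 1" for n by (simp add: exponent_sum_def)
  have two: "{0..<2 :: nat} = {0, 1}" by auto
  have Bx: "(B_mat 5 *\<^sub>v x) $ 0 = 16 * x $ 0 - 5 * x $ 1" "(B_mat 5 *\<^sub>v x) $ 1 = - 4 * x $ 0 + 5 * x $ 1"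
    if "x \<in> carrier_vec 2" for x
    using that dims by (simp_all add: scalar_prod_def two) (simp_all add: B mat_of_rows_list_def)
  show ?thesis
  proof
    assume "b \<in> lattice_span (B_mat 5)"
    then obtain x where x: "b = B_mat 5 *\<^sub>v x" "x \<in> carrier_vec 2"
      unfolding lattice_span_def dims by blast
    have "exponent_sum 5 0 b = 12 * x $ 0" "exponent_sum 5 2 b = 5 * (3 * x $ 1)"
      unfolding ex unfolding x(1) Bx[OF x(2)] by simp_all
    thus "12 dvd exponent_sum 5 0 b \<and> 5 dvd exponent_sum 5 2 b" by (metis dvd_triv_left)
  next
    assume "12 dvd exponent_sum 5 0 b \<and> 5 dvd exponent_sum 5 2 b"
    then obtain w v where wv: "b $ 0 + b $ 1 = 12 * w" "b $ 0 + 4 * b $ 1 = 5 * v"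
      unfolding ex by (auto elim!: dvdE)
    have "5 * v = (b $ 0 + b $ 1) + 3 * b $ 1" unfolding wv(2)[symmetric] by simp
    hence "5 * v = 3 * (b $ 1 + 4 * w)" unfolding wv(1) by simp
    hence "3 dvd v" by presburger
    then obtain y where "v = 3 * y" by blast
    hence b01: "b $ 0 = 16 * w - 5 * y" "b $ 1 = - 4 * w + 5 * y" using wv by simp_all
    define x where "x = vec 2 (\<lambda>i. if i = 0 then w else y)"
    have x: "x \<in> carrier_vec 2" "x $ 0 = w" "x $ 1 = y" by (simp_all add: x_def)
    have "B_mat 5 *\<^sub>v x = b"
    proof (rule eq_vecI)
      fix i assume "i < dim_vec b"
      hence "i = 0 \<or> i = 1" using b by auto
      thus "(B_mat 5 *\<^sub>v x) $ i = b $ i" using Bx[OF x(1)] b01 x by auto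
    qed (use b dims in simp)
    thus "b \<in> lattice_span (B_mat 5)" by (rule lattice_spanI) (simp add: dims x)
  qed
qed

theorem weight_congruences_iff_lattice:
  assumes N: "N \<ge> 5" and a: "a \<in> carrier_vec (N div 2)"
  shows "weight_congruences N k a \<longleftrightarrow>
    (\<exists>x\<in>carrier_vec (N div 2). a = int k \<cdot>\<^sub>v a_one N + B_mat N *\<^sub>v x)"
proof -
  define b where "b = a - int k \<cdot>\<^sub>v a_one N"
  have b: "b \<in> carrier_vec (N div 2)" unfolding b_def by (rule carrier_vecI) (use a_one_carrier[of N] in simp)
  have ab: "a = int k \<cdot>\<^sub>v a_one N + b" unfolding b_def using a a_one_carrier[of N] by (intro eq_vecI) auto
  have dims: "dim_row (B_mat N) = N div 2" "dim_col (B_mat N) = N div 2" using B_mat_carrier[OF N] by auto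
  have "weight_congruences N k a \<longleftrightarrow> weight_congruences N 0 b"
    unfolding ab by (rule weight_congruences_shift[OF N b])
  also have "\<dots> \<longleftrightarrow> b \<in> lattice_span (B_mat N)"
  proof (cases "N = 5")
    case True
    thus ?thesis using B_mat_span_iff_5[of b] b unfolding weight_congruences_iff_dvd by simp
  next
    case False
    thus ?thesis using B_mat_span_iff[OF _ b] N unfolding weight_congruences_iff_dvd by simp
  qed
  also have "\<dots> \<longleftrightarrow> (\<exists>x\<in>carrier_vec (N div 2). a = int k \<cdot>\<^sub>v a_one N + B_mat N *\<^sub>v x)"
  proof -
    have "b = v \<longleftrightarrow> a = int k \<cdot>\<^sub>v a_one N + v" if "v \<in> carrier_vec (N div 2)" for v
    proof
      assume "a = int k \<cdot>\<^sub>v a_one N + v"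
      thus "b = v" unfolding b_def using that a_one_carrier[of N] by (intro eq_vecI) auto
    qed (use ab in simp)
    moreover have "B_mat N *\<^sub>v x \<in> carrier_vec (N div 2)" for x by (rule carrier_vecI) (simp add: dims)
    ultimately show ?thesis unfolding lattice_span_def dims by blast
  qed
  finally show ?thesis .
qed

section \<open>The counting recursion\<close>

text \<open>The entry n i plays the role of the order at the i-th representative. Fixing the values
  from j on to be 0 makes tuples of different lengths comparable and equality of functions the
  equality of tuples.\<close>

definition solutions ::
  "('g, 'b) monoid_scheme \<Rightarrow> (nat \<Rightarrow> nat) \<Rightarrow> (nat \<Rightarrow> 'g) \<Rightarrow> nat \<Rightarrow> int \<Rightarrow> 'g \<Rightarrow> (nat \<Rightarrow> nat) set" where
  "solutions G \<mu> \<gamma> j S \<rho> = {n. (\<forall>i\<ge>j. n i = 0) \<and> (\<Sum>i<j. int (\<mu> i * n i)) = S \<and>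
     finprod G (\<lambda>i. \<gamma> i [^]\<^bsub>G\<^esub> n i) {..<j} = \<rho>}"

text \<open>Either n j = 0, or decreasing n j by one gives a solution with the sum lowered by
  \<mu>_j and the group element divided by \<gamma>_j. These are the two terms of the
  recursion.\<close>

lemma solutions_Suc:
  assumes G: "comm_group G" and \<gamma>: "\<And>i. i < Suc j \<Longrightarrow> \<gamma> i \<in> carrier G" and \<rho>: "\<rho> \<in> carrier G"
  shows "solutions G \<mu> \<gamma> (Suc j) S \<rho> = solutions G \<mu> \<gamma> j S \<rho> \<union>
    (\<lambda>n. n(j := Suc (n j))) ` solutions G \<mu> \<gamma> (Suc j) (S - int (\<mu> j)) (\<rho> \<otimes>\<^bsub>G\<^esub> inv\<^bsub>G\<^esub> \<gamma> j)"
    (is "_ = ?A \<union> ?f ` ?B")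
proof -
  interpret comm_group G by (rule G)
  have fin: "finprod G (\<lambda>i. \<gamma> i [^]\<^bsub>G\<^esub> n i) {..<Suc j} = \<gamma> j [^]\<^bsub>G\<^esub> n j \<otimes>\<^bsub>G\<^esub> finprod G (\<lambda>i. \<gamma> i [^]\<^bsub>G\<^esub> n i) {..<j}" for n :: "nat \<Rightarrow> nat"
    unfolding lessThan_Suc by (rule finprod_insert) (use \<gamma> in auto)
  have fc: "finprod G (\<lambda>i. \<gamma> i [^]\<^bsub>G\<^esub> n i) {..<j} \<in> carrier G" for n :: "nat \<Rightarrow> nat"
    by (rule finprod_closed) (use \<gamma> in auto)
  have gj: "\<gamma> j \<in> carrier G" using \<gamma> by simp
  have fupd: "finprod G (\<lambda>i. \<gamma> i [^]\<^bsub>G\<^esub> (n(j := x)) i) {..<j} = finprod G (\<lambda>i. \<gamma> i [^]\<^bsub>G\<^esub> n i) {..<j}" for n :: "nat \<Rightarrow> nat" and x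
    by (rule finprod_cong') (use \<gamma> in auto)
  have step: "?f n \<in> solutions G \<mu> \<gamma> (Suc j) S \<rho> \<longleftrightarrow> n \<in> ?B" for n
  proof -
    let ?P = "finprod G (\<lambda>i. \<gamma> i [^]\<^bsub>G\<^esub> n i) {..<Suc j}"
    have Pc: "?P \<in> carrier G" unfolding fin using fc gj by simp
    have "finprod G (\<lambda>i. \<gamma> i [^]\<^bsub>G\<^esub> ?f n i) {..<Suc j} = ?P \<otimes>\<^bsub>G\<^esub> \<gamma> j"
      unfolding fin fupd using fc[of n] gj by (simp add: m_ac)
    hence "finprod G (\<lambda>i. \<gamma> i [^]\<^bsub>G\<^esub> ?f n i) {..<Suc j} = \<rho> \<longleftrightarrow> ?P = \<rho> \<otimes>\<^bsub>G\<^esub> inv\<^bsub>G\<^esub> \<gamma> j"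
      using Pc gj \<rho> by (metis inv_solve_right)
    moreover have "(\<Sum>i<Suc j. int (\<mu> i * ?f n i)) = S \<longleftrightarrow> (\<Sum>i<Suc j. int (\<mu> i * n i)) = S - int (\<mu> j)"
      by (auto simp: algebra_simps)
    moreover have "(\<forall>i\<ge>Suc j. ?f n i = 0) \<longleftrightarrow> (\<forall>i\<ge>Suc j. n i = 0)" by auto
    ultimately show ?thesis unfolding solutions_def by blast
  qed
  show ?thesis
  proof (intro equalityI subsetI)
    fix n assume n: "n \<in> solutions G \<mu> \<gamma> (Suc j) S \<rho>"
    show "n \<in> ?A \<union> ?f ` ?B"
    proof (cases "n j")
      case 0
      have "\<forall>i\<ge>j. n i = 0" using n 0 unfolding solutions_def
        by (metis (mono_tags, lifting) le_neq_implies_less mem_Collect_eq Suc_leI)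
      hence "n \<in> ?A" using n fin[of n] fc[of n] 0 unfolding solutions_def by simp
      thus ?thesis by simp
    next
      case (Suc x)
      hence eq: "n = ?f (n(j := x))" by auto
      hence "n(j := x) \<in> ?B" using n step by metis
      thus ?thesis using eq by blast
    qed
  next
    fix n assume "n \<in> ?A \<union> ?f ` ?B"
    thus "n \<in> solutions G \<mu> \<gamma> (Suc j) S \<rho>"
    proof
      assume n: "n \<in> ?A"
      hence "n j = 0" by (simp add: solutions_def)
      thus ?thesis using n fin[of n] fc[of n] unfolding solutions_def by simp
    next
      assume "n \<in> ?f ` ?B"
      thus ?thesis using step by blast
    qed
  qed
qed

text \<open>Induction on j with an inner induction on S, which drops by \<mu>_j > 0. For S < 0 both
  sides vanish because the weighted sum is nonnegative. Finiteness is carried along for the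
  cardinality of the disjoint union.\<close>

theorem D_count_eq_card_solutions:
  assumes G: "comm_group G" and "\<And>i. i < j \<Longrightarrow> \<mu> i > 0" and "\<And>i. i < j \<Longrightarrow> \<gamma> i \<in> carrier G" and "\<rho> \<in> carrier G"
  shows "finite (solutions G \<mu> \<gamma> j S \<rho>) \<and> D_count G \<mu> \<gamma> j S \<rho> = card (solutions G \<mu> \<gamma> j S \<rho>)"
  using assms(2-)
proof (induction j arbitrary: S \<rho>)
  case 0
  have "solutions G \<mu> \<gamma> 0 S \<rho> = (if S = 0 \<and> \<rho> = \<one>\<^bsub>G\<^esub> then {\<lambda>_. 0} else {})"
    using comm_group.axioms(1)[OF G] by (auto simp: solutions_def comm_monoid.finprod_empty[OF comm_group.axioms(1)[OF G]])
  thus ?case by (simp add: D_count.simps(1))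
next
  case (Suc j)
  interpret comm_group G by (rule G)
  have \<mu>: "\<mu> j > 0" and gj: "\<gamma> j \<in> carrier G" using Suc.prems by auto
  have IH: "finite (solutions G \<mu> \<gamma> j S \<rho>) \<and> D_count G \<mu> \<gamma> j S \<rho> = card (solutions G \<mu> \<gamma> j S \<rho>)"
    if "\<rho> \<in> carrier G" for S \<rho>
    using Suc.prems that by (intro Suc.IH) auto
  show ?case using Suc.prems(3)
  proof (induction "nat (S + 1)" arbitrary: S \<rho> rule: less_induct)
    case less
    show ?case
    proof (cases "S < 0")
      case True
      have ge: "(\<Sum>i<Suc j. int (\<mu> i * n i)) \<ge> 0" for n by (intro sum_nonneg) simp
      have "(\<Sum>i<Suc j. int (\<mu> i * n i)) \<noteq> S" for n using ge[of n] True by linarith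
      hence "solutions G \<mu> \<gamma> (Suc j) S \<rho> = {}" unfolding solutions_def by blast
      thus ?thesis using True by (simp add: D_count.simps(2))
    next
      case False
      let ?B = "solutions G \<mu> \<gamma> (Suc j) (S - int (\<mu> j)) (\<rho> \<otimes>\<^bsub>G\<^esub> inv\<^bsub>G\<^esub> \<gamma> j)"
      let ?f = "\<lambda>n :: nat \<Rightarrow> nat. n(j := Suc (n j))"
      have B: "finite ?B \<and> D_count G \<mu> \<gamma> (Suc j) (S - int (\<mu> j)) (\<rho> \<otimes>\<^bsub>G\<^esub> inv\<^bsub>G\<^esub> \<gamma> j) = card ?B"
        using \<mu> False less.prems gj by (intro less.hyps) auto
      have inj: "inj_on ?f ?B"
      proof (rule inj_onI)
        fix n n' :: "nat \<Rightarrow> nat" assume eq: "?f n = ?f n'"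
        show "n = n'"
        proof
          fix i show "n i = n' i" using fun_cong[OF eq, of i] by (cases "i = j") auto
        qed
      qed
      have disj: "solutions G \<mu> \<gamma> j S \<rho> \<inter> ?f ` ?B = {}" by (auto simp: solutions_def)
      have eq: "solutions G \<mu> \<gamma> (Suc j) S \<rho> = solutions G \<mu> \<gamma> j S \<rho> \<union> ?f ` ?B"
        by (rule solutions_Suc[OF G]) (use Suc.prems less.prems in auto)
      have "card (solutions G \<mu> \<gamma> (Suc j) S \<rho>) = card (solutions G \<mu> \<gamma> j S \<rho>) + card ?B"
        unfolding eq using IH[OF less.prems] B disj by (simp add: card_Un_disjoint card_image[OF inj])
      moreover have "D_count G \<mu> \<gamma> (Suc j) S \<rho> = card (solutions G \<mu> \<gamma> j S \<rho>) + card ?B"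
        using False \<mu> B IH[OF less.prems] by (subst D_count.simps(2)) simp
      moreover have "finite (solutions G \<mu> \<gamma> (Suc j) S \<rho>)" unfolding eq using IH[OF less.prems] B by simp
      ultimately show ?thesis by simp
    qed
  qed
qed

section \<open>The group \<R>_N as a quotient of integer vectors\<close>

lemma comm_group_R_group: "comm_group (R_group D)"
proof (rule group.group_comm_groupI)
  show "group (R_group D)" unfolding R_group_def by simp
  show "x \<otimes>\<^bsub>R_group D\<^esub> y = y \<otimes>\<^bsub>R_group D\<^esub> x" for x y
    unfolding R_group_def by (simp add: add.commute)
qed

lemma R_class_carrier: "R_class D v \<in> carrier (R_group D)"
  unfolding R_class_def R_group_def by (auto simp: carrier_integer_mod_group)

lemma R_class_add:
  assumes "dim_vec w = dim_row D"
  shows "R_class D v \<otimes>\<^bsub>R_group D\<^esub> R_class D w = R_class D (v + w)"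
  unfolding R_class_def R_group_def using assms by (auto simp: restrict_def mod_add_eq)

lemma R_class_zero: "R_class D (0\<^sub>v (dim_row D)) = \<one>\<^bsub>R_group D\<^esub>"
  unfolding R_class_def R_group_def by (auto simp: restrict_def)

lemma R_class_pow:
  assumes "dim_vec v = dim_row D"
  shows "R_class D v [^]\<^bsub>R_group D\<^esub> (n :: nat) = R_class D (int n \<cdot>\<^sub>v v)"
proof (induction n)
  case 0
  have "int 0 \<cdot>\<^sub>v v = 0\<^sub>v (dim_row D)" using assms by (intro eq_vecI) auto
  thus ?case by (simp add: R_class_zero)
next
  case (Suc n)
  have "int n \<cdot>\<^sub>v v + v = int (Suc n) \<cdot>\<^sub>v v" by (intro eq_vecI) (auto simp: algebra_simps)
  thus ?case using Suc R_class_add[OF assms, of "int n \<cdot>\<^sub>v v"] by simp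
qed

lemma R_class_pow_neg:
  assumes "dim_vec v = dim_row D"
  shows "R_class D v [^]\<^bsub>R_group D\<^esub> (- int n) = R_class D (- int n \<cdot>\<^sub>v v)"
proof -
  interpret comm_group "R_group D" by (rule comm_group_R_group)
  have "R_class D v [^]\<^bsub>R_group D\<^esub> (- int n) = inv\<^bsub>R_group D\<^esub> (R_class D (int n \<cdot>\<^sub>v v))"
    using R_class_carrier by (simp add: int_pow_neg int_pow_int R_class_pow[OF assms])
  also have "\<dots> = R_class D (- int n \<cdot>\<^sub>v v)"
  proof (rule inv_equality)
    have "- int n \<cdot>\<^sub>v v + int n \<cdot>\<^sub>v v = 0\<^sub>v (dim_row D)" using assms by (intro eq_vecI) auto
    thus "R_class D (- int n \<cdot>\<^sub>v v) \<otimes>\<^bsub>R_group D\<^esub> R_class D (int n \<cdot>\<^sub>v v) = \<one>\<^bsub>R_group D\<^esub>"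
      using R_class_add[of "int n \<cdot>\<^sub>v v" D "- int n \<cdot>\<^sub>v v"] assms R_class_zero by simp
  qed (rule R_class_carrier)+
  finally show ?thesis .
qed

text \<open>This covers a vanishing diagonal entry too: reduction modulo 0 is the identity, and
  divisibility by 0 means equality.\<close>

lemma R_class_eq_iff:
  "R_class D v = R_class D w \<longleftrightarrow> (\<forall>i<dim_row D. D $$ (i, i) dvd v $ i - w $ i)"
proof -
  have "R_class D v = R_class D w \<longleftrightarrow> (\<forall>i<dim_row D. v $ i mod \<bar>D $$ (i, i)\<bar> = w $ i mod \<bar>D $$ (i, i)\<bar>)"
    unfolding R_class_def by (auto simp: restrict_def fun_eq_iff)
  thus ?thesis by (simp add: mod_eq_dvd_iff)
qed

text \<open>The index m contributes the neutral element: the order at i\<infinity> is not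
  constrained in the group and enters through the weighted sum only.\<close>

lemma finprod_gamma_class:
  assumes P: "P \<in> carrier_mat m m" and D: "dim_row D = m"
  shows "finprod (R_group D) (\<lambda>i. gamma_class D P i [^]\<^bsub>R_group D\<^esub> n i) {..<Suc m} =
    R_class D (P *\<^sub>v vec m (\<lambda>i. int (n i)))"
proof -
  interpret comm_group "R_group D" by (rule comm_group_R_group)
  have gc: "gamma_class D P i \<in> carrier (R_group D)" for i
    by (simp add: gamma_class_def R_class_carrier)
  have part: "finprod (R_group D) (\<lambda>i. gamma_class D P i [^]\<^bsub>R_group D\<^esub> n i) {..<j} =
      R_class D (vec m (\<lambda>r. \<Sum>i<j. P $$ (r, i) * int (n i)))" if "j \<le> m" for j
    using that
  proof (induction j)
    case 0
    have "vec m (\<lambda>r. \<Sum>i<0. P $$ (r, i) * int (n i)) = 0\<^sub>v (dim_row D)" using D by (intro eq_vecI) auto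
    thus ?case by (simp add: R_class_zero)
  next
    case (Suc j)
    have "finprod (R_group D) (\<lambda>i. gamma_class D P i [^]\<^bsub>R_group D\<^esub> n i) {..<Suc j} =
        gamma_class D P j [^]\<^bsub>R_group D\<^esub> n j \<otimes>\<^bsub>R_group D\<^esub> finprod (R_group D) (\<lambda>i. gamma_class D P i [^]\<^bsub>R_group D\<^esub> n i) {..<j}"
      unfolding lessThan_Suc by (rule finprod_insert) (use gc in auto)
    also have "gamma_class D P j = R_class D (col P j)" using Suc.prems D by (simp add: gamma_class_def)
    also have "R_class D (col P j) [^]\<^bsub>R_group D\<^esub> n j = R_class D (int (n j) \<cdot>\<^sub>v col P j)"
      using P D by (intro R_class_pow) auto
    also have "finprod (R_group D) (\<lambda>i. gamma_class D P i [^]\<^bsub>R_group D\<^esub> n i) {..<j} =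
        R_class D (vec m (\<lambda>r. \<Sum>i<j. P $$ (r, i) * int (n i)))"
      using Suc by simp
    also have "R_class D (int (n j) \<cdot>\<^sub>v col P j) \<otimes>\<^bsub>R_group D\<^esub> R_class D (vec m (\<lambda>r. \<Sum>i<j. P $$ (r, i) * int (n i))) =
        R_class D (int (n j) \<cdot>\<^sub>v col P j + vec m (\<lambda>r. \<Sum>i<j. P $$ (r, i) * int (n i)))"
      using D by (intro R_class_add) simp
    also have "int (n j) \<cdot>\<^sub>v col P j + vec m (\<lambda>r. \<Sum>i<j. P $$ (r, i) * int (n i)) =
        vec m (\<lambda>r. \<Sum>i<Suc j. P $$ (r, i) * int (n i))"
      using P Suc.prems by (intro eq_vecI) auto
    finally show ?case .
  qed
  have "finprod (R_group D) (\<lambda>i. gamma_class D P i [^]\<^bsub>R_group D\<^esub> n i) {..<Suc m} =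
      gamma_class D P m [^]\<^bsub>R_group D\<^esub> n m \<otimes>\<^bsub>R_group D\<^esub> finprod (R_group D) (\<lambda>i. gamma_class D P i [^]\<^bsub>R_group D\<^esub> n i) {..<m}"
    unfolding lessThan_Suc by (rule finprod_insert) (use gc in auto)
  also have "gamma_class D P m = \<one>\<^bsub>R_group D\<^esub>" using D by (simp only: gamma_class_def less_irrefl if_False)
  also have "finprod (R_group D) (\<lambda>i. gamma_class D P i [^]\<^bsub>R_group D\<^esub> n i) {..<m} =
      R_class D (vec m (\<lambda>r. \<Sum>i<m. P $$ (r, i) * int (n i)))" by (rule part) simp
  also have "vec m (\<lambda>r. \<Sum>i<m. P $$ (r, i) * int (n i)) = P *\<^sub>v vec m (\<lambda>i. int (n i))"
    using P by (intro eq_vecI) (auto simp: scalar_prod_def lessThan_atLeast0 simp del: atLeast0LessThan intro!: sum.cong)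
  finally show ?thesis using R_class_carrier nat_pow_one l_one by (simp only:)
qed

section \<open>The main theorem\<close>

text \<open>With j p = g f + y, the term (g/2) B_2(y/g) equals g/12 + p^2 j^2/(2g) - p j/2 plus an
  integer. Summation over j brings in the three moments of a, and the congruences leave only the
  half-integer p u (p h - 1)/2 to be examined.\<close>

lemma cusp_order_integral:
  assumes N: "N > 0" and "weight_congruences N k a"
  shows "cusp_order N k a (p, r) \<in> \<int>"
proof -
  define g where "g = gcd r (int N)"
  have g0: "g > 0" using N by (simp add: g_def)
  have "g dvd int N" by (simp add: g_def)
  then obtain h where h: "int N = g * h" by (rule dvdE)
  define s u t where "s = int k + exponent_sum N 0 a" and "u = exponent_sum N 1 a" and "t = exponent_sum N 2 a"
  have "12 dvd s" "2 * int N dvd t - int N * u" using assms(2) by (simp_all add: weight_congruences_def s_def u_def t_def)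
  then obtain v w where v: "s = 12 * v" and w': "t - int N * u = 2 * int N * w" by (elim dvdE)
  have w: "t = g * h * (u + 2 * w)" using w' by (simp add: h algebra_simps)
  have tu: "even (t - u)" unfolding t_def u_def by (rule even_exponent_sum_diff)
  \<comment> \<open>For even N the second congruence makes t, hence u, even. For odd N also h is
    odd, and then p or p h - 1 is even.\<close>
  have "even (p * u * (p * h - 1))"
  proof (cases "even (int N)")
    case True
    hence "even t" unfolding w h[symmetric] by simp
    thus ?thesis using tu by simp
  next
    case False
    hence "odd h" by (simp add: h)
    thus ?thesis by (cases "even p") simp_all
  qed
  then obtain z where z: "p * u * (p * h - 1) = 2 * z" by (rule evenE)
  \<comment> \<open>The integral remainder after substituting y = j p - g f; f(f + 1) is even, so
    the division is exact.\<close>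
  define I where "I j = (let f = (int j * p) div g in - (int j * p * f) + g * ((f * (f + 1)) div 2))" for j
  have summand: "of_nat (nat g) / 2 * periodic_B2 (nat g) (int j * p) =
      of_int g / 12 + of_int p ^ 2 / (2 * of_int g) * of_int (int j ^ 2) - of_int p / 2 * of_int (int j) + (of_int (I j) :: rat)" for j
  proof -
    define f y where "f = (int j * p) div g" and "y = (int j * p) mod g"
    have y: "y = int j * p - g * f" by (simp add: f_def y_def minus_mult_div_eq_mod)
    have "even (f * (f + 1))" by simp
    then obtain T where T: "f * (f + 1) = 2 * T" by (rule evenE)
    have I: "I j = - (int j * p * f) + g * T" by (simp add: I_def f_def[symmetric] T)
    have T': "of_int T = (of_int f * (of_int f + 1) / 2 :: rat)"
      using arg_cong[OF T, of "of_int :: int \<Rightarrow> rat"] by simp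
    have "of_nat (nat g) / 2 * periodic_B2 (nat g) (int j * p) = of_int g / 2 * B2 (of_int y / of_int g)"
      using g0 by (simp add: periodic_B2_def y_def)
    also have "\<dots> = of_int y ^ 2 / (2 * of_int g) - of_int y / 2 + of_int g / 12"
      using g0 by (simp add: B2_def field_simps power2_eq_square)
    also have "\<dots> = of_int g / 12 + of_int p ^ 2 / (2 * of_int g) * of_int (int j ^ 2) - of_int p / 2 * of_int (int j) + of_int (I j)"
      unfolding y I using g0 by (simp add: T' field_simps power2_eq_square)
    finally show ?thesis .
  qed
  have "cusp_order N k a (p, r) = of_nat k * of_int g / 12 + (\<Sum>j=1..N div 2. of_int (a $ (j - 1)) *
      (of_int g / 12 + of_int p ^ 2 / (2 * of_int g) * of_int (int j ^ 2) - of_int p / 2 * of_int (int j) + of_int (I j)))"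
    unfolding cusp_order_def prod.case Let_def g_def[symmetric] summand using g0 by simp
  also have "\<dots> = of_int g / 12 * of_int s + of_int p ^ 2 / (2 * of_int g) * of_int t - of_int p / 2 * of_int u +
      of_int (\<Sum>j=1..N div 2. a $ (j - 1) * I j)"
    by (simp add: s_def t_def u_def exponent_sum_def distrib_left right_diff_distrib sum.distrib sum_subtractf
      sum_distrib_left mult_ac)
  also have "\<dots> = of_int (g * v + p ^ 2 * h * w + (\<Sum>j=1..N div 2. a $ (j - 1) * I j)) + of_int (p * u * (p * h - 1)) / 2"
    unfolding v w using g0 by (simp add: field_simps power2_eq_square)
  also have "\<dots> = of_int (g * v + p ^ 2 * h * w + (\<Sum>j=1..N div 2. a $ (j - 1) * I j) + z)"
    unfolding z by simp
  finally show ?thesis by (metis Ints_of_int)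
qed

lemma cusp_order_cong:
  assumes "N > 0" "gcd r (int N) = gcd r' (int N)" "e \<in> {1, -1}" "[p = e * p'] (mod gcd r' (int N))"
  shows "cusp_order N k a (p, r) = cusp_order N k a (p', r')"
proof -
  define g where "g = gcd r' (int N)"
  have g0: "g > 0" using assms(1) by (simp add: g_def)
  have "periodic_B2 (nat g) (int j * p) = periodic_B2 (nat g) (int j * p')" for j
  proof -
    have "[int j * p = e * (int j * p')] (mod int (nat g))"
      using cong_mult[OF cong_refl assms(4), of "int j"] g0 by (simp add: g_def mult_ac)
    hence "periodic_B2 (nat g) (int j * p) = periodic_B2 (nat g) (e * (int j * p'))"
      by (intro periodic_B2_mod) (simp add: cong_def)
    thus ?thesis using assms(3) g0 periodic_B2_minus[of "nat g" "int j * p'"] by auto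
  qed
  thus ?thesis unfolding cusp_order_def prod.case Let_def assms(2) g_def[symmetric] by simp
qed

text \<open>The order depends only on g and on \<plusminus>a modulo g, hence is constant on Galois
  orbits. So the growth conditions for all of SL_2(\<int>) reduce to the m + 1
  representatives.\<close>

lemma L_set_eq:
  assumes N: "N \<ge> 5" and c: "cusp_orbit_representatives N c"
  shows "L_set N k = {a \<in> carrier_vec (N div 2). weight_congruences N k a \<and> (\<forall>i\<le>N div 2. cusp_order N k a (c i) \<ge> 0)}"
proof -
  have N0: "N > 0" using N by simp
  have "(\<forall>(p, q, r, s) \<in> SL2Z. cusp_order N k a (p, r) \<ge> 0) \<longleftrightarrow> (\<forall>i\<le>N div 2. cusp_order N k a (c i) \<ge> 0)" for a
  proof
    assume A: "\<forall>(p, q, r, s) \<in> SL2Z. cusp_order N k a (p, r) \<ge> 0"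
    show "\<forall>i\<le>N div 2. cusp_order N k a (c i) \<ge> 0"
    proof (intro allI impI)
      fix i assume i: "i \<le> N div 2"
      obtain p r where pr: "c i = (p, r)" by (cases "c i")
      have "coprime p r" using c i pr unfolding cusp_orbit_representatives_def by (metis fst_conv snd_conv)
      then obtain s q where "s * p + q * r = 1" using bezout_int[of p r] by (auto simp: coprime_iff_gcd_eq_1)
      hence "(p, - q, r, s) \<in> SL2Z" by (simp add: SL2Z_def algebra_simps)
      thus "cusp_order N k a (c i) \<ge> 0" using A pr by auto
    qed
  next
    assume A: "\<forall>i\<le>N div 2. cusp_order N k a (c i) \<ge> 0"
    have "cusp_order N k a (p, r) \<ge> 0" if "(p, q, r, s) \<in> SL2Z" for p q r s
    proof -
      have "coprime p r"
      proof (rule coprimeI)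
        fix d assume "d dvd p" "d dvd r"
        hence "d dvd p * s - q * r" by simp
        thus "is_unit d" using that by (simp add: SL2Z_def)
      qed
      hence "coprime p (gcd r (int N))" by (meson coprime_divisors dvd_refl gcd_dvd1)
      from cusp_residue_in_residues[OF N0 this]
      have res: "(p mod gcd r (int N), r mod int N) \<in> cusp_residues N" by (simp add: cusp_residue_def)
      obtain i where i: "i \<le> N div 2" "cusp_class N (p mod gcd r (int N), r mod int N) \<in> orbit_set N (fst (c i)) (cusp_gcd N (c i))"
        using orbit_attained[OF N c res] by blast
      obtain e where e: "e \<in> {1, -1}" "gcd (r mod int N) (int N) = cusp_gcd N (c i)"
        "[p mod gcd r (int N) = e * fst (c i)] (mod cusp_gcd N (c i))"
        using orbit_set_mem[OF N0 res i(2)] by blast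
      obtain p' r' where pr: "c i = (p', r')" by (cases "c i")
      have g: "gcd r (int N) = gcd r' (int N)" using e(2) unfolding gcd_mod_int pr by (simp add: cusp_gcd_def)
      have "[p = e * p'] (mod gcd r' (int N))" using e(3) by (simp add: pr cusp_gcd_def g)
      from cusp_order_cong[OF N0 g e(1) this] show ?thesis using A i(1) pr by metis
    qed
    thus "\<forall>(p, q, r, s) \<in> SL2Z. cusp_order N k a (p, r) \<ge> 0" by blast
  qed
  thus ?thesis unfolding L_set_def by (simp only: theta_product_modular_iff[OF N0])
qed

text \<open>The order at the last representative i\<infinity> is left out: A_N has rows for the
  first m representatives only, and the missing order is recovered from the total.\<close>

definition order_vec :: "nat \<Rightarrow> nat \<Rightarrow> (nat \<Rightarrow> int \<times> int) \<Rightarrow> int vec \<Rightarrow> rat vec" where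
  "order_vec N k c a = vec (N div 2) (\<lambda>i. cusp_order N k a (c i))"

lemma order_vec_eq:
  assumes N: "N > 0" and a: "a \<in> carrier_vec (N div 2)"
  shows "order_vec N k c a = (of_nat k / 12) \<cdot>\<^sub>v g_vec N c + A_mat N c *\<^sub>v map_vec of_int a"
proof (rule eq_vecI)
  fix i assume "i < dim_vec ((of_nat k / 12) \<cdot>\<^sub>v g_vec N c + A_mat N c *\<^sub>v map_vec of_int a)"
  hence i: "i < N div 2" by (simp add: A_mat_def)
  obtain p r where pr: "c i = (p, r)" by (cases "c i")
  have g0: "gcd r (int N) > 0" using N by simp
  have "(A_mat N c *\<^sub>v map_vec of_int a) $ i = (\<Sum>j=0..<N div 2. A_mat N c $$ (i, j) * of_int (a $ j))"
    using i a by (auto simp: scalar_prod_def A_mat_def intro!: sum.cong)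
  also have "\<dots> = (\<Sum>j=0..<N div 2. of_int (a $ j) * (of_nat (nat (gcd r (int N))) / 2 * periodic_B2 (nat (gcd r (int N))) (int (Suc j) * p)))"
  proof (rule sum.cong[OF refl])
    fix j assume "j \<in> {0..<N div 2}"
    thus "A_mat N c $$ (i, j) * of_int (a $ j) = of_int (a $ j) * (of_nat (nat (gcd r (int N))) / 2 * periodic_B2 (nat (gcd r (int N))) (int (Suc j) * p))"
      using i B2_frac_eq_periodic_B2[OF g0, of "int (Suc j) * p"]
      by (simp add: A_mat_def pr cusp_gcd_def Let_def del: of_nat_Suc)
  qed
  also have "\<dots> = (\<Sum>j=1..N div 2. of_int (a $ (j - 1)) * (of_nat (nat (gcd r (int N))) / 2 * periodic_B2 (nat (gcd r (int N))) (int j * p)))"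
    by (rule sum.reindex_bij_witness[of _ "\<lambda>j. j - 1" Suc]) auto
  finally have A: "(A_mat N c *\<^sub>v map_vec of_int a) $ i = \<dots>" .
  show "order_vec N k c a $ i = ((of_nat k / 12) \<cdot>\<^sub>v g_vec N c + A_mat N c *\<^sub>v map_vec of_int a) $ i"
  proof -
    have "((of_nat k / 12) \<cdot>\<^sub>v g_vec N c + A_mat N c *\<^sub>v map_vec of_int a) $ i =
        of_nat k / 12 * of_int (gcd r (int N)) + (A_mat N c *\<^sub>v map_vec of_int a) $ i"
      using i by (simp add: g_vec_def A_mat_def pr cusp_gcd_def)
    thus ?thesis unfolding A using i by (simp add: order_vec_def pr cusp_order_def Let_def)
  qed
qed (simp add: order_vec_def A_mat_def)

lemma GL_int_inverse:
  assumes "P \<in> GL_int m"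
  obtains P' where "P \<in> carrier_mat m m" "P' \<in> carrier_mat m m" "P * P' = 1\<^sub>m m" "P' * P = 1\<^sub>m m"
proof -
  have P: "P \<in> carrier_mat m m" and "invertible_mat P" using assms by (auto simp: GL_int_def)
  then obtain B where B: "P * B = 1\<^sub>m m" "B * P = 1\<^sub>m (dim_row B)"
    unfolding invertible_mat_def inverts_mat_def by auto
  have "dim_col B = m" using arg_cong[OF B(1), of dim_col] by simp
  moreover have "dim_row B = m" using arg_cong[OF B(2), of dim_col] P by simp
  ultimately have "B \<in> carrier_mat m m" by (intro carrier_matI)
  thus ?thesis using that[OF P _ B(1)] B(2) \<open>dim_row B = m\<close> by simp
qed

lemma diagonal_mat_mult_vec:
  fixes D :: "int mat"
  assumes "D \<in> carrier_mat m m" "diagonal_mat D" "y \<in> carrier_vec m" "i < m"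
  shows "(D *\<^sub>v y) $ i = D $$ (i, i) * y $ i"
proof -
  have "(D *\<^sub>v y) $ i = (\<Sum>j=0..<m. D $$ (i, j) * y $ j)"
    using assms by (auto simp: scalar_prod_def intro!: sum.cong)
  also have "\<dots> = (\<Sum>j=0..<m. if j = i then D $$ (i, i) * y $ i else 0)"
    using assms by (intro sum.cong) (auto simp: diagonal_mat_def)
  finally show ?thesis using assms(4) by simp
qed

text \<open>In the coordinates \<open>x = Q y\<close> on the lattice and \<open>P\<close> applied to the orders, the order map is affine
  with diagonal linear part.\<close>

lemma order_vec_smith:
  assumes N: "N \<ge> 5" and S: "smith_normal_form (N div 2) (V_mat N c) P D Q"
    and o1: "order_vec N 1 c (a_one N) = map_vec of_int w" "w \<in> carrier_vec (N div 2)"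
    and y: "y \<in> carrier_vec (N div 2)"
  shows "map_mat of_int P *\<^sub>v order_vec N k c (int k \<cdot>\<^sub>v a_one N + B_mat N *\<^sub>v (Q *\<^sub>v y)) =
    map_vec of_int (int k \<cdot>\<^sub>v (P *\<^sub>v w) + D *\<^sub>v y)"
proof -
  define m where "m = N div 2"
  have N0: "N > 0" using N by simp
  have P: "P \<in> carrier_mat m m" and Q: "Q \<in> carrier_mat m m" and D: "D \<in> carrier_mat m m"
    and eq: "map_mat of_int P * V_mat N c * map_mat of_int Q = map_mat of_int D"
    using S by (auto simp: smith_normal_form_def GL_int_def m_def)
  have B: "B_mat N \<in> carrier_mat m m" using B_mat_carrier[OF N] by (simp add: m_def)
  have A: "A_mat N c \<in> carrier_mat m m" by (simp add: A_mat_def m_def)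
  have a1: "a_one N \<in> carrier_vec m" using a_one_carrier by (simp add: m_def)
  have g: "g_vec N c \<in> carrier_vec m" by (simp add: g_vec_def m_def)
  have w: "w \<in> carrier_vec m" and y': "y \<in> carrier_vec m" using o1(2) y by (simp_all add: m_def)
  define x where "x = Q *\<^sub>v y"
  have x: "x \<in> carrier_vec m" using Q y' by (simp add: x_def)
  have Bx: "B_mat N *\<^sub>v x \<in> carrier_vec m" using B x by simp
  let ?r = "map_vec (of_int :: int \<Rightarrow> rat)" and ?R = "map_mat (of_int :: int \<Rightarrow> rat)"
  have RP: "?R P \<in> carrier_mat m m" and RQ: "?R Q \<in> carrier_mat m m" and RB: "?R (B_mat N) \<in> carrier_mat m m"
    using P Q B by simp_all
  have V: "V_mat N c \<in> carrier_mat m m" unfolding V_mat_def using A RB by simp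
  have "order_vec N k c (int k \<cdot>\<^sub>v a_one N + B_mat N *\<^sub>v x) =
      (of_nat k / 12) \<cdot>\<^sub>v g_vec N c + A_mat N c *\<^sub>v ?r (int k \<cdot>\<^sub>v a_one N + B_mat N *\<^sub>v x)"
    using a1 Bx by (intro order_vec_eq[OF N0]) (simp add: m_def)
  also have "?r (int k \<cdot>\<^sub>v a_one N + B_mat N *\<^sub>v x) = of_nat k \<cdot>\<^sub>v ?r (a_one N) + ?r (B_mat N *\<^sub>v x)"
    using a1 Bx carrier_vecD[OF a1] carrier_vecD[OF Bx] by (intro eq_vecI) (simp_all del: dim_mult_mat_vec index_mult_mat_vec)
  also have "?r (B_mat N *\<^sub>v x) = ?R (B_mat N) *\<^sub>v ?r x"
    by (rule of_int_hom.mult_mat_vec_hom[OF B x])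
  also have "A_mat N c *\<^sub>v (of_nat k \<cdot>\<^sub>v ?r (a_one N) + ?R (B_mat N) *\<^sub>v ?r x) =
      of_nat k \<cdot>\<^sub>v (A_mat N c *\<^sub>v ?r (a_one N)) + V_mat N c *\<^sub>v ?r x"
    using A RB a1 x unfolding V_mat_def
    by (subst mult_add_distrib_mat_vec[of _ m m]) (auto simp: mult_mat_vec[of _ m m] assoc_mult_mat_vec[of _ m m _ m])
  also have "(of_nat k / 12) \<cdot>\<^sub>v g_vec N c + (of_nat k \<cdot>\<^sub>v (A_mat N c *\<^sub>v ?r (a_one N)) + V_mat N c *\<^sub>v ?r x) =
      of_nat k \<cdot>\<^sub>v ((1 / 12) \<cdot>\<^sub>v g_vec N c + A_mat N c *\<^sub>v ?r (a_one N)) + V_mat N c *\<^sub>v ?r x"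
    using A g V by (intro eq_vecI) (auto simp: algebra_simps)
  also have "(1 / 12) \<cdot>\<^sub>v g_vec N c + A_mat N c *\<^sub>v ?r (a_one N) = ?r w"
    using order_vec_eq[OF N0 a1[unfolded m_def], of 1 c] unfolding o1(1) by simp
  finally have ov: "order_vec N k c (int k \<cdot>\<^sub>v a_one N + B_mat N *\<^sub>v x) = of_nat k \<cdot>\<^sub>v ?r w + V_mat N c *\<^sub>v ?r x" .
  have rx: "?r x = ?R Q *\<^sub>v ?r y" unfolding x_def by (rule of_int_hom.mult_mat_vec_hom[OF Q y'])
  have "?R P *\<^sub>v (V_mat N c *\<^sub>v ?r x) = (?R P * V_mat N c * ?R Q) *\<^sub>v ?r y"
    unfolding rx using RP V RQ y' by (simp add: assoc_mult_mat_vec[of _ m m _ m])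
  also have "\<dots> = ?r (D *\<^sub>v y)" unfolding eq by (rule of_int_hom.mult_mat_vec_hom[OF D y', symmetric])
  finally have PV: "?R P *\<^sub>v (V_mat N c *\<^sub>v ?r x) = ?r (D *\<^sub>v y)" .
  have "?R P *\<^sub>v (of_nat k \<cdot>\<^sub>v ?r w + V_mat N c *\<^sub>v ?r x) = of_nat k \<cdot>\<^sub>v (?R P *\<^sub>v ?r w) + ?R P *\<^sub>v (V_mat N c *\<^sub>v ?r x)"
    using RP V w x by (subst mult_add_distrib_mat_vec[of _ m m]) (auto simp: mult_mat_vec[of _ m m])
  also have "?R P *\<^sub>v ?r w = ?r (P *\<^sub>v w)" by (rule of_int_hom.mult_mat_vec_hom[OF P w, symmetric])
  also have "of_nat k \<cdot>\<^sub>v ?r (P *\<^sub>v w) + ?R P *\<^sub>v (V_mat N c *\<^sub>v ?r x) = ?r (int k \<cdot>\<^sub>v (P *\<^sub>v w) + D *\<^sub>v y)"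
    unfolding PV using P D w y' by (intro eq_vecI) auto
  finally show ?thesis unfolding ov[unfolded x_def] x_def .
qed

text \<open>Finiteness is stated along with the cardinality because \<open>card\<close> of an
  infinite set is 0. The floor only changes the type, k R_N being a sum of integral orders. The
  element given to the recursion is the inverse of the k-th power of the class of \<beta>, since
  \<R>_N is written multiplicatively.\<close>

theorem theorem4p5:
  fixes N k :: nat and c :: "nat \<Rightarrow> int \<times> int" and P Q D :: "int mat"
  assumes "N \<ge> 5"
    and "cusp_orbit_representatives N c"
    and "smith_normal_form (N div 2) (V_mat N c) P D Q"
  shows "finite (L_set N k) \<and>
    card (L_set N k) =
      D_count (R_group D) (orbit_size N c) (gamma_class D P) (N div 2 + 1)
        \<lfloor>of_nat k * R_num N\<rfloor> (beta_class N c D P [^]\<^bsub>R_group D\<^esub> (- int k))"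
proof -
  note N = assms(1) and c = assms(2) and S = assms(3)
  define m where "m = N div 2"
  have N0: "N > 0" using N by simp
  obtain P' where P: "P \<in> carrier_mat m m" "P' \<in> carrier_mat m m" "P * P' = 1\<^sub>m m" "P' * P = 1\<^sub>m m"
    using S GL_int_inverse[of P m] by (auto simp: smith_normal_form_def m_def)
  obtain Q' where Q: "Q \<in> carrier_mat m m" "Q' \<in> carrier_mat m m" "Q * Q' = 1\<^sub>m m" "Q' * Q = 1\<^sub>m m"
    using S GL_int_inverse[of Q m] by (auto simp: smith_normal_form_def m_def)
  have D: "D \<in> carrier_mat m m" "diagonal_mat D" using S by (auto simp: smith_normal_form_def m_def)
  have B: "B_mat N \<in> carrier_mat m m" using B_mat_carrier[OF N] by (simp add: m_def)
  have a1: "a_one N \<in> carrier_vec m" using a_one_carrier by (simp add: m_def)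
  have integral: "cusp_order N l a (c i) \<in> \<int>" if "weight_congruences N l a" for a i l
    using cusp_order_integral[OF N0 that] by (metis prod.collapse)
  have base: "weight_congruences N l (int l \<cdot>\<^sub>v a_one N + B_mat N *\<^sub>v x)" if "x \<in> carrier_vec m" for l x
  proof -
    have "int l \<cdot>\<^sub>v a_one N + B_mat N *\<^sub>v x \<in> carrier_vec (N div 2)"
      using a1 B that by (simp add: m_def)
    from weight_congruences_iff_lattice[OF N this] show ?thesis using that unfolding m_def by blast
  qed
  have wc1: "weight_congruences N 1 (a_one N)"
  proof -
    have "int 1 \<cdot>\<^sub>v a_one N + B_mat N *\<^sub>v 0\<^sub>v m = a_one N" using a1 B by (intro eq_vecI) auto
    thus ?thesis using base[of "0\<^sub>v m" 1] by simp
  qed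
  \<comment> \<open>The orders of a^(1) in weight 1. They are integral, so nothing is lost by the
    floor, and P w is minus the vector \<alpha>_N.\<close>
  define w where "w = vec m (\<lambda>i. \<lfloor>cusp_order N 1 (a_one N) (c i)\<rfloor>)"
  have w: "w \<in> carrier_vec m" by (simp add: w_def)
  have o1: "order_vec N 1 c (a_one N) = map_vec of_int w"
    using integral[OF wc1] by (intro eq_vecI) (auto simp: order_vec_def w_def m_def)
  note smith = order_vec_smith[OF N S o1 w[unfolded m_def], folded m_def]
  have alpha: "map_vec floor (alpha_vec N c P) = - (P *\<^sub>v w)"
  proof -
    have "alpha_vec N c P = - (map_mat of_int P *\<^sub>v order_vec N 1 c (a_one N))"
      unfolding alpha_vec_def order_vec_eq[OF N0 a1[unfolded m_def]] by simp
    also have "\<dots> = - map_vec of_int (P *\<^sub>v w)"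
      unfolding o1 of_int_hom.mult_mat_vec_hom[OF P(1) w] ..
    finally have e: "alpha_vec N c P = - map_vec of_int (P *\<^sub>v w)" .
    show ?thesis unfolding e by (rule eq_vecI) (use P w in auto)
  qed
  define \<rho> where "\<rho> = beta_class N c D P [^]\<^bsub>R_group D\<^esub> (- int k)"
  have rho: "\<rho> = R_class D (int k \<cdot>\<^sub>v (P *\<^sub>v w))"
  proof -
    have "\<rho> = R_class D (- int k \<cdot>\<^sub>v (- (P *\<^sub>v w)))"
      unfolding \<rho>_def beta_class_def alpha by (rule R_class_pow_neg) (use P D in simp)
    also have "- int k \<cdot>\<^sub>v (- (P *\<^sub>v w)) = int k \<cdot>\<^sub>v (P *\<^sub>v w)" by (rule eq_vecI) auto
    finally show ?thesis .
  qed
  define X where "X = solutions (R_group D) (orbit_size N c) (gamma_class D P) (m + 1) \<lfloor>of_nat k * R_num N\<rfloor> \<rho>"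
  have count: "finite X \<and> D_count (R_group D) (orbit_size N c) (gamma_class D P) (m + 1) \<lfloor>of_nat k * R_num N\<rfloor> \<rho> = card X"
    unfolding X_def
  proof (rule D_count_eq_card_solutions[OF comm_group_R_group])
    show "orbit_size N c i > 0" if "i < m + 1" for i using orbit_size_pos[OF N c] that by (simp add: m_def)
    show "gamma_class D P i \<in> carrier (R_group D)" for i
      by (simp add: gamma_class_def R_class_carrier comm_group.axioms(1)[OF comm_group_R_group]
        monoid.one_closed[OF comm_monoid.axioms(1)[OF comm_group.axioms(1)[OF comm_group_R_group]]])
    show "\<rho> \<in> carrier (R_group D)" unfolding rho by (rule R_class_carrier)
  qed
  have X_iff: "n \<in> X \<longleftrightarrow> (\<forall>i>m. n i = 0) \<and> (\<Sum>i\<le>m. int (orbit_size N c i * n i)) = \<lfloor>of_nat k * R_num N\<rfloor> \<and>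
      (\<forall>i<m. D $$ (i, i) dvd (P *\<^sub>v vec m (\<lambda>i. int (n i))) $ i - int k * (P *\<^sub>v w) $ i)" for n
  proof -
    have "finprod (R_group D) (\<lambda>i. gamma_class D P i [^]\<^bsub>R_group D\<^esub> n i) {..<m + 1} = \<rho> \<longleftrightarrow>
        (\<forall>i<m. D $$ (i, i) dvd (P *\<^sub>v vec m (\<lambda>i. int (n i))) $ i - (int k \<cdot>\<^sub>v (P *\<^sub>v w)) $ i)"
      using finprod_gamma_class[OF P(1), of D n] D unfolding rho by (simp add: R_class_eq_iff)
    also have "\<dots> \<longleftrightarrow> (\<forall>i<m. D $$ (i, i) dvd (P *\<^sub>v vec m (\<lambda>i. int (n i))) $ i - int k * (P *\<^sub>v w) $ i)"
      using P by auto
    finally show ?thesis unfolding X_def solutions_def by (auto simp: lessThan_Suc_atMost)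
  qed
  have osum: "(\<Sum>i\<le>m. of_nat (orbit_size N c i) * cusp_order N k a (c i)) = of_nat k * R_num N" for a
    using cusp_order_sum[OF N c] by (simp add: m_def)
  \<comment> \<open>The coset is never empty: already x = 0 gives a vector whose orders are
    integral, whatever their signs, and their weighted sum is k R_N.\<close>
  have RZ: "of_nat k * R_num N \<in> \<int>"
  proof -
    have "(\<Sum>i\<le>m. of_nat (orbit_size N c i) * cusp_order N k (int k \<cdot>\<^sub>v a_one N + B_mat N *\<^sub>v 0\<^sub>v m) (c i)) \<in> \<int>"
      by (intro Ints_sum Ints_mult integral base) auto
    thus ?thesis by (simp only: osum)
  qed
  define f where "f a = (\<lambda>i. if i \<le> m then nat \<lfloor>cusp_order N k a (c i)\<rfloor> else 0)" for a
  have fL: "of_nat (f a i) = cusp_order N k a (c i)" if "a \<in> L_set N k" "i \<le> m" for a i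
  proof -
    have "weight_congruences N k a" "cusp_order N k a (c i) \<ge> 0"
      using that unfolding L_set_eq[OF N c] m_def by auto
    from integral[OF this(1), of i] this(2) show ?thesis using that(2) by (auto simp: f_def elim!: Ints_cases)
  qed
  have "inj_on f (L_set N k)"
  proof (rule inj_onI)
    fix a b assume ab: "a \<in> L_set N k" "b \<in> L_set N k" "f a = f b"
    have ord: "cusp_order N k a (c i) = cusp_order N k b (c i)" if "i \<le> N div 2" for i
      using that fL[OF ab(1), of i] fL[OF ab(2), of i] ab(3) by (simp add: m_def)
    have *: "a $ i = b $ i" if "i < N div 2" for i
      using cusp_order_inj[OF N c ord, of "Suc i"] that by simp
    show "a = b" by (rule eq_vecI) (use ab(1,2) * in \<open>auto simp: L_set_def\<close>)
  qed
  moreover have "f ` L_set N k = X"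
  proof (intro equalityI subsetI)
    fix n assume "n \<in> f ` L_set N k"
    then obtain a where a: "a \<in> L_set N k" "n = f a" by blast
    have ac: "a \<in> carrier_vec m" "weight_congruences N k a" using a(1) unfolding L_set_eq[OF N c] m_def by auto
    then obtain x where x: "x \<in> carrier_vec m" "a = int k \<cdot>\<^sub>v a_one N + B_mat N *\<^sub>v x"
      using weight_congruences_iff_lattice[OF N, of a k] unfolding m_def by auto
    define y where "y = Q' *\<^sub>v x"
    have y: "y \<in> carrier_vec m" using Q x by (simp add: y_def)
    have "Q *\<^sub>v y = x" unfolding y_def using Q x by (simp flip: assoc_mult_mat_vec)
    hence "map_mat of_int P *\<^sub>v order_vec N k c a = map_vec of_int (int k \<cdot>\<^sub>v (P *\<^sub>v w) + D *\<^sub>v y)"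
      using smith[OF y, of k] x(2) by simp
    moreover have "order_vec N k c a = map_vec of_int (vec m (\<lambda>i. int (n i)))"
      unfolding a(2) using fL[OF a(1)] by (intro eq_vecI) (auto simp: order_vec_def m_def)
    ultimately have "map_vec (of_int :: int \<Rightarrow> rat) (P *\<^sub>v vec m (\<lambda>i. int (n i))) = map_vec of_int (int k \<cdot>\<^sub>v (P *\<^sub>v w) + D *\<^sub>v y)"
      using of_int_hom.mult_mat_vec_hom[where 'a = rat, OF P(1), of "vec m (\<lambda>i. int (n i))"] by simp
    hence Pn: "P *\<^sub>v vec m (\<lambda>i. int (n i)) = int k \<cdot>\<^sub>v (P *\<^sub>v w) + D *\<^sub>v y"
      by (rule of_int_hom.vec_hom_inj)
    have "of_int (\<Sum>i\<le>m. int (orbit_size N c i * n i)) = (\<Sum>i\<le>m. of_nat (orbit_size N c i) * cusp_order N k a (c i))"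
      using fL[OF a(1)] by (simp add: a(2))
    hence "of_int (\<Sum>i\<le>m. int (orbit_size N c i * n i)) = of_nat k * R_num N" unfolding osum .
    hence "(\<Sum>i\<le>m. int (orbit_size N c i * n i)) = \<lfloor>of_nat k * R_num N\<rfloor>" by (metis floor_of_int)
    moreover have "D $$ (i, i) dvd (P *\<^sub>v vec m (\<lambda>i. int (n i))) $ i - int k * (P *\<^sub>v w) $ i" if "i < m" for i
      unfolding Pn using that P w D diagonal_mat_mult_vec[OF D y that] by simp
    moreover have "\<forall>i>m. n i = 0" by (simp add: a(2) f_def)
    ultimately show "n \<in> X" unfolding X_iff by blast
  next
    fix n assume n: "n \<in> X"
    have sum: "(\<Sum>i\<le>m. int (orbit_size N c i * n i)) = \<lfloor>of_nat k * R_num N\<rfloor>" and n0: "\<forall>i>m. n i = 0"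
      and dv: "\<forall>i<m. D $$ (i, i) dvd (P *\<^sub>v vec m (\<lambda>i. int (n i))) $ i - int k * (P *\<^sub>v w) $ i"
      using n unfolding X_iff by auto
    define nv where "nv = vec m (\<lambda>i. int (n i))"
    have nv: "nv \<in> carrier_vec m" by (simp add: nv_def)
    \<comment> \<open>The quotients by the diagonal entries serve as Smith coordinates y; then Q y
      are the coordinates with respect to the columns of B_N.\<close>
    obtain z where z: "\<And>i. i < m \<Longrightarrow> (P *\<^sub>v nv) $ i - int k * (P *\<^sub>v w) $ i = D $$ (i, i) * z i"
      using dv unfolding nv_def[symmetric] dvd_def by metis
    define y where "y = vec m z"
    have y: "y \<in> carrier_vec m" by (simp add: y_def)
    have Dy: "int k \<cdot>\<^sub>v (P *\<^sub>v w) + D *\<^sub>v y = P *\<^sub>v nv"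
    proof (rule eq_vecI)
      fix i assume "i < dim_vec (P *\<^sub>v nv)"
      hence i: "i < m" using P by simp
      have "(D *\<^sub>v y) $ i = D $$ (i, i) * z i" using diagonal_mat_mult_vec[OF D y i] i by (simp add: y_def)
      thus "(int k \<cdot>\<^sub>v (P *\<^sub>v w) + D *\<^sub>v y) $ i = (P *\<^sub>v nv) $ i"
        using i z[OF i] P D w by simp
    qed (use P D in simp)
    define a where "a = int k \<cdot>\<^sub>v a_one N + B_mat N *\<^sub>v (Q *\<^sub>v y)"
    have wc: "weight_congruences N k a" unfolding a_def by (rule base) (use Q y in simp)
    have ac: "a \<in> carrier_vec m" unfolding a_def using a1 B Q y by simp
    let ?ov = "order_vec N k c a" and ?R = "map_mat (of_int :: int \<Rightarrow> rat)"
    have ovc: "?ov \<in> carrier_vec m" by (simp add: order_vec_def m_def)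
    have "?R P *\<^sub>v ?ov = map_vec of_int (P *\<^sub>v nv)" using smith[OF y, of k] unfolding a_def Dy .
    also have "\<dots> = ?R P *\<^sub>v map_vec of_int nv" by (rule of_int_hom.mult_mat_vec_hom[OF P(1) nv])
    finally have "?R P' *\<^sub>v (?R P *\<^sub>v ?ov) = ?R P' *\<^sub>v (?R P *\<^sub>v map_vec of_int nv)" by simp
    moreover have "?R P' * ?R P = 1\<^sub>m m"
      using of_int_hom.mat_hom_mult[OF P(2,1), where 'a = rat] P(4) of_int_hom.mat_hom_one[where 'a = rat] by metis
    moreover have "?R P' *\<^sub>v (?R P *\<^sub>v v) = (?R P' * ?R P) *\<^sub>v v" if "v \<in> carrier_vec m" for v
      using P that by (intro assoc_mult_mat_vec[symmetric, of _ m m _ m]) auto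
    ultimately have ov: "?ov = map_vec of_int nv" using ovc nv by simp
    have low: "cusp_order N k a (c i) = of_nat (n i)" if "i < m" for i
    proof -
      have "cusp_order N k a (c i) = ?ov $ i" using that by (simp add: order_vec_def m_def)
      also have "\<dots> = of_nat (n i)" unfolding ov using that by (simp add: nv_def)
      finally show ?thesis .
    qed
    have \<mu>: "orbit_size N c m = 1" using orbit_size_infinity[OF N c] by (simp add: m_def)
    have split: "(\<Sum>i\<le>m. h i) = (\<Sum>i<m. h i) + h m" for h :: "nat \<Rightarrow> rat"
      by (simp flip: lessThan_Suc_atMost)
    have "of_int (\<Sum>i\<le>m. int (orbit_size N c i * n i)) = of_nat k * R_num N"
      unfolding sum using RZ by (metis Ints_cases floor_of_int)
    hence "(\<Sum>i\<le>m. of_nat (orbit_size N c i) * of_nat (n i)) = (\<Sum>i\<le>m. of_nat (orbit_size N c i) * cusp_order N k a (c i))"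
      unfolding osum by simp
    \<comment> \<open>The weighted sums agree and so do their first m terms; as i\<infinity> has
      weight 1, the last orders agree as well.\<close>
    hence top: "cusp_order N k a (c m) = of_nat (n m)" unfolding split \<mu> by (simp add: low)
    have all: "cusp_order N k a (c i) = of_nat (n i)" if "i \<le> m" for i
      using low top that by (cases "i = m") auto
    have "a \<in> L_set N k" unfolding L_set_eq[OF N c] using ac wc all by (simp add: m_def)
    moreover have "f a = n"
    proof
      fix i show "f a i = n i" using all n0 by (cases "i \<le> m") (auto simp: f_def)
    qed
    ultimately show "n \<in> f ` L_set N k" by blast
  qed
  ultimately have "bij_betw f (L_set N k) X" by (simp add: bij_betw_def)
  hence "finite (L_set N k)" "card (L_set N k) = card X"
    using count bij_betw_finite bij_betw_same_card by blast+
  thus ?thesis using count unfolding m_def \<rho>_def by simp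
qed

end
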